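(* Let $F=F(y)$ be a Minkowski metric on $\mathbb{R}^{m+1}$ such that its $m$-harmonic symmetrization $F_{\mathrm{sym}}$ is also a Finsler metric on $\mathbb{R}^{m+1}$. Let $\mathscr{M}$ be a smooth oriented $m$-dimensional manifold with boundary $\partial\mathscr{M}$, and put $\mathrm{int}(\mathscr{M})=\mathscr{M}\setminus\partial\mathscr{M}$. Then the image $X(\mathscr{M})$ of any Finsler-minimal immersion $$X\in C^2(\mathrm{int}(\mathscr{M}),\mathbb{R}^{m+1})\cap C^0(\mathscr{M},\mathbb{R}^{m+1})$$ is contained in the convex hull of its boundary $X(\partial\mathscr{M})$.
   Context: **Finsler and Minkowski metrics.** A Finsler metric on $\mathbb{R}^{n}$ is a non-negative function $F=F(x,y)$ on $\mathbb{R}^{n}\times\mathbb{R}^{n}$, smooth for $y\neq0$, with (F1) $F(x,ty)=tF(x,y)$ for all $t>0$, and (F2) the matrix $\big((F^2/2)_{y^iy^j}(x,y)\big)_{ij}$ is positive definite for all $x$ and all $y\ne 0$. It is called a Minkowski metric if it depends only on $y$. **$m$-harmonic symmetrization.** For $F$ on $\mathbb{R}^{m+1}$, $$F_{\mathrm{sym}}(x,y):=\Big[\frac{2}{F^{-m}(x,y)+F^{-m}(x,-y)}\Big]^{1/m}\ (y\neq 0),$$ extended by zero at $y=0$. **Finsler area (Busemann–Hausdorff).** For an immersion $X:\mathscr{M}^k\to\mathbb{R}^{n}$ of a smooth $k$-manifold, $\mathrm{area}^F_\Omega(X):=\int_\Omega\sigma_{X^*F}(u)\,du^1\wedge\dots\wedge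 du^k$ for measurable $\Omega\subset\mathscr{M}$, where in local coordinates $$\sigma_{X^*F}(u):=\frac{\mathscr{H}^k(B^k_1(0))}{\mathscr{H}^k(\{v\in\mathbb{R}^k: F(X(u),dX|_u(v^\delta\partial_{u^\delta}))\le1\})},$$ $B^k_1(0)$ is the Euclidean unit ball in $\mathbb{R}^k$ and $\mathscr{H}^k$ is $k$-dimensional Hausdorff measure. **Finsler-minimal.** A map $X$ as in the claim is a Finsler-minimal immersion if it is a $C^2$-immersion on $\mathrm{int}(\mathscr{M})$ and is critical for Finsler area, i.e. the first variation of $\mathrm{area}^F_\Omega$ at $X$ vanishes for all smooth variations compactly supported in the interior (with $\Omega$ relatively compact in the interior and containing the support).
   Formalization: The manifold with boundary is additionally assumed to be compact; without this the claim fails, for example for a hyperplane (empty boundary) or a closed half-hyperplane. *)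

theory Defs
  imports "HOL-Analysis.Analysis"
begin

section \<open>Smooth maps\<close>

text \<open>\<open>C\<^sup>k\<close> regularity, only meant for open \<open>S\<close>.\<close>

fun higher_differentiable_on ::
  "'a::real_normed_vector set \<Rightarrow> ('a \<Rightarrow> 'b::real_normed_vector) \<Rightarrow> nat \<Rightarrow> bool" where
  "higher_differentiable_on S f 0 \<longleftrightarrow> continuous_on S f"
| "higher_differentiable_on S f (Suc k) \<longleftrightarrow>
     (\<forall>x\<in>S. f differentiable (at x)) \<and>
     (\<forall>v. higher_differentiable_on S (\<lambda>x. frechet_derivative f (at x) v) k)"

definition smooth_on ::
  "'a::real_normed_vector set \<Rightarrow> ('a \<Rightarrow> 'b::real_normed_vector) \<Rightarrow> bool" where
  "smooth_on S f \<longleftrightarrow> (\<forall>k. higher_differentiable_on S f k)"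

text \<open>Smoothness on a set that need not be open, such as a relatively open subset of a
  half-space: local existence of smooth extensions.\<close>

definition smooth_within ::
  "'a::real_normed_vector set \<Rightarrow> ('a \<Rightarrow> 'b::real_normed_vector) \<Rightarrow> bool" where
  "smooth_within S f \<longleftrightarrow>
     (\<forall>x\<in>S. \<exists>V g. open V \<and> x \<in> V \<and> smooth_on V g \<and> (\<forall>y\<in>V \<inter> S. g y = f y))"


section \<open>Finsler and Minkowski metrics\<close>

definition fundamental_tensor ::
  "(real^'n \<Rightarrow> real^'n \<Rightarrow> real) \<Rightarrow> real^'n \<Rightarrow> real^'n \<Rightarrow> real^'n^'n" where
  "fundamental_tensor F x y =
     (\<chi> i j. frechet_derivative
       (\<lambda>z. frechet_derivative (\<lambda>w. (F x w)\<^sup>2 / 2) (at z) (axis i 1)) (at y) (axis j 1))"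

definition finsler_metric :: "(real^'n \<Rightarrow> real^'n \<Rightarrow> real) \<Rightarrow> bool" where
  "finsler_metric F \<longleftrightarrow>
     (\<forall>x y. 0 \<le> F x y) \<and>
     smooth_on {p. snd p \<noteq> 0} (\<lambda>p. F (fst p) (snd p)) \<and>
     (\<forall>x y t. 0 < t \<longrightarrow> F x (t *\<^sub>R y) = t * F x y) \<and>
     (\<forall>x y v. y \<noteq> 0 \<longrightarrow> v \<noteq> 0 \<longrightarrow> 0 < v \<bullet> (fundamental_tensor F x y *v v))"

definition minkowski_metric :: "(real^'n \<Rightarrow> real^'n \<Rightarrow> real) \<Rightarrow> bool" where
  "minkowski_metric F \<longleftrightarrow> finsler_metric F \<and> (\<forall>x x' y. F x y = F x' y)"

definition harmonic_sym ::
  "nat \<Rightarrow> (real^'n \<Rightarrow> real^'n \<Rightarrow> real) \<Rightarrow> real^'n \<Rightarrow> real^'n \<Rightarrow> real" where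
  "harmonic_sym m F x y =
     (if y = 0 then 0
      else (2 / (F x y powr (- real m) + F x (- y) powr (- real m))) powr (1 / real m))"


section \<open>Hausdorff measure\<close>

text \<open>\<^const>\<open>diameter\<close> is only meaningful for bounded sets, so covers consist of bounded
  sets; empty members of a cover contribute nothing, also for \<open>k = 0\<close>.\<close>

definition hausdorff_premeasure :: "nat \<Rightarrow> real \<Rightarrow> 'a::metric_space set \<Rightarrow> ennreal" where
  "hausdorff_premeasure k \<delta> A =
     (INF C \<in> {C :: nat \<Rightarrow> 'a set. A \<subseteq> (\<Union>n. C n) \<and> (\<forall>n. bounded (C n) \<and> diameter (C n) \<le> \<delta>)}.
        \<Sum>n. if C n = {} then 0
             else ennreal (unit_ball_vol (real k) * (diameter (C n) / 2) ^ k))"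

definition hausdorff_measure :: "nat \<Rightarrow> 'a::metric_space set \<Rightarrow> ennreal" where
  "hausdorff_measure k A = (SUP \<delta> \<in> {0<..}. hausdorff_premeasure k \<delta> A)"


section \<open>Smooth oriented manifolds with boundary\<close>

text \<open>A chart is a pair \<open>(U, \<phi>)\<close> of a domain and a map; only the values of \<open>\<phi>\<close> on \<open>U\<close> matter.\<close>

type_synonym ('a, 'm) chart = "'a set \<times> ('a \<Rightarrow> real^'m)"

abbreviation chart_inv :: "('a, 'm::finite) chart \<Rightarrow> real^'m \<Rightarrow> 'a" where
  "chart_inv c \<equiv> inv_into (fst c) (snd c)"

abbreviation chart_image :: "('a, 'm::finite) chart \<Rightarrow> (real^'m) set" where
  "chart_image c \<equiv> snd c ` fst c"

text \<open>Charts take values in relatively open subsets of a half-space \<open>{x. 0 \<le> b \<bullet> x}\<close>, where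
  \<open>b\<close> may depend on the chart and \<open>b = 0\<close> gives the whole space. With one fixed half-space,
  a compact interval would have no oriented atlas.\<close>

definition is_chart :: "'a::topological_space set \<Rightarrow> ('a, 'm::finite) chart \<Rightarrow> bool" where
  "is_chart M c \<longleftrightarrow>
     openin (top_of_set M) (fst c) \<and>
     (\<exists>b. openin (top_of_set {x. 0 \<le> b \<bullet> x}) (chart_image c)) \<and>
     homeomorphism (fst c) (chart_image c) (snd c) (chart_inv c)"

definition oriented_compatible :: "('a, 'm::finite) chart \<Rightarrow> ('a, 'm) chart \<Rightarrow> bool" where
  "oriented_compatible c d \<longleftrightarrow>
     (let S = snd c ` (fst c \<inter> fst d); \<tau> = snd d \<circ> chart_inv c in
        smooth_within S \<tau> \<and>
        (\<forall>x\<in>S. \<exists>D. (\<tau> has_derivative D) (at x within S) \<and> 0 < det (matrix D)))"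

definition oriented_manifold ::
  "'a::{t2_space,second_countable_topology} set \<Rightarrow> ('a, 'm::finite) chart set \<Rightarrow> bool" where
  "oriented_manifold M A \<longleftrightarrow>
     (\<forall>c\<in>A. is_chart M c) \<and> M = (\<Union>c\<in>A. fst c) \<and>
     (\<forall>c\<in>A. \<forall>d\<in>A. oriented_compatible c d)"

definition manifold_interior :: "('a, 'm::finite) chart set \<Rightarrow> 'a set" where
  "manifold_interior A = {p. \<exists>c\<in>A. p \<in> fst c \<and> snd c p \<in> interior (chart_image c)}"

definition manifold_boundary :: "'a set \<Rightarrow> ('a, 'm::finite) chart set \<Rightarrow> 'a set" where
  "manifold_boundary M A = M - manifold_interior A"

definition manifold_measurable :: "('a, 'm::finite) chart set \<Rightarrow> 'a set \<Rightarrow> bool" where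
  "manifold_measurable A \<Omega> \<longleftrightarrow>
     \<Omega> \<subseteq> (\<Union>c\<in>A. fst c) \<and> (\<forall>c\<in>A. snd c ` (\<Omega> \<inter> fst c) \<in> sets lebesgue)"

definition C2_immersion ::
  "('a, 'm::finite) chart set \<Rightarrow> ('a \<Rightarrow> real^'n) \<Rightarrow> bool" where
  "C2_immersion A X \<longleftrightarrow>
     (\<forall>c\<in>A. higher_differentiable_on (interior (chart_image c)) (X \<circ> chart_inv c) 2 \<and>
        (\<forall>u\<in>interior (chart_image c). inj (frechet_derivative (X \<circ> chart_inv c) (at u))))"


section \<open>Busemann-Hausdorff area\<close>

text \<open>The density for a local parametrization \<open>Y\<close>. Where the derivative of \<open>Y\<close> is not injective,
  the denominator is infinite and the density is \<open>0\<close>.\<close>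

definition area_density ::
  "(real^'n \<Rightarrow> real^'n \<Rightarrow> real) \<Rightarrow> (real^'m::finite \<Rightarrow> real^'n) \<Rightarrow> real^'m \<Rightarrow> ennreal" where
  "area_density F Y u =
     hausdorff_measure CARD('m) (ball (0::real^'m) 1) /
     hausdorff_measure CARD('m) {v. F (Y u) (frechet_derivative Y (at u) v) \<le> 1}"

text \<open>The integral of the area form over \<open>\<Omega>\<close> is computed by cutting \<open>\<Omega>\<close> into the disjoint pieces
  \<open>\<Omega> \<inter> (U\<^sub>n - (\<Union>k<n. U\<^sub>k))\<close> for a sequence of charts covering the manifold, which exists by
  second countability. By the transformation formula, the value does not depend on the
  chosen sequence; since the atlas is oriented, \<open>du\<^sup>1 \<and> \<dots> \<and> du\<^sup>k\<close> integrates as Lebesgue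
  measure in each chart.\<close>

definition chart_enum :: "('a, 'm::finite) chart set \<Rightarrow> nat \<Rightarrow> ('a, 'm) chart" where
  "chart_enum A = (SOME c. range c \<subseteq> A \<and> (\<Union>n. fst (c n)) = (\<Union>c\<in>A. fst c))"

definition finsler_area ::
  "(real^'n \<Rightarrow> real^'n \<Rightarrow> real) \<Rightarrow> ('a, 'm::finite) chart set \<Rightarrow>
   ('a \<Rightarrow> real^'n) \<Rightarrow> 'a set \<Rightarrow> ennreal" where
  "finsler_area F A X \<Omega> =
     (\<Sum>n. let c = chart_enum A n; E = \<Omega> \<inter> disjointed (\<lambda>k. fst (chart_enum A k)) n in
        \<integral>\<^sup>+u\<in>snd c ` E. area_density F (X \<circ> chart_inv c) u \<partial>lebesgue)"


section \<open>Finsler-minimal immersions\<close>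

text \<open>A variation of \<open>X\<close> is written \<open>X + \<zeta> t\<close> for \<open>\<bar>t\<bar> < \<epsilon>\<close>. As \<open>X\<close> is only \<open>C\<^sup>2\<close>, it is the
  displacement \<open>\<zeta>\<close> that is smooth, jointly in \<open>t\<close> and the point.\<close>

definition smooth_variation ::
  "('a::topological_space, 'm::finite) chart set \<Rightarrow> real \<Rightarrow> 'a set \<Rightarrow>
   (real \<Rightarrow> 'a \<Rightarrow> real^'n) \<Rightarrow> bool" where
  "smooth_variation A \<epsilon> K \<zeta> \<longleftrightarrow>
     compact K \<and> K \<subseteq> manifold_interior A \<and>
     (\<forall>p. \<zeta> 0 p = 0) \<and>
     (\<forall>t p. \<bar>t\<bar> < \<epsilon> \<longrightarrow> p \<notin> K \<longrightarrow> \<zeta> t p = 0) \<and>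
     (\<forall>c\<in>A. smooth_on ({-\<epsilon><..<\<epsilon>} \<times> interior (chart_image c))
        (\<lambda>z. \<zeta> (fst z) (chart_inv c (snd z))))"

definition critical_for_area ::
  "(real^'n \<Rightarrow> real^'n \<Rightarrow> real) \<Rightarrow> ('a::topological_space, 'm::finite) chart set \<Rightarrow>
   ('a \<Rightarrow> real^'n) \<Rightarrow> bool" where
  "critical_for_area F A X \<longleftrightarrow>
     (\<forall>\<epsilon> K \<zeta> \<Omega> C. 0 < \<epsilon> \<longrightarrow> smooth_variation A \<epsilon> K \<zeta> \<longrightarrow>
        manifold_measurable A \<Omega> \<longrightarrow> K \<subseteq> \<Omega> \<longrightarrow>
        \<Omega> \<subseteq> C \<longrightarrow> compact C \<longrightarrow> C \<subseteq> manifold_interior A \<longrightarrow>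
        ((\<lambda>t. enn2real (finsler_area F A (\<lambda>p. X p + \<zeta> t p) \<Omega>)) has_real_derivative 0) (at 0))"

definition finsler_minimal ::
  "(real^'n \<Rightarrow> real^'n \<Rightarrow> real) \<Rightarrow> ('a::topological_space, 'm::finite) chart set \<Rightarrow>
   ('a \<Rightarrow> real^'n) \<Rightarrow> bool" where
  "finsler_minimal F A X \<longleftrightarrow> C2_immersion A X \<and> critical_for_area F A X"

end

theory Submission
  imports Defs "HOL-Analysis.Analysis"
begin

text \<open>The area element of a Busemann-Hausdorff area is the reciprocal of the volume of a section of the
  unit ball \<open>F \<le> 1\<close>. In polar coordinates this volume is an integral of \<open>F\<^sup>-\<^sup>m\<close>, so it does not change
  if \<open>F\<close> is replaced by its \<open>m\<close>-harmonic symmetrization \<open>\<Phi>\<close>. As \<open>\<Phi>\<close> is an even Finsler metric, it is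
  a uniformly convex norm. Up to a constant, the area of an immersion with derivative matrices \<open>P\<close> is
  therefore the integral of \<open>sect_area \<Phi> P\<close>, the reciprocal volume of \<open>{v. \<Phi> (P v) \<le> 1}\<close>.

  If a point of the image lay outside the convex hull of the image of the boundary, a hyperplane
  would separate the two. Bending it slightly gives a sphere that encloses the image and touches it at
  an interior point. There is then a linear function \<open>a\<close> for which \<open>a \<bullet> X\<close> has, near some
  parameter \<open>u0\<close>, a strict maximum at \<open>u0\<close>. Let \<open>P0\<close> be the derivative matrix at \<open>u0\<close>, whose columns are orthogonal
  to \<open>a\<close>. There is a vector \<open>w\<close> with \<open>a \<bullet> w = 1\<close> such that the derivative of the area integrand at
  \<open>P0\<close> vanishes in all directions \<open>w x\<^sup>T\<close> (lemma \<open>stationary_transversal\<close>). Displacing the surface by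
  \<open>\<phi> w\<close>, where \<open>\<phi>\<close> is the square of the positive part of \<open>a \<bullet> X - m0\<close> and \<open>m0\<close> is slightly below the
  maximum, changes \<open>P\<close> to first order by a nonnegative multiple of \<open>w (a P)\<^sup>T\<close>. Along the line
  \<open>P + t w (a P)\<^sup>T\<close> the area integrand is strictly convex, and at \<open>t = -1\<close> it is stationary, because the
  section there is parallel to the tangent plane at \<open>u0\<close>. Its derivative at \<open>t = 0\<close> is
  therefore positive unless \<open>a P = 0\<close> (theorem \<open>darea_shear_pos\<close>; if \<open>w\<close> is tangent to the section, the
  line only changes the parametrization, and the derivative is explicit). So the first variation has a
  nonnegative integrand; since it vanishes, \<open>\<phi>\<close> is constant near \<open>u0\<close>, which contradicts the strict
  maximum (lemma \<open>no_interior_touching\<close>).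

  The convexity of the area integrand along such lines is Busemann's theorem on sections of convex
  bodies. A symmetric star body is a double cone over an affine hyperplane, which writes its volume as
  an integral of \<open>\<Phi>\<^sup>-\<^sup>m\<close> over \<open>m - 1\<close> variables. In these coordinates the integrand is convex jointly with the
  parameter of the line, and the Borell-Brascamp-Lieb inequality (\<open>borell_brascamp_lieb\<close>) applies. For strictness,
  a small multiple of the square of a linear form is subtracted from \<open>\<Phi>\<^sup>2\<close>; positivity of the Hessian
  ensures that the difference is still the square of a norm (\<open>uniformly_convex_norm_if_hessian_pos\<close>).

  The function \<open>\<phi>\<close> is only once continuously differentiable, whereas criticality concerns smooth
  displacements. The first variation pairs the gradient of the displacement with a continuously
  differentiable vector field, since the area integrand is smooth and \<open>X\<close> is twice continuously
  differentiable. Testing with smooth bumps shows that this field is divergence free, and integration by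
  parts then admits all test functions of class \<open>C\<^sup>1\<close> (\<open>first_variation_C1\<close>). To compare the area
  of the manifold with an integral over a single chart, one needs that Hausdorff measure is a
  constant multiple of Lebesgue measure, the change-of-variables formula, and invariance of domain.\<close>

section \<open>Change of variables for arbitrary finite index types\<close>

text \<open>The change-of-variables theorem is stated for vectors indexed by a wellordered type. Every
  finite type has a wellordered copy, and renaming coordinates preserves Lebesgue measure.\<close>

typedef 'a ordered_copy = "UNIV :: 'a set" by simp

lemma bij_Rep_ordered_copy: "bij Rep_ordered_copy"
  using type_definition.Rep_range[OF type_definition_ordered_copy] type_definition.Rep_inject[OF type_definition_ordered_copy]
  by (auto simp: bij_def inj_def)

instance ordered_copy :: (finite) finite
proof
  show "finite (UNIV :: 'a ordered_copy set)"
    using bij_Rep_ordered_copy by (metis bij_betw_finite finite)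
qed

lemma card_UNIV_ordered_copy: "CARD('a ordered_copy) = CARD('a)"
  by (rule bij_betw_same_card[OF bij_Rep_ordered_copy])

instantiation ordered_copy :: (finite) wellorder
begin

definition less_eq_ordered_copy :: "'a ordered_copy \<Rightarrow> 'a ordered_copy \<Rightarrow> bool" where
  "less_eq_ordered_copy x y \<longleftrightarrow>
     to_nat_on (UNIV :: 'a set) (Rep_ordered_copy x) \<le> to_nat_on UNIV (Rep_ordered_copy y)"

definition less_ordered_copy :: "'a ordered_copy \<Rightarrow> 'a ordered_copy \<Rightarrow> bool" where
  "less_ordered_copy x y \<longleftrightarrow>
     to_nat_on (UNIV :: 'a set) (Rep_ordered_copy x) < to_nat_on UNIV (Rep_ordered_copy y)"

instance
proof
  fix x y z :: "'a ordered_copy" and P :: "'a ordered_copy \<Rightarrow> bool"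
  show "x < y \<longleftrightarrow> x \<le> y \<and> \<not> y \<le> x" by (auto simp: less_eq_ordered_copy_def less_ordered_copy_def)
  show "x \<le> x" "x \<le> y \<Longrightarrow> y \<le> z \<Longrightarrow> x \<le> z" "x \<le> y \<or> y \<le> x" by (auto simp: less_eq_ordered_copy_def)
  show "x \<le> y \<Longrightarrow> y \<le> x \<Longrightarrow> x = y"
    using to_nat_on_inj[of "UNIV :: 'a set"] by (auto simp: less_eq_ordered_copy_def Rep_ordered_copy_inject)
  assume step: "\<And>x. (\<And>y. y < x \<Longrightarrow> P y) \<Longrightarrow> P x"
  have "P x" for x
  proof (induction "to_nat_on (UNIV :: 'a set) (Rep_ordered_copy x)" arbitrary: x rule: less_induct)
    case less
    show ?case by (rule step) (use less in \<open>auto simp: less_ordered_copy_def\<close>)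
  qed
  then show "P x" .
qed

end

definition reindex :: "real^'m \<Rightarrow> real^'m ordered_copy" where
  "reindex x = (\<chi> i. x $ Rep_ordered_copy i)"

definition unreindex :: "real^'m ordered_copy \<Rightarrow> real^'m" where
  "unreindex y = (\<chi> j. y $ Abs_ordered_copy j)"

lemma unreindex_reindex[simp]: "unreindex (reindex x) = x"
  and reindex_unreindex[simp]: "reindex (unreindex y) = y"
  by (simp_all add: reindex_def unreindex_def Abs_ordered_copy_inverse Rep_ordered_copy_inverse)

lemma linear_reindex: "linear reindex" and linear_unreindex: "linear unreindex"
  by (auto intro!: linearI simp: reindex_def unreindex_def vec_eq_iff)

lemma bounded_linear_reindex: "bounded_linear reindex" and bounded_linear_unreindex: "bounded_linear unreindex"
  using linear_reindex linear_unreindex by (simp_all add: linear_linear)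

lemma prod_Basis_cart: "(\<Prod>b\<in>Basis. (v :: real^'m) \<bullet> b) = (\<Prod>i\<in>UNIV. v $ i)"
proof -
  have Basis: "(Basis :: (real^'m) set) = (\<lambda>i. axis i 1) ` UNIV" by (auto simp: Basis_vec_def)
  have "inj (\<lambda>i. axis i 1 :: real^'m)" by (auto simp: inj_def axis_eq_axis)
  then have "(\<Prod>b\<in>(\<lambda>i. axis i 1) ` UNIV. v \<bullet> b) = (\<Prod>i\<in>UNIV. v \<bullet> axis i 1)"
    by (simp only: prod.reindex o_def)
  then have "(\<Prod>b\<in>Basis. v \<bullet> b) = (\<Prod>i\<in>UNIV. v \<bullet> axis i 1)"
    by (simp only: Basis)
  then show ?thesis by (simp add: inner_axis)
qed

lemma distr_reindex: "distr lborel borel (reindex :: real^'m \<Rightarrow> _) = lborel"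
proof (rule lborel_eqI[symmetric])
  have meas[measurable]: "reindex \<in> borel_measurable (borel :: (real^'m) measure)"
    by (intro borel_measurable_continuous_onI linear_continuous_on bounded_linear_reindex)
  fix l u :: "real^'m ordered_copy" assume le: "\<And>b. b \<in> Basis \<Longrightarrow> l \<bullet> b \<le> u \<bullet> b"
  have comp: "l $ i \<le> u $ i" for i using le[of "axis i 1"] by (simp add: inner_axis axis_in_Basis_iff)
  have pre: "reindex -` box l u = box (unreindex l) (unreindex u)"
  proof (intro set_eqI iffI)
    fix x assume "x \<in> reindex -` box l u"
    then have a: "l $ i < x $ Rep_ordered_copy i \<and> x $ Rep_ordered_copy i < u $ i" for i
      by (simp add: mem_box_cart reindex_def)
    show "x \<in> box (unreindex l) (unreindex u)" unfolding mem_box_cart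
    proof
      fix j
      show "unreindex l $ j < x $ j \<and> x $ j < unreindex u $ j"
        using a[of "Abs_ordered_copy j"] by (simp add: unreindex_def Abs_ordered_copy_inverse)
    qed
  next
    fix x assume "x \<in> box (unreindex l) (unreindex u)"
    then have a: "unreindex l $ j < x $ j \<and> x $ j < unreindex u $ j" for j by (simp add: mem_box_cart)
    show "x \<in> reindex -` box l u" unfolding vimage_eq mem_box_cart
    proof
      fix i
      show "l $ i < reindex x $ i \<and> reindex x $ i < u $ i"
        using a[of "Rep_ordered_copy i"] by (simp add: unreindex_def reindex_def Rep_ordered_copy_inverse)
    qed
  qed
  have le': "unreindex l \<bullet> b \<le> unreindex u \<bullet> b" if "b \<in> Basis" for b :: "real^'m"
    using that comp by (auto simp: Basis_vec_def inner_axis unreindex_def)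
  have "emeasure (distr lborel borel (reindex :: real^'m \<Rightarrow> _)) (box l u)
      = emeasure lborel (box (unreindex l) (unreindex u))"
    by (subst emeasure_distr) (simp_all add: pre)
  also have "\<dots> = ennreal (\<Prod>b\<in>Basis. (unreindex u - unreindex l) \<bullet> b)"
    using le' by (intro emeasure_lborel_box)
  also have "(\<Prod>b\<in>Basis. (unreindex u - unreindex l) \<bullet> b)
      = (\<Prod>j\<in>(UNIV::'m set). (u - l) $ Abs_ordered_copy j)"
    unfolding prod_Basis_cart by (simp add: unreindex_def)
  also have "\<dots> = (\<Prod>i\<in>UNIV. (u - l) $ i)"
  proof -
    have "bij (Abs_ordered_copy :: 'm \<Rightarrow> _)"
      by (rule o_bij[of Rep_ordered_copy]) (auto simp: fun_eq_iff Abs_ordered_copy_inverse Rep_ordered_copy_inverse)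
    then show ?thesis by (rule prod.reindex_bij_betw)
  qed
  also have "\<dots> = (\<Prod>b\<in>Basis. (u - l) \<bullet> b)" by (rule prod_Basis_cart[symmetric])
  finally show "emeasure (distr lborel borel (reindex :: real^'m \<Rightarrow> _)) (box l u)
      = ennreal (\<Prod>b\<in>Basis. (u - l) \<bullet> b)" .
qed simp

lemma lebesgue_reindex:
  "(reindex :: real^'m \<Rightarrow> _) \<in> lebesgue \<rightarrow>\<^sub>M lebesgue" "distr lebesgue lebesgue (reindex :: real^'m \<Rightarrow> _) = lebesgue"
proof -
  have meas[measurable]: "reindex \<in> (lborel :: (real^'m) measure) \<rightarrow>\<^sub>M lborel"
    by (simp, intro borel_measurable_continuous_onI linear_continuous_on bounded_linear_reindex)
  have d: "distr lebesgue lborel (reindex :: real^'m \<Rightarrow> _) = lborel"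
  proof -
    have "distr lebesgue lborel (reindex :: real^'m \<Rightarrow> _) = distr lborel lborel reindex"
      by (rule distr_completion[OF meas])
    also have "\<dots> = distr lborel borel reindex" by (rule distr_cong) simp_all
    finally show ?thesis by (simp only: distr_reindex)
  qed
  have meas': "reindex \<in> (lebesgue :: (real^'m) measure) \<rightarrow>\<^sub>M lborel"
    using meas by (rule measurable_completion)
  show 1: "reindex \<in> (lebesgue :: (real^'m) measure) \<rightarrow>\<^sub>M lebesgue"
    by (rule completion.measurable_completion2[OF meas']) (simp add: d)
  have "completion (distr lebesgue lborel (reindex :: real^'m \<Rightarrow> _)) = distr lebesgue lebesgue reindex"
    by (rule completion.completion_distr_eq[OF meas']) (simp add: d)
  then show "distr lebesgue lebesgue (reindex :: real^'m \<Rightarrow> _) = lebesgue" by (simp add: d)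
qed

lemma measurable_unreindex: "unreindex \<in> lebesgue \<rightarrow>\<^sub>M lebesgue"
proof (rule measurableI)
  fix S :: "(real^'m) set" assume S: "S \<in> sets lebesgue"
  have "S \<in> sets lebesgue \<Longrightarrow> reindex ` S \<in> sets lebesgue"
    by (rule differentiable_image_in_sets_lebesgue)
      (auto intro!: linear_imp_differentiable_on linear_reindex simp: card_UNIV_ordered_copy)
  moreover have "unreindex -` S \<inter> space lebesgue = reindex ` S" 
    by (auto simp: image_iff) (metis reindex_unreindex)
  ultimately show "unreindex -` S \<inter> space lebesgue \<in> sets lebesgue" using S by simp
qed simp

lemma integrable_reindex:
  fixes f :: "real^'m \<Rightarrow> real"
  shows "(\<lambda>y. f (unreindex y)) absolutely_integrable_on reindex ` S \<longleftrightarrow> f absolutely_integrable_on S"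
    and "f absolutely_integrable_on S \<Longrightarrow> integral (reindex ` S) (\<lambda>y. f (unreindex y)) = integral S f"
proof -
  let ?g = "\<lambda>y. indicator (reindex ` S) y *\<^sub>R f (unreindex y)"
  have eq: "?g (reindex x) = indicator S x *\<^sub>R f x" for x
  proof -
    have "reindex x \<in> reindex ` S \<longleftrightarrow> x \<in> S" by (metis image_iff unreindex_reindex)
    then show ?thesis by (simp add: indicator_def)
  qed
  have m: "?g \<in> borel_measurable lebesgue \<longleftrightarrow> (\<lambda>x. indicator S x *\<^sub>R f x) \<in> borel_measurable lebesgue"
  proof
    assume "?g \<in> borel_measurable lebesgue"
    from measurable_compose[OF lebesgue_reindex(1) this]
    show "(\<lambda>x. indicator S x *\<^sub>R f x) \<in> borel_measurable lebesgue" by (simp only: eq)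
  next
    assume "(\<lambda>x. indicator S x *\<^sub>R f x) \<in> borel_measurable lebesgue"
    from measurable_compose[OF measurable_unreindex this]
    have "(\<lambda>y. indicator S (unreindex y) *\<^sub>R f (unreindex y)) \<in> borel_measurable lebesgue" .
    moreover have "?g y = indicator S (unreindex y) *\<^sub>R f (unreindex y)" for y
      using eq[of "unreindex y"] by (simp only: reindex_unreindex)
    ultimately show "?g \<in> borel_measurable lebesgue" by (simp only:)
  qed
  have int: "integrable lebesgue ?g \<longleftrightarrow> integrable lebesgue (\<lambda>x. indicator S x *\<^sub>R f x)"
  proof (cases "?g \<in> borel_measurable lebesgue")
    case True
    have "integrable (distr lebesgue lebesgue (reindex :: real^'m \<Rightarrow> _)) ?g
        \<longleftrightarrow> integrable lebesgue (\<lambda>x. ?g (reindex x))"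
      by (rule integrable_distr_eq[OF lebesgue_reindex(1) True])
    then show ?thesis by (simp only: lebesgue_reindex(2) eq)
  next
    case False
    then show ?thesis using m by (auto dest: borel_measurable_integrable)
  qed
  then show 1: "(\<lambda>y. f (unreindex y)) absolutely_integrable_on reindex ` S \<longleftrightarrow> f absolutely_integrable_on S"
    by (simp add: set_integrable_def)
  assume f: "f absolutely_integrable_on S"
  have "integral\<^sup>L (distr lebesgue lebesgue (reindex :: real^'m \<Rightarrow> _)) ?g = integral\<^sup>L lebesgue (\<lambda>x. ?g (reindex x))"
    using f 1 by (intro integral_distr[OF lebesgue_reindex(1)]) (auto simp: set_integrable_def dest: borel_measurable_integrable)
  then have "integral\<^sup>L lebesgue ?g = integral\<^sup>L lebesgue (\<lambda>x. indicator S x *\<^sub>R f x)"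
    by (simp only: lebesgue_reindex(2) eq)
  then show "integral (reindex ` S) (\<lambda>y. f (unreindex y)) = integral S f"
    using set_lebesgue_integral_eq_integral(2)[OF f] set_lebesgue_integral_eq_integral(2)[OF 1[THEN iffD2, OF f]]
    by (simp add: set_lebesgue_integral_def)
qed

text \<open>The absolute value of the determinant. It is written in the wellordered coordinates to which the
  change-of-variables formula refers; renaming the coordinates does not change it.\<close>

definition jacobian :: "(real^'m \<Rightarrow> real^'m) \<Rightarrow> real" where
  "jacobian f = \<bar>det (matrix (\<lambda>y. reindex (f (unreindex y))))\<bar>"

theorem change_of_variables:
  fixes f :: "real^'m \<Rightarrow> real" and g :: "real^'m \<Rightarrow> real^'m"
  assumes S: "S \<in> sets lebesgue"
    and der: "\<And>x. x \<in> S \<Longrightarrow> (g has_derivative g' x) (at x within S)"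
    and inj: "inj_on g S"
    and int: "(\<lambda>x. jacobian (g' x) * f (g x)) absolutely_integrable_on S"
  shows "f absolutely_integrable_on g ` S"
    and "integral (g ` S) f = integral S (\<lambda>x. jacobian (g' x) * f (g x))"
proof -
  let ?g = "\<lambda>y. reindex (g (unreindex y))" and ?g' = "\<lambda>y v. reindex (g' (unreindex y) (unreindex v))"
  \<comment> \<open>the change-of-variables formula integrates vector-valued functions, here of dimension one\<close>
  let ?f = "\<lambda>y. \<chi> i::1. f (unreindex y)"
  let ?b = "\<chi> i::1. integral S (\<lambda>x. jacobian (g' x) * f (g x))"
  have S': "reindex ` S \<in> sets lebesgue"
    by (rule differentiable_image_in_sets_lebesgue[OF S])
      (auto intro!: linear_imp_differentiable_on linear_reindex simp: card_UNIV_ordered_copy)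
  have img: "unreindex ` reindex ` S = S" by (simp add: image_image)
  have der': "(?g has_derivative ?g' y) (at y within reindex ` S)" if y: "y \<in> reindex ` S" for y
  proof -
    have y': "unreindex y \<in> S" using y by auto
    have 1: "(unreindex has_derivative unreindex) (at y within reindex ` S)"
      by (rule bounded_linear_imp_has_derivative[OF bounded_linear_unreindex])
    have "(g has_derivative g' (unreindex y)) (at (unreindex y) within unreindex ` reindex ` S)"
      unfolding img by (rule der[OF y'])
    from has_derivative_in_compose[OF 1 this]
    show ?thesis by (rule bounded_linear.has_derivative[OF bounded_linear_reindex])
  qed
  have inj': "inj_on ?g (reindex ` S)"
  proof (rule inj_onI)
    fix x y assume xy: "x \<in> reindex ` S" "y \<in> reindex ` S" "?g x = ?g y"
    then have "g (unreindex x) = g (unreindex y)" by (metis unreindex_reindex)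
    moreover have "unreindex x \<in> S" "unreindex y \<in> S" using xy by auto
    ultimately have "unreindex x = unreindex y" using inj by (auto dest: inj_onD)
    then show "x = y" by (metis reindex_unreindex)
  qed
  have det: "\<bar>det (matrix (?g' y))\<bar> = jacobian (g' (unreindex y))" for y by (simp add: jacobian_def)
  note intr = integrable_reindex(1)[THEN iffD2, OF int] integrable_reindex(2)[OF int]
  have comp: "h absolutely_integrable_on T \<longleftrightarrow> (\<lambda>x. h x $ 1) absolutely_integrable_on T"
    for h :: "real^'m ordered_copy \<Rightarrow> real^1" and T
    by (subst absolutely_integrable_componentwise_iff) (simp add: Basis_vec_def inner_axis)
  have "(\<lambda>y. \<bar>det (matrix (?g' y))\<bar> *\<^sub>R ?f (?g y)) absolutely_integrable_on reindex ` S"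
    using intr(1) by (subst comp) (simp add: det)
  moreover have "integral (reindex ` S) (\<lambda>y. \<bar>det (matrix (?g' y))\<bar> *\<^sub>R ?f (?g y)) = ?b"
  proof -
    have i: "(\<lambda>y. \<bar>det (matrix (?g' y))\<bar> *\<^sub>R ?f (?g y)) integrable_on reindex ` S"
      using calculation by (rule set_lebesgue_integral_eq_integral(1))
    show ?thesis
      unfolding vec_eq_iff
      using integral_component_eq_cart[OF i] intr(2) by (simp add: det)
  qed
  ultimately have *: "?f absolutely_integrable_on ?g ` reindex ` S \<and> integral (?g ` reindex ` S) ?f = ?b"
    using has_absolute_integral_change_of_variables[OF S' der' inj', of ?f ?b] by blast
  have img': "?g ` reindex ` S = reindex ` g ` S" by (simp add: image_image)
  have "(\<lambda>y. f (unreindex y)) absolutely_integrable_on reindex ` g ` S"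
    using * by (subst (asm) comp) (simp add: img')
  then show f: "f absolutely_integrable_on g ` S" by (simp add: integrable_reindex(1))
  have "?f integrable_on reindex ` g ` S"
    using * unfolding img' by (intro set_lebesgue_integral_eq_integral(1)) simp
  from integral_component_eq_cart[OF this, of 1]
  have "integral (reindex ` g ` S) (\<lambda>y. f (unreindex y)) = integral S (\<lambda>x. jacobian (g' x) * f (g x))"
    using * by (simp add: img')
  then show "integral (g ` S) f = integral S (\<lambda>x. jacobian (g' x) * f (g x))"
    using integrable_reindex(2)[OF f] by simp
qed

lemma measure_linear_image_jacobian:
  fixes f :: "real^'m \<Rightarrow> real^'m"
  assumes "linear f" "inj f" "S \<in> lmeasurable"
  shows "measure lebesgue (f ` S) = jacobian f * measure lebesgue S"
proof -
  have i: "(\<lambda>x. jacobian f * (\<lambda>_. 1) (f x)) absolutely_integrable_on S"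
    using assms(3) by (rule absolutely_integrable_on_const)
  have injS: "inj_on f S" using assms(2) by (rule inj_on_subset) simp
  note cv = change_of_variables[of S f "\<lambda>_. f" "\<lambda>_. 1", OF _ _ _ i]
  have d: "(f has_derivative f) (at x within S)" for x
    using assms(1) by (rule linear_imp_has_derivative)
  have "(\<lambda>x. 1 :: real) absolutely_integrable_on f ` S"
    using assms d by (intro cv(1)) (simp_all add: fmeasurableD injS)
  then have "f ` S \<in> lmeasurable"
    by (simp add: lmeasurable_iff_integrable_on set_lebesgue_integral_eq_integral(1))
  moreover have "integral (f ` S) (\<lambda>_. 1) = jacobian f * integral S (\<lambda>x. 1)"
    unfolding integral_mult_right[symmetric] using assms d
    by (intro cv(2)) (simp_all add: fmeasurableD injS)
  ultimately show ?thesis using assms(3) by (simp add: lmeasure_integral)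
qed

lemma jacobian_pos:
  assumes "linear f" "inj f" shows "0 < jacobian f"
proof -
  let ?h = "\<lambda>y. reindex (f (unreindex y))"
  have l: "linear ?h"
    using linear_compose[OF linear_compose[OF linear_unreindex assms(1)] linear_reindex] by (simp add: o_def)
  moreover have "inj ?h" using assms(2) by (intro injI) (metis injD reindex_unreindex unreindex_reindex)
  ultimately show ?thesis using det_nz_iff_inj[of ?h] by (simp add: jacobian_def)
qed

section \<open>Calculus of finitely often differentiable maps\<close>

abbreviation hd_on where "hd_on \<equiv> higher_differentiable_on"

lemma frechet_derivative_cong_open:
  assumes "open S" "x \<in> S" "\<And>y. y \<in> S \<Longrightarrow> f y = g y"
  shows "frechet_derivative f (at x) = frechet_derivative g (at x)"
    and "f differentiable (at x) \<longleftrightarrow> g differentiable (at x)"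
proof -
  have *: "(f has_derivative D) (at x) \<longleftrightarrow> (g has_derivative D) (at x)" for D
    using assms by (metis has_derivative_transform_within_open)
  show "frechet_derivative f (at x) = frechet_derivative g (at x)"
    by (simp add: frechet_derivative_def *)
  show "f differentiable (at x) \<longleftrightarrow> g differentiable (at x)"
    by (simp add: differentiable_def *)
qed

lemma hd_cong:
  assumes "open S" "\<And>y. y \<in> S \<Longrightarrow> f y = g y" "hd_on S f k"
  shows "hd_on S g k"
  using assms
proof (induction k arbitrary: f g)
  case 0
  then show ?case by (metis continuous_on_eq higher_differentiable_on.simps(1))
next
  case (Suc k)
  have "g differentiable (at x)" if "x \<in> S" for x
    using Suc.prems(3) frechet_derivative_cong_open(2)[OF Suc.prems(1) that Suc.prems(2)] that by auto
  moreover have "hd_on S (\<lambda>x. frechet_derivative g (at x) v) k" for v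
  proof (rule Suc.IH[OF Suc.prems(1)])
    show "frechet_derivative f (at y) v = frechet_derivative g (at y) v" if "y \<in> S" for y
      using frechet_derivative_cong_open(1)[OF Suc.prems(1) that Suc.prems(2)] by simp
    show "hd_on S (\<lambda>x. frechet_derivative f (at x) v) k" using Suc.prems(3) by simp
  qed
  ultimately show ?case by simp
qed

lemma hd_imp_continuous: "hd_on S f k \<Longrightarrow> continuous_on S f"
  by (cases k) (auto intro!: continuous_at_imp_continuous_on differentiable_imp_continuous_within)

lemma hd_SucD: "hd_on S f (Suc k) \<Longrightarrow> hd_on S f k"
proof (induction k arbitrary: f)
  case 0 then show ?case using hd_imp_continuous[of S f "Suc 0"] by simp
next
  case (Suc k)
  have "\<forall>x\<in>S. f differentiable (at x)" "\<And>v. hd_on S (\<lambda>x. frechet_derivative f (at x) v) (Suc k)"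
    using Suc.prems by auto
  then show ?case using Suc.IH by simp
qed

lemma hd_Suc_intro:
  assumes "\<And>x. x \<in> S \<Longrightarrow> (f has_derivative D x) (at x)" "open S"
    and "\<And>v. hd_on S (\<lambda>x. D x v) k"
  shows "hd_on S f (Suc k)"
proof -
  have "frechet_derivative f (at x) = D x" if "x \<in> S" for x
    using assms(1)[OF that] frechet_derivative_at by metis
  then have "hd_on S (\<lambda>x. frechet_derivative f (at x) v) k" for v
    by (intro hd_cong[OF assms(2) _ assms(3)[of v]]) simp
  moreover have "f differentiable (at x)" if "x \<in> S" for x
    using assms(1)[OF that] by (auto simp: differentiable_def)
  ultimately show ?thesis by simp
qed

lemma hd_SucE:
  assumes "hd_on S f (Suc k)" "x \<in> S"
  shows "(f has_derivative frechet_derivative f (at x)) (at x)"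
  using assms by (simp add: frechet_derivative_works[symmetric])

lemma hd_local:
  assumes "\<And>x. x \<in> S \<Longrightarrow> \<exists>V. open V \<and> x \<in> V \<and> hd_on V f k"
  shows "hd_on S f k"
  using assms
proof (induction k arbitrary: f)
  case 0
  have "continuous (at x) f" if "x \<in> S" for x
    using 0[OF that] by (auto simp: continuous_on_eq_continuous_at)
  then show ?case by (simp add: continuous_at_imp_continuous_on)
next
  case (Suc k)
  have "f differentiable (at x)" if "x \<in> S" for x using Suc.prems[OF that] by auto
  moreover have "hd_on S (\<lambda>x. frechet_derivative f (at x) v) k" for v
  proof (rule Suc.IH)
    fix x assume "x \<in> S"
    then obtain V where "open V" "x \<in> V" "hd_on V f (Suc k)" using Suc.prems by blast
    then show "\<exists>V. open V \<and> x \<in> V \<and> hd_on V (\<lambda>x. frechet_derivative f (at x) v) k"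
      by (intro exI[of _ V]) simp
  qed
  ultimately show ?case by simp
qed

lemma hd_const: "hd_on S (\<lambda>x. c) k"
proof (induction k arbitrary: c)
  case (Suc k)
  have "frechet_derivative (\<lambda>x. c) (at x) = (\<lambda>v. 0)" for x :: 'a
    using frechet_derivative_at[OF has_derivative_const] by metis
  then show ?case using Suc by simp
qed auto

lemma hd_linear:
  assumes "bounded_linear f" shows "hd_on S f k"
proof (cases k)
  case 0 then show ?thesis by (simp add: assms linear_continuous_on)
next
  case (Suc j)
  have "(f has_derivative f) (at x)" for x using assms by (rule bounded_linear_imp_has_derivative)
  then have "frechet_derivative f (at x) = f" "f differentiable (at x)" for x
    using frechet_derivative_at by (metis, auto simp: differentiable_def)
  then show ?thesis using Suc by (simp add: hd_const)
qed

lemma hd_add: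
  assumes "open S" "hd_on S f k" "hd_on S g k" shows "hd_on S (\<lambda>x. f x + g x) k"
  using assms
proof (induction k arbitrary: f g)
  case (Suc k)
  show ?case
    by (rule hd_Suc_intro[OF has_derivative_add[OF hd_SucE[OF Suc.prems(2)] hd_SucE[OF Suc.prems(3)]]])
      (use Suc.prems in \<open>auto intro: Suc.IH\<close>)
qed (auto intro: continuous_on_add)

text \<open>By the product rule the directional derivatives are sums of two products of the same form.\<close>

lemma hd_bilinear:
  assumes B: "bounded_bilinear B" and "open S" "hd_on S f k" "hd_on S g k"
  shows "hd_on S (\<lambda>x. B (f x) (g x)) k"
  using assms(2-)
proof (induction k arbitrary: f g)
  case 0 then show ?case using bounded_bilinear.continuous_on[OF B] by auto
next
  case (Suc k)
  have f: "hd_on S f k" and g: "hd_on S g k" using Suc.prems hd_SucD by blast+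
  show ?case
  proof (rule hd_Suc_intro)
    fix x assume x: "x \<in> S"
    show "((\<lambda>x. B (f x) (g x)) has_derivative
      (\<lambda>h. B (f x) (frechet_derivative g (at x) h) + B (frechet_derivative f (at x) h) (g x))) (at x)"
      by (rule bounded_bilinear.FDERIV[OF B hd_SucE[OF Suc.prems(2) x] hd_SucE[OF Suc.prems(3) x]])
  next
    fix v
    show "hd_on S (\<lambda>x. B (f x) (frechet_derivative g (at x) v) + B (frechet_derivative f (at x) v) (g x)) k"
      using Suc.prems f g by (intro hd_add Suc.IH) auto
  qed fact
qed

lemmas hd_mult = hd_bilinear[OF bounded_bilinear_mult]
lemmas hd_scaleR = hd_bilinear[OF bounded_bilinear_scaleR]

lemma hd_sum:
  assumes "open S" "\<And>i. i \<in> I \<Longrightarrow> hd_on S (f i) k" shows "hd_on S (\<lambda>x. \<Sum>i\<in>I. f i x) k"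
  using assms(2)
proof (induction I rule: infinite_finite_induct)
  case (insert i I)
  then show ?case using hd_add[OF assms(1), of "f i" k "\<lambda>x. \<Sum>i\<in>I. f i x"] by simp
qed (simp_all add: hd_const)

lemma linear_componentwise_basis:
  fixes f :: "'a::euclidean_space \<Rightarrow> 'b::real_vector"
  assumes "linear f" shows "f w = (\<Sum>b\<in>Basis. (w \<bullet> b) *\<^sub>R f b)"
proof -
  have "f w = f (\<Sum>b\<in>Basis. (w \<bullet> b) *\<^sub>R b)" by (simp only: euclidean_representation)
  also have "\<dots> = (\<Sum>b\<in>Basis. (w \<bullet> b) *\<^sub>R f b)"
    by (simp only: linear_sum[OF assms] linear_scale[OF assms])
  finally show ?thesis .
qed

text \<open>By the chain rule the directional derivatives of a composition are finite sums of products
  of directional derivatives of the inner map with partial derivatives of the outer one, so that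
  the claim reproduces itself with one derivative less.\<close>

lemma hd_compose:
  fixes g :: "'a::real_normed_vector \<Rightarrow> 'b::euclidean_space"
  assumes "open S" "open T" "hd_on S g k" "hd_on T f k" "g ` S \<subseteq> T"
  shows "hd_on S (\<lambda>x. f (g x)) k"
  using assms(3-)
proof (induction k arbitrary: f)
  case 0 then show ?case using continuous_on_compose2[of T f S g] by auto
next
  case (Suc k)
  have gk: "hd_on S g k" using Suc.prems hd_SucD by blast
  show ?case
  proof (rule hd_Suc_intro)
    fix x assume x: "x \<in> S"
    have gx: "g x \<in> T" using Suc.prems x by auto
    have D: "((\<lambda>x. f (g x)) has_derivative
       (\<lambda>v. frechet_derivative f (at (g x)) (frechet_derivative g (at x) v))) (at x)"
      using has_derivative_compose[OF hd_SucE[OF Suc.prems(1) x] hd_SucE[OF Suc.prems(2) gx]] .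
    have lin: "linear (frechet_derivative f (at (g x)))"
      using hd_SucE[OF Suc.prems(2) gx] has_derivative_linear by blast
    have rep: "frechet_derivative f (at (g x)) w
        = (\<Sum>b\<in>Basis. (w \<bullet> b) *\<^sub>R frechet_derivative f (at (g x)) b)" for w
      by (rule linear_componentwise_basis[OF lin])
    show "((\<lambda>x. f (g x)) has_derivative
       (\<lambda>v. \<Sum>b\<in>Basis. (frechet_derivative g (at x) v \<bullet> b) *\<^sub>R frechet_derivative f (at (g x)) b)) (at x)"
      by (rule has_derivative_eq_rhs[OF D]) (rule ext, rule rep)
  next
    fix v
    have "hd_on S (\<lambda>x. frechet_derivative f (at (g x)) b) k" for b
      using Suc.prems by (intro Suc.IH gk) auto
    moreover have "hd_on S (\<lambda>x. frechet_derivative g (at x) v \<bullet> b) k" for b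
      using hd_bilinear[OF bounded_bilinear_inner \<open>open S\<close> _ hd_const[of S b]] Suc.prems(1) by simp
    ultimately show "hd_on S (\<lambda>x. \<Sum>b\<in>Basis. (frechet_derivative g (at x) v \<bullet> b) *\<^sub>R
        frechet_derivative f (at (g x)) b) k"
      using \<open>open S\<close> by (intro hd_sum hd_scaleR) auto
  qed fact
qed

lemma hd_inverse: "hd_on {0<..} (inverse :: real \<Rightarrow> real) k"
proof (induction k)
  case 0 then show ?case by (auto intro!: continuous_intros)
next
  case (Suc k)
  show ?case
  proof (rule hd_Suc_intro)
    fix x :: real assume "x \<in> {0<..}"
    then show "(inverse has_derivative (\<lambda>h. - (inverse x * h * inverse x))) (at x)"
      by (auto intro!: derivative_eq_intros)
  next
    fix v :: real
    have "hd_on {0<..} (\<lambda>x. (- v) * (inverse x * inverse x)) k"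
      by (intro hd_mult hd_const Suc) auto
    then show "hd_on {0<..} (\<lambda>x. - (inverse x * v * inverse x)) k" by (simp add: mult_ac)
  qed auto
qed

lemma hd_power:
  fixes f :: "'a::real_normed_vector \<Rightarrow> real"
  assumes "open S" "hd_on S f k" shows "hd_on S (\<lambda>x. f x ^ j) k"
proof (induction j)
  case (Suc j) then show ?case using hd_mult[OF assms Suc] by simp
qed (simp add: hd_const)

lemma hd_Pair:
  assumes "open S" "hd_on S f k" "hd_on S g k" shows "hd_on S (\<lambda>x. (f x, g x)) k"
  using assms
proof (induction k arbitrary: f g)
  case (Suc k)
  show ?case
    by (rule hd_Suc_intro[OF has_derivative_Pair[OF hd_SucE[OF Suc.prems(2)] hd_SucE[OF Suc.prems(3)]]])
      (use Suc.prems in \<open>auto intro: Suc.IH\<close>)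
qed (auto intro: continuous_on_Pair)

subsection \<open>A smooth bump\<close>

text \<open>The functions \<open>s\<^sup>-\<^sup>j exp (-1/s)\<close>, extended by zero, are closed under differentiation up to
  linear combinations, which makes all of them smooth at once.\<close>

definition flat_exp :: "nat \<Rightarrow> real \<Rightarrow> real" where
  "flat_exp j s = (if s \<le> 0 then 0 else inverse s ^ j * exp (- inverse s))"

lemma flat_exp_tendsto_0: "(flat_exp j \<longlongrightarrow> 0) (at 0)"
proof -
  have lim: "((\<lambda>s. inverse s ^ j * exp (- inverse s)) \<longlongrightarrow> (0::real)) (at_right 0)"
  proof -
    have "((\<lambda>x. x ^ j / exp x) \<longlongrightarrow> (0::real)) at_top" by (rule tendsto_power_div_exp_0)
    then have "((\<lambda>s. inverse s ^ j / exp (inverse s)) \<longlongrightarrow> (0::real)) (at_right 0)"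
      by (rule filterlim_compose[OF _ filterlim_inverse_at_top_right])
    then show ?thesis by (simp add: exp_minus divide_inverse)
  qed
  have "(flat_exp j \<longlongrightarrow> 0) (at_right 0)"
    by (rule Lim_transform_eventually[OF lim])
      (auto simp: eventually_at_filter flat_exp_def)
  moreover have "(flat_exp j \<longlongrightarrow> 0) (at_left 0)"
    by (rule Lim_transform_eventually[OF tendsto_const])
      (auto simp: eventually_at_filter flat_exp_def)
  ultimately show ?thesis using filterlim_split_at by blast
qed

lemma flat_exp_derivative:
  "(flat_exp j has_real_derivative flat_exp (j + 2) s - real j * flat_exp (Suc j) s) (at s)"
proof -
  consider "s < 0" | "s = 0" | "s > 0" by linarith
  then show ?thesis
  proof cases
    case 1
    have "((\<lambda>_. 0) has_real_derivative 0) (at s)" by simp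
    then have "(flat_exp j has_real_derivative 0) (at s)"
      by (rule has_field_derivative_transform_within_open[where S="{..<0}"])
        (use 1 in \<open>auto simp: flat_exp_def\<close>)
    then show ?thesis using 1 by (simp add: flat_exp_def)
  next
    case 2
    have "((\<lambda>h. (flat_exp j (0 + h) - flat_exp j 0) / h) \<longlongrightarrow> 0) (at 0)"
      by (rule Lim_transform_eventually[OF flat_exp_tendsto_0[of "Suc j"]])
        (auto simp: eventually_at_filter flat_exp_def field_simps)
    then show ?thesis using 2 unfolding DERIV_def by (simp add: flat_exp_def)
  next
    case 3
    have "((\<lambda>s. inverse s ^ j * exp (- inverse s)) has_real_derivative
        real j * inverse s ^ (j - 1) * (- (inverse s ^ 2)) * exp (- inverse s)
        + inverse s ^ j * (exp (- inverse s) * inverse s ^ 2)) (at s)"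
      using 3 by (auto intro!: derivative_eq_intros simp: power2_eq_square)
    moreover have "real j * inverse s ^ (j - 1) * (- (inverse s ^ 2)) * exp (- inverse s)
        + inverse s ^ j * (exp (- inverse s) * inverse s ^ 2)
        = flat_exp (j + 2) s - real j * flat_exp (Suc j) s"
      using 3 by (cases j) (simp_all add: flat_exp_def algebra_simps power2_eq_square)
    ultimately have "((\<lambda>s. inverse s ^ j * exp (- inverse s)) has_real_derivative
        flat_exp (j + 2) s - real j * flat_exp (Suc j) s) (at s)" by simp
    then show ?thesis
      by (rule has_field_derivative_transform_within_open[where S="{0<..}"])
        (use 3 in \<open>auto simp: flat_exp_def\<close>)
  qed
qed

lemma hd_flat_exp: "hd_on UNIV (flat_exp j) k"
proof (induction k arbitrary: j)
  case 0
  then show ?case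
    using flat_exp_derivative by (auto intro!: continuous_at_imp_continuous_on DERIV_isCont)
next
  case (Suc k)
  show ?case
  proof (rule hd_Suc_intro)
    fix s :: real
    show "(flat_exp j has_derivative
        (\<lambda>v. v * flat_exp (j + 2) s + (- v * real j) * flat_exp (Suc j) s)) (at s)"
      using flat_exp_derivative[of j s]
      by (auto simp: has_field_derivative_def algebra_simps elim!: has_derivative_eq_rhs)
  next
    fix v :: real
    show "hd_on UNIV (\<lambda>s. v * flat_exp (j + 2) s + (- v * real j) * flat_exp (Suc j) s) k"
      by (intro hd_add hd_mult hd_const Suc) auto
  qed auto
qed

definition bump :: "'a::euclidean_space \<Rightarrow> real \<Rightarrow> 'a \<Rightarrow> real" where
  "bump x0 r x = flat_exp 0 (r\<^sup>2 - (x - x0) \<bullet> (x - x0))"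

lemma hd_bump: "hd_on UNIV (bump x0 r) k"
proof -
  have id: "hd_on UNIV (\<lambda>x::'a. x) k" by (rule hd_linear[OF bounded_linear_ident])
  have "hd_on UNIV (\<lambda>x::'a. x + (- x0)) k" by (intro hd_add id hd_const) auto
  then have 1: "hd_on UNIV (\<lambda>x::'a. x - x0) k" by simp
  have "hd_on UNIV (\<lambda>x::'a. r\<^sup>2 + (-1) * ((x - x0) \<bullet> (x - x0))) k"
    by (intro hd_add hd_const hd_mult hd_bilinear[OF bounded_bilinear_inner] 1) auto
  then have "hd_on UNIV (\<lambda>x::'a. r\<^sup>2 - ((x - x0) \<bullet> (x - x0))) k" by simp
  from hd_compose[OF _ _ this hd_flat_exp[of 0 k]] show ?thesis
    by (simp add: bump_def[abs_def])
qed

lemma bump_nonneg: "0 \<le> bump x0 r x" by (simp add: bump_def flat_exp_def)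

lemma bump_pos_iff:
  assumes "0 < r" shows "0 < bump x0 r x \<longleftrightarrow> x \<in> ball x0 r"
proof -
  have "(x - x0) \<bullet> (x - x0) < r\<^sup>2 \<longleftrightarrow> norm (x - x0) < r"
    using assms by (simp add: norm_lt_square)
  then show ?thesis by (auto simp: bump_def flat_exp_def dist_norm norm_minus_commute)
qed

lemma bump_eq_0: "0 < r \<Longrightarrow> x \<notin> ball x0 r \<Longrightarrow> bump x0 r x = 0"
  using bump_pos_iff[of r x0 x] bump_nonneg[of x0 r x] by force

section \<open>Hausdorff measure is a multiple of Lebesgue measure\<close>

abbreviation hausdorff_cost :: "nat \<Rightarrow> 'a::metric_space set \<Rightarrow> ennreal" where
  "hausdorff_cost k C \<equiv>
     (if C = {} then 0 else ennreal (unit_ball_vol (real k) * (diameter C / 2) ^ k))"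

abbreviation is_cover :: "real \<Rightarrow> 'a::metric_space set \<Rightarrow> (nat \<Rightarrow> 'a set) \<Rightarrow> bool" where
  "is_cover \<delta> A C \<equiv> A \<subseteq> (\<Union>n. C n) \<and> (\<forall>n. bounded (C n) \<and> diameter (C n) \<le> \<delta>)"

lemma premeasure_le_cover:
  "is_cover \<delta> A C \<Longrightarrow> hausdorff_premeasure k \<delta> A \<le> (\<Sum>n. hausdorff_cost k (C n))"
  unfolding hausdorff_premeasure_def by (rule INF_lower) auto

lemma premeasure_greatest:
  "(\<And>C. is_cover \<delta> A C \<Longrightarrow> x \<le> (\<Sum>n. hausdorff_cost k (C n))) \<Longrightarrow> x \<le> hausdorff_premeasure k \<delta> A"
  unfolding hausdorff_premeasure_def by (rule INF_greatest) auto

lemma premeasure_lessD: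
  "hausdorff_premeasure k \<delta> A < x \<Longrightarrow> \<exists>C. is_cover \<delta> A C \<and> (\<Sum>n. hausdorff_cost k (C n)) < x"
  unfolding hausdorff_premeasure_def by (simp only: INF_less_iff mem_Collect_eq Bex_def)

lemma premeasure_mono: "A \<subseteq> B \<Longrightarrow> hausdorff_premeasure k \<delta> A \<le> hausdorff_premeasure k \<delta> B"
  by (rule premeasure_greatest) (auto intro!: premeasure_le_cover)

lemma hausdorff_measure_mono: "A \<subseteq> B \<Longrightarrow> hausdorff_measure k A \<le> hausdorff_measure k B"
  unfolding hausdorff_measure_def by (rule SUP_mono) (use premeasure_mono in blast)

lemma premeasure_le_measure:
  "0 < \<delta> \<Longrightarrow> hausdorff_premeasure k \<delta> A \<le> hausdorff_measure k A"
  unfolding hausdorff_measure_def by (rule SUP_upper) auto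

lemma hausdorff_measure_empty: "hausdorff_measure k {} = 0"
proof -
  have "hausdorff_premeasure k \<delta> {} \<le> 0" if "\<delta> > 0" for \<delta>
    using premeasure_le_cover[of "{}" "\<lambda>_. {}" \<delta> k] that by simp
  then have "hausdorff_measure k {} \<le> 0"
    unfolding hausdorff_measure_def by (intro SUP_least) auto
  then show ?thesis by simp
qed

lemma ennreal_less_add_pos: "x < top \<Longrightarrow> 0 < y \<Longrightarrow> x < x + (y::ennreal)"
  using ennreal_add_left_cancel_less[of x 0 y] by simp

text \<open>Covers of the single sets whose costs exceed the infima by summable amounts of total \<open>e\<close> are merged
  into one cover of the union.\<close>

lemma premeasure_countable_subadditive:
  "hausdorff_premeasure k \<delta> (\<Union>n. A n) \<le> (\<Sum>n. hausdorff_premeasure k \<delta> (A n))"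
proof (rule ennreal_le_epsilon)
  fix e :: real assume fin: "(\<Sum>n. hausdorff_premeasure k \<delta> (A n)) < top" and e: "0 < e"
  have half_pos: "0 < ennreal (e * (1/2) ^ Suc n)" for n
    using e by (subst ennreal_less_zero_iff) simp
  have fin': "hausdorff_premeasure k \<delta> (A n) < top" for n
    using ennreal_suminf_lessD[OF fin] by auto
  have "\<exists>C. is_cover \<delta> (A n) C \<and>
      (\<Sum>j. hausdorff_cost k (C j)) < hausdorff_premeasure k \<delta> (A n) + ennreal (e * (1/2) ^ Suc n)" for n
  proof -
    have "hausdorff_premeasure k \<delta> (A n) < hausdorff_premeasure k \<delta> (A n) + ennreal (e * (1/2) ^ Suc n)"
      by (rule ennreal_less_add_pos[OF fin' half_pos])
    then show ?thesis by (rule premeasure_lessD)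
  qed
  then obtain C where *: "\<forall>n. is_cover \<delta> (A n) (C n) \<and>
      (\<Sum>j. hausdorff_cost k (C n j)) < hausdorff_premeasure k \<delta> (A n) + ennreal (e * (1/2) ^ Suc n)"
    using choice[of "\<lambda>n C. is_cover \<delta> (A n) C \<and>
      (\<Sum>j. hausdorff_cost k (C j)) < hausdorff_premeasure k \<delta> (A n) + ennreal (e * (1/2) ^ Suc n)"]
    by blast
  have C: "is_cover \<delta> (A n) (C n)" for n by (rule conjunct1[OF spec[OF *]])
  have lt: "(\<Sum>j. hausdorff_cost k (C n j))
      < hausdorff_premeasure k \<delta> (A n) + ennreal (e * (1/2) ^ Suc n)" for n
    by (rule conjunct2[OF spec[OF *]])
  define D where "D i = C (fst (prod_decode i)) (snd (prod_decode i))" for i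
  have "(\<Union>n. A n) \<subseteq> (\<Union>i. D i)"
  proof
    fix x assume "x \<in> (\<Union>n. A n)"
    then obtain n j where "x \<in> C n j" using C by blast
    then have "x \<in> D (prod_encode (n, j))" by (simp add: D_def)
    then show "x \<in> (\<Union>i. D i)" by blast
  qed
  then have "is_cover \<delta> (\<Union>n. A n) D" using C by (auto simp: D_def)
  then have "hausdorff_premeasure k \<delta> (\<Union>n. A n) \<le> (\<Sum>i. hausdorff_cost k (D i))"
    by (rule premeasure_le_cover)
  also have "\<dots> = (\<Sum>n. \<Sum>j. hausdorff_cost k (C n j))"
    unfolding D_def
    by (subst suminf_ennreal_2dimen[where f="\<lambda>p. hausdorff_cost k (C (fst p) (snd p))"])
      (simp_all only: fst_conv snd_conv)
  also have "\<dots> \<le> (\<Sum>n. hausdorff_premeasure k \<delta> (A n) + ennreal (e * (1/2) ^ Suc n))"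
    by (rule suminf_le[OF less_imp_le[OF lt] summableI summableI])
  also have "\<dots> = (\<Sum>n. hausdorff_premeasure k \<delta> (A n)) + (\<Sum>n. ennreal (e * (1/2) ^ Suc n))"
    by (intro suminf_add[symmetric]) auto
  also have "(\<Sum>n. ennreal (e * (1/2) ^ Suc n)) = ennreal e"
    using e sums_mult[OF power_half_series, of e] by (intro suminf_ennreal_eq) (auto simp: mult_1_right)
  finally show "hausdorff_premeasure k \<delta> (\<Union>n. A n)
      \<le> (\<Sum>n. hausdorff_premeasure k \<delta> (A n)) + ennreal e" .
qed

lemma hausdorff_countable_subadditive:
  "hausdorff_measure k (\<Union>n. A n) \<le> (\<Sum>n. hausdorff_measure k (A n))"
proof -
  have "hausdorff_premeasure k \<delta> (\<Union>n. A n) \<le> (\<Sum>n. hausdorff_measure k (A n))" if "\<delta> > 0" for \<delta>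
    by (rule order_trans[OF premeasure_countable_subadditive])
      (intro suminf_le premeasure_le_measure that, auto)
  then show ?thesis unfolding hausdorff_measure_def[of k "\<Union>n. A n"] by (intro SUP_least) auto
qed

lemma hausdorff_subadditive:
  "hausdorff_measure k (A \<union> B) \<le> hausdorff_measure k A + hausdorff_measure k B"
  using hausdorff_countable_subadditive[of k "binaryset A B"]
  by (simp add: UN_binaryset_eq suminf_binaryset_eq hausdorff_measure_empty)

lemma ennreal_cancel_factor:
  assumes "0 < c" shows "ennreal (inverse c) * (ennreal c * x) = x"
proof -
  have "0 \<le> inverse c" "0 \<le> c" and 1: "inverse c * c = 1" using assms by auto
  then have "ennreal (inverse c) * (ennreal c * x) = ennreal (inverse c * c) * x"
    by (subst ennreal_mult) (auto simp: mult.assoc)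
  then show ?thesis unfolding 1 by simp
qed

lemma ennreal_le_factorI:
  assumes "0 < c" "ennreal (inverse c) * x \<le> y" shows "x \<le> ennreal c * y"
proof -
  have "ennreal c * (ennreal (inverse c) * x) \<le> ennreal c * y"
    using assms(2) by (rule mult_left_mono) simp
  then show ?thesis using ennreal_cancel_factor[of "inverse c" x] assms(1) by simp
qed

lemma hausdorff_affine_le:
  fixes A :: "'a::real_normed_vector set"
  assumes r: "0 < r"
  shows "hausdorff_measure k ((\<lambda>x. a + r *\<^sub>R x) ` A) \<le> ennreal (r ^ k) * hausdorff_measure k A"
proof -
  let ?f = "\<lambda>x. a + r *\<^sub>R x"
  have *: "hausdorff_premeasure k \<delta> (?f ` A) \<le> ennreal (r ^ k) * hausdorff_measure k A" if "\<delta> > 0" for \<delta>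
  proof -
    have "ennreal (inverse r ^ k) * hausdorff_premeasure k \<delta> (?f ` A) \<le> hausdorff_premeasure k (\<delta> / r) A"
    proof (rule premeasure_greatest)
      fix C assume C: "is_cover (\<delta> / r) A C"
      have diam: "diameter (?f ` C n) \<le> r * diameter (C n)" for n
      proof (cases "C n = {}")
        case False
        have "norm (x - y) \<le> r * diameter (C n)" if "x \<in> ?f ` C n" "y \<in> ?f ` C n" for x y
        proof -
          obtain u v where "u \<in> C n" "v \<in> C n" "x = ?f u" "y = ?f v" using \<open>x \<in> _\<close> \<open>y \<in> _\<close> by auto
          then have "norm (x - y) = r * dist u v"
            using r by (simp add: dist_norm flip: scaleR_diff_right)
          then show ?thesis using diameter_bounded_bound[of "C n" u v] C \<open>u \<in> _\<close> \<open>v \<in> _\<close> r by simp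
        qed
        then show ?thesis using False by (intro diameter_le) auto
      qed simp
      have "is_cover \<delta> (?f ` A) (\<lambda>n. ?f ` C n)"
      proof (intro conjI allI)
        show "?f ` A \<subseteq> (\<Union>n. ?f ` C n)" using C by blast
        show "bounded (?f ` C n)" for n
          using C bounded_translation[OF bounded_scaling[of "C n" r], of a] by (simp add: image_image)
        show "diameter (?f ` C n) \<le> \<delta>" for n
        proof -
          have "r * diameter (C n) \<le> r * (\<delta> / r)" using C r by (intro mult_left_mono) auto
          then show ?thesis using diam[of n] r by simp
        qed
      qed
      then have "hausdorff_premeasure k \<delta> (?f ` A) \<le> (\<Sum>n. hausdorff_cost k (?f ` C n))"
        by (rule premeasure_le_cover)
      also have "\<dots> \<le> (\<Sum>n. ennreal (r ^ k) * hausdorff_cost k (C n))"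
      proof (intro suminf_le)
        fix n
        show "hausdorff_cost k (?f ` C n) \<le> ennreal (r ^ k) * hausdorff_cost k (C n)"
        proof (cases "C n = {}")
          case False
          have "0 \<le> diameter (?f ` C n)"
            using C bounded_translation[OF bounded_scaling[of "C n" r], of a]
            by (intro diameter_ge_0) (simp add: image_image)
          then have "(diameter (?f ` C n) / 2) ^ k \<le> (r * (diameter (C n) / 2)) ^ k"
            using diam[of n] by (intro power_mono) auto
          then have "unit_ball_vol (real k) * (diameter (?f ` C n) / 2) ^ k
              \<le> r ^ k * (unit_ball_vol (real k) * (diameter (C n) / 2) ^ k)"
            using mult_left_mono[of "(diameter (?f ` C n) / 2) ^ k" "(r * (diameter (C n) / 2)) ^ k" "unit_ball_vol (real k)"]
            by (simp only: power_mult_distrib unit_ball_vol_nonneg mult.left_commute of_nat_0_le_iff)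
          then show ?thesis using False r
            by (simp add: ennreal_mult'[symmetric] ennreal_leI)
        qed simp
      qed auto
      also have "\<dots> = ennreal (r ^ k) * (\<Sum>n. hausdorff_cost k (C n))" by (simp only: ennreal_suminf_cmult)
      finally have "ennreal (inverse r ^ k) * hausdorff_premeasure k \<delta> (?f ` A)
          \<le> ennreal (inverse r ^ k) * (ennreal (r ^ k) * (\<Sum>n. hausdorff_cost k (C n)))"
        by (intro mult_left_mono) auto
      also have "\<dots> = ennreal (inverse r ^ k * r ^ k) * (\<Sum>n. hausdorff_cost k (C n))"
        using r by (simp add: ennreal_mult mult.assoc)
      also have "inverse r ^ k * r ^ k = 1" using r by (simp add: power_mult_distrib[symmetric])
      finally show "ennreal (inverse r ^ k) * hausdorff_premeasure k \<delta> (?f ` A)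
          \<le> (\<Sum>n. hausdorff_cost k (C n))" by simp
    qed
    also have "\<dots> \<le> hausdorff_measure k A" using r that by (intro premeasure_le_measure) auto
    finally have "ennreal (r ^ k) * (ennreal (inverse r ^ k) * hausdorff_premeasure k \<delta> (?f ` A))
        \<le> ennreal (r ^ k) * hausdorff_measure k A" by (intro mult_left_mono) auto
    moreover have "ennreal (r ^ k) * (ennreal (inverse r ^ k) * hausdorff_premeasure k \<delta> (?f ` A))
        = ennreal (r ^ k * inverse r ^ k) * hausdorff_premeasure k \<delta> (?f ` A)"
      using r by (simp add: ennreal_mult mult.assoc)
    moreover have "r ^ k * inverse r ^ k = 1" using r by (simp add: power_mult_distrib[symmetric])
    ultimately show ?thesis by simp
  qed
  show ?thesis unfolding hausdorff_measure_def[of k "?f ` A"] using * by (intro SUP_least) auto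
qed

lemma hausdorff_ball:
  fixes x :: "'a::real_normed_vector"
  assumes r: "0 < r"
  shows "hausdorff_measure k (ball x r) = ennreal (r ^ k) * hausdorff_measure k (ball (0::'a) 1)"
proof (rule antisym)
  have 1: "(\<lambda>y. x + r *\<^sub>R y) ` ball 0 1 = ball x r"
  proof -
    have "(\<lambda>y. x + r *\<^sub>R y) ` ball (0::'a) 1 = (+) x ` ((*\<^sub>R) r ` ball 0 1)"
      by (simp add: image_image)
    then show ?thesis using r by (simp add: ball_scale ball_translation[symmetric])
  qed
  show "hausdorff_measure k (ball x r) \<le> ennreal (r ^ k) * hausdorff_measure k (ball (0::'a) 1)"
    using hausdorff_affine_le[OF r, of k x "ball 0 1"] 1 by simp
  have "(\<lambda>y. (- inverse r *\<^sub>R x) + inverse r *\<^sub>R y) ` ball x r = (\<lambda>y. y) ` ball 0 1"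
    unfolding 1[symmetric] image_image using r by (intro image_cong) (auto simp: algebra_simps)
  then have "hausdorff_measure k (ball (0::'a) 1) \<le> ennreal (inverse r ^ k) * hausdorff_measure k (ball x r)"
    using hausdorff_affine_le[of "inverse r" k "- inverse r *\<^sub>R x" "ball x r"] r by simp
  then have "ennreal (r ^ k) * hausdorff_measure k (ball (0::'a) 1)
      \<le> ennreal (r ^ k) * (ennreal (inverse r ^ k) * hausdorff_measure k (ball x r))"
    by (intro mult_left_mono) auto
  also have "\<dots> = ennreal (r ^ k * inverse r ^ k) * hausdorff_measure k (ball x r)"
    using r by (simp add: ennreal_mult mult.assoc)
  also have "r ^ k * inverse r ^ k = 1" using r by (simp add: power_mult_distrib[symmetric])
  finally show "ennreal (r ^ k) * hausdorff_measure k (ball (0::'a) 1) \<le> hausdorff_measure k (ball x r)"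
    by simp
qed

lemma countable_disjoint_enumeration:
  assumes "countable C" "pairwise (\<lambda>i j. disjnt (S i) (S j)) C"
  obtains J :: "nat set" and i where "bij_betw i J C" "disjoint_family_on (\<lambda>n. S (i n)) J"
proof -
  have b: "bij_betw (from_nat_into C) (to_nat_on C ` C) C"
    by (rule bij_betw_byWitness[where f'="to_nat_on C"]) (use assms(1) in auto)
  have "disjoint_family_on (\<lambda>n. S (from_nat_into C n)) (to_nat_on C ` C)"
    unfolding disjoint_family_on_def
  proof (intro ballI impI)
    fix m n assume mn: "m \<in> to_nat_on C ` C" "n \<in> to_nat_on C ` C" "m \<noteq> n"
    then have "from_nat_into C m \<in> C" "from_nat_into C n \<in> C" "from_nat_into C m \<noteq> from_nat_into C n"
      using b by (auto simp: bij_betw_def inj_on_def)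
    then show "S (from_nat_into C m) \<inter> S (from_nat_into C n) = {}"
      using assms(2) by (auto simp: pairwise_def disjnt_def)
  qed
  with b show ?thesis by (rule that)
qed

text \<open>Vitali's covering lemma yields disjoint balls inside an open set whose fivefold dilations
  cover it.\<close>

lemma hausdorff_open_le:
  fixes U :: "'a::euclidean_space set"
  assumes "open U"
  shows "hausdorff_measure DIM('a) U \<le> ennreal (5 ^ DIM('a)) * emeasure lborel U"
proof -
  let ?k = "DIM('a)"
  have "hausdorff_premeasure ?k \<delta> U \<le> ennreal (5 ^ ?k) * emeasure lborel U" if "\<delta> > 0" for \<delta>
  proof -
    have "\<exists>s. 0 < s \<and> s \<le> \<delta> / 10 \<and> cball x s \<subseteq> U" if x: "x \<in> U" for x
    proof -
      obtain e where "e > 0" "cball x e \<subseteq> U" using assms x open_contains_cball by blast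
      then show ?thesis using \<open>\<delta> > 0\<close> by (intro exI[of _ "min e (\<delta>/10)"]) auto
    qed
    then obtain s where s: "\<And>x. x \<in> U \<Longrightarrow> 0 < s x \<and> s x \<le> \<delta> / 10 \<and> cball x (s x) \<subseteq> U" by metis
    have cov: "U \<subseteq> (\<Union>x\<in>U. cball x (s x))" using s by (force intro: less_imp_le)
    obtain C where C: "countable C" "C \<subseteq> U"
      and dis: "pairwise (\<lambda>i j. disjnt (cball i (s i)) (cball j (s j))) C"
      and U: "U \<subseteq> (\<Union>i\<in>C. cball i (5 * s i))"
      by (rule Vitali_covering_lemma_cballs[OF cov, of "\<delta> / 10"]) (use s in auto)
    obtain J :: "nat set" and i where i: "bij_betw i J C"
      and disJ: "disjoint_family_on (\<lambda>n. cball (i n) (s (i n))) J"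
      by (rule countable_disjoint_enumeration[OF C(1) dis])
    define D where "D n = (if n \<in> J then cball (i n) (s (i n)) else {})" for n
    define E where "E n = (if n \<in> J then cball (i n) (5 * s (i n)) else {})" for n
    have iJ: "i n \<in> U" if "n \<in> J" for n using i that C(2) by (auto simp: bij_betw_def)
    have disD: "disjoint_family D" using disJ by (auto simp: disjoint_family_on_def D_def)
    have "is_cover \<delta> U E"
    proof (intro conjI allI)
      show "U \<subseteq> (\<Union>n. E n)"
      proof
        fix x assume "x \<in> U"
        then obtain c where "c \<in> C" "x \<in> cball c (5 * s c)" using U by blast
        moreover obtain n where "n \<in> J" "c = i n" using i \<open>c \<in> C\<close> by (auto simp: bij_betw_def)
        ultimately show "x \<in> (\<Union>n. E n)" by (auto simp: E_def)
      qed
      show "bounded (E n)" for n by (simp add: E_def)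
      show "diameter (E n) \<le> \<delta>" for n using s[OF iJ, of n] \<open>\<delta> > 0\<close> by (auto simp: E_def)
    qed
    then have "hausdorff_premeasure ?k \<delta> U \<le> (\<Sum>n. hausdorff_cost ?k (E n))" by (rule premeasure_le_cover)
    also have "\<dots> \<le> (\<Sum>n. ennreal (5 ^ ?k) * emeasure lborel (D n))"
    proof (intro suminf_le)
      fix n show "hausdorff_cost ?k (E n) \<le> ennreal (5 ^ ?k) * emeasure lborel (D n)"
      proof (cases "n \<in> J")
        case True
        then have p: "0 < s (i n)" using s iJ by auto
        then have "hausdorff_cost ?k (E n) = ennreal (5 ^ ?k * (unit_ball_vol ?k * s (i n) ^ ?k))"
          using True by (simp add: E_def power_mult_distrib mult_ac)
        also have "\<dots> = ennreal (5 ^ ?k) * emeasure lborel (D n)"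
          using True p by (simp add: D_def emeasure_cball ennreal_mult)
        finally show ?thesis by simp
      qed (simp add: E_def)
    qed auto
    also have "\<dots> = ennreal (5 ^ ?k) * (\<Sum>n. emeasure lborel (D n))" by simp
    also have "(\<Sum>n. emeasure lborel (D n)) = emeasure lborel (\<Union>n. D n)"
    proof (rule suminf_emeasure[OF _ disD])
      show "range D \<subseteq> sets lborel" by (auto simp: D_def)
    qed
    also have "\<dots> \<le> emeasure lborel U"
      using s iJ assms by (intro emeasure_mono) (auto simp: D_def split: if_splits)
    finally show ?thesis by (simp add: mult_left_mono)
  qed
  then show ?thesis unfolding hausdorff_measure_def by (intro SUP_least) auto
qed

text \<open>Lebesgue measure is outer regular, so an upper bound need only be checked on open sets.\<close>

lemma outer_open_bound:
  fixes A :: "'a::euclidean_space set" and \<gamma> :: real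
  assumes A: "A \<in> sets lebesgue"
    and le: "\<And>U::'a set. open U \<Longrightarrow> hausdorff_measure k U \<le> ennreal \<gamma> * emeasure lborel U"
  shows "hausdorff_measure k A \<le> ennreal \<gamma> * emeasure lebesgue A"
proof (rule ennreal_le_epsilon)
  fix e :: real assume e: "0 < e"
  define e' where "e' = e / (\<bar>\<gamma>\<bar> + 1)"
  have e': "e' > 0" using e by (simp add: e'_def)
  obtain T where T: "open T" "A \<subseteq> T" "T - A \<in> lmeasurable" "emeasure lebesgue (T - A) < ennreal e'"
    using sets_lebesgue_outer_open[OF A e'] by blast
  have "emeasure lborel T = emeasure lebesgue (A \<union> (T - A))"
    using T by (simp add: Un_absorb1)
  also have "\<dots> \<le> emeasure lebesgue A + emeasure lebesgue (T - A)"
    using A T by (intro emeasure_subadditive) auto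
  also have "\<dots> \<le> emeasure lebesgue A + ennreal e'" using T by (intro add_left_mono) auto
  finally have "ennreal \<gamma> * emeasure lborel T \<le> ennreal \<gamma> * (emeasure lebesgue A + ennreal e')"
    by (intro mult_left_mono) auto
  also have "\<dots> = ennreal \<gamma> * emeasure lebesgue A + ennreal \<gamma> * ennreal e'" by (simp add: distrib_left)
  finally have *: "ennreal \<gamma> * emeasure lborel T
      \<le> ennreal \<gamma> * emeasure lebesgue A + ennreal \<gamma> * ennreal e'" .
  have "ennreal \<gamma> * ennreal e' \<le> ennreal e"
  proof -
    have "\<gamma> * e' \<le> (\<bar>\<gamma>\<bar> + 1) * e'" using e' by (intro mult_right_mono) auto
    also have "\<dots> = e" by (simp add: e'_def)
    finally have "\<gamma> * e' \<le> e" .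
    then show ?thesis using e' by (cases "\<gamma> \<ge> 0") (auto simp: ennreal_mult[symmetric] ennreal_neg ennreal_leI)
  qed
  then have "ennreal \<gamma> * emeasure lebesgue A + ennreal \<gamma> * ennreal e'
      \<le> ennreal \<gamma> * emeasure lebesgue A + ennreal e" by (rule add_left_mono)
  from order_trans[OF order_trans[OF order_trans[OF hausdorff_measure_mono[OF T(2)] le[OF T(1)]] *] this]
  show "hausdorff_measure k A \<le> ennreal \<gamma> * emeasure lebesgue A + ennreal e" .
qed

text \<open>A set of diameter \<open>d\<close> lies in a ball of radius \<open>d\<close>, while the Hausdorff premeasure charges it for a
  ball of half that radius.\<close>

lemma lebesgue_le_hausdorff:
  fixes A :: "'a::euclidean_space set"
  assumes A: "A \<in> sets lebesgue"
  shows "emeasure lebesgue A \<le> ennreal (2 ^ DIM('a)) * hausdorff_measure DIM('a) A"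
proof -
  let ?k = "DIM('a)"
  have "ennreal (inverse (2 ^ ?k)) * emeasure lebesgue A \<le> hausdorff_premeasure ?k 1 A"
  proof (rule premeasure_greatest)
    fix C assume C: "is_cover 1 A C"
    define c where "c n = (SOME x. x \<in> C n)" for n
    define B where "B n = (if C n = {} then {} else cball (c n) (diameter (C n)))" for n
    have CB: "C n \<subseteq> B n" for n
    proof
      fix x assume "x \<in> C n"
      moreover from this have "c n \<in> C n" unfolding c_def by (rule someI)
      ultimately show "x \<in> B n" using C diameter_bounded_bound[of "C n" "c n" x] by (auto simp: B_def)
    qed
    have Bs: "B n \<in> sets lebesgue" for n by (simp add: B_def)
    have "A \<subseteq> (\<Union>n. B n)" using C CB by blast
    then have "emeasure lebesgue A \<le> emeasure lebesgue (\<Union>n. B n)"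
      using Bs by (intro emeasure_mono sets.countable_UN) auto
    also have "\<dots> \<le> (\<Sum>n. emeasure lebesgue (B n))"
      by (intro emeasure_subadditive_countably) (auto simp: B_def)
    also have "\<dots> = (\<Sum>n. ennreal (2 ^ ?k) * hausdorff_cost ?k (C n))"
    proof (intro suminf_cong)
      fix n show "emeasure lebesgue (B n) = ennreal (2 ^ ?k) * hausdorff_cost ?k (C n)"
      proof (cases "C n = {}")
        case False
        have d: "0 \<le> diameter (C n)" using C by (intro diameter_ge_0) auto
        have "ennreal (2 ^ ?k) * hausdorff_cost ?k (C n)
            = ennreal (2 ^ ?k * (unit_ball_vol ?k * (diameter (C n) / 2) ^ ?k))"
          using False d by (simp add: ennreal_mult)
        also have "2 ^ ?k * (unit_ball_vol ?k * (diameter (C n) / 2) ^ ?k)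
            = unit_ball_vol ?k * diameter (C n) ^ ?k" by (simp add: power_divide)
        finally show ?thesis using False d by (simp add: B_def emeasure_cball)
      qed (simp add: B_def)
    qed
    also have "\<dots> = ennreal (2 ^ ?k) * (\<Sum>n. hausdorff_cost ?k (C n))" by (simp only: ennreal_suminf_cmult)
    finally have "ennreal (inverse (2 ^ ?k)) * emeasure lebesgue A
        \<le> ennreal (inverse (2 ^ ?k)) * (ennreal (2 ^ ?k) * (\<Sum>n. hausdorff_cost ?k (C n)))"
      by (rule mult_left_mono) simp
    then show "ennreal (inverse (2 ^ ?k)) * emeasure lebesgue A \<le> (\<Sum>n. hausdorff_cost ?k (C n))"
      by (subst (asm) ennreal_cancel_factor) simp_all
  qed
  also have "\<dots> \<le> hausdorff_measure ?k A" by (rule premeasure_le_measure) simp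
  finally show ?thesis by (intro ennreal_le_factorI) simp_all
qed

text \<open>The upper bound comes from Vitali's covering theorem, since on balls the identity holds by
  scaling and null sets are harmless by the crude estimate. As the total on a large ball is
  correct, no part of it can have less than its share.\<close>

theorem hausdorff_eq_lebesgue:
  obtains \<gamma> :: real where "0 < \<gamma>"
    "\<And>A::'a::euclidean_space set. A \<in> sets lebesgue \<Longrightarrow> bounded A \<Longrightarrow>
       hausdorff_measure DIM('a) A = ennreal \<gamma> * emeasure lebesgue A"
proof -
  let ?k = "DIM('a)" let ?H = "hausdorff_measure DIM('a) :: 'a set \<Rightarrow> ennreal"
  let ?w = "unit_ball_vol (real ?k)"
  have w: "0 < ?w" by simp
  have crude: "?H A \<le> ennreal (5 ^ ?k) * emeasure lebesgue A" if "A \<in> sets lebesgue" for A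
    by (rule outer_open_bound[OF that hausdorff_open_le])
  have "?H (ball 0 1) < top"
  proof -
    have "?H (ball 0 1) \<le> ennreal (5 ^ ?k) * emeasure lebesgue (ball (0::'a) 1)" by (rule crude) simp
    also have "\<dots> < top" by (simp add: emeasure_ball ennreal_mult_less_top)
    finally show ?thesis .
  qed
  moreover have "?H (ball 0 1) \<noteq> 0"
  proof
    assume "?H (ball 0 1) = 0"
    then have "emeasure lebesgue (ball (0::'a) 1) \<le> 0" using lebesgue_le_hausdorff[of "ball (0::'a) 1"] by simp
    then show False using w by (simp add: emeasure_ball)
  qed
  ultimately obtain c where c: "0 < c" "?H (ball 0 1) = ennreal c"
    by (cases "?H (ball 0 1)") (auto simp: ennreal_eq_0_iff not_le)
  define \<gamma> where "\<gamma> = c / ?w"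
  have \<gamma>: "0 < \<gamma>" using c w by (simp add: \<gamma>_def)
  have ball: "?H (ball x r) = ennreal \<gamma> * emeasure lebesgue (ball x r)" if "0 < r" for x r
  proof -
    have "?H (ball x r) = ennreal (r ^ ?k * c)"
      unfolding hausdorff_ball[OF that, of _ x] c(2) using that c(1) by (simp add: ennreal_mult)
    also have "r ^ ?k * c = \<gamma> * (?w * r ^ ?k)" using less_imp_neq[OF w] by (simp add: \<gamma>_def)
    finally show ?thesis using that \<gamma> by (simp add: emeasure_ball ennreal_mult)
  qed
  have op: "?H U \<le> ennreal \<gamma> * emeasure lborel U" if U: "open U" for U
  proof -
    define K where "K = {(x, r). 0 < r \<and> ball x r \<subseteq> U}"
    have K: "\<exists>i. i \<in> K \<and> x \<in> ball (fst i) (snd i) \<and> snd i < d" if "x \<in> U" "0 < d" for x d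
    proof -
      obtain e where "e > 0" "ball x e \<subseteq> U" using U \<open>x \<in> U\<close> open_contains_ball by blast
      then show ?thesis using \<open>0 < d\<close>
        by (intro exI[of _ "(x, min e (d/2))"]) (auto simp: K_def)
    qed
    obtain C where C: "countable C" "C \<subseteq> K"
      and dis: "pairwise (\<lambda>i j. disjnt (ball (fst i) (snd i)) (ball (fst j) (snd j))) C"
      and neg: "negligible (U - (\<Union>i\<in>C. ball (fst i) (snd i)))"
      by (rule Vitali_covering_theorem_balls[of U K fst snd, OF K]) auto
    obtain J :: "nat set" and i where i: "bij_betw i J C"
      and disJ: "disjoint_family_on (\<lambda>n. ball (fst (i n)) (snd (i n))) J"
      by (rule countable_disjoint_enumeration[OF C(1) dis])
    define D where "D n = (if n \<in> J then ball (fst (i n)) (snd (i n)) else {})" for n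
    let ?N = "U - (\<Union>i\<in>C. ball (fst i) (snd i))"
    have iJ: "i n \<in> K" if "n \<in> J" for n using i that C(2) by (auto simp: bij_betw_def)
    have "(\<Union>i\<in>C. ball (fst i) (snd i)) = (\<Union>n. D n)"
      using i by (auto simp: D_def bij_betw_def split: if_splits)
    then have "U \<subseteq> ?N \<union> (\<Union>n. D n)" by blast
    then have "?H U \<le> ?H ?N + ?H (\<Union>n. D n)"
      by (meson hausdorff_measure_mono hausdorff_subadditive order_trans)
    moreover have "?H ?N \<le> 0"
    proof -
      have N: "?N \<in> sets lebesgue" "emeasure lebesgue ?N = 0"
        using neg by (auto simp only: negligible_iff_null_sets null_sets_def mem_Collect_eq)
      show ?thesis using crude[OF N(1)] unfolding N(2) by simp
    qed
    ultimately have "?H U \<le> ?H (\<Union>n. D n)" by simp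
    also have "\<dots> \<le> (\<Sum>n. ?H (D n))" by (rule hausdorff_countable_subadditive)
    also have "\<dots> = (\<Sum>n. ennreal \<gamma> * emeasure lborel (D n))"
    proof (intro suminf_cong)
      fix n show "?H (D n) = ennreal \<gamma> * emeasure lborel (D n)"
        using iJ[of n] ball by (auto simp: D_def K_def hausdorff_measure_empty split: prod.splits)
    qed
    also have "\<dots> = ennreal \<gamma> * (\<Sum>n. emeasure lborel (D n))" by simp
    also have "(\<Sum>n. emeasure lborel (D n)) = emeasure lborel (\<Union>n. D n)"
    proof (rule suminf_emeasure)
      show "range D \<subseteq> sets lborel" by (auto simp: D_def)
      show "disjoint_family D" using disJ by (auto simp: D_def disjoint_family_on_def)
    qed
    also have "\<dots> \<le> emeasure lborel U"
      using iJ U by (intro emeasure_mono) (fastforce simp: D_def K_def split: if_splits prod.splits)+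
    finally show ?thesis by (simp add: mult_left_mono)
  qed
  have upper: "?H A \<le> ennreal \<gamma> * emeasure lebesgue A" if "A \<in> sets lebesgue" for A
    by (rule outer_open_bound[OF that op])
  show ?thesis
  proof (rule that[OF \<gamma>])
    fix A :: "'a set" assume A: "A \<in> sets lebesgue" "bounded A"
    obtain r where r: "0 < r" "A \<subseteq> ball 0 r" using bounded_subset_ballD[OF A(2), of 0] by blast
    let ?B = "ball (0::'a) r"
    have split: "emeasure lebesgue ?B = emeasure lebesgue A + emeasure lebesgue (?B - A)"
      using r A by (subst plus_emeasure) (auto simp: Un_absorb1)
    have fin: "emeasure lebesgue ?B < top" by (simp add: emeasure_ball less_imp_le[OF r(1)])
    have finD: "ennreal \<gamma> * emeasure lebesgue (?B - A) < top"
      using fin split by (auto simp: ennreal_mult_less_top)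
    have "ennreal \<gamma> * emeasure lebesgue A + ennreal \<gamma> * emeasure lebesgue (?B - A) = ?H ?B"
      using ball[OF r(1)] split by (simp add: distrib_left)
    also have "\<dots> \<le> ?H A + ?H (?B - A)"
      using hausdorff_subadditive[of ?k A "?B - A"] r by (simp add: Un_absorb1)
    also have "\<dots> \<le> ?H A + ennreal \<gamma> * emeasure lebesgue (?B - A)"
      using A by (intro add_left_mono upper) auto
    finally have "ennreal \<gamma> * emeasure lebesgue A \<le> ?H A"
      using less_imp_neq[OF finD] by (simp add: ennreal_add_left_cancel_le add.commute)
    then show "?H A = ennreal \<gamma> * emeasure lebesgue A" using upper[OF A(1)] by simp
  qed
qed

section \<open>Volumes of sublevel sets of homogeneous functions\<close>

definition pos_homogeneous :: "('a::real_vector \<Rightarrow> real) \<Rightarrow> bool" where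
  "pos_homogeneous f \<longleftrightarrow> (\<forall>t v. 0 < t \<longrightarrow> f (t *\<^sub>R v) = t * f v) \<and> (\<forall>v. v \<noteq> 0 \<longrightarrow> 0 < f v)"

lemma pos_homogeneous_scale: "pos_homogeneous f \<Longrightarrow> 0 < t \<Longrightarrow> f (t *\<^sub>R v) = t * f v"
  by (simp add: pos_homogeneous_def)

lemma pos_homogeneous_pos: "pos_homogeneous f \<Longrightarrow> v \<noteq> 0 \<Longrightarrow> 0 < f v"
  by (simp add: pos_homogeneous_def)

lemma pos_homogeneous_zero: "pos_homogeneous f \<Longrightarrow> f 0 = 0"
  using pos_homogeneous_scale[of f 2 0] by simp

lemma pos_homogeneous_nonneg: "pos_homogeneous f \<Longrightarrow> 0 \<le> f v"
  using pos_homogeneous_pos[of f v] pos_homogeneous_zero[of f] by (cases "v = 0") auto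

text \<open>A continuous cutoff supported in the annulus \<open>1 \<le> norm v \<le> 2\<close>, where negative powers of a
  homogeneous function are harmless.\<close>

definition tent :: "real \<Rightarrow> real" where
  "tent s = max 0 (min (s - 1) (2 - s))"

lemma tent_nonneg: "0 \<le> tent s" by (simp add: tent_def)
lemma tent_zero: "s \<le> 1 \<or> 2 \<le> s \<Longrightarrow> tent s = 0" by (auto simp: tent_def)
lemma continuous_tent: "continuous_on S tent" unfolding tent_def by (intro continuous_intros)
lemma borel_tent[measurable]: "tent \<in> borel_measurable borel"
  by (intro borel_measurable_continuous_onI continuous_tent)

lemma nn_integral_scale:
  fixes g :: "'a::euclidean_space \<Rightarrow> ennreal"
  assumes [measurable]: "g \<in> borel_measurable borel" and c: "0 < c"
  shows "(\<integral>\<^sup>+x. g x \<partial>lborel) = ennreal (c ^ DIM('a)) * (\<integral>\<^sup>+x. g (c *\<^sub>R x) \<partial>lborel)"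
  using c by (subst lborel_affine[of c 0])
    (simp_all add: nn_integral_density nn_integral_distr nn_integral_cmult)

lemma nn_integral_reflect:
  fixes g :: "'a::euclidean_space \<Rightarrow> ennreal"
  assumes [measurable]: "g \<in> borel_measurable borel"
  shows "(\<integral>\<^sup>+x. g x \<partial>lborel) = (\<integral>\<^sup>+x. g (- x) \<partial>lborel)"
  by (subst lborel_affine[of "-1" 0])
    (simp_all add: nn_integral_density nn_integral_distr nn_integral_cmult)

abbreviation tent_moment :: ennreal where
  "tent_moment \<equiv> (\<integral>\<^sup>+s. ennreal (tent s / s) * indicator {0<..} s \<partial>lborel)"

text \<open>The measure \<open>ds / s\<close> is invariant under dilations.\<close>

lemma tent_moment_scale:
  assumes n: "0 < n"
  shows "(\<integral>\<^sup>+s. ennreal (tent (s * n) / s) * indicator {0<..} s \<partial>lborel) = tent_moment"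
proof -
  have "tent_moment = \<bar>n\<bar> * (\<integral>\<^sup>+s. ennreal (tent (0 + n * s) / (0 + n * s)) * indicator {0<..} (0 + n * s) \<partial>lborel)"
    using n by (intro nn_integral_real_affine) auto
  also have "\<dots> = (\<integral>\<^sup>+s. ennreal n * (ennreal (tent (n * s) / (n * s)) * indicator {0<..} (n * s)) \<partial>lborel)"
    using n by (subst nn_integral_cmult) auto
  also have "\<dots> = (\<integral>\<^sup>+s. ennreal (tent (s * n) / s) * indicator {0<..} s \<partial>lborel)"
  proof (rule nn_integral_cong)
    fix s :: real
    show "ennreal n * (ennreal (tent (n * s) / (n * s)) * indicator {0<..} (n * s))
        = ennreal (tent (s * n) / s) * indicator {0<..} s"
    proof (cases "0 < s")
      case True
      then have "ennreal n * ennreal (tent (n * s) / (n * s)) = ennreal (n * (tent (n * s) / (n * s)))"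
        using n by (subst ennreal_mult') auto
      then show ?thesis using n True by (simp add: mult.commute indicator_def)
    next
      case False
      then have "\<not> 0 < n * s" using n by (simp add: zero_less_mult_iff)
      then show ?thesis using False by simp
    qed
  qed
  finally show ?thesis ..
qed

lemma tent_moment_bounds: "0 < tent_moment" "tent_moment < top"
proof -
  have "0 < (\<integral>\<^sup>+s. ennreal (1/8) * indicator {5/4..7/4::real} s \<partial>lborel)"
    by (subst nn_integral_cmult_indicator) (simp_all add: ennreal_zero_less_mult_iff ennreal_inverse_positive)
  also have "\<dots> \<le> tent_moment"
  proof (intro nn_integral_mono)
    fix s :: real
    show "ennreal (1/8) * indicator {5/4..7/4} s \<le> ennreal (tent s / s) * indicator {0<..} s"
    proof (cases "s \<in> {5/4..7/4}")
      case True
      then have "1/8 \<le> tent s / s" by (auto simp: tent_def field_simps min_def max_def)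
      then show ?thesis using True by (simp add: ennreal_leI)
    qed simp
  qed
  finally show "0 < tent_moment" .
  have "tent_moment \<le> (\<integral>\<^sup>+s. indicator {1..2::real} s \<partial>lborel)"
  proof (intro nn_integral_mono)
    fix s :: real
    show "ennreal (tent s / s) * indicator {0<..} s \<le> indicator {1..2} s"
    proof (cases "s \<in> {1..2}")
      case True
      then have "tent s / s \<le> 1" by (auto simp: tent_def field_simps)
      then have "ennreal (tent s / s) \<le> 1" by simp
      then show ?thesis using True by simp
    next
      case False
      then have "tent s = 0" by (intro tent_zero) auto
      then show ?thesis by simp
    qed
  qed
  also have "\<dots> < top" by simp
  finally show "tent_moment < top" .
qed

lemma nn_integral_inverse_power:
  assumes a: "0 < a" and m: "0 < m"
  shows "(\<integral>\<^sup>+s. ennreal (inverse s ^ (m + 1)) * indicator {a..} s \<partial>lborel)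
     = ennreal (inverse a ^ m / real m)"
proof -
  have "(\<integral>\<^sup>+s. ennreal (inverse s ^ (m + 1)) * indicator {a..} s \<partial>lborel)
      = ennreal (0 - (- (inverse a ^ m) / real m))"
  proof (rule nn_integral_FTC_atLeast)
    fix x assume "a \<le> x"
    then have x: "x > 0" using a by simp
    have "((\<lambda>s. - (inverse s ^ m) / real m) has_real_derivative
       - (real m * inverse x ^ (m - 1) * (- (inverse x ^ 2))) / real m) (at x)"
      using x by (auto intro!: derivative_eq_intros simp: power2_eq_square)
    moreover have "inverse x ^ (m - 1) * inverse x ^ 2 = inverse x ^ (m + 1)"
      using m by (subst power_add[symmetric]) simp
    ultimately show "((\<lambda>s. - (inverse s ^ m) / real m) has_real_derivative inverse x ^ (m + 1)) (at x)"
      using m by (simp add: mult.assoc)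
    show "0 \<le> inverse x ^ (m + 1)" using x by simp
  next
    have lim: "((\<lambda>s. inverse s ^ m) \<longlongrightarrow> (0::real) ^ m) at_top"
      by (rule tendsto_power[OF tendsto_inverse_0_at_top[OF filterlim_ident]])
    then have "((\<lambda>s. - (inverse s ^ m) / real m) \<longlongrightarrow> - (0 ^ m) / real m) at_top"
      using m by (intro tendsto_divide tendsto_minus lim tendsto_const) auto
    then show "((\<lambda>s. - (inverse s ^ m) / real m) \<longlongrightarrow> 0) at_top"
      using m by (simp add: power_0_left)
  qed auto
  then show ?thesis by simp
qed

text \<open>Integrating \<open>tent (s * norm v) / s\<close> over the region \<open>f v \<le> 1\<close> and all \<open>s > 0\<close> in one order
  gives the volume, up to a universal constant. Substituting \<open>v / s\<close> for \<open>v\<close> and integrating over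
  \<open>s\<close> first gives an integral of \<open>f\<^sup>-\<^sup>m\<close> over an annulus, away from the singularity at the origin.\<close>

lemma volume_radial:
  fixes f :: "'a::euclidean_space \<Rightarrow> real"
  assumes f: "pos_homogeneous f" and fm[measurable]: "f \<in> borel_measurable borel"
  shows "tent_moment * emeasure lborel {v. f v \<le> 1} =
    (\<integral>\<^sup>+v. ennreal (tent (norm v) * (inverse (f v) ^ DIM('a) / real DIM('a))) \<partial>lborel)"
proof -
  let ?m = "DIM('a)"
  let ?g = "\<lambda>(v::'a) s::real. indicator {v. f v \<le> 1} v * (ennreal (tent (s * norm v) / s) * indicator {0<..} s)"
  have "tent_moment * emeasure lborel {v. f v \<le> 1}
      = (\<integral>\<^sup>+v. tent_moment * indicator {v. f v \<le> 1} v \<partial>lborel)"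
    by (subst nn_integral_cmult_indicator) auto
  also have "\<dots> = (\<integral>\<^sup>+v. (\<integral>\<^sup>+s. ?g v s \<partial>lborel) \<partial>lborel)"
  proof (rule nn_integral_cong_AE)
    have "AE v::'a in lborel. v \<noteq> 0" using AE_lborel_singleton .
    then show "AE v in lborel. tent_moment * indicator {v. f v \<le> 1} v = (\<integral>\<^sup>+s. ?g v s \<partial>lborel)"
    proof eventually_elim
      case (elim v)
      have "(\<integral>\<^sup>+s. ?g v s \<partial>lborel) = indicator {v. f v \<le> 1} v *
          (\<integral>\<^sup>+s. ennreal (tent (s * norm v) / s) * indicator {0<..} s \<partial>lborel)"
        by (rule nn_integral_cmult) auto
      also have "\<dots> = indicator {v. f v \<le> 1} v * tent_moment"
        using elim by (subst tent_moment_scale) auto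
      finally show ?case by (simp add: mult.commute)
    qed
  qed
  also have "\<dots> = (\<integral>\<^sup>+s. (\<integral>\<^sup>+v. ?g v s \<partial>lborel) \<partial>lborel)"
    by (rule lborel_pair.Fubini'[symmetric]) measurable
  also have "\<dots> = (\<integral>\<^sup>+s. (\<integral>\<^sup>+v. ennreal (tent (norm v)) *
      (ennreal (inverse s ^ (?m + 1)) * indicator {0<..} s * indicator {v. f v \<le> s} v) \<partial>lborel) \<partial>lborel)"
  proof (rule nn_integral_cong)
    fix s :: real
    show "(\<integral>\<^sup>+v. ?g v s \<partial>lborel) = (\<integral>\<^sup>+v. ennreal (tent (norm v)) *
      (ennreal (inverse s ^ (?m + 1)) * indicator {0<..} s * indicator {v. f v \<le> s} v) \<partial>lborel)"
    proof (cases "0 < s")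
      case s: True
      have "(\<integral>\<^sup>+v. ?g v s \<partial>lborel) = ennreal (inverse s ^ ?m) * (\<integral>\<^sup>+v. ?g (inverse s *\<^sub>R v) s \<partial>lborel)"
        using s by (intro nn_integral_scale) auto
      also have "\<dots> = (\<integral>\<^sup>+v. ennreal (inverse s ^ ?m) * ?g (inverse s *\<^sub>R v) s \<partial>lborel)"
        by (rule nn_integral_cmult[symmetric]) auto
      also have "\<dots> = (\<integral>\<^sup>+v. ennreal (tent (norm v)) *
          (ennreal (inverse s ^ (?m + 1)) * indicator {0<..} s * indicator {v. f v \<le> s} v) \<partial>lborel)"
      proof (rule nn_integral_cong)
        fix v :: 'a
        have "f (inverse s *\<^sub>R v) = inverse s * f v"
          using pos_homogeneous_scale[OF f, of "inverse s" v] s by simp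
        moreover have "inverse s * f v \<le> 1 \<longleftrightarrow> f v \<le> s" using s by (simp add: field_simps)
        ultimately have 1: "indicator {v. f v \<le> 1} (inverse s *\<^sub>R v) = (indicator {v. f v \<le> s} v :: ennreal)"
          by (simp only: indicator_def mem_Collect_eq)
        have 2: "s * norm (inverse s *\<^sub>R v) = norm v" using s by simp
        have 3: "ennreal (inverse s ^ ?m) * ennreal (tent (norm v) / s)
            = ennreal (tent (norm v)) * ennreal (inverse s ^ (?m + 1))"
          using s tent_nonneg[of "norm v"]
          by (simp add: ennreal_mult[symmetric] divide_inverse mult_ac)
        have "ennreal (inverse s ^ ?m) * ?g (inverse s *\<^sub>R v) s
            = (ennreal (inverse s ^ ?m) * ennreal (tent (norm v) / s)) * indicator {v. f v \<le> s} v"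
          unfolding 1 2 using s by (simp add: mult_ac)
        also have "\<dots> = ennreal (tent (norm v)) *
          (ennreal (inverse s ^ (?m + 1)) * indicator {0<..} s * indicator {v. f v \<le> s} v)"
          unfolding 3 using s by (simp add: mult_ac)
        finally show "ennreal (inverse s ^ ?m) * ?g (inverse s *\<^sub>R v) s = ennreal (tent (norm v)) *
          (ennreal (inverse s ^ (?m + 1)) * indicator {0<..} s * indicator {v. f v \<le> s} v)" .
      qed
      finally show ?thesis .
    qed simp
  qed
  also have "\<dots> = (\<integral>\<^sup>+v. (\<integral>\<^sup>+s. ennreal (tent (norm v)) *
      (ennreal (inverse s ^ (?m + 1)) * indicator {0<..} s * indicator {v. f v \<le> s} v) \<partial>lborel) \<partial>lborel)"
  proof (rule lborel_pair.Fubini')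
    have "case_prod (\<lambda>(v::'a) s. ennreal (tent (norm v)) *
        (ennreal (inverse s ^ (?m + 1)) * indicator {0<..} s * indicator {p. f (fst p) \<le> snd p} (v, s)))
        \<in> borel_measurable (lborel \<Otimes>\<^sub>M lborel)" by measurable
    then show "case_prod (\<lambda>(v::'a) s. ennreal (tent (norm v)) *
        (ennreal (inverse s ^ (?m + 1)) * indicator {0<..} s * indicator {v. f v \<le> s} v))
        \<in> borel_measurable (lborel \<Otimes>\<^sub>M lborel)" by (simp add: indicator_def)
  qed
  also have "\<dots> = (\<integral>\<^sup>+v. ennreal (tent (norm v) * (inverse (f v) ^ ?m / real ?m)) \<partial>lborel)"
  proof (rule nn_integral_cong)
    fix v :: 'a
    show "(\<integral>\<^sup>+s. ennreal (tent (norm v)) *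
      (ennreal (inverse s ^ (?m + 1)) * indicator {0<..} s * indicator {v. f v \<le> s} v) \<partial>lborel)
      = ennreal (tent (norm v) * (inverse (f v) ^ ?m / real ?m))"
    proof (cases "v = 0")
      case False
      then have p: "0 < f v" using f pos_homogeneous_pos by blast
      have "(\<integral>\<^sup>+s. ennreal (tent (norm v)) *
        (ennreal (inverse s ^ (?m + 1)) * indicator {0<..} s * indicator {v. f v \<le> s} v) \<partial>lborel)
        = (\<integral>\<^sup>+s. ennreal (tent (norm v)) * (ennreal (inverse s ^ (?m + 1)) * indicator {f v..} s) \<partial>lborel)"
        using p by (intro nn_integral_cong) (auto simp: indicator_def)
      also have "\<dots> = ennreal (tent (norm v)) *
          (\<integral>\<^sup>+s. ennreal (inverse s ^ (?m + 1)) * indicator {f v..} s \<partial>lborel)"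
        by (rule nn_integral_cmult) auto
      also have "\<dots> = ennreal (tent (norm v)) * ennreal (inverse (f v) ^ ?m / real ?m)"
        by (subst nn_integral_inverse_power[OF p]) auto
      also have "\<dots> = ennreal (tent (norm v) * (inverse (f v) ^ ?m / real ?m))"
        by (rule ennreal_mult'[symmetric]) (rule tent_nonneg)
      finally show ?thesis .
    qed (simp add: tent_zero)
  qed
  finally show ?thesis .
qed

lemma tent_continuous_extension:
  fixes g :: "'a::euclidean_space \<Rightarrow> real"
  assumes "continuous_on (- {0}) g"
  shows "continuous_on UNIV (\<lambda>v. tent (norm v) * g v)"
proof -
  have 1: "continuous_on (- {0}) (\<lambda>v. tent (norm v) * g v)"
    by (intro continuous_intros assms continuous_on_compose2[OF continuous_tent[of UNIV]]) auto
  have 2: "continuous_on (ball 0 1) (\<lambda>v. tent (norm v) * g v)"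
    by (rule continuous_on_eq[of _ "\<lambda>v. 0"]) (auto simp: tent_zero)
  have "continuous_on (- {0} \<union> ball 0 1) (\<lambda>v. tent (norm v) * g v)"
    by (rule continuous_on_open_Un[OF _ _ 1 2]) auto
  moreover have "- {0} \<union> ball (0::'a) 1 = UNIV" by auto
  ultimately show ?thesis by simp
qed

abbreviation big_box :: "'a::euclidean_space set" where
  "big_box \<equiv> cbox (- 2 *\<^sub>R One) (2 *\<^sub>R One)"

lemma norm_less_2_big_box: "norm v \<le> 2 \<Longrightarrow> v \<in> big_box"
proof -
  assume "norm v \<le> 2"
  then have "\<bar>v \<bullet> b\<bar> \<le> 2" if "b \<in> Basis" for b using Basis_le_norm[OF that, of v] by simp
  then show ?thesis by (force simp: mem_box abs_le_iff)
qed

definition volume_const :: "nat \<Rightarrow> real" where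
  "volume_const m = inverse (enn2real tent_moment * real m)"

lemma volume_const_pos: "0 < m \<Longrightarrow> 0 < volume_const m"
  using tent_moment_bounds by (simp add: volume_const_def enn2real_positive_iff)

text \<open>The volume as the integral of a continuous function over a fixed box, a form that can be
  differentiated with respect to parameters of \<open>f\<close>.\<close>

lemma volume_formula:
  fixes f :: "'a::euclidean_space \<Rightarrow> real"
  assumes f: "pos_homogeneous f" and cont: "continuous_on (- {0}) f"
  shows "f \<in> borel_measurable borel"
    and "emeasure lborel {v. f v \<le> 1} =
      ennreal (volume_const DIM('a) * integral big_box (\<lambda>v. tent (norm v) * inverse (f v) ^ DIM('a)))"
proof -
  let ?m = "DIM('a)"
  show fm: "f \<in> borel_measurable borel"
    by (rule borel_measurable_continuous_countable_exceptions[OF _ cont]) simp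
  let ?g = "\<lambda>v. tent (norm v) * inverse (f v) ^ ?m"
  have gc: "continuous_on UNIV ?g"
    by (intro tent_continuous_extension continuous_intros cont) (use pos_homogeneous_pos[OF f] in force)
  have g0: "0 \<le> ?g v" for v using tent_nonneg pos_homogeneous_nonneg[OF f] by simp
  have "?g integrable_on big_box"
    by (rule integrable_continuous) (rule continuous_on_subset[OF gc], simp)
  then have "(?g has_integral integral big_box ?g) big_box" by (rule integrable_integral)
  then have "(?g has_integral integral big_box ?g) UNIV"
    by (rule has_integral_on_superset) (use norm_less_2_big_box in \<open>force simp: tent_zero\<close>)+
  then have I: "(\<integral>\<^sup>+v. ennreal (?g v) \<partial>lborel) = ennreal (integral big_box ?g)"
    using g0 by (intro nn_integral_has_integral_lborel borel_measurable_continuous_onI gc) auto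
  have "tent_moment * emeasure lborel {v. f v \<le> 1} = (\<integral>\<^sup>+v. ennreal (inverse (real ?m)) * ennreal (?g v) \<partial>lborel)"
    unfolding volume_radial[OF f fm] using g0
    by (intro nn_integral_cong) (simp add: ennreal_mult[symmetric] divide_inverse mult_ac)
  also have "\<dots> = ennreal (inverse (real ?m)) * ennreal (integral big_box ?g)"
    unfolding I[symmetric]
    by (rule nn_integral_cmult) (use borel_measurable_continuous_onI[OF gc] in measurable)
  finally have *: "tent_moment * emeasure lborel {v. f v \<le> 1}
      = ennreal (inverse (real ?m) * integral big_box ?g)"
    by (subst ennreal_mult') simp_all
  define c where "c = enn2real tent_moment"
  have c: "0 < c" "tent_moment = ennreal c"
    using tent_moment_bounds by (auto simp: c_def enn2real_positive_iff)
  have "emeasure lborel {v. f v \<le> 1} = ennreal (inverse c) * (ennreal c * emeasure lborel {v. f v \<le> 1})"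
  proof -
    have "ennreal (inverse c) * (ennreal c * emeasure lborel {v. f v \<le> 1})
        = ennreal (inverse c * c) * emeasure lborel {v. f v \<le> 1}"
      using c(1) by (subst ennreal_mult) (auto simp: mult.assoc)
    then show ?thesis using c(1) by simp
  qed
  also have "\<dots> = ennreal (inverse c) * ennreal (inverse (real ?m) * integral big_box ?g)"
    using * unfolding c(2) by (rule arg_cong)
  also have "\<dots> = ennreal (volume_const ?m * integral big_box ?g)"
    using c(1) unfolding volume_const_def c_def[symmetric] by (simp add: ennreal_mult'[symmetric] mult.assoc)
  finally show "emeasure lborel {v. f v \<le> 1} = ennreal (volume_const ?m * integral big_box ?g)" .
qed

lemma volume_formula_measure:
  fixes f :: "'a::euclidean_space \<Rightarrow> real"
  assumes f: "pos_homogeneous f" and cont: "continuous_on (- {0}) f"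
  shows "measure lborel {v. f v \<le> 1} =
      volume_const DIM('a) * integral big_box (\<lambda>v. tent (norm v) * inverse (f v) ^ DIM('a))"
proof -
  have "continuous_on UNIV (\<lambda>v. tent (norm v) * inverse (f v) ^ DIM('a))"
    by (intro tent_continuous_extension continuous_intros cont) (use pos_homogeneous_pos[OF f] in force)
  then have "0 \<le> integral big_box (\<lambda>v. tent (norm v) * inverse (f v) ^ DIM('a))"
    by (intro integral_nonneg integrable_continuous)
      (auto intro: continuous_on_subset simp: tent_nonneg pos_homogeneous_nonneg[OF f])
  then show ?thesis
    unfolding measure_def volume_formula(2)[OF assms]
    using volume_const_pos[of "DIM('a)"] by simp
qed

section \<open>The area integrand on injective matrices\<close>

lemma pos_homogeneous_bounds:
  fixes f :: "'a::euclidean_space \<Rightarrow> real"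
  assumes f: "pos_homogeneous f" and cont: "continuous_on (- {0}) f"
  obtains c C where "0 < c" "0 < C" "\<And>v. c * norm v \<le> f v" "\<And>v. f v \<le> C * norm v"
proof -
  have cont': "continuous_on (sphere 0 1) f" by (rule continuous_on_subset[OF cont]) auto
  have ne: "sphere (0::'a) 1 \<noteq> {}"
    using SOME_Basis by (metis empty_iff mem_sphere_0 norm_Basis)
  obtain p where p: "p \<in> sphere 0 1" "\<And>v. v \<in> sphere 0 1 \<Longrightarrow> f p \<le> f v"
    using continuous_attains_inf[OF compact_sphere ne cont'] by blast
  obtain q where q: "q \<in> sphere 0 1" "\<And>v. v \<in> sphere 0 1 \<Longrightarrow> f v \<le> f q"
    using continuous_attains_sup[OF compact_sphere ne cont'] by blast
  have "p \<noteq> 0" "q \<noteq> 0" using p q by auto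
  then have pos: "0 < f p" "0 < f q" using pos_homogeneous_pos[OF f] by auto
  have "f p * norm v \<le> f v \<and> f v \<le> f q * norm v" for v
  proof (cases "v = 0")
    case True then show ?thesis using pos_homogeneous_zero[OF f] by simp
  next
    case False
    then have s: "inverse (norm v) *\<^sub>R v \<in> sphere 0 1" by simp
    have "f v = norm v * f (inverse (norm v) *\<^sub>R v)"
      using pos_homogeneous_scale[OF f, of "norm v" "inverse (norm v) *\<^sub>R v"] False by simp
    then show ?thesis using p(2)[OF s] q(2)[OF s] False
      by (metis mult.commute mult_left_mono norm_ge_zero)
  qed
  with pos show ?thesis by (intro that[of "f p" "f q"]) auto
qed

lemma pos_homogeneous_sublevel:
  fixes f :: "'a::euclidean_space \<Rightarrow> real"
  assumes f: "pos_homogeneous f" and cont: "continuous_on (- {0}) f"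
  shows "bounded {v. f v \<le> 1}" "{v. f v \<le> 1} \<in> sets borel" "{v. f v \<le> 1} \<in> lmeasurable"
    "0 < measure lborel {v. f v \<le> 1}"
proof -
  obtain c C where c: "0 < c" "0 < C" "\<And>v. c * norm v \<le> f v" "\<And>v. f v \<le> C * norm v"
    using pos_homogeneous_bounds[OF assms] by blast
  show b: "bounded {v. f v \<le> 1}"
  proof (rule boundedI)
    fix v assume "v \<in> {v. f v \<le> 1}"
    then show "norm v \<le> 1 / c" using c(1) c(3)[of v] by (simp add: field_simps)
  qed
  show s: "{v. f v \<le> 1} \<in> sets borel"
    using volume_formula(1)[OF assms] by measurable
  show lm: "{v. f v \<le> 1} \<in> lmeasurable"
    using b s by (intro bounded_set_imp_lmeasurable) auto
  have "ball 0 (1 / C) \<subseteq> {v. f v \<le> 1}"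
  proof
    fix v :: 'a assume "v \<in> ball 0 (1 / C)"
    then have "C * norm v \<le> 1" using c(2) by (simp add: field_simps)
    then show "v \<in> {v. f v \<le> 1}" using c(4)[of v] by simp
  qed
  then have "measure lebesgue (ball (0::'a) (1 / C)) \<le> measure lebesgue {v. f v \<le> 1}"
    using lm by (intro measure_mono_fmeasurable) auto
  then show "0 < measure lborel {v. f v \<le> 1}" using c(2) s
    by (simp add: content_ball_gt_0_iff[THEN iffD2] less_le_trans[rotated])
qed

definition inj_mats :: "(real^'m^'n) set" where
  "inj_mats = {P. inj ((*v) P)}"

lemma inj_mats_iff: "P \<in> inj_mats \<longleftrightarrow> (\<forall>v. P *v v = 0 \<longrightarrow> v = 0)"
  unfolding inj_mats_def mem_Collect_eq
  by (subst linear_injective_0) auto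

lemma bounded_bilinear_matrix_vector_mult:
  "bounded_bilinear (\<lambda>(P::real^'m^'n) v. P *v v)"
proof -
  have "bilinear (\<lambda>(P::real^'m^'n) v. P *v v)"
    unfolding bilinear_def
    by (auto intro!: linearI simp: matrix_vector_mult_add_rdistrib matrix_vector_right_distrib
        scaleR_matrix_vector_assoc[symmetric] matrix_vector_mult_scaleR)
  then show ?thesis by (simp add: bilinear_conv_bounded_bilinear)
qed

lemma open_inj_mats: "open (inj_mats :: (real^'m^'n) set)"
unfolding open_contains_ball
proof
  fix P :: "real^'m^'n" assume P: "P \<in> inj_mats"
  then obtain B where B: "B > 0" "\<And>v. B * norm v \<le> norm (P *v v)"
    using linear_inj_bounded_below_pos[of "(*v) P"] by (auto simp: inj_mats_def)
  obtain K where K: "K > 0" "\<And>(Q::real^'m^'n) v. norm (Q *v v) \<le> norm Q * norm v * K"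
    using bounded_bilinear.pos_bounded[OF bounded_bilinear_matrix_vector_mult] by blast
  have "ball P (B / K) \<subseteq> inj_mats"
  proof
    fix Q assume "Q \<in> ball P (B / K)"
    then have Q: "norm (P - Q) * K < B" using K(1) by (simp add: dist_norm field_simps)
    show "Q \<in> inj_mats" unfolding inj_mats_iff
    proof (intro allI impI)
      fix v assume "Q *v v = 0"
      then have "P *v v = (P - Q) *v v" by (simp add: matrix_vector_mult_diff_rdistrib)
      then have "B * norm v \<le> norm (P - Q) * K * norm v"
        using B(2)[of v] K(2)[of "P - Q" v] by (simp add: mult_ac)
      show "v = 0"
      proof (rule ccontr)
        assume "v \<noteq> 0"
        then have "norm (P - Q) * K * norm v < B * norm v" using Q by (intro mult_strict_right_mono) auto
        then show False using \<open>B * norm v \<le> norm (P - Q) * K * norm v\<close> by simp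
      qed
    qed
  qed
  then show "\<exists>e>0. ball P e \<subseteq> inj_mats" using B(1) K(1) by (intro exI[of _ "B / K"]) auto
qed

lemma weighted_integrand_continuous:
  fixes f :: "real^'n \<Rightarrow> real" and b :: "real^'m \<Rightarrow> real"
  assumes f: "continuous_on (- {0}) f" and b: "continuous_on UNIV b" "\<And>v. norm v \<le> 1 \<Longrightarrow> b v = 0"
  shows "continuous_on (inj_mats \<times> UNIV) (\<lambda>(P, v). b v * f (P *v v))"
proof -
  let ?g = "\<lambda>(P::real^'m^'n, v). b v * f (P *v v)"
  have mv: "continuous_on S (\<lambda>p. (fst p :: real^'m^'n) *v snd p)" for S
    by (intro bounded_bilinear.continuous_on[OF bounded_bilinear_matrix_vector_mult] continuous_intros)
  have 1: "continuous_on (inj_mats \<times> (- {0})) ?g"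
    unfolding case_prod_beta
    by (intro continuous_intros continuous_on_compose2[OF b(1)] continuous_on_compose2[OF f mv])
      (auto simp: inj_mats_iff)
  have 2: "continuous_on (inj_mats \<times> ball 0 1) ?g"
    by (rule continuous_on_eq[of _ "\<lambda>p. 0"]) (auto simp: b(2))
  have "continuous_on (inj_mats \<times> (- {0}) \<union> inj_mats \<times> ball 0 1) ?g"
    by (rule continuous_on_open_Un[OF _ _ 1 2]) (auto intro!: open_Times open_inj_mats)
  moreover have "inj_mats \<times> (- {0}) \<union> inj_mats \<times> ball 0 1 = (inj_mats \<times> UNIV :: ((real^'m^'n) \<times> (real^'m)) set)"
    by auto
  ultimately show ?thesis by simp
qed

text \<open>Differentiating under the integral sign produces integrals of the same form, with the partial
  derivatives of \<open>f\<close> in place of \<open>f\<close> and new weights. Hence the induction on the order of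
  differentiability only loses derivatives of \<open>f\<close>.\<close>

lemma hd_weighted_integral:
  fixes f :: "real^'n \<Rightarrow> real" and b :: "real^'m \<Rightarrow> real"
  assumes "hd_on (- {0}) f k" "continuous_on UNIV b" "\<And>v. norm v \<le> 1 \<Longrightarrow> b v = 0"
  shows "hd_on inj_mats (\<lambda>P. integral big_box (\<lambda>v. b v * f (P *v v))) k"
  using assms
proof (induction k arbitrary: f b)
  case 0
  have "continuous_on (inj_mats \<times> big_box) (\<lambda>(P::real^'m^'n, v). b v * f (P *v v))"
    using 0 by (intro continuous_on_subset[OF weighted_integrand_continuous]) auto
  from integral_continuous_on_param[OF this] show ?case by simp
next
  case (Suc k)
  have fc: "continuous_on (- {0}) f" using Suc.prems(1) hd_imp_continuous by blast
  define pf where "pf c y = frechet_derivative f (at y) c" for c y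
  have pf: "hd_on (- {0}) (pf c) k" for c using Suc.prems(1) by (simp add: pf_def[abs_def])
  have pfc: "continuous_on (- {0}) (pf c)" for c using pf hd_imp_continuous by blast
  define w where "w Q c v = b v * ((Q *v v) \<bullet> c)" for Q :: "real^'m^'n" and c v
  have wc: "continuous_on UNIV (w Q c)" for Q c
    unfolding w_def by (intro continuous_intros Suc.prems(2) linear_continuous_on
      matrix_vector_mul_bounded_linear)
  have w0: "norm v \<le> 1 \<Longrightarrow> w Q c v = 0" for Q c v by (simp add: w_def Suc.prems(3))
  define D where "D P v Q = (\<Sum>c\<in>Basis. w Q c v * pf c (P *v v))" for P Q :: "real^'m^'n" and v
  have lin: "bounded_linear (D P v)" for P v
  proof -
    have "linear (D P v)"
      by (rule linearI) (simp_all add: D_def w_def matrix_vector_mult_add_rdistrib inner_add_left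
          algebra_simps sum.distrib sum_distrib_left scaleR_matrix_vector_assoc[symmetric])
    then show ?thesis by (simp add: linear_linear)
  qed
  define fx where "fx P v = Blinfun (D P v)" for P v
  have fx: "blinfun_apply (fx P v) = D P v" for P v
    by (simp add: fx_def bounded_linear_Blinfun_apply lin)
  have Dc: "continuous_on (inj_mats \<times> UNIV) (\<lambda>(P, v). D P v Q)" for Q
    unfolding D_def case_prod_beta
    using weighted_integrand_continuous[OF pfc wc w0, unfolded case_prod_beta]
    by (intro continuous_on_sum) auto
  have fxc: "continuous_on (inj_mats \<times> UNIV) (\<lambda>(P, v). fx P v)"
  proof (rule continuous_on_blinfun_componentwise)
    fix i :: "real^'m^'n"
    show "continuous_on (inj_mats \<times> UNIV) (\<lambda>x. blinfun_apply (case x of (P, v) \<Rightarrow> fx P v) i)"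
      using Dc[of i] by (simp add: case_prod_beta fx)
  qed
  have der: "((\<lambda>P. b v * f (P *v v)) has_derivative blinfun_apply (fx P v)) (at P)"
    if P: "P \<in> inj_mats" for P v
  proof (cases "v = 0")
    case True
    then have "b v = 0" using Suc.prems(3) by simp
    then show ?thesis unfolding fx D_def w_def by simp
  next
    case False
    then have Pv: "P *v v \<in> - {0}" using P by (auto simp: inj_mats_iff)
    have "((\<lambda>P. P *v v) has_derivative (\<lambda>Q. Q *v v)) (at P)"
      by (intro bounded_linear_imp_has_derivative
        bounded_bilinear.bounded_linear_left[OF bounded_bilinear_matrix_vector_mult])
    from has_derivative_compose[OF this hd_SucE[OF Suc.prems(1) Pv]]
    have "((\<lambda>P. b v * f (P *v v)) has_derivative (\<lambda>Q. b v * frechet_derivative f (at (P *v v)) (Q *v v))) (at P)"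
      by (rule has_derivative_mult_right)
    moreover have "b v * frechet_derivative f (at (P *v v)) (Q *v v) = D P v Q" for Q
    proof -
      have "linear (frechet_derivative f (at (P *v v)))"
        using hd_SucE[OF Suc.prems(1) Pv] has_derivative_linear by blast
      from linear_componentwise_basis[OF this, of "Q *v v"]
      have e: "frechet_derivative f (at (P *v v)) (Q *v v) = (\<Sum>c\<in>Basis. ((Q *v v) \<bullet> c) *\<^sub>R pf c (P *v v))"
        by (simp only: pf_def)
      show ?thesis unfolding e D_def w_def sum_distrib_left by (simp add: mult.assoc)
    qed
    ultimately show ?thesis unfolding fx by (simp add: has_derivative_eq_rhs)
  qed
  show ?case
  proof (rule hd_Suc_intro)
    fix P0 :: "real^'m^'n" assume P0: "P0 \<in> inj_mats"
    obtain e where e: "e > 0" "ball P0 e \<subseteq> inj_mats"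
      by (rule openE[OF open_inj_mats P0])
    let ?U = "ball P0 e"
    have "((\<lambda>P. integral big_box (\<lambda>v. b v * f (P *v v))) has_derivative
        blinfun_apply (integral big_box (fx P0))) (at P0 within ?U)"
    proof (rule leibniz_rule[where f="\<lambda>P v. b v * f (P *v v)" and fx=fx and U="?U"])
      fix P v assume "P \<in> ?U"
      then show "((\<lambda>P. b v * f (P *v v)) has_derivative blinfun_apply (fx P v)) (at P within ?U)"
        by (rule has_derivative_at_withinI[OF der[OF subsetD[OF e(2)]]])
    next
      fix P assume "P \<in> ?U"
      then have "P \<in> inj_mats" using e(2) by auto
      then have "continuous_on big_box (\<lambda>v. b v * f (P *v v))"
        by (intro continuous_on_compose2[OF weighted_integrand_continuous[OF fc Suc.prems(2,3)],
            of _ "\<lambda>v. (P, v)", unfolded prod.case] continuous_intros) auto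
      then show "(\<lambda>v. b v * f (P *v v)) integrable_on big_box" by (rule integrable_continuous)
    next
      show "continuous_on (?U \<times> big_box) (\<lambda>(P, v). fx P v)"
        by (rule continuous_on_subset[OF fxc]) (use e(2) in auto)
    qed (use e in auto)
    then have 1: "((\<lambda>P. integral big_box (\<lambda>v. b v * f (P *v v))) has_derivative
        blinfun_apply (integral big_box (fx P0))) (at P0)"
      using e by (simp add: at_within_open[of P0 ?U])
    have fxint: "fx P0 integrable_on big_box"
      by (intro integrable_continuous continuous_on_compose2[OF fxc, of _ "\<lambda>v. (P0, v)", unfolded prod.case]
          continuous_intros) (use P0 in auto)
    have "blinfun_apply (integral big_box (fx P0)) Q
        = (\<Sum>c\<in>Basis. integral big_box (\<lambda>v. w Q c v * pf c (P0 *v v)))" for Q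
    proof -
      have int: "(\<lambda>v. w Q c v * pf c (P0 *v v)) integrable_on big_box" for c
        by (intro integrable_continuous continuous_on_compose2[OF weighted_integrand_continuous[OF pfc wc w0],
            of _ "\<lambda>v. (P0, v)", unfolded prod.case] continuous_intros) (use P0 in auto)
      have "blinfun_apply (integral big_box (fx P0)) Q = integral big_box (\<lambda>v. D P0 v Q)"
        using blinfun_apply_integral[OF fxint] by (simp add: fx)
      also have "\<dots> = (\<Sum>c\<in>Basis. integral big_box (\<lambda>v. w Q c v * pf c (P0 *v v)))"
        unfolding D_def by (rule integral_sum) (use int in auto)
      finally show ?thesis .
    qed
    then show "((\<lambda>P. integral big_box (\<lambda>v. b v * f (P *v v))) has_derivative
        (\<lambda>Q. \<Sum>c\<in>Basis. integral big_box (\<lambda>v. w Q c v * pf c (P0 *v v)))) (at P0)"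
      by (intro has_derivative_eq_rhs[OF 1]) (rule ext)
  next
    fix Q :: "real^'m^'n"
    show "hd_on inj_mats (\<lambda>P. \<Sum>c\<in>Basis. integral big_box (\<lambda>v. w Q c v * pf c (P *v v))) k"
      by (intro hd_sum open_inj_mats Suc.IH[OF pf wc w0])
  qed (rule open_inj_mats)
qed

definition sect_vol :: "(real^'n \<Rightarrow> real) \<Rightarrow> real^'m^'n \<Rightarrow> real" where
  "sect_vol f P = measure lborel {v. f (P *v v) \<le> 1}"

lemma pos_homogeneous_section:
  fixes P :: "real^'m^'n"
  assumes "pos_homogeneous f" "continuous_on (- {0}) f" "P \<in> inj_mats"
  shows "pos_homogeneous (\<lambda>v. f (P *v v))" "continuous_on (- {0}) (\<lambda>v. f (P *v v))"
proof -
  have nz: "P *v v \<noteq> 0" if "v \<noteq> 0" for v using assms(3) that by (auto simp: inj_mats_iff)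
  show "pos_homogeneous (\<lambda>v. f (P *v v))"
    using assms(1) nz by (auto simp: pos_homogeneous_def matrix_vector_mult_scaleR)
  show "continuous_on (- {0}) (\<lambda>v. f (P *v v))"
  proof (rule continuous_on_compose2[OF assms(2) linear_continuous_on[OF matrix_vector_mul_bounded_linear]])
    show "(*v) P ` (- {0}) \<subseteq> - {0}"
    proof
      fix y assume "y \<in> (*v) P ` (- {0})"
      then obtain v where "v \<noteq> 0" "y = P *v v" by blast
      then show "y \<in> - {0}" using nz by simp
    qed
  qed
qed

lemma sect_vol_pos:
  fixes P :: "real^'m^'n"
  assumes "pos_homogeneous f" "continuous_on (- {0}) f" "P \<in> inj_mats"
  shows "0 < sect_vol f P"
  unfolding sect_vol_def by (rule pos_homogeneous_sublevel(4)[OF pos_homogeneous_section[OF assms]])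

lemma hd_sect_vol:
  fixes f :: "real^'n \<Rightarrow> real"
  assumes f: "pos_homogeneous f" and s: "hd_on (- {0}) f k"
  shows "hd_on inj_mats (sect_vol f :: real^'m^'n \<Rightarrow> real) k"
proof -
  let ?m = "CARD('m)"
  have c: "continuous_on (- {0}) f" using s by (rule hd_imp_continuous)
  have o: "open (- {0::real^'n})" by auto
  have "hd_on (- {0}) (\<lambda>y. inverse (f y)) k"
    by (rule hd_compose[OF o _ s hd_inverse]) (use pos_homogeneous_pos[OF f] in auto)
  then have h: "hd_on (- {0}) (\<lambda>y. inverse (f y) ^ ?m) k" by (intro hd_power o)
  have b: "continuous_on UNIV (\<lambda>v::real^'m. tent (norm v))"
    using tent_continuous_extension[of "\<lambda>_. 1"] by simp
  have "hd_on inj_mats (\<lambda>P::real^'m^'n. integral big_box (\<lambda>v. tent (norm v) * (inverse (f (P *v v)) ^ ?m))) k"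
    by (rule hd_weighted_integral[OF h b]) (simp add: tent_zero)
  then have "hd_on inj_mats (\<lambda>P::real^'m^'n. volume_const ?m *
      integral big_box (\<lambda>v. tent (norm v) * (inverse (f (P *v v)) ^ ?m))) k"
    by (intro hd_mult hd_const open_inj_mats)
  then show ?thesis
    by (rule hd_cong[OF open_inj_mats, rotated])
      (simp add: sect_vol_def volume_formula_measure[OF pos_homogeneous_section[OF f c]])
qed

text \<open>Up to the volume of the Euclidean unit ball this is the area density of an immersion with derivative
  matrix \<open>P\<close>, measured by \<open>f\<close>.\<close>

definition sect_area :: "(real^'n \<Rightarrow> real) \<Rightarrow> real^'m^'n \<Rightarrow> real" where
  "sect_area f P = inverse (sect_vol f P)"

lemma hd_sect_area:
  fixes f :: "real^'n \<Rightarrow> real"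
  assumes f: "pos_homogeneous f" and s: "hd_on (- {0}) f k"
  shows "hd_on inj_mats (sect_area f :: real^'m^'n \<Rightarrow> real) k"
  unfolding sect_area_def[abs_def]
  by (rule hd_compose[OF open_inj_mats _ hd_sect_vol[OF assms] hd_inverse])
    (use sect_vol_pos[OF f hd_imp_continuous[OF s]] in auto)

lemma sect_area_pos:
  "pos_homogeneous f \<Longrightarrow> continuous_on (- {0}) f \<Longrightarrow> P \<in> inj_mats \<Longrightarrow> 0 < sect_area f P"
  unfolding sect_area_def using sect_vol_pos by (metis inverse_positive_iff_positive)

lemma inj_mats_mult:
  fixes P :: "real^'m^'n" and A :: "real^'m^'m"
  assumes "P \<in> inj_mats" "inj ((*v) A)" shows "P ** A \<in> inj_mats"
  unfolding inj_mats_iff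
proof (intro allI impI)
  fix v assume "P ** A *v v = 0"
  then have "A *v v = A *v 0" using assms(1) by (simp add: inj_mats_iff matrix_vector_mul_assoc[symmetric])
  then show "v = 0" using assms(2) by (rule injD[rotated])
qed

lemma sect_area_mult:
  fixes P :: "real^'m^'n" and A :: "real^'m^'m"
  assumes f: "pos_homogeneous f" "continuous_on (- {0}) f" and P: "P \<in> inj_mats" and A: "inj ((*v) A)"
  shows "sect_area f (P ** A) = jacobian ((*v) A) * sect_area f P"
proof -
  let ?S = "{v. f ((P ** A) *v v) \<le> 1}"
  have "surj ((*v) A)" using A by (rule linear_injective_imp_surjective[OF matrix_vector_mul_linear _ refl])
  have img: "(*v) A ` ?S = {v. f (P *v v) \<le> 1}"
  proof (intro set_eqI iffI)
    fix y assume y: "y \<in> {v. f (P *v v) \<le> 1}"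
    obtain x where "y = A *v x" using \<open>surj ((*v) A)\<close> by (metis surjD)
    then show "y \<in> (*v) A ` ?S" using y by (auto simp: matrix_vector_mul_assoc)
  qed (auto simp: matrix_vector_mul_assoc)
  note S = pos_homogeneous_section[OF f inj_mats_mult[OF P A]]
  note S' = pos_homogeneous_section[OF f P]
  have "measure lebesgue ((*v) A ` ?S) = jacobian ((*v) A) * measure lebesgue ?S"
    by (rule measure_linear_image_jacobian) (use pos_homogeneous_sublevel(3)[OF S] A in auto)
  then have "sect_vol f P = jacobian ((*v) A) * sect_vol f (P ** A)"
    unfolding img sect_vol_def
    using pos_homogeneous_sublevel(2)[OF S] pos_homogeneous_sublevel(2)[OF S'] by simp
  then show ?thesis using jacobian_pos[OF matrix_vector_mul_linear A]
    by (simp add: sect_area_def field_simps)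
qed

definition dyad :: "real^'n \<Rightarrow> real^'m \<Rightarrow> real^'m^'n" where
  "dyad w x = (\<chi> i j. w $ i * x $ j)"

lemma dyad_mult: "dyad w x *v v = (x \<bullet> v) *\<^sub>R w"
  by (simp add: dyad_def matrix_vector_mult_def vec_eq_iff inner_vec_def sum_distrib_right
      sum_distrib_left mult_ac)

lemma matrix_mult_dyad: "P ** dyad c x = dyad (P *v c) x"
  by (simp add: dyad_def matrix_matrix_mult_def matrix_vector_mult_def vec_eq_iff
      sum_distrib_right sum_distrib_left mult_ac)

lemma dyad_mult_matrix: "dyad w x ** A = dyad w (x v* A)"
  by (simp add: dyad_def matrix_matrix_mult_def vector_matrix_mult_def vec_eq_iff
      sum_distrib_left mult_ac)

lemma dyad_add_right: "dyad w (x + y) = dyad w x + dyad w y"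
  and dyad_scaleR_right: "dyad w (r *\<^sub>R x) = r *\<^sub>R dyad w x"
  and dyad_add_left: "dyad (w + w') x = dyad w x + dyad w' x"
  and dyad_scaleR_left: "dyad (r *\<^sub>R w) x = r *\<^sub>R dyad w x"
  by (simp_all add: dyad_def vec_eq_iff algebra_simps)

text \<open>The matrix differs from the identity in a single column, so that Cramer's rule applies.\<close>

lemma det_column_perturbation:
  "det (mat 1 + s *\<^sub>R dyad c (axis k 1) :: real^'m^'m) = 1 + s * c $ k"
proof -
  have "det (\<chi> i j. if j = k then (mat 1 *v (axis k 1 + s *\<^sub>R c)) $ i else (mat 1 :: real^'m^'m) $ i $ j)
      = (axis k 1 + s *\<^sub>R c) $ k * det (mat 1 :: real^'m^'m)"
    by (rule cramer_lemma)
  moreover have "(\<chi> i j. if j = k then (mat 1 *v (axis k 1 + s *\<^sub>R c)) $ i else (mat 1 :: real^'m^'m) $ i $ j)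
     = mat 1 + s *\<^sub>R dyad c (axis k 1)"
    unfolding matrix_vector_mul_lid by (auto simp: vec_eq_iff dyad_def mat_def axis_def)
  ultimately show ?thesis by (simp add: axis_def)
qed

lemma inner_unreindex: "unreindex y \<bullet> axis k 1 = y \<bullet> axis (Abs_ordered_copy k) 1"
  by (simp add: inner_axis unreindex_def)

lemma jacobian_column_perturbation:
  fixes c :: "real^'m"
  shows "jacobian ((*v) (mat 1 + s *\<^sub>R dyad c (axis k 1))) = \<bar>1 + s * c $ k\<bar>"
proof -
  let ?k = "Abs_ordered_copy k"
  have "reindex ((mat 1 + s *\<^sub>R dyad c (axis k 1)) *v unreindex y)
      = (mat 1 + s *\<^sub>R dyad (reindex c) (axis ?k 1)) *v y" for y :: "real^'m ordered_copy"
    by (simp add: linear_add[OF linear_reindex] linear_scale[OF linear_reindex] matrix_vector_mult_add_rdistrib scaleR_matrix_vector_assoc[symmetric] dyad_mult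
        inner_unreindex inner_commute[of "axis _ _"])
  then have "jacobian ((*v) (mat 1 + s *\<^sub>R dyad c (axis k 1)))
      = \<bar>det (matrix ((*v) (mat 1 + s *\<^sub>R dyad (reindex c) (axis ?k 1))))\<bar>"
    unfolding jacobian_def by simp
  also have "\<dots> = \<bar>1 + s * reindex c $ ?k\<bar>" by (simp add: det_column_perturbation)
  finally show ?thesis by (simp add: reindex_def Abs_ordered_copy_inverse)
qed

section \<open>An integral inequality of Brunn-Minkowski type\<close>

lemma emeasure_affine_image_le:
  fixes T C :: "real set"
  assumes "T \<in> sets borel" "C \<in> sets borel" "0 < c" "\<And>x. x \<in> T \<Longrightarrow> d + c * x \<in> C"
  shows "ennreal c * emeasure lborel T \<le> emeasure lborel C"
proof -
  have "emeasure lborel C = (\<integral>\<^sup>+y. indicator C y \<partial>lborel)" using assms(2) by simp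
  also have "\<dots> = ennreal \<bar>c\<bar> * (\<integral>\<^sup>+x. indicator C (d + c * x) \<partial>lborel)"
    using assms by (intro nn_integral_real_affine) auto
  finally have eq: "emeasure lborel C = ennreal c * (\<integral>\<^sup>+x. indicator C (d + c * x) \<partial>lborel)"
    using assms(3) by simp
  have "emeasure lborel T = (\<integral>\<^sup>+x. indicator T x \<partial>lborel)" using assms(1) by simp
  also have "\<dots> \<le> (\<integral>\<^sup>+x. indicator C (d + c * x) \<partial>lborel)"
    using assms(4) by (intro nn_integral_mono) (auto simp: indicator_def)
  finally show ?thesis unfolding eq by (rule mult_left_mono) simp
qed

text \<open>On the line, the part of the first set left of one of its points and the part of the second
  set right of one of its points have averages on different sides of the average of these
  points.\<close>

lemma brunn_minkowski_line:
  fixes A B C :: "real set"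
  assumes [measurable]: "A \<in> sets borel" "B \<in> sets borel" "C \<in> sets borel"
    and ne: "A \<noteq> {}" "B \<noteq> {}" and bdd: "A \<subseteq> {-R..R}" "B \<subseteq> {-R..R}" and l: "0 < l" "l < 1"
    and mix: "\<And>a b. a \<in> A \<Longrightarrow> b \<in> B \<Longrightarrow> (1 - l) * a + l * b \<in> C"
  shows "ennreal (1 - l) * emeasure lborel A + ennreal l * emeasure lborel B \<le> emeasure lborel C"
proof (rule ennreal_le_epsilon)
  fix e :: real assume e: "0 < e"
  have bA: "bdd_above A" "bdd_below B" using bdd by (meson bdd_above_Icc bdd_below_Icc bdd_above_mono bdd_below_mono)+
  have "Sup A - e < Sup A" "Inf B < Inf B + e" using e by auto
  then obtain a b where a: "a \<in> A" "Sup A - e < a" and b: "b \<in> B" "b < Inf B + e"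
    using less_cSup_iff[OF ne(1) bA(1)] cInf_less_iff[OF ne(2) bA(2)] by blast
  define p where "p = (1 - l) * a + l * b"
  have "emeasure lborel A \<le> emeasure lborel ((A \<inter> {..a}) \<union> {a..a + e})"
  proof (intro emeasure_mono subsetI)
    fix x assume "x \<in> A"
    then have "x \<le> Sup A" using bA by (intro cSup_upper)
    then show "x \<in> (A \<inter> {..a}) \<union> {a..a + e}" using a \<open>x \<in> A\<close> by auto
  qed simp
  also have "\<dots> \<le> emeasure lborel (A \<inter> {..a}) + emeasure lborel {a..a + e}"
    by (intro emeasure_subadditive) auto
  finally have 1: "emeasure lborel A \<le> emeasure lborel (A \<inter> {..a}) + ennreal e" using e by simp
  have "emeasure lborel B \<le> emeasure lborel ((B \<inter> {b..}) \<union> {b - e..b})"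
  proof (intro emeasure_mono subsetI)
    fix x assume "x \<in> B"
    then have "Inf B \<le> x" using bA by (intro cInf_lower)
    then show "x \<in> (B \<inter> {b..}) \<union> {b - e..b}" using b \<open>x \<in> B\<close> by auto
  qed simp
  also have "\<dots> \<le> emeasure lborel (B \<inter> {b..}) + emeasure lborel {b - e..b}"
    by (intro emeasure_subadditive) auto
  finally have 2: "emeasure lborel B \<le> emeasure lborel (B \<inter> {b..}) + ennreal e" using e by simp
  have 3: "ennreal (1 - l) * emeasure lborel (A \<inter> {..a}) \<le> emeasure lborel (C \<inter> {..p})"
  proof (rule emeasure_affine_image_le[where d="l * b"])
    fix x assume "x \<in> A \<inter> {..a}"
    then show "l * b + (1 - l) * x \<in> C \<inter> {..p}"
      using mix[of x b] b(1) l by (auto simp: p_def add.commute intro: mult_left_mono)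
  qed (use l in auto)
  have 4: "ennreal l * emeasure lborel (B \<inter> {b..}) \<le> emeasure lborel (C \<inter> {p..})"
  proof (rule emeasure_affine_image_le[where d="(1 - l) * a"])
    fix x assume "x \<in> B \<inter> {b..}"
    then show "(1 - l) * a + l * x \<in> C \<inter> {p..}"
      using mix[of a x] a(1) l by (auto simp: p_def intro: mult_left_mono)
  qed (use l in auto)
  have "emeasure lborel (C \<inter> {p..}) \<le> emeasure lborel ((C \<inter> {p<..}) \<union> {p})"
    by (intro emeasure_mono) auto
  also have "\<dots> \<le> emeasure lborel (C \<inter> {p<..}) + emeasure lborel {p}"
    by (intro emeasure_subadditive) auto
  finally have 5: "emeasure lborel (C \<inter> {p..}) \<le> emeasure lborel (C \<inter> {p<..})" by simp
  have "(C \<inter> {..p}) \<union> (C \<inter> {p<..}) = C" by auto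
  moreover have "emeasure lborel (C \<inter> {..p}) + emeasure lborel (C \<inter> {p<..})
      = emeasure lborel ((C \<inter> {..p}) \<union> (C \<inter> {p<..}))"
    by (intro plus_emeasure) auto
  ultimately have 6: "emeasure lborel (C \<inter> {..p}) + emeasure lborel (C \<inter> {p<..}) = emeasure lborel C"
    by simp
  have "ennreal (1 - l) * emeasure lborel A + ennreal l * emeasure lborel B
      \<le> ennreal (1 - l) * (emeasure lborel (A \<inter> {..a}) + ennreal e)
        + ennreal l * (emeasure lborel (B \<inter> {b..}) + ennreal e)"
    by (intro add_mono mult_left_mono 1 2) auto
  also have "\<dots> = (ennreal (1 - l) * emeasure lborel (A \<inter> {..a}) + ennreal l * emeasure lborel (B \<inter> {b..}))
      + (ennreal (1 - l) * ennreal e + ennreal l * ennreal e)"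
    by (simp add: distrib_left add_ac)
  also have "ennreal (1 - l) * ennreal e + ennreal l * ennreal e = ennreal e"
  proof -
    have "ennreal (1 - l) * ennreal e + ennreal l * ennreal e = ennreal ((1 - l) * e + l * e)"
      using l e by (subst ennreal_plus) (auto simp: ennreal_mult)
    also have "(1 - l) * e + l * e = e" by (simp add: algebra_simps)
    finally show ?thesis .
  qed
  also have "ennreal (1 - l) * emeasure lborel (A \<inter> {..a}) + ennreal l * emeasure lborel (B \<inter> {b..})
      \<le> emeasure lborel (C \<inter> {..p}) + emeasure lborel (C \<inter> {p<..})"
    by (intro add_mono 3 order_trans[OF 4 5])
  finally show "ennreal (1 - l) * emeasure lborel A + ennreal l * emeasure lborel B
      \<le> emeasure lborel C + ennreal e"
    unfolding 6 by (simp add: add_right_mono)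
qed

lemma layer_cake:
  fixes g :: "real \<Rightarrow> real"
  assumes [measurable]: "g \<in> borel_measurable borel" "S \<in> sets borel" and nonneg: "\<And>x. 0 \<le> g x"
  shows "(\<integral>\<^sup>+s. emeasure lborel {x\<in>S. s \<le> g x} * indicator {0<..<1} s \<partial>lborel)
    = (\<integral>\<^sup>+x. ennreal (min 1 (g x)) * indicator S x \<partial>lborel)"
proof -
  let ?h = "\<lambda>(x::real) (s::real). indicator S x * indicator {p. snd p \<le> g (fst p)} (x, s) * indicator {0<..<1} s :: ennreal"
  have "(\<integral>\<^sup>+s. emeasure lborel {x\<in>S. s \<le> g x} * indicator {0<..<1} s \<partial>lborel)
      = (\<integral>\<^sup>+s. (\<integral>\<^sup>+x. ?h x s \<partial>lborel) \<partial>lborel)"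
  proof (rule nn_integral_cong)
    fix s :: real
    have "emeasure lborel {x\<in>S. s \<le> g x} = (\<integral>\<^sup>+x. indicator {x\<in>S. s \<le> g x} x \<partial>lborel)" by simp
    also have "\<dots> * indicator {0<..<1} s = (\<integral>\<^sup>+x. indicator {x\<in>S. s \<le> g x} x * indicator {0<..<1} s \<partial>lborel)"
      by (subst nn_integral_multc) auto
    also have "\<dots> = (\<integral>\<^sup>+x. ?h x s \<partial>lborel)"
      by (rule nn_integral_cong) (auto simp: indicator_def)
    finally show "emeasure lborel {x\<in>S. s \<le> g x} * indicator {0<..<1} s = (\<integral>\<^sup>+x. ?h x s \<partial>lborel)" .
  qed
  also have "\<dots> = (\<integral>\<^sup>+x. (\<integral>\<^sup>+s. ?h x s \<partial>lborel) \<partial>lborel)"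
    by (rule lborel_pair.Fubini') measurable
  also have "\<dots> = (\<integral>\<^sup>+x. ennreal (min 1 (g x)) * indicator S x \<partial>lborel)"
  proof (rule nn_integral_cong)
    fix x :: real
    have "(\<integral>\<^sup>+s. ?h x s \<partial>lborel) = (\<integral>\<^sup>+s. indicator S x * indicator ({0<..<1} \<inter> {..g x}) s \<partial>lborel)"
      by (rule nn_integral_cong) (auto simp: indicator_def)
    also have "\<dots> = indicator S x * emeasure lborel ({0<..<1} \<inter> {..g x})"
      by (subst nn_integral_cmult) auto
    also have "emeasure lborel ({0<..<1} \<inter> {..g x}) = ennreal (min 1 (g x))"
    proof (cases "1 \<le> g x")
      case True
      then have "{0<..<1} \<inter> {..g x} = {0<..<1}" by auto
      then show ?thesis using True by simp
    next
      case False
      then have "{0<..<1} \<inter> {..g x} = {0<..g x}" by auto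
      then show ?thesis using False nonneg[of x] by simp
    qed
    finally show "(\<integral>\<^sup>+s. ?h x s \<partial>lborel) = ennreal (min 1 (g x)) * indicator S x" by (simp add: mult.commute)
  qed
  finally show ?thesis .
qed

text \<open>Jensen's inequality for \<open>x \<mapsto> x\<^sup>\<beta>\<close>, in the homogeneous form in which it combines the
  normalisations by the infima with the powers of the integrals.\<close>

lemma powr_perspective_convex:
  fixes u v a b :: real
  assumes "0 < u" "0 < v" "0 < a" "0 < b" "1 \<le> \<beta>"
  shows "(a + b) powr \<beta> * (u + v) powr (1 - \<beta>) \<le> a powr \<beta> * u powr (1 - \<beta>) + b powr \<beta> * v powr (1 - \<beta>)"
proof -
  define w where w_eq: "w = u + v"
  have w: "0 < w" using assms by (simp add: w_eq)
  have w1: "1 - v / w = u / w" using w by (simp add: w_eq field_simps)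
  have "((u / w) * (a / u) + (v / w) * (b / v)) powr \<beta> \<le> (u / w) * (a / u) powr \<beta> + (v / w) * (b / v) powr \<beta>"
    using convex_onD[OF powr_convex[OF assms(5)], of "v / w" "a / u" "b / v"] assms w
    unfolding w1 by (simp add: w_eq)
  moreover have "(u / w) * (a / u) = a / w" "(v / w) * (b / v) = b / w" using assms by auto
  then have "(u / w) * (a / u) + (v / w) * (b / v) = (a + b) / w" by (simp only: add_divide_distrib)
  ultimately have "w * ((a + b) / w) powr \<beta> \<le> w * ((u / w) * (a / u) powr \<beta> + (v / w) * (b / v) powr \<beta>)"
    using w by (simp add: mult_left_mono)
  also have "\<dots> = u * (a / u) powr \<beta> + v * (b / v) powr \<beta>" using w by (simp add: distrib_left)
  finally have "w * ((a + b) / w) powr \<beta> \<le> u * (a / u) powr \<beta> + v * (b / v) powr \<beta>" .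
  moreover have "x * (y / x) powr \<beta> = y powr \<beta> * x powr (1 - \<beta>)" if "0 < x" "0 < y" for x y :: real
    using that by (simp add: powr_divide powr_diff)
  ultimately show ?thesis using assms w by (simp add: add_pos_pos w_eq)
qed

abbreviation cube :: "real \<Rightarrow> 'i set \<Rightarrow> ('i \<Rightarrow> real) set" where
  "cube R I \<equiv> (\<Pi>\<^sub>E i\<in>I. {-R..R})"

lemma inverse_power_integral_bounds:
  fixes \<phi> :: "real \<Rightarrow> real"
  assumes [measurable]: "\<phi> \<in> borel_measurable borel" and R: "0 < R"
    and c: "0 < c" "\<And>x. x \<in> {-R..R} \<Longrightarrow> c \<le> \<phi> x"
    and \<beta>: "0 < \<beta>"
  defines "U \<equiv> (\<integral>\<^sup>+x. ennreal (\<phi> x powr (- \<beta>)) * indicator {-R..R} x \<partial>lborel)"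
  shows "U \<le> ennreal (2 * R * c powr (- \<beta>))" "0 < enn2real U" "U = ennreal (enn2real U)"
proof -
  have "U \<le> (\<integral>\<^sup>+x. ennreal (c powr (- \<beta>)) * indicator {-R..R} x \<partial>lborel)"
    unfolding U_def
  proof (intro nn_integral_mono)
    fix x
    show "ennreal (\<phi> x powr (- \<beta>)) * indicator {-R..R} x \<le> ennreal (c powr (- \<beta>)) * indicator {-R..R} x"
      using c \<beta> by (cases "x \<in> {-R..R}") (auto intro!: ennreal_leI powr_mono2')
  qed
  also have "\<dots> = ennreal (c powr (- \<beta>)) * ennreal (2 * R)"
    using R by (subst nn_integral_cmult_indicator) auto
  also have "\<dots> = ennreal (2 * R * c powr (- \<beta>))"
    using R by (simp add: ennreal_mult'[symmetric] mult.commute)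
  finally show le: "U \<le> ennreal (2 * R * c powr (- \<beta>))" .
  then have fin: "U < top" by (rule order_le_less_trans) simp
  have "U \<noteq> 0"
  proof
    assume "U = 0"
    then have "AE x in lborel. ennreal (\<phi> x powr (- \<beta>)) * indicator {-R..R} x = 0"
      unfolding U_def by (subst (asm) nn_integral_0_iff_AE) auto
    then have "AE x in lborel. x \<notin> {-R..R}"
    proof eventually_elim
      case (elim x)
      then show ?case using c(1) c(2)[of x] by (auto simp: indicator_def split: if_splits)
    qed
    moreover have "{x \<in> space lborel. \<not> x \<notin> {-R..R}} = {-R..R}" by auto
    ultimately have "emeasure lborel {-R..R} = 0"
      using AE_iff_measurable[of "{-R..R}" lborel "\<lambda>x. x \<notin> {-R..R}"] by simp
    then show False using R by simp
  qed
  then show "0 < enn2real U" using fin by (metis enn2real_positive_iff not_gr_zero)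
  show "U = ennreal (enn2real U)" using fin by simp
qed

text \<open>Normalise each function by its infimum \<open>\<alpha>\<close>. Then all superlevel sets of the quotients \<open>(\<alpha> / \<phi>)\<^sup>\<beta>\<close> at
  levels below one are nonempty, and the Brunn-Minkowski inequality on the line compares them level by
  level. Integration over the levels gives a linear inequality between the normalised integrals, from
  which the normalisation is removed by convexity of a power function.\<close>

lemma borell_brascamp_lieb_line:
  fixes \<phi>0 \<phi>1 \<phi>h :: "real \<Rightarrow> real"
  assumes [measurable]: "\<phi>0 \<in> borel_measurable borel" "\<phi>1 \<in> borel_measurable borel" "\<phi>h \<in> borel_measurable borel"
    and R: "0 < R" and l: "0 < l" "l < 1" and \<beta>: "1 < \<beta>" and c: "0 < c"
    and lb: "\<And>x. x \<in> {-R..R} \<Longrightarrow> c \<le> \<phi>0 x" "\<And>x. x \<in> {-R..R} \<Longrightarrow> c \<le> \<phi>1 x" "\<And>x. x \<in> {-R..R} \<Longrightarrow> c \<le> \<phi>h x"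
    and mix: "\<And>x y. x \<in> {-R..R} \<Longrightarrow> y \<in> {-R..R} \<Longrightarrow>
       \<phi>h ((1 - l) * x + l * y) \<le> (1 - l) * \<phi>0 x + l * \<phi>1 y"
  defines "U \<equiv> \<lambda>\<phi>. enn2real (\<integral>\<^sup>+x. ennreal (\<phi> x powr (- \<beta>)) * indicator {-R..R} x \<partial>lborel)"
  shows "U \<phi>h powr (- 1 / (\<beta> - 1)) \<le> (1 - l) * U \<phi>0 powr (- 1 / (\<beta> - 1)) + l * U \<phi>1 powr (- 1 / (\<beta> - 1))"
proof -
  let ?S = "{-R..R}"
  have b0: "0 < \<beta>" using \<beta> by simp
  define \<alpha> where "\<alpha> \<phi> = Inf (\<phi> ` ?S)" for \<phi> :: "real \<Rightarrow> real"
  have ne: "?S \<noteq> {}" using R by auto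
  have bdd: "bdd_below (\<phi>0 ` ?S)" "bdd_below (\<phi>1 ` ?S)"
    using lb(1,2) by (intro bdd_belowI2[of _ c]; blast)+
  have \<alpha>pos: "0 < \<alpha> \<phi>0" "0 < \<alpha> \<phi>1"
  proof -
    have "c \<le> \<alpha> \<phi>0" unfolding \<alpha>_def by (rule cINF_greatest[OF ne]) (rule lb(1))
    moreover have "c \<le> \<alpha> \<phi>1" unfolding \<alpha>_def by (rule cINF_greatest[OF ne]) (rule lb(2))
    ultimately show "0 < \<alpha> \<phi>0" "0 < \<alpha> \<phi>1" using c by linarith+
  qed
  have \<alpha>le: "x \<in> ?S \<Longrightarrow> \<alpha> \<phi>0 \<le> \<phi>0 x" "x \<in> ?S \<Longrightarrow> \<alpha> \<phi>1 \<le> \<phi>1 x" for x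
    unfolding \<alpha>_def by (intro cINF_lower bdd; simp)+
  \<comment> \<open>the normalisation of \<open>\<phi>h\<close>, a lower bound for its values on the mixtures of near-minimal points\<close>
  define A where "A = (1 - l) * \<alpha> \<phi>0 + l * \<alpha> \<phi>1"
  have A: "0 < A" using \<alpha>pos l by (simp add: A_def add_pos_pos)
  define g where "g \<phi> a x = (if x \<in> ?S then (a / \<phi> x) powr \<beta> else 0)" for \<phi> :: "real \<Rightarrow> real" and a x
  have gm[measurable]: "g \<phi> a \<in> borel_measurable borel" if [measurable]: "\<phi> \<in> borel_measurable borel" for \<phi> a
    unfolding g_def by measurable
  have g0: "0 \<le> g \<phi> a x" for \<phi> a x by (simp add: g_def)
  define D where "D \<phi> a s = {x\<in>?S. s \<le> g \<phi> a x}" for \<phi> a s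
  have Dm[measurable]: "D \<phi> a s \<in> sets borel" if [measurable]: "\<phi> \<in> borel_measurable borel" for \<phi> a s
    unfolding D_def by measurable
  have D_iff: "x \<in> D \<phi> a s \<longleftrightarrow> x \<in> ?S \<and> \<phi> x * s powr (1 / \<beta>) \<le> a"
    if "0 < s" "0 < a" "x \<in> ?S \<Longrightarrow> c \<le> \<phi> x" for x \<phi> a s
  proof (cases "x \<in> ?S")
    case True
    have p: "0 < \<phi> x" using that(3)[OF True] c by simp
    have "s \<le> (a / \<phi> x) powr \<beta> \<longleftrightarrow> s powr (1 / \<beta>) \<le> a / \<phi> x"
    proof
      assume "s \<le> (a / \<phi> x) powr \<beta>"
      then have "s powr (1 / \<beta>) \<le> ((a / \<phi> x) powr \<beta>) powr (1 / \<beta>)"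
        using that b0 by (intro powr_mono2) auto
      then show "s powr (1 / \<beta>) \<le> a / \<phi> x" using b0 p that by (simp add: powr_powr)
    next
      assume "s powr (1 / \<beta>) \<le> a / \<phi> x"
      then have "(s powr (1 / \<beta>)) powr \<beta> \<le> (a / \<phi> x) powr \<beta>"
        using that b0 by (intro powr_mono2) auto
      then show "s \<le> (a / \<phi> x) powr \<beta>" using b0 that by (simp add: powr_powr)
    qed
    also have "\<dots> \<longleftrightarrow> \<phi> x * s powr (1 / \<beta>) \<le> a" using p by (simp add: field_simps)
    finally show ?thesis using True by (simp add: D_def g_def)
  qed (auto simp: D_def)
  have key: "ennreal (1 - l) * emeasure lborel (D \<phi>0 (\<alpha> \<phi>0) s) + ennreal l * emeasure lborel (D \<phi>1 (\<alpha> \<phi>1) s)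
      \<le> emeasure lborel (D \<phi>h A s)" if s: "0 < s" "s < 1" for s
  proof (rule brunn_minkowski_line[where R=R, OF _ _ _ _ _ _ _ l])
    define r where "r = s powr (1 / \<beta>)"
    have "r < 1 powr (1 / \<beta>)" unfolding r_def using s b0 by (intro powr_less_mono2) auto
    then have r: "0 < r" "r < 1" using s by (auto simp: r_def)
    have ex: "\<exists>x\<in>?S. \<phi> x * r \<le> \<alpha> \<phi>" if p: "0 < \<alpha> \<phi>" and q: "bdd_below (\<phi> ` ?S)" for \<phi>
    proof -
      have "\<alpha> \<phi> < \<alpha> \<phi> / r" using p r by (simp add: field_simps)
      then obtain x where "x \<in> ?S" "\<phi> x < \<alpha> \<phi> / r"
        unfolding \<alpha>_def cINF_less_iff[OF ne q] by blast
      then show ?thesis using r by (intro bexI[of _ x]) (auto simp: field_simps)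
    qed
    have D0: "x \<in> D \<phi>0 (\<alpha> \<phi>0) s \<longleftrightarrow> x \<in> ?S \<and> \<phi>0 x * r \<le> \<alpha> \<phi>0" for x
      unfolding r_def by (rule D_iff[of s "\<alpha> \<phi>0" x "\<phi>0", OF s(1) \<alpha>pos(1) lb(1)])
    have D1: "x \<in> D \<phi>1 (\<alpha> \<phi>1) s \<longleftrightarrow> x \<in> ?S \<and> \<phi>1 x * r \<le> \<alpha> \<phi>1" for x
      unfolding r_def by (rule D_iff[of s "\<alpha> \<phi>1" x "\<phi>1", OF s(1) \<alpha>pos(2) lb(2)])
    have Dh: "x \<in> D \<phi>h A s \<longleftrightarrow> x \<in> ?S \<and> \<phi>h x * r \<le> A" for x
      unfolding r_def by (rule D_iff[of s "A" x "\<phi>h", OF s(1) A lb(3)])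
    show "D \<phi>0 (\<alpha> \<phi>0) s \<noteq> {}" "D \<phi>1 (\<alpha> \<phi>1) s \<noteq> {}"
      using ex[OF \<alpha>pos(1) bdd(1)] ex[OF \<alpha>pos(2) bdd(2)] D0 D1 by blast+
    show "D \<phi>0 (\<alpha> \<phi>0) s \<subseteq> ?S" "D \<phi>1 (\<alpha> \<phi>1) s \<subseteq> ?S" by (auto simp: D_def)
    fix x y assume x: "x \<in> D \<phi>0 (\<alpha> \<phi>0) s" and y: "y \<in> D \<phi>1 (\<alpha> \<phi>1) s"
    have xS: "x \<in> ?S" "\<phi>0 x * r \<le> \<alpha> \<phi>0" using x unfolding D0 by blast+
    have yS: "y \<in> ?S" "\<phi>1 y * r \<le> \<alpha> \<phi>1" using y unfolding D1 by blast+
    have zS: "(1 - l) * x + l * y \<in> ?S"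
      using convexD[OF convex_real_interval(5)[of "-R" R] xS(1) yS(1), of "1 - l" l] l by simp
    have "\<phi>h ((1 - l) * x + l * y) * r \<le> ((1 - l) * \<phi>0 x + l * \<phi>1 y) * r"
      using mix[OF xS(1) yS(1)] r by (intro mult_right_mono) auto
    also have "\<dots> = (1 - l) * (\<phi>0 x * r) + l * (\<phi>1 y * r)" by (simp add: algebra_simps)
    also have "\<dots> \<le> A" unfolding A_def using xS yS l by (intro add_mono mult_left_mono) auto
    finally show "(1 - l) * x + l * y \<in> D \<phi>h A s"
      using zS unfolding Dh by blast
  qed measurable
  \<comment> \<open>only levels below one are compared; for \<open>\<phi>0\<close> and \<open>\<phi>1\<close> the truncation has no effect\<close>
  define W where "W \<phi> a = (\<integral>\<^sup>+x. ennreal (min 1 (g \<phi> a x)) * indicator ?S x \<partial>lborel)" for \<phi> a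
  have W: "W \<phi> a = (\<integral>\<^sup>+s. emeasure lborel (D \<phi> a s) * indicator {0<..<1} s \<partial>lborel)"
    if "\<phi> \<in> borel_measurable borel" for \<phi> a
    unfolding W_def D_def by (rule layer_cake[symmetric]) (use that gm g0 in auto)
  have Fm: "(\<lambda>s. emeasure lborel (D \<phi> a s)) \<in> borel_measurable borel"
    if [measurable]: "\<phi> \<in> borel_measurable borel" for \<phi> a
  proof -
    have "(\<lambda>s. \<integral>\<^sup>+x. indicator {p. fst p \<le> g \<phi> a (snd p)} (s, x) * indicator ?S x \<partial>lborel) \<in> borel_measurable borel"
      by measurable
    moreover have "emeasure lborel (D \<phi> a s) = (\<integral>\<^sup>+x. indicator {p. fst p \<le> g \<phi> a (snd p)} (s, x) * indicator ?S x \<partial>lborel)" for s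
    proof -
      have "emeasure lborel (D \<phi> a s) = (\<integral>\<^sup>+x. indicator (D \<phi> a s) x \<partial>lborel)" by simp
      also have "\<dots> = (\<integral>\<^sup>+x. indicator {p. fst p \<le> g \<phi> a (snd p)} (s, x) * indicator ?S x \<partial>lborel)"
        by (rule nn_integral_cong) (auto simp: indicator_def D_def)
      finally show ?thesis .
    qed
    ultimately show ?thesis by simp
  qed
  have "ennreal (1 - l) * W \<phi>0 (\<alpha> \<phi>0) + ennreal l * W \<phi>1 (\<alpha> \<phi>1)
      = (\<integral>\<^sup>+s. (ennreal (1 - l) * emeasure lborel (D \<phi>0 (\<alpha> \<phi>0) s)
          + ennreal l * emeasure lborel (D \<phi>1 (\<alpha> \<phi>1) s)) * indicator {0<..<1} s \<partial>lborel)"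
    using Fm by (simp add: W distrib_right nn_integral_add nn_integral_cmult mult.assoc)
  also have "\<dots> \<le> (\<integral>\<^sup>+s. emeasure lborel (D \<phi>h A s) * indicator {0<..<1} s \<partial>lborel)"
    using key by (intro nn_integral_mono) (auto simp: indicator_def)
  also have "\<dots> = W \<phi>h A" by (simp add: W)
  finally have WW: "ennreal (1 - l) * W \<phi>0 (\<alpha> \<phi>0) + ennreal l * W \<phi>1 (\<alpha> \<phi>1) \<le> W \<phi>h A" .
  define V where "V \<phi> = (\<integral>\<^sup>+x. ennreal (\<phi> x powr (- \<beta>)) * indicator ?S x \<partial>lborel)" for \<phi> :: "real \<Rightarrow> real"
  have geq: "g \<phi> a x = a powr \<beta> * \<phi> x powr (- \<beta>)" if "0 < a" "x \<in> ?S" "c \<le> \<phi> x" for \<phi> a x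
    using that c by (simp add: g_def powr_divide powr_minus_divide)
  have W01: "W \<phi> (\<alpha> \<phi>) = ennreal (\<alpha> \<phi> powr \<beta>) * V \<phi>"
    if [measurable]: "\<phi> \<in> borel_measurable borel" and p: "0 < \<alpha> \<phi>" "\<And>x. x \<in> ?S \<Longrightarrow> \<alpha> \<phi> \<le> \<phi> x" "\<And>x. x \<in> ?S \<Longrightarrow> c \<le> \<phi> x" for \<phi>
  proof -
    have "W \<phi> (\<alpha> \<phi>) = (\<integral>\<^sup>+x. ennreal (\<alpha> \<phi> powr \<beta>) * (ennreal (\<phi> x powr (- \<beta>)) * indicator ?S x) \<partial>lborel)"
      unfolding W_def
    proof (rule nn_integral_cong)
      fix x
      show "ennreal (min 1 (g \<phi> (\<alpha> \<phi>) x)) * indicator ?S x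
          = ennreal (\<alpha> \<phi> powr \<beta>) * (ennreal (\<phi> x powr (- \<beta>)) * indicator ?S x)"
      proof (cases "x \<in> ?S")
        case True
        have "\<alpha> \<phi> / \<phi> x \<le> 1" using p True c by (smt (verit) divide_le_eq_1)
        then have "(\<alpha> \<phi> / \<phi> x) powr \<beta> \<le> 1"
          using p(1) p(3)[OF True] c b0 by (intro powr_le1) auto
        then have "min 1 (g \<phi> (\<alpha> \<phi>) x) = \<alpha> \<phi> powr \<beta> * \<phi> x powr (- \<beta>)"
          using geq[of "\<alpha> \<phi>" x \<phi>, OF p(1) True p(3)[OF True]] True by (simp add: g_def)
        then show ?thesis using True by (simp add: ennreal_mult)
      qed simp
    qed
    then show ?thesis unfolding V_def by (subst (asm) nn_integral_cmult) auto
  qed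
  have Wh: "W \<phi>h A \<le> ennreal (A powr \<beta>) * V \<phi>h"
  proof -
    have "W \<phi>h A \<le> (\<integral>\<^sup>+x. ennreal (A powr \<beta>) * (ennreal (\<phi>h x powr (- \<beta>)) * indicator ?S x) \<partial>lborel)"
      unfolding W_def
    proof (intro nn_integral_mono)
      fix x
      show "ennreal (min 1 (g \<phi>h A x)) * indicator ?S x
          \<le> ennreal (A powr \<beta>) * (ennreal (\<phi>h x powr (- \<beta>)) * indicator ?S x)"
      proof (cases "x \<in> ?S")
        case True
        have "ennreal (min 1 (g \<phi>h A x)) \<le> ennreal (g \<phi>h A x)" by (intro ennreal_leI) simp
        also have "\<dots> = ennreal (A powr \<beta>) * ennreal (\<phi>h x powr (- \<beta>))"
          unfolding geq[of A x \<phi>h, OF A True lb(3)[OF True]] by (simp add: ennreal_mult)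
        finally show ?thesis using True by simp
      qed simp
    qed
    also have "\<dots> = ennreal (A powr \<beta>) * V \<phi>h" unfolding V_def by (rule nn_integral_cmult) auto
    finally show ?thesis .
  qed
  note U0 = inverse_power_integral_bounds[OF assms(1) R c lb(1) b0]
  note U1 = inverse_power_integral_bounds[OF assms(2) R c lb(2) b0]
  note Uh = inverse_power_integral_bounds[OF assms(3) R c lb(3) b0]
  have UV: "V \<phi>0 = ennreal (U \<phi>0)" "V \<phi>1 = ennreal (U \<phi>1)" "V \<phi>h = ennreal (U \<phi>h)"
    unfolding V_def U_def using U0(3) U1(3) Uh(3) by auto
  have pos: "0 < U \<phi>0" "0 < U \<phi>1" "0 < U \<phi>h" unfolding U_def using U0(2) U1(2) Uh(2) by auto
  have "ennreal ((1 - l) * (\<alpha> \<phi>0 powr \<beta> * U \<phi>0) + l * (\<alpha> \<phi>1 powr \<beta> * U \<phi>1))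
      = ennreal (1 - l) * W \<phi>0 (\<alpha> \<phi>0) + ennreal l * W \<phi>1 (\<alpha> \<phi>1)"
    using pos l W01[OF assms(1) \<alpha>pos(1) \<alpha>le(1) lb(1)] W01[OF assms(2) \<alpha>pos(2) \<alpha>le(2) lb(2)]
    by (simp add: UV ennreal_plus ennreal_mult)
  also have "\<dots> \<le> ennreal (A powr \<beta> * U \<phi>h)"
    using order_trans[OF WW Wh] pos by (simp add: UV ennreal_mult)
  finally have main: "(1 - l) * (\<alpha> \<phi>0 powr \<beta> * U \<phi>0) + l * (\<alpha> \<phi>1 powr \<beta> * U \<phi>1) \<le> A powr \<beta> * U \<phi>h"
    using pos by (subst (asm) ennreal_le_iff) auto
  define u where "u \<phi> = U \<phi> powr (- 1 / (\<beta> - 1))" for \<phi>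
  have u: "0 < u \<phi>0" "0 < u \<phi>1" "0 < u \<phi>h" using pos by (auto simp: u_def)
  have Uu: "U \<phi> = u \<phi> powr (1 - \<beta>)" if "0 < U \<phi>" for \<phi>
  proof -
    have "(- 1 / (\<beta> - 1)) * (1 - \<beta>) = 1" using \<beta> by (simp add: field_simps)
    then have "u \<phi> powr (1 - \<beta>) = U \<phi> powr 1" unfolding u_def powr_powr by (simp only:)
    then show ?thesis using that by simp
  qed
  let ?z = "(1 - l) * u \<phi>0 + l * u \<phi>1"
  have z: "0 < ?z" using u l by (simp add: add_pos_pos)
  have "A powr \<beta> * ?z powr (1 - \<beta>) \<le> ((1 - l) * \<alpha> \<phi>0) powr \<beta> * ((1 - l) * u \<phi>0) powr (1 - \<beta>)
      + (l * \<alpha> \<phi>1) powr \<beta> * (l * u \<phi>1) powr (1 - \<beta>)"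
    unfolding A_def using powr_perspective_convex[of "(1 - l) * u \<phi>0" "l * u \<phi>1" "(1 - l) * \<alpha> \<phi>0" "l * \<alpha> \<phi>1" \<beta>]
      u \<alpha>pos l \<beta> by simp
  also have "\<dots> = (1 - l) * (\<alpha> \<phi>0 powr \<beta> * U \<phi>0) + l * (\<alpha> \<phi>1 powr \<beta> * U \<phi>1)"
  proof -
    have "(k * a) powr \<beta> * (k * w) powr (1 - \<beta>) = k * (a powr \<beta> * w powr (1 - \<beta>))" if "0 < k" "0 < a" "0 < w" for k a w :: real
    proof -
      have "k powr \<beta> * k powr (1 - \<beta>) = k" using that by (simp flip: powr_add)
      then show ?thesis using that by (simp add: powr_mult mult_ac)
    qed
    then show ?thesis using l u \<alpha>pos pos by (simp add: Uu)
  qed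
  also have "\<dots> \<le> A powr \<beta> * U \<phi>h" by (rule main)
  finally have "?z powr (1 - \<beta>) \<le> u \<phi>h powr (1 - \<beta>)" using A pos Uu by simp
  then have "u \<phi>h \<le> ?z" using powr_less_mono2_neg[of "1 - \<beta>" ?z "u \<phi>h"] \<beta> z u by force
  then show ?thesis by (simp add: u_def)
qed

definition box_integral :: "real \<Rightarrow> real \<Rightarrow> 'i set \<Rightarrow> (('i \<Rightarrow> real) \<Rightarrow> real) \<Rightarrow> ennreal" where
  "box_integral R \<beta> I \<phi> =
     (\<integral>\<^sup>+x. ennreal (\<phi> x powr (- \<beta>)) * indicator (cube R I) x \<partial>PiM I (\<lambda>_. lborel))"

interpretation lborel_product: product_sigma_finite "\<lambda>_. lborel :: real measure" ..

lemma cube_measurable: "finite I \<Longrightarrow> cube R I \<in> sets (PiM I (\<lambda>_. lborel))"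
  by (rule sets_PiM_I_finite) auto

lemma cube_subset_space: "x \<in> cube R I \<Longrightarrow> x \<in> space (PiM I (\<lambda>_. lborel))"
  by (auto simp: space_PiM PiE_iff)

text \<open>Integrating out one coordinate turns the exponent \<open>\<beta>\<close> into \<open>\<beta> - 1\<close>, and by the inequality on
  the line the resulting functions satisfy the same kind of convexity condition in the remaining
  coordinates.\<close>

lemma borell_brascamp_lieb:
  fixes I :: "'i set"
  assumes "finite I" and R: "0 < R" and l: "0 < l" "l < 1" and "real (card I) < \<beta>" "0 < c"
    and "\<phi>0 \<in> borel_measurable (PiM I (\<lambda>_. lborel))" "\<phi>1 \<in> borel_measurable (PiM I (\<lambda>_. lborel))"
      "\<phi>h \<in> borel_measurable (PiM I (\<lambda>_. lborel))"
    and "\<And>x. x \<in> cube R I \<Longrightarrow> c \<le> \<phi>0 x" "\<And>x. x \<in> cube R I \<Longrightarrow> c \<le> \<phi>1 x"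
      "\<And>x. x \<in> cube R I \<Longrightarrow> c \<le> \<phi>h x"
    and "\<And>x y. x \<in> cube R I \<Longrightarrow> y \<in> cube R I \<Longrightarrow>
       \<phi>h (\<lambda>i\<in>I. (1 - l) * x i + l * y i) \<le> (1 - l) * \<phi>0 x + l * \<phi>1 y"
  shows "enn2real (box_integral R \<beta> I \<phi>h) powr (- 1 / (\<beta> - card I))
    \<le> (1 - l) * enn2real (box_integral R \<beta> I \<phi>0) powr (- 1 / (\<beta> - card I))
      + l * enn2real (box_integral R \<beta> I \<phi>1) powr (- 1 / (\<beta> - card I))"
  using assms(1,5-)
proof (induction I arbitrary: \<beta> c \<phi>0 \<phi>1 \<phi>h rule: finite_induct)
  case empty
  let ?o = "\<lambda>_. undefined :: real"
  have U: "enn2real (box_integral R \<beta> {} \<phi>) powr (- 1 / \<beta>) = \<phi> ?o" if "c \<le> \<phi> ?o" for \<phi>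
  proof -
    have "box_integral R \<beta> {} \<phi> = ennreal (\<phi> ?o powr (- \<beta>))"
      by (simp add: box_integral_def PiM_empty nn_integral_count_space_finite)
    then show ?thesis using that empty.prems(1,2) by (simp add: powr_powr)
  qed
  have "\<phi>h (\<lambda>i\<in>{}. (1 - l) * ?o i + l * ?o i) \<le> (1 - l) * \<phi>0 ?o + l * \<phi>1 ?o"
    by (rule empty.prems(9)) auto
  then show ?case
    using U[of \<phi>0] U[of \<phi>1] U[of \<phi>h] empty.prems(6)[of ?o] empty.prems(7)[of ?o] empty.prems(8)[of ?o]
    by (simp add: restrict_def)
next
  case (insert k I)
  note fin = \<open>finite I\<close> and k = \<open>k \<notin> I\<close>
  let ?J = "insert k I" let ?S = "{-R..R}"
  have \<beta>: "1 < \<beta>" "real (card I) < \<beta> - 1" using insert.prems(1) fin k by simp_all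
  define inner where "inner \<phi> x = (\<integral>\<^sup>+t. ennreal (\<phi> (x(k := t)) powr (- \<beta>)) * indicator ?S t \<partial>lborel)"
    for \<phi> :: "('i \<Rightarrow> real) \<Rightarrow> real" and x
  define \<psi> where "\<psi> \<phi> x = enn2real (inner \<phi> x) powr (- 1 / (\<beta> - 1))" for \<phi> x
  have sect: "(\<lambda>t. \<phi> (x(k := t))) \<in> borel_measurable borel"
    if "\<phi> \<in> borel_measurable (PiM ?J (\<lambda>_. lborel))" "x \<in> cube R I" for \<phi> x
    using measurable_compose[OF measurable_component_update[OF cube_subset_space[OF that(2)] k] that(1)] by simp
  have upd: "x(k := t) \<in> cube R ?J" if "x \<in> cube R I" "t \<in> ?S" for x t
    using that by (intro PiE_fun_upd) auto
  have inner_meas: "inner \<phi> \<in> borel_measurable (PiM I (\<lambda>_. lborel))"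
    if [measurable]: "\<phi> \<in> borel_measurable (PiM ?J (\<lambda>_. lborel))" for \<phi>
  proof -
    have [measurable]: "(\<lambda>p. (fst p)(k := snd p)) \<in> PiM I (\<lambda>_. lborel :: real measure) \<Otimes>\<^sub>M lborel \<rightarrow>\<^sub>M PiM ?J (\<lambda>_. lborel)"
      using measurable_add_dim[of k I "\<lambda>_. lborel"] by (simp add: case_prod_beta')
    have "(\<lambda>p. ennreal (\<phi> ((fst p)(k := snd p)) powr (- \<beta>)) * indicator ?S (snd p))
        \<in> borel_measurable (PiM I (\<lambda>_. lborel) \<Otimes>\<^sub>M lborel)" by measurable
    then show ?thesis unfolding inner_def[abs_def]
      by (intro lborel.borel_measurable_nn_integral) (simp add: case_prod_beta')
  qed
  have ip: "inner \<phi> x \<le> ennreal (2 * R * c powr (- \<beta>))" "0 < enn2real (inner \<phi> x)"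
      "inner \<phi> x = ennreal (enn2real (inner \<phi> x))"
    if "\<phi> \<in> borel_measurable (PiM ?J (\<lambda>_. lborel))" "\<And>x. x \<in> cube R ?J \<Longrightarrow> c \<le> \<phi> x" "x \<in> cube R I" for \<phi> x
    using inverse_power_integral_bounds[OF sect[OF that(1,3)] R insert.prems(2), of \<beta>]
      that(2)[OF upd[OF that(3)]] \<beta>(1) unfolding inner_def by auto
  define c' where "c' = (2 * R * c powr (- \<beta>)) powr (- 1 / (\<beta> - 1))"
  have c': "0 < c'" using R insert.prems(2) by (simp add: c'_def)
  have \<psi>lb: "c' \<le> \<psi> \<phi> x"
    if "\<phi> \<in> borel_measurable (PiM ?J (\<lambda>_. lborel))" "\<And>x. x \<in> cube R ?J \<Longrightarrow> c \<le> \<phi> x" "x \<in> cube R I" for \<phi> x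
  proof -
    have "enn2real (inner \<phi> x) \<le> 2 * R * c powr (- \<beta>)"
      using ip(1)[OF that] R by (intro enn2real_leI) auto
    then show ?thesis unfolding \<psi>_def c'_def using ip(2)[OF that] \<beta>(1)
      by (intro powr_mono2') (auto simp: divide_nonpos_pos)
  qed
  have \<psi>m: "\<psi> \<phi> \<in> borel_measurable (PiM I (\<lambda>_. lborel))"
    if "\<phi> \<in> borel_measurable (PiM ?J (\<lambda>_. lborel))" for \<phi>
    unfolding \<psi>_def[abs_def] using inner_meas[OF that] by measurable
  have reduce: "box_integral R (\<beta> - 1) I (\<psi> \<phi>) = box_integral R \<beta> ?J \<phi>"
    if \<phi>[measurable]: "\<phi> \<in> borel_measurable (PiM ?J (\<lambda>_. lborel))" and lb: "\<And>x. x \<in> cube R ?J \<Longrightarrow> c \<le> \<phi> x" for \<phi>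
  proof -
    have [measurable]: "cube R ?J \<in> sets (PiM ?J (\<lambda>_. lborel))" using fin by (intro cube_measurable) simp
    have "box_integral R \<beta> ?J \<phi> = (\<integral>\<^sup>+x. (\<integral>\<^sup>+t. ennreal (\<phi> (x(k := t)) powr (- \<beta>)) * indicator (cube R ?J) (x(k := t)) \<partial>lborel)
        \<partial>PiM I (\<lambda>_. lborel))"
      unfolding box_integral_def by (rule lborel_product.product_nn_integral_insert[OF fin k]) measurable
    also have "\<dots> = (\<integral>\<^sup>+x. ennreal (\<psi> \<phi> x powr (- (\<beta> - 1))) * indicator (cube R I) x \<partial>PiM I (\<lambda>_. lborel))"
    proof (rule nn_integral_cong)
      fix x assume x: "x \<in> space (PiM I (\<lambda>_. lborel :: real measure))"
      have ind: "indicator (cube R ?J) (x(k := t)) = (indicator (cube R I) x * indicator ?S t :: ennreal)" for t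
      proof -
        have "x(k := t) \<in> cube R ?J \<longleftrightarrow> x \<in> cube R I \<and> t \<in> ?S"
          using x k by (auto simp: space_PiM PiE_iff extensional_def)
        then show ?thesis by (simp add: indicator_def)
      qed
      show "(\<integral>\<^sup>+t. ennreal (\<phi> (x(k := t)) powr (- \<beta>)) * indicator (cube R ?J) (x(k := t)) \<partial>lborel)
          = ennreal (\<psi> \<phi> x powr (- (\<beta> - 1))) * indicator (cube R I) x"
      proof (cases "x \<in> cube R I")
        case True
        have "(- 1 / (\<beta> - 1)) * (- (\<beta> - 1)) = 1" using \<beta>(1) by (simp add: field_simps)
        then have "\<psi> \<phi> x powr (- (\<beta> - 1)) = enn2real (inner \<phi> x) powr 1"
          unfolding \<psi>_def powr_powr by (simp only:)
        also have "\<dots> = enn2real (inner \<phi> x)" using ip(2)[OF \<phi> lb True] by simp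
        finally have "ennreal (\<psi> \<phi> x powr (- (\<beta> - 1))) = inner \<phi> x" using ip(3)[OF \<phi> lb True] by simp
        then show ?thesis using True unfolding ind by (simp add: inner_def)
      qed (simp add: ind)
    qed
    finally show ?thesis by (simp add: box_integral_def)
  qed
  note m0 = insert.prems(3) and m1 = insert.prems(4) and mh = insert.prems(5)
  note lb0 = insert.prems(6) and lb1 = insert.prems(7) and lbh = insert.prems(8)
  have mix: "\<psi> \<phi>h (\<lambda>i\<in>I. (1 - l) * x i + l * y i) \<le> (1 - l) * \<psi> \<phi>0 x + l * \<psi> \<phi>1 y"
    if x: "x \<in> cube R I" and y: "y \<in> cube R I" for x y
  proof -
    let ?z = "\<lambda>i\<in>I. (1 - l) * x i + l * y i"
    have z: "?z \<in> cube R I"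
    proof (rule PiE_I)
      fix i assume i: "i \<in> I"
      then have "x i \<in> ?S" "y i \<in> ?S" using x y by auto
      then show "?z i \<in> ?S" 
        using convexD[OF convex_real_interval(5)[of "-R" R], of "x i" "y i" "1 - l" l] l i by simp
    qed simp
    show ?thesis unfolding \<psi>_def inner_def
    proof (rule borell_brascamp_lieb_line[OF sect[OF m0 x] sect[OF m1 y] sect[OF mh z] R l \<beta>(1) insert.prems(2)])
      fix s t assume st: "s \<in> ?S" "t \<in> ?S"
      show "c \<le> \<phi>0 (x(k := s))" "c \<le> \<phi>1 (y(k := s))" "c \<le> \<phi>h (?z(k := s))"
        using lb0[OF upd[OF x st(1)]] lb1[OF upd[OF y st(1)]] lbh[OF upd[OF z st(1)]] .
      have eq: "(\<lambda>i\<in>?J. (1 - l) * (x(k := s)) i + l * (y(k := t)) i) = ?z(k := (1 - l) * s + l * t)"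
        using k by (auto simp: fun_eq_iff restrict_def)
      show "\<phi>h (?z(k := (1 - l) * s + l * t)) \<le> (1 - l) * \<phi>0 (x(k := s)) + l * \<phi>1 (y(k := t))"
        using insert.prems(9)[OF upd[OF x st(1)] upd[OF y st(2)]] unfolding eq .
    qed
  qed
  have "enn2real (box_integral R (\<beta> - 1) I (\<psi> \<phi>h)) powr (- 1 / (\<beta> - 1 - card I))
    \<le> (1 - l) * enn2real (box_integral R (\<beta> - 1) I (\<psi> \<phi>0)) powr (- 1 / (\<beta> - 1 - card I))
      + l * enn2real (box_integral R (\<beta> - 1) I (\<psi> \<phi>1)) powr (- 1 / (\<beta> - 1 - card I))"
    by (rule insert.IH[OF \<beta>(2) c' \<psi>m[OF m0] \<psi>m[OF m1] \<psi>m[OF mh] \<psi>lb[OF m0 lb0] \<psi>lb[OF m1 lb1] \<psi>lb[OF mh lbh] mix])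
  moreover have "\<beta> - 1 - card I = \<beta> - card ?J" using fin k by simp
  ultimately show ?case
    by (simp only: reduce[of \<phi>0, OF m0 lb0] reduce[of \<phi>1, OF m1 lb1] reduce[of \<phi>h, OF mh lbh])
qed

section \<open>Convexity of the area integrand\<close>

lemma nn_integral_PiM_scale:
  fixes g :: "('i \<Rightarrow> real) \<Rightarrow> ennreal"
  assumes "finite I" "0 < r" "g \<in> borel_measurable (PiM I (\<lambda>_. lborel))"
  shows "(\<integral>\<^sup>+x. g x \<partial>PiM I (\<lambda>_. lborel))
    = ennreal (r ^ card I) * (\<integral>\<^sup>+x. g (\<lambda>i\<in>I. r * x i) \<partial>PiM I (\<lambda>_. lborel))"
  using assms(1,3)
proof (induction I arbitrary: g rule: finite_induct)
  case empty
  have "(\<lambda>i\<in>{}. r * undefined) = (\<lambda>_. undefined)" by (simp add: restrict_def)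
  then show ?case by (simp add: PiM_empty nn_integral_count_space_finite restrict_def)
next
  case (insert k I)
  note fin = \<open>finite I\<close> and k = \<open>k \<notin> I\<close> and g[measurable] = insert.prems
  let ?J = "insert k I"
  have [measurable]: "(\<lambda>p. (fst p)(k := snd p)) \<in> PiM I (\<lambda>_. lborel :: real measure) \<Otimes>\<^sub>M lborel \<rightarrow>\<^sub>M PiM ?J (\<lambda>_. lborel)"
    using measurable_add_dim[of k I "\<lambda>_. lborel"] by (simp add: case_prod_beta')
  have [measurable]: "(\<lambda>x. \<lambda>i\<in>?J. r * x i) \<in> PiM ?J (\<lambda>_. lborel :: real measure) \<rightarrow>\<^sub>M PiM ?J (\<lambda>_. lborel)"
    by measurable
  define h where "h x = (\<integral>\<^sup>+t. g (x(k := r * t)) \<partial>lborel)" for x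
  have hm: "h \<in> borel_measurable (PiM I (\<lambda>_. lborel))"
  proof -
    have "(\<lambda>p. g ((\<lambda>p. (fst p)(k := snd p)) (fst p, r * snd p))) \<in> borel_measurable (PiM I (\<lambda>_. lborel) \<Otimes>\<^sub>M lborel)"
      by measurable
    then show ?thesis unfolding h_def[abs_def]
      by (intro lborel.borel_measurable_nn_integral) (simp add: case_prod_beta')
  qed
  have "(\<integral>\<^sup>+x. g x \<partial>PiM ?J (\<lambda>_. lborel)) = (\<integral>\<^sup>+x. (\<integral>\<^sup>+t. g (x(k := t)) \<partial>lborel) \<partial>PiM I (\<lambda>_. lborel))"
    by (rule lborel_product.product_nn_integral_insert[OF fin k g])
  also have "\<dots> = (\<integral>\<^sup>+x. ennreal r * h x \<partial>PiM I (\<lambda>_. lborel))"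
  proof (rule nn_integral_cong)
    fix x assume x: "x \<in> space (PiM I (\<lambda>_. lborel :: real measure))"
    have "(\<lambda>t. g (x(k := t))) \<in> borel_measurable lborel"
      by (rule measurable_compose[OF measurable_component_update[OF x k] g])
    then have "(\<lambda>t. g (x(k := t))) \<in> borel_measurable borel" unfolding measurable_lborel2 .
    from nn_integral_real_affine[OF this, of r 0] assms(2)
    show "(\<integral>\<^sup>+t. g (x(k := t)) \<partial>lborel) = ennreal r * h x" by (simp add: h_def)
  qed
  also have "\<dots> = ennreal r * (\<integral>\<^sup>+x. h x \<partial>PiM I (\<lambda>_. lborel))" using hm by (rule nn_integral_cmult)
  also have "\<dots> = ennreal r * (ennreal (r ^ card I) * (\<integral>\<^sup>+x. h (\<lambda>i\<in>I. r * x i) \<partial>PiM I (\<lambda>_. lborel)))"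
    by (simp only: insert.IH[OF hm])
  also have "\<dots> = ennreal (r ^ card ?J) * (\<integral>\<^sup>+x. h (\<lambda>i\<in>I. r * x i) \<partial>PiM I (\<lambda>_. lborel))"
    using assms(2) fin k by (simp add: ennreal_mult mult.assoc)
  also have "(\<integral>\<^sup>+x. h (\<lambda>i\<in>I. r * x i) \<partial>PiM I (\<lambda>_. lborel))
      = (\<integral>\<^sup>+x. (\<integral>\<^sup>+t. g (\<lambda>i\<in>?J. r * (x(k := t)) i) \<partial>lborel) \<partial>PiM I (\<lambda>_. lborel))"
  proof -
    have "(\<lambda>i\<in>I. r * x i)(k := r * t) = (\<lambda>i\<in>?J. r * (x(k := t)) i)" for x :: "'i \<Rightarrow> real" and t
      using k by (auto simp: fun_eq_iff restrict_def)
    then show ?thesis by (simp only: h_def)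
  qed
  also have "\<dots> = (\<integral>\<^sup>+x. g (\<lambda>i\<in>?J. r * x i) \<partial>PiM ?J (\<lambda>_. lborel))"
    by (rule lborel_product.product_nn_integral_insert[OF fin k, symmetric]) measurable
  finally show ?case .
qed

lemma nn_integral_power_segment:
  assumes "0 < a" "0 < m"
  shows "(\<integral>\<^sup>+r. ennreal (r ^ (m - 1)) * indicator {0<..a} r \<partial>lborel) = ennreal (a ^ m / real m)"
proof -
  have "(\<integral>\<^sup>+r. ennreal (r ^ (m - 1)) * indicator {0<..a} r \<partial>lborel)
      = (\<integral>\<^sup>+r. ennreal (r ^ (m - 1)) * indicator {0..a} r \<partial>lborel)"
  proof (rule nn_integral_cong_AE)
    show "AE r in lborel. ennreal (r ^ (m - 1)) * indicator {0<..a} r = ennreal (r ^ (m - 1)) * indicator {0..a} r"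
      using AE_lborel_singleton[of "0::real"] by eventually_elim (auto simp: indicator_def)
  qed
  also have "\<dots> = ennreal (a ^ m / real m - 0 ^ m / real m)"
  proof (rule nn_integral_FTC_Icc)
    show "((\<lambda>r. r ^ m / real m) has_real_derivative r ^ (m - 1)) (at r)" for r
      using assms by (auto intro!: derivative_eq_intros)
  qed (use assms in auto)
  finally show ?thesis using assms by (simp add: power_0_left)
qed

text \<open>Coordinates on the hyperplane \<open>v \<bullet> k = 1\<close>, indexed by the remaining basis vectors so that product
  measures can be used.\<close>

definition affine_chart :: "'a::euclidean_space \<Rightarrow> ('a \<Rightarrow> real) \<Rightarrow> 'a" where
  "affine_chart k z = (\<Sum>b\<in>Basis - {k}. z b *\<^sub>R b) + k"

lemma affine_chart_inner:
  assumes "k \<in> Basis" shows "affine_chart k z \<bullet> k = 1"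
proof -
  have "(\<Sum>b\<in>Basis - {k}. z b *\<^sub>R b) \<bullet> k = (\<Sum>b\<in>Basis - {k}. z b * (b \<bullet> k))" by (simp add: inner_sum_left)
  also have "\<dots> = 0" using assms by (intro sum.neutral) (auto simp: inner_Basis)
  finally show ?thesis using assms by (simp add: affine_chart_def inner_add_left)
qed

text \<open>A symmetric star body consists of two cones over the affine hyperplane \<open>v \<bullet> k = 1\<close>.\<close>

lemma volume_cone:
  fixes f :: "'a::euclidean_space \<Rightarrow> real"
  assumes f: "pos_homogeneous f" and fm[measurable]: "f \<in> borel_measurable borel"
    and even: "\<And>v. f (- v) = f v" and k: "k \<in> Basis"
  shows "emeasure lborel {v. f v \<le> 1} = 2 *
    (\<integral>\<^sup>+z. ennreal (inverse (f (affine_chart k z)) ^ DIM('a) / real DIM('a)) \<partial>PiM (Basis - {k}) (\<lambda>_. lborel))"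
proof -
  let ?I = "Basis - {k} :: 'a set" let ?m = "DIM('a)"
  let ?P = "{v. f v \<le> 1 \<and> 0 < v \<bullet> k}" and ?N = "{v. f v \<le> 1 \<and> 0 < (- v) \<bullet> k}"
  let ?Z = "{v. v \<bullet> k = 0}"
  have fin: "finite ?I" and kI: "k \<notin> ?I" and Bas: "insert k ?I = Basis" using k by auto
  have Z: "?Z \<in> null_sets lborel"
    using negligible_standard_hyperplane[OF k, of 0] by (simp add: negligible_iff_null_sets null_sets_completion_iff)
  have "emeasure lborel {v. f v \<le> 1} = emeasure lborel ({v. f v \<le> 1} - ?Z)"
    using Z by (intro emeasure_Diff_null_set[symmetric]) auto
  also have "{v. f v \<le> 1} - ?Z = ?P \<union> ?N" by auto
  also have "emeasure lborel (?P \<union> ?N) = emeasure lborel ?P + emeasure lborel ?N"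
    by (intro plus_emeasure[symmetric]) auto
  also have "emeasure lborel ?N = emeasure lborel ?P"
  proof -
    have "emeasure lborel ?P = (\<integral>\<^sup>+v. indicator ?P v \<partial>lborel)" by simp
    also have "\<dots> = (\<integral>\<^sup>+v. indicator ?P (- v) \<partial>lborel)" by (rule nn_integral_reflect) measurable
    also have "\<dots> = (\<integral>\<^sup>+v. indicator ?N v \<partial>lborel)" by (rule nn_integral_cong) (simp add: indicator_def even)
    finally show ?thesis by simp
  qed
  finally have 1: "emeasure lborel {v. f v \<le> 1} = 2 * emeasure lborel ?P" by (simp add: mult_2)
  have chart[measurable]: "affine_chart k \<in> PiM ?I (\<lambda>_. lborel) \<rightarrow>\<^sub>M borel"
    unfolding affine_chart_def by measurable
  have "emeasure lborel ?P = (\<integral>\<^sup>+v. indicator ?P v \<partial>lborel)" by simp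
  also have "\<dots> = (\<integral>\<^sup>+x. indicator ?P (\<Sum>b\<in>Basis. x b *\<^sub>R b) \<partial>PiM Basis (\<lambda>_. lborel))"
    unfolding lborel_def[where 'a='a] lborel_eq_real[symmetric]
    by (subst nn_integral_distr) (auto simp: lborel_eq_real[symmetric])
  also have "\<dots> = (\<integral>\<^sup>+r. (\<integral>\<^sup>+x. indicator ?P (\<Sum>b\<in>Basis. (x(k := r)) b *\<^sub>R b) \<partial>PiM ?I (\<lambda>_. lborel)) \<partial>lborel)"
    using lborel_product.product_nn_integral_insert_rev[OF fin kI, of "\<lambda>x. indicator ?P (\<Sum>b\<in>Basis. x b *\<^sub>R b)"]
    unfolding Bas by simp
  also have "\<dots> = (\<integral>\<^sup>+r. (\<integral>\<^sup>+z. ennreal (r ^ (?m - 1)) * indicator {0<..} r * indicator {p. snd p * f (affine_chart k (fst p)) \<le> 1} (z, r)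
      \<partial>PiM ?I (\<lambda>_. lborel)) \<partial>lborel)"
  proof (rule nn_integral_cong)
    fix r :: real
    have sumeq: "(\<Sum>b\<in>Basis. (x(k := r)) b *\<^sub>R b) = (\<Sum>b\<in>?I. x b *\<^sub>R b) + r *\<^sub>R k" for x
    proof -
      have "(\<Sum>b\<in>Basis. (x(k := r)) b *\<^sub>R b) = (\<Sum>b\<in>insert k ?I. (x(k := r)) b *\<^sub>R b)" by (simp only: Bas)
      also have "\<dots> = r *\<^sub>R k + (\<Sum>b\<in>?I. (x(k := r)) b *\<^sub>R b)" using fin kI by (subst sum.insert) auto
      also have "(\<Sum>b\<in>?I. (x(k := r)) b *\<^sub>R b) = (\<Sum>b\<in>?I. x b *\<^sub>R b)" by (rule sum.cong) auto
      finally show ?thesis by (simp add: add.commute)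
    qed
    have meas: "(\<lambda>x. indicator ?P ((\<Sum>b\<in>?I. x b *\<^sub>R b) + r *\<^sub>R k) :: ennreal) \<in> borel_measurable (PiM ?I (\<lambda>_. lborel))"
      by measurable
    show "(\<integral>\<^sup>+x. indicator ?P (\<Sum>b\<in>Basis. (x(k := r)) b *\<^sub>R b) \<partial>PiM ?I (\<lambda>_. lborel))
      = (\<integral>\<^sup>+z. ennreal (r ^ (?m - 1)) * indicator {0<..} r * indicator {p. snd p * f (affine_chart k (fst p)) \<le> 1} (z, r) \<partial>PiM ?I (\<lambda>_. lborel))"
    proof (cases "0 < r")
      case True
      have ev: "indicator ?P ((\<Sum>b\<in>?I. (\<lambda>i\<in>?I. r * z i) b *\<^sub>R b) + r *\<^sub>R k)
          = (indicator {p. snd p * f (affine_chart k (fst p)) \<le> 1} (z, r) :: ennreal)" for z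
      proof -
        have "(\<Sum>b\<in>?I. (\<lambda>i\<in>?I. r * z i) b *\<^sub>R b) + r *\<^sub>R k = r *\<^sub>R affine_chart k z"
          by (simp add: affine_chart_def scaleR_add_right scaleR_sum_right)
        moreover have "f (r *\<^sub>R affine_chart k z) = r * f (affine_chart k z)"
          by (rule pos_homogeneous_scale[OF f True])
        moreover have "0 < (r *\<^sub>R affine_chart k z) \<bullet> k" using True affine_chart_inner[OF k] by simp
        ultimately show ?thesis by (simp add: indicator_def)
      qed
      have "card ?I = ?m - 1" using k by simp
      then have "(\<integral>\<^sup>+x. indicator ?P (\<Sum>b\<in>Basis. (x(k := r)) b *\<^sub>R b) \<partial>PiM ?I (\<lambda>_. lborel))
         = ennreal (r ^ (?m - 1)) * (\<integral>\<^sup>+z. indicator {p. snd p * f (affine_chart k (fst p)) \<le> 1} (z, r) \<partial>PiM ?I (\<lambda>_. lborel))"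
        unfolding sumeq using nn_integral_PiM_scale[OF fin True meas] by (simp only: ev)
      also have "\<dots> = (\<integral>\<^sup>+z. ennreal (r ^ (?m - 1)) * indicator {p. snd p * f (affine_chart k (fst p)) \<le> 1} (z, r) \<partial>PiM ?I (\<lambda>_. lborel))"
        by (rule nn_integral_cmult[symmetric]) measurable
      finally show ?thesis using True by simp
    next
      case False
      have "indicator ?P ((\<Sum>b\<in>?I. x b *\<^sub>R b) + r *\<^sub>R k) = (0::ennreal)" for x
      proof -
        have "(\<Sum>b\<in>?I. x b *\<^sub>R b) \<bullet> k = (\<Sum>b\<in>?I. x b * (b \<bullet> k))" by (simp add: inner_sum_left)
        also have "\<dots> = 0" using k by (intro sum.neutral) (auto simp: inner_Basis)
        finally have "((\<Sum>b\<in>?I. x b *\<^sub>R b) + r *\<^sub>R k) \<bullet> k = r" using k by (simp add: inner_add_left)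
        then show ?thesis using False by (simp add: indicator_def)
      qed
      then show ?thesis using False unfolding sumeq by simp
    qed
  qed
  also have "\<dots> = (\<integral>\<^sup>+z. (\<integral>\<^sup>+r. ennreal (r ^ (?m - 1)) * indicator {0<..} r * indicator {p. snd p * f (affine_chart k (fst p)) \<le> 1} (z, r)
      \<partial>lborel) \<partial>PiM ?I (\<lambda>_. lborel))"
  proof (rule pair_sigma_finite.Fubini')
    show "pair_sigma_finite (PiM ?I (\<lambda>_. lborel :: real measure)) lborel"
      by (intro pair_sigma_finite.intro lborel_product.sigma_finite fin lborel.sigma_finite_measure_axioms)
  qed measurable
  also have "\<dots> = (\<integral>\<^sup>+z. ennreal (inverse (f (affine_chart k z)) ^ ?m / real ?m) \<partial>PiM ?I (\<lambda>_. lborel))"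
  proof (rule nn_integral_cong)
    fix z
    have "affine_chart k z \<noteq> 0" using affine_chart_inner[OF k, of z] by auto
    then have p: "0 < f (affine_chart k z)" by (rule pos_homogeneous_pos[OF f])
    have "(\<integral>\<^sup>+r. ennreal (r ^ (?m - 1)) * indicator {0<..} r * indicator {p. snd p * f (affine_chart k (fst p)) \<le> 1} (z, r) \<partial>lborel)
       = (\<integral>\<^sup>+r. ennreal (r ^ (?m - 1)) * indicator {0<..inverse (f (affine_chart k z))} r \<partial>lborel)"
      using p by (intro nn_integral_cong) (auto simp: indicator_def field_simps)
    also have "\<dots> = ennreal (inverse (f (affine_chart k z)) ^ ?m / real ?m)"
      using p by (intro nn_integral_power_segment) auto
    finally show "(\<integral>\<^sup>+r. ennreal (r ^ (?m - 1)) * indicator {0<..} r * indicator {p. snd p * f (affine_chart k (fst p)) \<le> 1} (z, r) \<partial>lborel)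
       = ennreal (inverse (f (affine_chart k z)) ^ ?m / real ?m)" .
  qed
  finally show ?thesis by (simp only: 1)
qed

lemma box_integral_tendsto:
  fixes \<phi> :: "('i \<Rightarrow> real) \<Rightarrow> real"
  assumes fin: "finite I" and [measurable]: "\<phi> \<in> borel_measurable (PiM I (\<lambda>_. lborel))"
  shows "(\<lambda>n. box_integral (real (Suc n)) \<beta> I \<phi>)
    \<longlonglongrightarrow> (\<integral>\<^sup>+x. ennreal (\<phi> x powr (- \<beta>)) \<partial>PiM I (\<lambda>_. lborel))"
proof -
  let ?f = "\<lambda>n x. ennreal (\<phi> x powr (- \<beta>)) * indicator (cube (real (Suc n)) I) x"
  let ?u = "\<lambda>x. ennreal (\<phi> x powr (- \<beta>)) * indicator (PiE I (\<lambda>_. UNIV)) x"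
  have sub: "cube (real (Suc m)) I \<subseteq> cube (real (Suc n)) I" if "m \<le> n" for m n
    using that by (intro PiE_mono) auto
  have "(\<lambda>n. integral\<^sup>N (PiM I (\<lambda>_. lborel)) (?f n)) \<longlonglongrightarrow> integral\<^sup>N (PiM I (\<lambda>_. lborel)) ?u"
  proof (rule nn_integral_LIMSEQ)
    show "incseq ?f"
      using sub by (auto simp: incseq_def le_fun_def intro!: mult_left_mono split: split_indicator)
    show "?f n \<in> borel_measurable (PiM I (\<lambda>_. lborel))" for n
      using cube_measurable[OF fin, of "real (Suc n)"] by measurable
    show "(\<lambda>n. ?f n x) \<longlonglongrightarrow> ?u x" for x
    proof (cases "x \<in> PiE I (\<lambda>_. UNIV)")
      case True
      obtain N where N: "(\<Sum>i\<in>I. \<bar>x i\<bar>) \<le> real N" using real_arch_simple by blast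
      have "x \<in> cube (real (Suc n)) I" if "N \<le> n" for n
      proof (rule PiE_I)
        fix i assume i: "i \<in> I"
        have "\<bar>x i\<bar> \<le> (\<Sum>i\<in>I. \<bar>x i\<bar>)" using i fin by (intro member_le_sum) auto
        then show "x i \<in> {- real (Suc n)..real (Suc n)}" using N that by auto
      qed (use True in \<open>auto simp: PiE_def extensional_def\<close>)
      then have "eventually (\<lambda>n. ?f n x = ?u x) sequentially"
        using True by (intro eventually_sequentiallyI[of N]) (simp add: indicator_def)
      then show ?thesis by (rule tendsto_eventually)
    next
      case False
      then have "x \<notin> cube (real (Suc n)) I" for n by (auto simp: PiE_def)
      then show ?thesis using False by simp
    qed
  qed
  moreover have "integral\<^sup>N (PiM I (\<lambda>_. lborel)) ?u = (\<integral>\<^sup>+x. ennreal (\<phi> x powr (- \<beta>)) \<partial>PiM I (\<lambda>_. lborel))"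
    by (rule nn_integral_cong) (simp add: space_PiM)
  ultimately show ?thesis by (simp add: box_integral_def)
qed

definition even_norm :: "('a::real_normed_vector \<Rightarrow> real) \<Rightarrow> bool" where
  "even_norm N \<longleftrightarrow> pos_homogeneous N \<and> continuous_on (- {0}) N \<and> (\<forall>v. N (- v) = N v) \<and>
     (\<forall>v w. N (v + w) \<le> N v + N w)"

lemma even_norm_convex:
  assumes N: "even_norm N" and l: "0 < l" "l < 1"
  shows "N ((1 - l) *\<^sub>R v + l *\<^sub>R w) \<le> (1 - l) * N v + l * N w"
proof -
  have "N ((1 - l) *\<^sub>R v + l *\<^sub>R w) \<le> N ((1 - l) *\<^sub>R v) + N (l *\<^sub>R w)"
    using N unfolding even_norm_def by blast
  then show ?thesis using N l by (simp add: even_norm_def pos_homogeneous_scale)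
qed

text \<open>Busemann's theorem. In the affine chart the sections \<open>P + t *\<^sub>R dyad w (axis k 1)\<close> become parallel: the integrand is a
  convex function of the chart coordinates and of \<open>t\<close> jointly, so that the integral inequality
  applies. In \<open>m - 1\<close> variables and for the power \<open>-m\<close> its exponent is \<open>-1\<close>, so it states that the
  reciprocal of the integral is convex.\<close>

lemma sect_area_convex_axis:
  fixes N :: "real^'n \<Rightarrow> real" and P :: "real^'m^'n" and k :: 'm and w :: "real^'n"
  assumes N: "even_norm N" and l: "0 < l" "l < 1"
  defines "Q \<equiv> \<lambda>t. P + t *\<^sub>R dyad w (axis k 1)"
  assumes inj: "Q s \<in> inj_mats" "Q t \<in> inj_mats" "Q ((1 - l) * s + l * t) \<in> inj_mats"
  shows "sect_area N (Q ((1 - l) * s + l * t)) \<le> (1 - l) * sect_area N (Q s) + l * sect_area N (Q t)"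
proof -
  let ?e = "axis k 1 :: real^'m" let ?m = "CARD('m)" let ?I = "Basis - {?e}"
  let ?h = "(1 - l) * s + l * t"
  have e: "?e \<in> Basis" by (simp add: axis_in_Basis_iff)
  have fin: "finite ?I" by simp
  have ph: "pos_homogeneous N" and c: "continuous_on (- {0}) N" and even: "N (- v) = N v" for v
    using N by (auto simp: even_norm_def)
  define \<phi> where "\<phi> t z = N (Q t *v affine_chart ?e z)" for t z
  note sec = pos_homogeneous_section[OF ph c]
  have chart[measurable]: "affine_chart ?e \<in> PiM ?I (\<lambda>_. lborel) \<rightarrow>\<^sub>M borel"
    unfolding affine_chart_def by measurable
  have \<phi>m: "\<phi> r \<in> borel_measurable (PiM ?I (\<lambda>_. lborel))" if "Q r \<in> inj_mats" for r
  proof -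
    have [measurable]: "(\<lambda>v. N (Q r *v v)) \<in> borel_measurable borel"
      by (rule volume_formula(1)[OF sec[OF that]])
    show ?thesis unfolding \<phi>_def[abs_def] by measurable
  qed
  have lb: "\<exists>c>0. \<forall>z. c \<le> \<phi> r z" if r: "Q r \<in> inj_mats" for r
  proof -
    obtain c C where c: "0 < c" "\<And>v. c * norm v \<le> N (Q r *v v)"
      using pos_homogeneous_bounds[OF sec[OF r]] by metis
    have "c \<le> \<phi> r z" for z
    proof -
      have "1 \<le> norm (affine_chart ?e z)"
        using Basis_le_norm[OF e, of "affine_chart ?e z"] affine_chart_inner[OF e, of z] by simp
      then have "c * 1 \<le> c * norm (affine_chart ?e z)" using c(1) by (intro mult_left_mono) auto
      then show ?thesis using c(2)[of "affine_chart ?e z"] by (simp add: \<phi>_def)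
    qed
    then show ?thesis using c(1) by blast
  qed
  obtain c0 c1 ch where cs: "0 < c0" "0 < c1" "0 < ch"
    "\<And>z. c0 \<le> \<phi> s z" "\<And>z. c1 \<le> \<phi> t z" "\<And>z. ch \<le> \<phi> ?h z"
    using lb[OF inj(1)] lb[OF inj(2)] lb[OF inj(3)] by blast
  define c where "c = min c0 (min c1 ch)"
  have c: "0 < c" "c \<le> \<phi> s z" "c \<le> \<phi> t z" "c \<le> \<phi> ?h z" for z
    using cs(1-3) cs(4)[of z] cs(5)[of z] cs(6)[of z] by (auto simp: c_def)
  have mix: "\<phi> ?h (\<lambda>i\<in>?I. (1 - l) * x i + l * y i) \<le> (1 - l) * \<phi> s x + l * \<phi> t y" for x y
  proof -
    let ?z = "\<lambda>i\<in>?I. (1 - l) * x i + l * y i"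
    have c1: "affine_chart ?e ?z = (1 - l) *\<^sub>R affine_chart ?e x + l *\<^sub>R affine_chart ?e y"
    proof -
      have comb: "S + e = (1 - l) *\<^sub>R (T + e) + l *\<^sub>R (T' + e)"
        if "S = (1 - l) *\<^sub>R T + l *\<^sub>R T'" for S T T' e :: "real^'m"
        by (simp add: that algebra_simps)
      have "(\<Sum>b\<in>?I. ?z b *\<^sub>R b) = (\<Sum>b\<in>?I. (1 - l) *\<^sub>R (x b *\<^sub>R b) + l *\<^sub>R (y b *\<^sub>R b))"
        by (rule sum.cong) (simp_all add: scaleR_add_left)
      also have "\<dots> = (1 - l) *\<^sub>R (\<Sum>b\<in>?I. x b *\<^sub>R b) + l *\<^sub>R (\<Sum>b\<in>?I. y b *\<^sub>R b)"
        by (simp only: sum.distrib scaleR_sum_right)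
      finally show ?thesis unfolding affine_chart_def by (rule comb)
    qed
    have Qc: "Q r *v affine_chart ?e z = P *v affine_chart ?e z + r *\<^sub>R w" for r z
      using affine_chart_inner[OF e, of z]
      by (simp add: Q_def matrix_vector_mult_add_rdistrib scaleR_matrix_vector_assoc[symmetric]
          dyad_mult inner_commute)
    have "Q ?h *v affine_chart ?e ?z
        = P *v ((1 - l) *\<^sub>R affine_chart ?e x + l *\<^sub>R affine_chart ?e y) + ?h *\<^sub>R w"
      by (subst Qc, subst c1, rule refl)
    also have "\<dots> = (1 - l) *\<^sub>R (Q s *v affine_chart ?e x) + l *\<^sub>R (Q t *v affine_chart ?e y)"
      by (simp add: Qc matrix_vector_right_distrib matrix_vector_mult_scaleR algebra_simps)
    finally show ?thesis unfolding \<phi>_def using even_norm_convex[OF N l] by simp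
  qed
  have card: "real (card ?I) < real ?m" "real ?m - card ?I = 1"
    using e by (simp_all add: card_Diff_singleton)
  have powr: "\<phi> r z powr (- real ?m) = inverse (\<phi> r z) ^ ?m" if "0 < \<phi> r z" for r z
    using that by (simp add: powr_minus powr_realpow power_inverse)
  define V where "V r = enn2real (\<integral>\<^sup>+z. ennreal (\<phi> r z powr (- real ?m)) \<partial>PiM ?I (\<lambda>_. lborel))" for r
  have vol: "sect_area N (Q r) = real ?m / 2 * V r powr (- 1)" "0 < V r"
      "(\<integral>\<^sup>+z. ennreal (\<phi> r z powr (- real ?m)) \<partial>PiM ?I (\<lambda>_. lborel)) = ennreal (V r)"
    if r: "Q r \<in> inj_mats" for r
  proof -
    obtain c where c: "0 < c" "\<And>z. c \<le> \<phi> r z" using lb[OF r] by blast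
    have pos: "0 < \<phi> r z" for z using c(1) c(2)[of z] by linarith
    let ?W = "\<integral>\<^sup>+z. ennreal (\<phi> r z powr (- real ?m)) \<partial>PiM ?I (\<lambda>_. lborel)"
    have Wm: "(\<lambda>z. ennreal (\<phi> r z powr (- real ?m))) \<in> borel_measurable (PiM ?I (\<lambda>_. lborel))"
      using \<phi>m[OF r] by measurable
    have ev: "N (Q r *v (- v)) = N (Q r *v v)" for v
      using even[of "Q r *v v"] by (simp add: vec.neg)
    have "emeasure lborel {v. N (Q r *v v) \<le> 1} = 2 *
      (\<integral>\<^sup>+z. ennreal (inverse (N (Q r *v affine_chart ?e z)) ^ DIM(real^'m) / real DIM(real^'m)) \<partial>PiM ?I (\<lambda>_. lborel))"
      by (rule volume_cone[OF sec(1)[OF r] volume_formula(1)[OF sec[OF r]] ev e])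
    also have "\<dots> = 2 * (\<integral>\<^sup>+z. ennreal (inverse (real ?m)) * ennreal (\<phi> r z powr (- real ?m)) \<partial>PiM ?I (\<lambda>_. lborel))"
    proof -
      have "ennreal (inverse (N (Q r *v affine_chart ?e z)) ^ DIM(real^'m) / real DIM(real^'m))
          = ennreal (inverse (real ?m)) * ennreal (\<phi> r z powr (- real ?m))" for z
        unfolding powr[OF pos] \<phi>_def[symmetric] by (simp add: ennreal_mult'[symmetric] divide_inverse mult.commute)
      then show ?thesis by (simp only:)
    qed
    also have "\<dots> = 2 * (ennreal (inverse (real ?m)) * ?W)"
      using Wm by (simp only: nn_integral_cmult)
    also have "\<dots> = ennreal (2 / real ?m) * ?W"
      by (simp add: divide_inverse ennreal_mult mult.assoc)
    finally have em: "emeasure lborel {v. N (Q r *v v) \<le> 1} = ennreal (2 / real ?m) * ?W" .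
    have "emeasure lborel {v. N (Q r *v v) \<le> 1} < top"
      unfolding volume_formula(2)[OF sec[OF r]] by simp
    then have "?W < top" unfolding em by (auto simp: ennreal_mult_less_top)
    then show VW: "?W = ennreal (V r)" by (simp add: V_def)
    have m: "sect_vol N (Q r) = 2 / real ?m * V r"
      unfolding sect_vol_def measure_def em by (simp add: enn2real_mult V_def)
    then show V: "0 < V r" using sect_vol_pos[OF ph \<open>continuous_on (- {0}) N\<close> r] by (simp add: zero_less_mult_iff zero_less_divide_iff)
    show "sect_area N (Q r) = real ?m / 2 * V r powr (- 1)"
      using V by (simp add: sect_area_def m powr_minus inverse_eq_divide)
  qed
  define U where "U n r = enn2real (box_integral (real (Suc n)) (real ?m) ?I (\<phi> r))" for n r
  have "U n ?h powr (- 1) \<le> (1 - l) * U n s powr (- 1) + l * U n t powr (- 1)" for n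
  proof -
    have "enn2real (box_integral (real (Suc n)) (real ?m) ?I (\<phi> ?h)) powr (- 1 / (real ?m - card ?I))
      \<le> (1 - l) * enn2real (box_integral (real (Suc n)) (real ?m) ?I (\<phi> s)) powr (- 1 / (real ?m - card ?I))
        + l * enn2real (box_integral (real (Suc n)) (real ?m) ?I (\<phi> t)) powr (- 1 / (real ?m - card ?I))"
      by (rule borell_brascamp_lieb[where c=c])
        (use fin l card(1) c \<phi>m[OF inj(1)] \<phi>m[OF inj(2)] \<phi>m[OF inj(3)] mix in simp_all)
    then show ?thesis unfolding U_def card(2) by simp
  qed
  moreover have lim: "(\<lambda>n. U n r powr (- 1)) \<longlonglongrightarrow> V r powr (- 1)" if r: "Q r \<in> inj_mats" for r
  proof -
    have "(\<lambda>n. U n r) \<longlonglongrightarrow> V r"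
      unfolding U_def using box_integral_tendsto[OF fin \<phi>m[OF r], of "real ?m"] vol(2)[OF r]
      unfolding vol(3)[OF r] by (intro tendsto_enn2real) auto
    then show ?thesis using vol(2)[OF r] by (intro tendsto_powr) auto
  qed
  moreover have "(\<lambda>n. (1 - l) * U n s powr (- 1) + l * U n t powr (- 1))
      \<longlonglongrightarrow> (1 - l) * V s powr (- 1) + l * V t powr (- 1)"
    by (rule tendsto_add[OF tendsto_mult[OF tendsto_const lim[OF inj(1)]] tendsto_mult[OF tendsto_const lim[OF inj(2)]]])
  ultimately have "V ?h powr (- 1) \<le> (1 - l) * V s powr (- 1) + l * V t powr (- 1)"
    using LIMSEQ_le[OF lim[OF inj(3)]] by blast
  then have "real ?m / 2 * V ?h powr (- 1) \<le> real ?m / 2 * ((1 - l) * V s powr (- 1) + l * V t powr (- 1))"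
    by (intro mult_left_mono) auto
  then show ?thesis unfolding vol(1)[OF inj(1)] vol(1)[OF inj(2)] vol(1)[OF inj(3)]
    by (simp add: algebra_simps)
qed

lemma matrix_add_scaleR_mult:
  fixes X Y :: "real^'m^'n" and Z :: "real^'k^'m"
  shows "(X + r *\<^sub>R Y) ** Z = X ** Z + r *\<^sub>R (Y ** Z)"
  by (simp add: matrix_matrix_mult_def vec_eq_iff sum.distrib sum_distrib_left algebra_simps)

text \<open>A linear change of the parameters moves any covector to a coordinate functional.\<close>

lemma sect_area_convex:
  fixes N :: "real^'n \<Rightarrow> real" and P :: "real^'m^'n" and w :: "real^'n" and x :: "real^'m"
  assumes N: "even_norm N" and l: "0 < l" "l < 1"
  defines "Q \<equiv> \<lambda>t. P + t *\<^sub>R dyad w x"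
  assumes inj: "Q s \<in> inj_mats" "Q t \<in> inj_mats" "Q ((1 - l) * s + l * t) \<in> inj_mats"
  shows "sect_area N (Q ((1 - l) * s + l * t)) \<le> (1 - l) * sect_area N (Q s) + l * sect_area N (Q t)"
proof (cases "x = 0")
  case True
  then have "dyad w x = (0 :: real^'m^'n)" by (simp add: dyad_def vec_eq_iff)
  then have "Q r = P" for r by (simp add: Q_def)
  then show ?thesis by (simp add: algebra_simps)
next
  case False
  then obtain k where k: "x $ k \<noteq> 0" by (auto simp: vec_eq_iff)
  define A :: "real^'m^'m" where "A = mat 1 + dyad (axis k 1) (x - axis k 1)"
  have Av: "A *v v = v + ((x - axis k 1) \<bullet> v) *\<^sub>R axis k 1" for v
    by (simp add: A_def matrix_vector_mult_add_rdistrib dyad_mult)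
  have Ak: "(A *v v) $ k = x \<bullet> v" for v
  proof -
    have "axis k (1::real) $ k = 1" by (simp add: axis_def)
    then show ?thesis unfolding Av by (simp add: inner_diff_left inner_axis')
  qed
  have injA: "inj ((*v) A)"
  proof (subst linear_injective_0[OF matrix_vector_mul_linear], intro allI impI)
    fix v assume v: "A *v v = 0"
    then have "v = (- ((x - axis k 1) \<bullet> v)) *\<^sub>R axis k 1" unfolding Av by (simp add: eq_neg_iff_add_eq_0)
    then obtain r where r: "v = r *\<^sub>R axis k 1" by blast
    have "x \<bullet> v = 0" using Ak[of v] v by simp
    then have "r * x $ k = 0" unfolding r by (simp add: inner_axis)
    then show "v = 0" using k r by simp
  qed
  then obtain B where B: "B ** A = mat 1" using matrix_left_invertible_injective by blast
  then have AB: "A ** B = mat 1" by (simp add: matrix_left_right_inverse)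
  have injB: "inj ((*v) B)" using AB matrix_left_invertible_injective by blast
  have xA: "axis k 1 v* A = x"
  proof -
    have "(axis k 1 v* A) \<bullet> v = x \<bullet> v" for v
      using Ak[of v] by (simp add: dot_lmul_matrix inner_axis')
    then have "\<forall>v. (axis k 1 v* A) \<bullet> v = x \<bullet> v" by blast
    then show ?thesis by (simp only: vector_eq_rdot)
  qed
  define Q' where "Q' r = P ** B + r *\<^sub>R dyad w (axis k 1)" for r
  have QQ': "Q' r ** A = Q r" for r
  proof -
    have "Q' r ** A = P ** B ** A + r *\<^sub>R (dyad w (axis k 1) ** A)"
      unfolding Q'_def by (rule matrix_add_scaleR_mult)
    then show ?thesis by (simp add: matrix_mul_assoc[symmetric] B dyad_mult_matrix xA Q_def)
  qed
  have Q'Q: "Q' r = Q r ** B" for r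
    unfolding QQ'[symmetric] by (simp add: matrix_mul_assoc[symmetric] AB)
  have inj': "Q' r \<in> inj_mats" if "Q r \<in> inj_mats" for r
    unfolding Q'Q by (rule inj_mats_mult[OF that injB])
  have ph: "pos_homogeneous N" "continuous_on (- {0}) N" using N by (auto simp: even_norm_def)
  have area: "sect_area N (Q r) = jacobian ((*v) A) * sect_area N (Q' r)" if "Q r \<in> inj_mats" for r
    unfolding QQ'[symmetric] by (rule sect_area_mult[OF ph inj'[OF that] injA])
  have "sect_area N (Q' ((1 - l) * s + l * t)) \<le> (1 - l) * sect_area N (Q' s) + l * sect_area N (Q' t)"
    unfolding Q'_def by (rule sect_area_convex_axis[OF N l]) (use inj' inj in \<open>simp_all flip: Q'_def\<close>)
  then have "jacobian ((*v) A) * sect_area N (Q' ((1 - l) * s + l * t))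
      \<le> jacobian ((*v) A) * ((1 - l) * sect_area N (Q' s) + l * sect_area N (Q' t))"
    using jacobian_pos[OF matrix_vector_mul_linear injA] by (intro mult_left_mono) auto
  then show ?thesis unfolding area[OF inj(1)] area[OF inj(2)] area[OF inj(3)] by (simp add: algebra_simps)
qed

text \<open>A form of uniform convexity that involves no derivatives: in every direction \<open>a\<close> the square of the
  norm has some convexity to spare.\<close>

definition uniformly_convex_norm :: "(real^'n \<Rightarrow> real) \<Rightarrow> bool" where
  "uniformly_convex_norm f \<longleftrightarrow> even_norm f \<and>
     (\<forall>a. \<exists>d>0. \<exists>N. even_norm N \<and> (\<forall>y. (N y)\<^sup>2 = (f y)\<^sup>2 - d * (a \<bullet> y)\<^sup>2))"

text \<open>Strictness follows by comparison with a smaller norm that agrees with the given one on the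
  middle section. Its form \<open>a\<close> is orthogonal to that section; it does not vanish on the other sections,
  where the smaller norm therefore has smaller area.\<close>

lemma sect_area_strictly_convex:
  fixes f :: "real^'n \<Rightarrow> real" and P :: "real^'m^'n" and w :: "real^'n" and x :: "real^'m"
  assumes f: "uniformly_convex_norm f" and l: "0 < l" "l < 1"
  defines "Q \<equiv> \<lambda>t. P + t *\<^sub>R dyad w x"
  assumes inj: "Q s \<in> inj_mats" "Q t \<in> inj_mats" "Q ((1 - l) * s + l * t) \<in> inj_mats"
    and st: "s \<noteq> t" and x: "x \<noteq> 0" and w: "w \<notin> range ((*v) (Q ((1 - l) * s + l * t)))"
  shows "sect_area f (Q ((1 - l) * s + l * t)) < (1 - l) * sect_area f (Q s) + l * sect_area f (Q t)"
proof -
  let ?h = "(1 - l) * s + l * t"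
  let ?S = "range ((*v) (Q ?h))"
  have S: "subspace ?S" by (intro linear_subspace_image matrix_vector_mul_linear subspace_UNIV)
  obtain y a where ya: "y \<in> span ?S" "\<And>z. z \<in> span ?S \<Longrightarrow> orthogonal a z" "w = y + a"
    using orthogonal_subspace_decomp_exists[of ?S w] by metis
  have spanS: "span ?S = ?S" using S by (simp add: span_eq_iff)
  have a0: "a \<noteq> 0" using ya w spanS by auto
  have aw: "a \<bullet> w \<noteq> 0" using ya a0 by (auto simp: inner_add_right orthogonal_def)
  have aQ: "a \<bullet> (Q r *v v) = (r - ?h) * (x \<bullet> v) * (a \<bullet> w)" for r v
  proof -
    have "a \<bullet> (Q ?h *v v) = 0" using ya(2) spanS by (auto simp: orthogonal_def)
    moreover have "Q r *v v = Q ?h *v v + ((r - ?h) * (x \<bullet> v)) *\<^sub>R w"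
      by (simp add: Q_def matrix_vector_mult_add_rdistrib scaleR_matrix_vector_assoc[symmetric] dyad_mult algebra_simps)
    ultimately show ?thesis by (simp add: inner_add_right)
  qed
  obtain d N where d: "0 < d" and N: "even_norm N" and Nf: "\<And>y. (N y)\<^sup>2 = (f y)\<^sup>2 - d * (a \<bullet> y)\<^sup>2"
    using f unfolding uniformly_convex_norm_def by blast
  have fn: "even_norm f" using f by (simp add: uniformly_convex_norm_def)
  have pf: "pos_homogeneous f" "continuous_on (- {0}) f" and pN: "pos_homogeneous N" "continuous_on (- {0}) N"
    using fn N by (auto simp: even_norm_def)
  have le: "N y \<le> f y" for y
  proof (rule power2_le_imp_le)
    show "(N y)\<^sup>2 \<le> (f y)\<^sup>2" unfolding Nf using d by simp
  qed (rule pos_homogeneous_nonneg[OF pf(1)])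
  have eq: "N y = f y" if "a \<bullet> y = 0" for y
  proof -
    have "(N y)\<^sup>2 = (f y)\<^sup>2" unfolding Nf using that by simp
    then show ?thesis
      by (rule power2_eq_imp_eq[OF _ pos_homogeneous_nonneg[OF pN(1)] pos_homogeneous_nonneg[OF pf(1)]])
  qed
  have lt: "N y < f y" if "a \<bullet> y \<noteq> 0" for y
  proof (rule power2_less_imp_less)
    show "(N y)\<^sup>2 < (f y)\<^sup>2" unfolding Nf using d that by simp
  qed (rule pos_homogeneous_nonneg[OF pf(1)])
  have hvol: "sect_area N (Q ?h) = sect_area f (Q ?h)"
    using aQ[of ?h] by (simp add: sect_area_def sect_vol_def eq)
  have mono: "sect_vol f (Q r) \<le> sect_vol N (Q r)" if r: "Q r \<in> inj_mats" for r
    unfolding sect_vol_def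
  proof (rule measure_mono_fmeasurable)
    show "{v. f (Q r *v v) \<le> 1} \<subseteq> {v. N (Q r *v v) \<le> 1}" using le by (auto intro: order_trans)
    show "{v. f (Q r *v v) \<le> 1} \<in> sets lborel"
      using pos_homogeneous_sublevel(2)[OF pos_homogeneous_section[OF pf r]] by simp
    show "{v. N (Q r *v v) \<le> 1} \<in> fmeasurable lborel"
      using pos_homogeneous_sublevel(2)[OF pos_homogeneous_section[OF pN r]]
        volume_formula(2)[OF pos_homogeneous_section[OF pN r]] by (intro fmeasurableI) auto
  qed
  have strict: "sect_vol f (Q s) < sect_vol N (Q s)"
  proof -
    note sf = pos_homogeneous_section[OF pf inj(1)] and sN = pos_homogeneous_section[OF pN inj(1)]
    let ?f = "\<lambda>v. f (Q s *v v)" and ?N = "\<lambda>v. N (Q s *v v)"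
    let ?O = "(- {0} \<inter> ?N -` {..<1}) \<inter> (- {0} \<inter> ?f -` {1<..})"
    have op: "open ?O"
      by (intro open_Int continuous_open_preimage sN(2) sf(2)) auto
    have sh: "s - ?h \<noteq> 0"
    proof -
      have "s - ?h = l * (s - t)" by (simp add: algebra_simps)
      then show ?thesis using l st by simp
    qed
    have xx: "x \<bullet> x \<noteq> 0" "x \<noteq> 0" using x by auto
    have Nx: "?N x < ?f x" using lt aQ[of s x] sh xx aw by simp
    have p: "0 < ?f x" "0 < ?N x" using pos_homogeneous_pos[OF sf(1) xx(2)] pos_homogeneous_pos[OF sN(1) xx(2)] by auto
    define r where "r = 2 / (?f x + ?N x)"
    have r: "0 < r" using p by (simp add: r_def)
    have "r * ?N x < 1" "1 < r * ?f x" using p Nx by (simp_all add: r_def field_simps)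
    then have "?N (r *\<^sub>R x) < 1" "1 < ?f (r *\<^sub>R x)"
      using pos_homogeneous_scale[OF sf(1) r, of x] pos_homogeneous_scale[OF sN(1) r, of x] by (simp_all only:)
    moreover have "r *\<^sub>R x \<noteq> 0" using r xx(2) by simp
    ultimately have "r *\<^sub>R x \<in> ?O" by simp
    then have "?O \<noteq> {}" by blast
    then have "\<not> negligible ?O" using op open_not_negligible by blast
    moreover have Ob: "?O \<in> sets borel" using op by (rule borel_open)
    ultimately have Opos: "emeasure lborel ?O \<noteq> 0"
      by (simp add: negligible_iff_null_sets null_sets_def)
    have sets: "{v. ?f v \<le> 1} \<in> sets borel" "{v. ?N v \<le> 1} \<in> sets borel"
      using pos_homogeneous_sublevel(2)[OF sf] pos_homogeneous_sublevel(2)[OF sN] by auto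
    have finN: "emeasure lborel {v. ?N v \<le> 1} < top" unfolding volume_formula(2)[OF sN] by simp
    have sub: "{v. ?f v \<le> 1} \<union> ?O \<subseteq> {v. ?N v \<le> 1}" using le by (auto intro: order_trans less_imp_le)
    have OfinN: "emeasure lborel ?O \<le> emeasure lborel {v. ?N v \<le> 1}" using sub sets by (intro emeasure_mono) auto
    have ffin: "emeasure lborel {v. ?f v \<le> 1} \<le> emeasure lborel {v. ?N v \<le> 1}" using sub sets by (intro emeasure_mono) auto
    have "measure lborel {v. ?f v \<le> 1} + measure lborel ?O = measure lborel ({v. ?f v \<le> 1} \<union> ?O)"
      using sets Ob less_imp_neq[OF order_le_less_trans[OF OfinN finN]] less_imp_neq[OF order_le_less_trans[OF ffin finN]]
      by (intro measure_Union[symmetric]) auto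
    also have "\<dots> \<le> measure lborel {v. ?N v \<le> 1}"
      using sub sets Ob finN by (intro measure_mono_fmeasurable fmeasurableI) auto
    finally have "measure lborel {v. ?f v \<le> 1} + measure lborel ?O \<le> measure lborel {v. ?N v \<le> 1}" .
    moreover have "0 < measure lborel ?O"
      using Opos order_le_less_trans[OF OfinN finN] by (simp add: measure_def enn2real_positive_iff) (metis not_gr_zero)
    ultimately show ?thesis by (simp add: sect_vol_def)
  qed
  have "sect_area N (Q s) < sect_area f (Q s)"
    using strict sect_vol_pos[OF pf inj(1)] by (simp add: sect_area_def less_imp_inverse_less)
  moreover have "sect_area N (Q t) \<le> sect_area f (Q t)"
    using mono[OF inj(2)] sect_vol_pos[OF pf inj(2)] by (simp add: sect_area_def le_imp_inverse_le)
  moreover have "sect_area N (Q ?h) \<le> (1 - l) * sect_area N (Q s) + l * sect_area N (Q t)"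
    unfolding Q_def by (rule sect_area_convex[OF N l]) (use inj in \<open>simp_all add: Q_def\<close>)
  moreover have "(1 - l) * sect_area N (Q s) < (1 - l) * sect_area f (Q s)"
      "l * sect_area N (Q t) \<le> l * sect_area f (Q t)"
    using calculation l by (auto intro: mult_strict_left_mono mult_left_mono)
  ultimately show ?thesis unfolding hvol[symmetric] by linarith
qed

section \<open>From Finsler metrics to uniformly convex norms\<close>

lemma hd_directional_derivative:
  fixes f :: "'a::real_normed_vector \<Rightarrow> real"
  assumes "hd_on S f (Suc k)" "y + t *\<^sub>R v \<in> S"
  shows "((\<lambda>s. f (y + s *\<^sub>R v)) has_real_derivative frechet_derivative f (at (y + t *\<^sub>R v)) v) (at t)"
proof -
  have 1: "((\<lambda>s. y + s *\<^sub>R v) has_derivative (\<lambda>h. h *\<^sub>R v)) (at t)"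
    by (auto intro!: derivative_eq_intros)
  have d: "(f has_derivative frechet_derivative f (at (y + t *\<^sub>R v))) (at (y + t *\<^sub>R v))"
    using hd_SucE[OF assms] .
  have lin: "linear (frechet_derivative f (at (y + t *\<^sub>R v)))" using d has_derivative_linear by blast
  show ?thesis unfolding has_field_derivative_def
    by (rule has_derivative_eq_rhs[OF has_derivative_compose[OF 1 d]])
      (simp add: fun_eq_iff linear_scale[OF lin])
qed

definition hess :: "(real^'n \<Rightarrow> real) \<Rightarrow> real^'n \<Rightarrow> real^'n \<Rightarrow> real" where
  "hess p y v = frechet_derivative (\<lambda>z. frechet_derivative p (at z) v) (at y) v"

lemma linear_axis_expansion:
  fixes D :: "real^'n \<Rightarrow> real"
  assumes "linear D" shows "D v = (\<Sum>i\<in>UNIV. v $ i * D (axis i 1))"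
proof -
  have "D v = D (\<Sum>i\<in>UNIV. v $ i *\<^sub>R axis i 1)" by (simp add: basis_expansion flip: scalar_mult_eq_scaleR)
  then show ?thesis by (simp add: linear_sum[OF assms] linear_scale[OF assms])
qed

lemma hess_expansion:
  fixes p :: "real^'n \<Rightarrow> real"
  assumes p: "hd_on (- {0}) p 2" and y: "y \<noteq> 0"
  shows "hess p y v = (\<Sum>i\<in>UNIV. \<Sum>j\<in>UNIV. v $ i * v $ j *
    frechet_derivative (\<lambda>z. frechet_derivative p (at z) (axis i 1)) (at y) (axis j 1))"
proof -
  let ?q = "\<lambda>i z. frechet_derivative p (at z) (axis i 1)"
  have p2: "hd_on (- {0}) p (Suc (Suc 0))" using p by (simp add: numeral_2_eq_2)
  have dp: "(p has_derivative frechet_derivative p (at z)) (at z)" if "z \<noteq> 0" for z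
    using hd_SucE[OF p2] that by simp
  have exp1: "frechet_derivative p (at z) v = (\<Sum>i\<in>UNIV. v $ i * ?q i z)" if "z \<noteq> 0" for z
    by (rule linear_axis_expansion) (use dp[OF that] has_derivative_linear in blast)
  have q: "hd_on (- {0}) (?q i) (Suc 0)" for i using p2 by simp
  have dq: "(?q i has_derivative frechet_derivative (?q i) (at y)) (at y)" for i
    using hd_SucE[OF q] y by simp
  have "frechet_derivative (\<lambda>z. frechet_derivative p (at z) v) (at y)
      = frechet_derivative (\<lambda>z. \<Sum>i\<in>UNIV. v $ i * ?q i z) (at y)"
    by (rule frechet_derivative_cong_open(1)[of "- {0}"]) (use y exp1 in auto)
  also have "\<dots> = (\<lambda>w. \<Sum>i\<in>UNIV. v $ i * frechet_derivative (?q i) (at y) w)"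
  proof -
    have "((\<lambda>z. \<Sum>i\<in>UNIV. v $ i * ?q i z) has_derivative
        (\<lambda>w. \<Sum>i\<in>UNIV. v $ i * frechet_derivative (?q i) (at y) w)) (at y)"
    proof (rule has_derivative_sum)
      show "((\<lambda>z. v $ i * ?q i z) has_derivative (\<lambda>w. v $ i * frechet_derivative (?q i) (at y) w)) (at y)" for i
        by (rule has_derivative_mult_right[OF dq])
    qed
    then show ?thesis by (rule frechet_derivative_at[symmetric])
  qed
  finally have "hess p y v = (\<Sum>i\<in>UNIV. v $ i * frechet_derivative (?q i) (at y) v)" by (simp add: hess_def)
  also have "\<dots> = (\<Sum>i\<in>UNIV. v $ i * (\<Sum>j\<in>UNIV. v $ j * frechet_derivative (?q i) (at y) (axis j 1)))"
    using linear_axis_expansion[OF has_derivative_linear[OF dq], of _ v] by simp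
  finally show ?thesis by (simp add: sum_distrib_left mult.assoc)
qed

lemma hess_line:
  fixes p :: "real^'n \<Rightarrow> real"
  assumes p: "hd_on (- {0}) p 2" and y: "y + t *\<^sub>R v \<noteq> 0"
  shows "((\<lambda>s. p (y + s *\<^sub>R v)) has_real_derivative frechet_derivative p (at (y + t *\<^sub>R v)) v) (at t)"
    and "((\<lambda>s. frechet_derivative p (at (y + s *\<^sub>R v)) v) has_real_derivative hess p (y + t *\<^sub>R v) v) (at t)"
proof -
  have p2: "hd_on (- {0}) p (Suc (Suc 0))" using p by (simp add: numeral_2_eq_2)
  show "((\<lambda>s. p (y + s *\<^sub>R v)) has_real_derivative frechet_derivative p (at (y + t *\<^sub>R v)) v) (at t)"
    by (rule hd_directional_derivative[OF p2]) (use y in simp)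
  have q: "hd_on (- {0}) (\<lambda>z. frechet_derivative p (at z) v) (Suc 0)" using p2 by simp
  show "((\<lambda>s. frechet_derivative p (at (y + s *\<^sub>R v)) v) has_real_derivative hess p (y + t *\<^sub>R v) v) (at t)"
    unfolding hess_def by (rule hd_directional_derivative[OF q]) (use y in simp)
qed

text \<open>Euler's relations for a function of degree two: its first derivative has degree one and its second
  derivative degree zero.\<close>

lemma two_homogeneous_hess:
  fixes p :: "real^'n \<Rightarrow> real"
  assumes p: "hd_on (- {0}) p 2" and hom: "\<And>t y. 0 < t \<Longrightarrow> p (t *\<^sub>R y) = t\<^sup>2 * p y" and y: "y \<noteq> 0"
  shows "hess p y y = 2 * p y" and "0 < t \<Longrightarrow> hess p (t *\<^sub>R y) v = hess p y v"
proof -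
  have first: "frechet_derivative p (at (t *\<^sub>R z)) v = t * frechet_derivative p (at z) v"
    if t: "0 < t" and z: "z \<noteq> 0" for t z v
  proof -
    have 1: "((\<lambda>s. p (t *\<^sub>R z + s *\<^sub>R (t *\<^sub>R v))) has_real_derivative
        frechet_derivative p (at (t *\<^sub>R z)) (t *\<^sub>R v)) (at 0)"
      using hess_line(1)[OF p, of "t *\<^sub>R z" 0 "t *\<^sub>R v"] t z by simp
    have "(\<lambda>s. p (t *\<^sub>R z + s *\<^sub>R (t *\<^sub>R v))) = (\<lambda>s. t\<^sup>2 * p (z + s *\<^sub>R v))"
      using hom[OF t] by (intro ext) (metis scaleR_add_right scaleR_left_commute)
    moreover have "((\<lambda>s. t\<^sup>2 * p (z + s *\<^sub>R v)) has_real_derivative t\<^sup>2 * frechet_derivative p (at z) v) (at 0)"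
      using DERIV_cmult[OF hess_line(1)[OF p, of z 0 v], of "t\<^sup>2"] z by simp
    ultimately have "frechet_derivative p (at (t *\<^sub>R z)) (t *\<^sub>R v) = t\<^sup>2 * frechet_derivative p (at z) v"
      using DERIV_unique 1 by metis
    moreover have "linear (frechet_derivative p (at (t *\<^sub>R z)))"
      using hd_SucE[of "- {0}" p 1 "t *\<^sub>R z"] p t z has_derivative_linear by (fastforce simp: numeral_2_eq_2)
    ultimately show ?thesis using t by (simp add: linear_scale power2_eq_square)
  qed
  show "hess p (t *\<^sub>R y) v = hess p y v" if t: "0 < t"
  proof -
    have 1: "((\<lambda>s. frechet_derivative p (at (t *\<^sub>R y + s *\<^sub>R v)) v) has_real_derivative hess p (t *\<^sub>R y) v) (at (t * 0))"
      using hess_line(2)[OF p, of "t *\<^sub>R y" 0 v] t y by simp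
    have 2: "((\<lambda>s. frechet_derivative p (at (t *\<^sub>R y + (t * s) *\<^sub>R v)) v) has_real_derivative hess p (t *\<^sub>R y) v * t) (at 0)"
      by (rule DERIV_chain2[where g="\<lambda>s. t * s" and x=0, OF 1]) (auto intro!: derivative_eq_intros)
    have 3: "((\<lambda>s. t * frechet_derivative p (at (y + s *\<^sub>R v)) v) has_real_derivative t * hess p y v) (at 0)"
      using DERIV_cmult[OF hess_line(2)[OF p, of y 0 v], of t] y by simp
    have "((\<lambda>s. y + s *\<^sub>R v) \<longlongrightarrow> y + 0 *\<^sub>R v) (nhds (0::real))"
      by (intro tendsto_intros filterlim_ident)
    then have "eventually (\<lambda>s. y + s *\<^sub>R v \<in> - {0}) (nhds (0::real))"
      using y by (intro topological_tendstoD) auto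
    then have ev: "eventually (\<lambda>s. t * frechet_derivative p (at (y + s *\<^sub>R v)) v
        = frechet_derivative p (at (t *\<^sub>R y + (t * s) *\<^sub>R v)) v) (nhds (0::real))"
    proof eventually_elim
      case (elim s)
      then show ?case using first[OF t, of "y + s *\<^sub>R v" v] by (simp add: scaleR_add_right)
    qed
    have "((\<lambda>s. frechet_derivative p (at (t *\<^sub>R y + (t * s) *\<^sub>R v)) v) has_real_derivative t * hess p y v) (at 0)"
      using 3 DERIV_cong_ev[OF refl ev refl] by blast
    then have "hess p (t *\<^sub>R y) v * t = t * hess p y v" using 2 DERIV_unique by blast
    then show ?thesis using t by simp
  qed
  have 1: "((\<lambda>s. frechet_derivative p (at (y + s *\<^sub>R y)) y) has_real_derivative hess p y y) (at 0)"
    using hess_line(2)[OF p, of y 0 y] y by simp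
  have euler: "frechet_derivative p (at z) z = 2 * p z" if z: "z \<noteq> 0" for z
  proof -
    have a: "((\<lambda>s. p (z + s *\<^sub>R z)) has_real_derivative frechet_derivative p (at z) z) (at 0)"
      using hess_line(1)[OF p, of z 0 z] z by simp
    have ev: "eventually (\<lambda>s. p (z + s *\<^sub>R z) = (1 + s)\<^sup>2 * p z) (nhds (0::real))"
    proof -
      have "eventually (\<lambda>s::real. s \<in> {-1<..}) (nhds 0)" by (rule eventually_nhds_in_open) auto
      then show ?thesis
      proof eventually_elim
        case (elim s)
        then show ?case using hom[of "1 + s" z] by (simp add: scaleR_add_left)
      qed
    qed
    have "((\<lambda>s. (1 + s)\<^sup>2 * p z) has_real_derivative 2 * p z) (at 0)"
      by (auto intro!: derivative_eq_intros)
    then have "((\<lambda>s. p (z + s *\<^sub>R z)) has_real_derivative 2 * p z) (at 0)"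
      using DERIV_cong_ev[OF refl ev refl] by blast
    then show ?thesis using a DERIV_unique by blast
  qed
  have ev: "eventually (\<lambda>s. frechet_derivative p (at (y + s *\<^sub>R y)) y = (1 + s) * (2 * p y)) (nhds (0::real))"
  proof -
    have "eventually (\<lambda>s::real. s \<in> {-1<..}) (nhds 0)" by (rule eventually_nhds_in_open) auto
    then show ?thesis
    proof eventually_elim
      case (elim s)
      have "frechet_derivative p (at ((1 + s) *\<^sub>R y)) y = (1 + s) * frechet_derivative p (at y) y"
        using elim by (intro first y) auto
      then show ?case using euler[OF y] by (simp add: scaleR_add_left)
    qed
  qed
  have "((\<lambda>s. (1 + s) * (2 * p y)) has_real_derivative 2 * p y) (at 0)"
    by (auto intro!: derivative_eq_intros)
  then have "((\<lambda>s. frechet_derivative p (at (y + s *\<^sub>R y)) y) has_real_derivative 2 * p y) (at 0)"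
    using DERIV_cong_ev[OF refl ev refl] by blast
  then show "hess p y y = 2 * p y" using 1 DERIV_unique by blast
qed

text \<open>The unit ball of \<open>sqrt q\<close> is convex, because \<open>q\<close> is convex on segments that avoid the origin. A segment
  through the origin between unit vectors is a diameter, on which \<open>q\<close> is explicitly known.\<close>

lemma sqrt_convex_is_norm:
  fixes q :: "real^'n \<Rightarrow> real"
  assumes hom: "\<And>t y. 0 < t \<Longrightarrow> q (t *\<^sub>R y) = t\<^sup>2 * q y" and even: "\<And>y. q (- y) = q y"
    and pos: "\<And>y. y \<noteq> 0 \<Longrightarrow> 0 < q y" and cont: "continuous_on (- {0}) q"
    and conv: "\<And>y v. (\<And>t. t \<in> {0..1} \<Longrightarrow> y + t *\<^sub>R v \<noteq> 0) \<Longrightarrow> convex_on {0..1} (\<lambda>t. q (y + t *\<^sub>R v))"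
  shows "even_norm (\<lambda>y. sqrt (q y))"
proof -
  have q0: "q 0 = 0" using hom[of 2 0] by simp
  have sc: "sqrt (q (t *\<^sub>R y)) = t * sqrt (q y)" if "0 < t" for t y
    using that by (simp add: hom real_sqrt_mult)
  have unit: "sqrt (q (a *\<^sub>R x + b *\<^sub>R y)) \<le> 1"
    if "0 < a" "0 < b" "a + b = 1" "q x = 1" "q y = 1" for a b x y
  proof (cases "\<forall>t\<in>{0..1}. x + t *\<^sub>R (y - x) \<noteq> 0")
    case True
    then have "convex_on {0..1} (\<lambda>t. q (x + t *\<^sub>R (y - x)))" by (intro conv) auto
    from convex_onD[OF this, of b 0 1]
    have "q (x + b *\<^sub>R (y - x)) \<le> (1 - b) * q x + b * q y" using that by simp
    moreover have "a = 1 - b" using that by simp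
    then have "x + b *\<^sub>R (y - x) = a *\<^sub>R x + b *\<^sub>R y" by (simp only:) (simp add: algebra_simps)
    ultimately have "q (a *\<^sub>R x + b *\<^sub>R y) \<le> 1" using that by simp
    then show ?thesis by simp
  next
    case False
    then obtain t where t: "t \<in> {0..1}" "x + t *\<^sub>R (y - x) = 0" by blast
    have xy: "x \<noteq> 0" "y \<noteq> 0" using that q0 by auto
    have t01: "0 < t" "t < 1"
      using t xy by (auto simp: less_le algebra_simps)
    have eq: "(1 - t) *\<^sub>R x = - (t *\<^sub>R y)" using t(2) by (simp add: algebra_simps eq_neg_iff_add_eq_0)
    have "(1 - t)\<^sup>2 * q x = t\<^sup>2 * q y"
      using hom[of "1 - t" x] hom[of t y] even[of "t *\<^sub>R y"] t01 eq by simp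
    then have h: "1 - t = t" using that t01 by (simp add: power2_eq_iff_nonneg)
    have "t *\<^sub>R x = t *\<^sub>R (- y)" using eq unfolding h by simp
    then have "x = - y" using t01 by (simp only: scaleR_cancel_left) auto
    then have yx: "y = - x" by simp
    have "a *\<^sub>R x + b *\<^sub>R y = (a - b) *\<^sub>R x" by (simp add: yx algebra_simps)
    moreover have "q ((a - b) *\<^sub>R x) = (a - b)\<^sup>2"
    proof (cases "a - b" "0::real" rule: linorder_cases)
      case less
      have "q ((a - b) *\<^sub>R x) = q ((b - a) *\<^sub>R x)" using even[of "(b - a) *\<^sub>R x"] by (simp add: scaleR_left_diff_distrib)
      then show ?thesis using hom[of "b - a" x] less that by (simp add: power2_commute)
    next
      case equal then show ?thesis using q0 by simp
    next
      case greater then show ?thesis using hom[of "a - b" x] that by simp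
    qed
    moreover have "\<bar>a - b\<bar> \<le> 1" using that by auto
    ultimately show ?thesis by simp
  qed
  have tri: "sqrt (q (v + w)) \<le> sqrt (q v) + sqrt (q w)" for v w
  proof (cases "v = 0 \<or> w = 0")
    case True then show ?thesis using q0 by auto
  next
    case False
    define \<alpha> \<beta> where "\<alpha> = sqrt (q v)" and "\<beta> = sqrt (q w)"
    have p: "0 < \<alpha>" "0 < \<beta>" using False pos by (auto simp: \<alpha>_def \<beta>_def)
    have u: "q (inverse \<alpha> *\<^sub>R v) = 1" "q (inverse \<beta> *\<^sub>R w) = 1"
      using p False pos[of v] pos[of w] by (simp_all add: hom \<alpha>_def \<beta>_def power_inverse)
    have "sqrt (q ((\<alpha> / (\<alpha> + \<beta>)) *\<^sub>R (inverse \<alpha> *\<^sub>R v) + (\<beta> / (\<alpha> + \<beta>)) *\<^sub>R (inverse \<beta> *\<^sub>R w))) \<le> 1"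
      by (rule unit) (use p u in \<open>auto simp: add_divide_distrib[symmetric]\<close>)
    moreover have "(\<alpha> / (\<alpha> + \<beta>)) *\<^sub>R (inverse \<alpha> *\<^sub>R v) + (\<beta> / (\<alpha> + \<beta>)) *\<^sub>R (inverse \<beta> *\<^sub>R w) = inverse (\<alpha> + \<beta>) *\<^sub>R (v + w)"
    proof -
      have "\<alpha> / (\<alpha> + \<beta>) * inverse \<alpha> = inverse (\<alpha> + \<beta>)" "\<beta> / (\<alpha> + \<beta>) * inverse \<beta> = inverse (\<alpha> + \<beta>)"
        using p by (simp_all add: field_simps)
      then show ?thesis by (simp only: scaleR_scaleR scaleR_add_right)
    qed
    ultimately have "sqrt (q (inverse (\<alpha> + \<beta>) *\<^sub>R (v + w))) \<le> 1" by (simp only:)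
    moreover have "0 < inverse (\<alpha> + \<beta>)" using p by simp
    ultimately have "inverse (\<alpha> + \<beta>) * sqrt (q (v + w)) \<le> 1" by (simp only: sc)
    then have "sqrt (q (v + w)) \<le> \<alpha> + \<beta>" using p by (simp add: field_simps)
    then show ?thesis by (simp add: \<alpha>_def \<beta>_def)
  qed
  show ?thesis unfolding even_norm_def pos_homogeneous_def
    using sc pos even tri cont by (auto intro!: continuous_on_real_sqrt)
qed

text \<open>By homogeneity and compactness the Hessian of \<open>f\<^sup>2 / 2\<close> is uniformly positive, so that a small
  multiple of the square of a linear form can be subtracted.\<close>

lemma uniformly_convex_norm_if_hessian_pos:
  fixes f :: "real^'n \<Rightarrow> real"
  assumes smooth: "hd_on (- {0}) f 2" and nonneg: "\<And>y. 0 \<le> f y"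
    and hom: "\<And>t y. 0 < t \<Longrightarrow> f (t *\<^sub>R y) = t * f y" and even: "\<And>y. f (- y) = f y"
    and hess: "\<And>y v. y \<noteq> 0 \<Longrightarrow> v \<noteq> 0 \<Longrightarrow> 0 < hess (\<lambda>y. (f y)\<^sup>2 / 2) y v"
  shows "uniformly_convex_norm f"
proof -
  let ?p = "\<lambda>y. (f y)\<^sup>2 / 2"
  have op: "open (- {0 :: real^'n})" by auto
  have "hd_on (- {0}) (\<lambda>y. (1/2) * (f y)\<^sup>2) 2" by (intro hd_mult hd_const hd_power op smooth)
  then have p: "hd_on (- {0}) ?p 2" by simp
  have phom: "?p (t *\<^sub>R y) = t\<^sup>2 * ?p y" if "0 < t" for t y using hom[OF that] by (simp add: power_mult_distrib)
  have hom2: "y \<noteq> 0 \<Longrightarrow> hess ?p y y = 2 * ?p y"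
      "y \<noteq> 0 \<Longrightarrow> 0 < t \<Longrightarrow> hess ?p (t *\<^sub>R y) v = hess ?p y v" for y v t
    using two_homogeneous_hess[OF p, of y] phom by blast+
  let ?d = "\<lambda>i j y. frechet_derivative (\<lambda>z. frechet_derivative ?p (at z) (axis i 1)) (at y) (axis j 1)"
  have dc: "continuous_on (- {0}) (?d i j)" for i j
    using p by (simp add: numeral_2_eq_2)
  let ?K = "sphere 0 1 \<times> sphere 0 1 :: ((real^'n) \<times> (real^'n)) set"
  have "continuous_on ?K (\<lambda>z. \<Sum>i\<in>UNIV. \<Sum>j\<in>UNIV. snd z $ i * snd z $ j * ?d i j (fst z))"
    by (intro continuous_intros continuous_on_compose2[OF dc]) auto
  moreover have "(\<Sum>i\<in>UNIV. \<Sum>j\<in>UNIV. snd z $ i * snd z $ j * ?d i j (fst z)) = hess ?p (fst z) (snd z)"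
    if "z \<in> ?K" for z
  proof -
    have "fst z \<noteq> 0" using that by auto
    then show ?thesis by (rule hess_expansion[OF p, symmetric])
  qed
  ultimately have hc: "continuous_on ?K (\<lambda>z. hess ?p (fst z) (snd z))" by (rule continuous_on_eq)
  have ne: "?K \<noteq> {}" using norm_axis_1[of undefined] by (metis SigmaI empty_iff mem_sphere_0)
  obtain z0 where z0: "z0 \<in> ?K" "\<And>z. z \<in> ?K \<Longrightarrow> hess ?p (fst z0) (snd z0) \<le> hess ?p (fst z) (snd z)"
    using continuous_attains_inf[OF compact_Times[OF compact_sphere compact_sphere] ne hc] by blast
  define \<mu> where "\<mu> = hess ?p (fst z0) (snd z0)"
  have \<mu>: "0 < \<mu>" unfolding \<mu>_def using z0(1) by (intro hess) auto
  have lower: "\<mu> * (norm v)\<^sup>2 \<le> hess ?p y v" if y: "y \<noteq> 0" for y v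
  proof (cases "v = 0")
    case True
    then show ?thesis using hess_expansion[OF p y, of v] by simp
  next
    case False
    let ?y = "inverse (norm y) *\<^sub>R y" and ?v = "inverse (norm v) *\<^sub>R v"
    have "\<mu> \<le> hess ?p ?y ?v" unfolding \<mu>_def using z0(2)[of "(?y, ?v)"] y False by simp
    also have "\<dots> = hess ?p y ?v" using hom2(2)[OF y, of "inverse (norm y)" ?v] y by simp
    also have "\<dots> = (inverse (norm v))\<^sup>2 * hess ?p y v"
      unfolding hess_expansion[OF p y] by (simp add: sum_distrib_left power2_eq_square mult_ac)
    finally have "\<mu> * (norm v)\<^sup>2 \<le> (inverse (norm v))\<^sup>2 * hess ?p y v * (norm v)\<^sup>2"
      by (rule mult_right_mono) simp
    also have "\<dots> = hess ?p y v" using False by (simp add: power_inverse)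
    finally show ?thesis .
  qed
  have flow: "\<mu> * (norm y)\<^sup>2 \<le> (f y)\<^sup>2" if "y \<noteq> 0" for y
    using lower[OF that, of y] hom2(1)[OF that] by simp
  have perturb: "\<exists>d>0. \<exists>N. even_norm N \<and> (\<forall>y. (N y)\<^sup>2 = (f y)\<^sup>2 - d * (a \<bullet> y)\<^sup>2)" for a
  proof -
    define d where "d = \<mu> / ((norm a)\<^sup>2 + 1)"
    have d: "0 < d" unfolding d_def using \<mu> by (intro divide_pos_pos add_nonneg_pos) auto
    have small: "d * (a \<bullet> v)\<^sup>2 < \<mu> * (norm v)\<^sup>2" if "v \<noteq> 0" for v
    proof -
      have "(a \<bullet> v)\<^sup>2 \<le> (norm a * norm v)\<^sup>2"
        using Cauchy_Schwarz_ineq2[of a v] by (metis abs_ge_zero power2_abs power_mono)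
      then have "d * (a \<bullet> v)\<^sup>2 \<le> d * ((norm a)\<^sup>2 * (norm v)\<^sup>2)"
        using d by (intro mult_left_mono) (auto simp: power_mult_distrib)
      also have "\<dots> < d * (((norm a)\<^sup>2 + 1) * (norm v)\<^sup>2)"
        using d that by (intro mult_strict_left_mono) (auto simp: algebra_simps)
      also have "\<dots> = \<mu> * (norm v)\<^sup>2"
      proof -
        have "(norm a)\<^sup>2 + 1 \<noteq> 0" by (metis add_nonneg_pos less_irrefl zero_le_power2 zero_less_one)
        then show ?thesis by (simp add: d_def)
      qed
      finally show ?thesis .
    qed
    define q where "q y = (f y)\<^sup>2 - d * (a \<bullet> y)\<^sup>2" for y
    have qpos: "0 < q y" if "y \<noteq> 0" for y using flow[OF that] small[OF that] by (simp add: q_def)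
    have qhom: "q (t *\<^sub>R y) = t\<^sup>2 * q y" if "0 < t" for t y
      using hom[OF that] by (simp add: q_def power_mult_distrib algebra_simps)
    have f0: "f 0 = 0" using hom[of 2 0] by simp
    have "even_norm (\<lambda>y. sqrt (q y))"
    proof (rule sqrt_convex_is_norm[OF qhom _ qpos])
      show "q (- y) = q y" for y by (simp add: q_def even)
      show "continuous_on (- {0}) q"
        unfolding q_def using hd_imp_continuous[OF smooth] by (intro continuous_intros)
      fix y v :: "real^'n" assume nz: "\<And>t::real. t \<in> {0..1} \<Longrightarrow> y + t *\<^sub>R v \<noteq> 0"
      show "convex_on {0..1} (\<lambda>t. q (y + t *\<^sub>R v))"
      proof (rule f''_ge0_imp_convex)
        fix t :: real assume t: "t \<in> {0..1}"
        have "((\<lambda>t. 2 * ?p (y + t *\<^sub>R v) - d * (a \<bullet> (y + t *\<^sub>R v))\<^sup>2) has_real_derivative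
          2 * frechet_derivative ?p (at (y + t *\<^sub>R v)) v - d * (2 * (a \<bullet> (y + t *\<^sub>R v)) * (a \<bullet> v))) (at t)"
          by (intro DERIV_diff DERIV_cmult hess_line(1)[OF p nz[OF t]])
            (auto intro!: derivative_eq_intros simp: inner_add_right)
        then show "((\<lambda>t. q (y + t *\<^sub>R v)) has_real_derivative
          2 * frechet_derivative ?p (at (y + t *\<^sub>R v)) v - d * (2 * (a \<bullet> (y + t *\<^sub>R v)) * (a \<bullet> v))) (at t)"
          by (simp add: q_def)
        show "((\<lambda>t. 2 * frechet_derivative ?p (at (y + t *\<^sub>R v)) v - d * (2 * (a \<bullet> (y + t *\<^sub>R v)) * (a \<bullet> v)))
          has_real_derivative 2 * hess ?p (y + t *\<^sub>R v) v - d * (2 * (a \<bullet> v) * (a \<bullet> v))) (at t)"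
          by (intro DERIV_diff DERIV_cmult hess_line(2)[OF p nz[OF t]])
            (auto intro!: derivative_eq_intros simp: inner_add_right)
        show "0 \<le> 2 * hess ?p (y + t *\<^sub>R v) v - d * (2 * (a \<bullet> v) * (a \<bullet> v))"
          using lower[OF nz[OF t], of v] small[of v] by (cases "v = 0") (auto simp: power2_eq_square)
      qed simp
    qed
    moreover have "(sqrt (q y))\<^sup>2 = (f y)\<^sup>2 - d * (a \<bullet> y)\<^sup>2" for y
      using qpos[of y] f0 by (cases "y = 0") (auto simp: q_def)
    ultimately show ?thesis using d by blast
  qed
  obtain d N where N: "even_norm N" "\<And>y. (N y)\<^sup>2 = (f y)\<^sup>2 - d * (0 \<bullet> y)\<^sup>2"
    using perturb[of 0] by blast
  have "N y = f y" for y
    using N(2)[of y] nonneg[of y] N(1) by (simp add: even_norm_def pos_homogeneous_nonneg power2_eq_iff_nonneg)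
  then have "N = f" by blast
  then show ?thesis using N(1) perturb by (simp add: uniformly_convex_norm_def)
qed

text \<open>Positivity of the metric comes from the positive definite Hessian: by Euler's relation its value at
  \<open>y\<close> in direction \<open>y\<close> is \<open>(G x y)\<^sup>2\<close>.\<close>

lemma finsler_slice:
  fixes G :: "real^'n \<Rightarrow> real^'n \<Rightarrow> real"
  assumes G: "finsler_metric G"
  shows "hd_on (- {0}) (G x) k" "pos_homogeneous (G x)"
    and "y \<noteq> 0 \<Longrightarrow> v \<noteq> 0 \<Longrightarrow> 0 < hess (\<lambda>y. (G x y)\<^sup>2 / 2) y v"
proof -
  show s: "hd_on (- {0}) (G x) k" for k
  proof -
    have op: "open (- {0 :: real^'n})" "open {p :: (real^'n) \<times> (real^'n). snd p \<noteq> 0}"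
      by (auto intro!: open_Collect_neq continuous_intros)
    have "hd_on {p. snd p \<noteq> 0} (\<lambda>p. G (fst p) (snd p)) k"
      using G by (simp add: finsler_metric_def smooth_on_def)
    from hd_compose[OF op hd_Pair[OF op(1) hd_const hd_linear[OF bounded_linear_ident]] this, of x]
    show ?thesis by (simp add: image_subset_iff)
  qed
  have op: "open (- {0 :: real^'n})" by auto
  have "hd_on (- {0}) (\<lambda>y. (1/2) * (G x y)\<^sup>2) 2" by (intro hd_mult hd_const hd_power op s)
  then have p: "hd_on (- {0}) (\<lambda>y. (G x y)\<^sup>2 / 2) 2" by simp
  show h: "0 < hess (\<lambda>y. (G x y)\<^sup>2 / 2) y v" if "y \<noteq> 0" "v \<noteq> 0" for y v
  proof -
    have "0 < v \<bullet> (fundamental_tensor G x y *v v)" using G that by (simp add: finsler_metric_def)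
    also have "\<dots> = hess (\<lambda>y. (G x y)\<^sup>2 / 2) y v"
      unfolding hess_expansion[OF p that(1)]
      by (simp add: fundamental_tensor_def inner_vec_def matrix_vector_mult_def sum_distrib_left mult_ac)
    finally show ?thesis .
  qed
  have hom: "G x (t *\<^sub>R y) = t * G x y" if "0 < t" for t y using G that by (simp add: finsler_metric_def)
  have "0 < G x y" if y: "y \<noteq> 0" for y
  proof -
    have "hess (\<lambda>y. (G x y)\<^sup>2 / 2) y y = 2 * ((G x y)\<^sup>2 / 2)"
      by (rule two_homogeneous_hess(1)[OF p _ y]) (simp add: hom power_mult_distrib)
    then have "0 < (G x y)\<^sup>2" using h[OF y y] by simp
    moreover have "0 \<le> G x y" using G by (simp add: finsler_metric_def)
    ultimately show ?thesis by (simp add: less_le)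
  qed
  then show "pos_homogeneous (G x)" using hom by (simp add: pos_homogeneous_def)
qed

lemma harmonic_sym_uniformly_convex:
  fixes F :: "real^'n \<Rightarrow> real^'n \<Rightarrow> real"
  assumes "finsler_metric (harmonic_sym m F)"
  shows "uniformly_convex_norm (harmonic_sym m F x)"
proof (rule uniformly_convex_norm_if_hessian_pos)
  show "hd_on (- {0}) (harmonic_sym m F x) 2" by (rule finsler_slice(1)[OF assms])
  show "0 \<le> harmonic_sym m F x y" for y by (rule pos_homogeneous_nonneg[OF finsler_slice(2)[OF assms]])
  show "0 < t \<Longrightarrow> harmonic_sym m F x (t *\<^sub>R y) = t * harmonic_sym m F x y" for t y
    by (rule pos_homogeneous_scale[OF finsler_slice(2)[OF assms]])
  show "harmonic_sym m F x (- y) = harmonic_sym m F x y" for y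
    by (simp add: harmonic_sym_def add.commute)
  show "y \<noteq> 0 \<Longrightarrow> v \<noteq> 0 \<Longrightarrow> 0 < hess (\<lambda>y. (harmonic_sym m F x y)\<^sup>2 / 2) y v" for y v
    by (rule finsler_slice(3)[OF assms])
qed

section \<open>The first derivative of the area integrand\<close>

definition darea :: "(real^'n \<Rightarrow> real) \<Rightarrow> real^'m^'n \<Rightarrow> real^'m^'n \<Rightarrow> real" where
  "darea f P Q = frechet_derivative (sect_area f) (at P) Q"

lemma darea_linear:
  fixes P :: "real^'m^'n"
  assumes f: "pos_homogeneous f" "hd_on (- {0}) f 1" and P: "P \<in> inj_mats"
  shows "linear (darea f P)"
  unfolding darea_def using hd_SucE[of inj_mats "sect_area f" 0 P] hd_sect_area[OF f] P has_derivative_linear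
  by auto

lemma darea_line:
  fixes P Q :: "real^'m^'n"
  assumes f: "pos_homogeneous f" "hd_on (- {0}) f 1" and P: "P + t *\<^sub>R Q \<in> inj_mats"
  shows "((\<lambda>s. sect_area f (P + s *\<^sub>R Q)) has_real_derivative darea f (P + t *\<^sub>R Q) Q) (at t)"
  unfolding darea_def by (rule hd_directional_derivative[of inj_mats _ 0]) (use hd_sect_area[OF f] P in auto)

lemma dyad_expansion:
  fixes x :: "real^'b" and w :: "real^'c"
  shows "dyad w x = (\<Sum>k\<in>UNIV. x $ k *\<^sub>R dyad w (axis k 1))"
proof -
  have lin: "linear (dyad w :: real^'b \<Rightarrow> _)" by (rule linearI) (simp_all add: dyad_add_right dyad_scaleR_right)
  then have "dyad w (\<Sum>k\<in>UNIV. x $ k *\<^sub>R axis k 1) = (\<Sum>k\<in>UNIV. x $ k *\<^sub>R dyad w (axis k 1))"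
    by (simp only: linear_sum[OF lin] linear_scale[OF lin])
  moreover have "(\<Sum>k\<in>UNIV. x $ k *\<^sub>R axis k 1) = x" by (simp add: basis_expansion flip: scalar_mult_eq_scaleR)
  ultimately show ?thesis by simp
qed

text \<open>Adding \<open>s P c x\<^sup>T\<close> to \<open>P\<close> means multiplying by \<open>1 + s c x\<^sup>T\<close> from the right, which changes only the
  parametrization and scales the area by a determinant. For a coordinate vector \<open>x\<close> a single column is
  perturbed; the general case follows by linearity.\<close>

lemma darea_tangential:
  fixes P :: "real^'m^'n"
  assumes f: "pos_homogeneous f" "hd_on (- {0}) f 1" and P: "P \<in> inj_mats"
  shows "darea f P (dyad (P *v c) x) = (x \<bullet> c) * sect_area f P"
proof -
  have cont: "continuous_on (- {0}) f" using f(2) by (rule hd_imp_continuous)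
  have axis: "darea f P (dyad (P *v c) (axis k 1)) = c $ k * sect_area f P" for k
  proof -
    let ?D = "dyad (P *v c) (axis k 1)"
    have "((\<lambda>s. 1 + s * c $ k) \<longlongrightarrow> 1 + 0 * c $ k) (nhds 0)" by (intro tendsto_intros filterlim_ident)
    then have "eventually (\<lambda>s. 1 + s * c $ k \<in> {0<..}) (nhds 0)" by (intro topological_tendstoD) auto
    then have ev: "eventually (\<lambda>s. sect_area f (P + s *\<^sub>R ?D) = (1 + s * c $ k) * sect_area f P) (nhds 0)"
    proof eventually_elim
      case (elim s)
      let ?A = "mat 1 + s *\<^sub>R dyad c (axis k 1) :: real^'m^'m"
      have Av: "?A *v v = v + (s * v $ k) *\<^sub>R c" for v
        by (simp add: matrix_vector_mult_add_rdistrib scaleR_matrix_vector_assoc[symmetric] dyad_mult inner_axis')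
      have "inj ((*v) ?A)"
      proof (subst linear_injective_0[OF matrix_vector_mul_linear], intro allI impI)
        fix v assume v: "?A *v v = 0"
        then have "(v + (s * v $ k) *\<^sub>R c) $ k = 0" unfolding Av by simp
        then have "v $ k * (1 + s * c $ k) = 0" by (simp add: algebra_simps)
        then have "v $ k = 0" using elim by simp
        then show "v = 0" using v unfolding Av by simp
      qed
      from sect_area_mult[OF f(1) cont P this]
      have "sect_area f (P ** ?A) = \<bar>1 + s * c $ k\<bar> * sect_area f P" by (simp add: jacobian_column_perturbation)
      moreover have "P ** ?A = P + s *\<^sub>R ?D"
      proof -
        have "P ** ?A = P ** mat 1 + P ** (s *\<^sub>R dyad c (axis k 1))" by (rule matrix_add_ldistrib)
        also have "P ** (s *\<^sub>R dyad c (axis k 1)) = s *\<^sub>R (P ** dyad c (axis k 1))"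
          by (simp add: matrix_matrix_mult_def vec_eq_iff sum_distrib_left mult_ac)
        finally show ?thesis by (simp add: matrix_mult_dyad)
      qed
      ultimately show ?case using elim by simp
    qed
    have "((\<lambda>s. (1 + s * c $ k) * sect_area f P) has_real_derivative c $ k * sect_area f P) (at 0)"
      by (auto intro!: derivative_eq_intros)
    then have "((\<lambda>s. sect_area f (P + s *\<^sub>R ?D)) has_real_derivative c $ k * sect_area f P) (at 0)"
      using DERIV_cong_ev[OF refl ev refl] by blast
    moreover have "((\<lambda>s. sect_area f (P + s *\<^sub>R ?D)) has_real_derivative darea f P ?D) (at 0)"
      using darea_line[OF f, of P 0 ?D] P by simp
    ultimately show ?thesis using DERIV_unique by blast
  qed
  have "darea f P (dyad (P *v c) x) = (\<Sum>k\<in>UNIV. x $ k * darea f P (dyad (P *v c) (axis k 1)))"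
    using darea_linear[OF f P] by (subst dyad_expansion) (simp add: linear_sum linear_scale)
  also have "\<dots> = (x \<bullet> c) * sect_area f P" by (simp add: axis inner_vec_def sum_distrib_right mult.assoc)
  finally show ?thesis .
qed

lemma darea_reparametrize:
  fixes P :: "real^'m^'n" and A :: "real^'m^'m"
  assumes f: "pos_homogeneous f" "hd_on (- {0}) f 1" and P: "P \<in> inj_mats" and A: "inj ((*v) A)"
  shows "darea f (P ** A) (dyad w (x v* A)) = jacobian ((*v) A) * darea f P (dyad w x)"
proof -
  have cont: "continuous_on (- {0}) f" using f(2) by (rule hd_imp_continuous)
  have PA: "P ** A \<in> inj_mats" by (rule inj_mats_mult[OF P A])
  have "((\<lambda>s. P + s *\<^sub>R dyad w x) \<longlongrightarrow> P + 0 *\<^sub>R dyad w x) (nhds (0::real))"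
    by (intro tendsto_intros filterlim_ident)
  then have "eventually (\<lambda>s. P + s *\<^sub>R dyad w x \<in> inj_mats) (nhds (0::real))"
    by (rule topological_tendstoD[OF _ open_inj_mats]) (use P in simp)
  then have ev: "eventually (\<lambda>s. sect_area f (P ** A + s *\<^sub>R dyad w (x v* A))
      = jacobian ((*v) A) * sect_area f (P + s *\<^sub>R dyad w x)) (nhds 0)"
  proof eventually_elim
    case (elim s)
    show ?case using sect_area_mult[OF f(1) cont elim A]
      unfolding matrix_add_scaleR_mult dyad_mult_matrix .
  qed
  have "((\<lambda>s. jacobian ((*v) A) * sect_area f (P + s *\<^sub>R dyad w x)) has_real_derivative
      jacobian ((*v) A) * darea f P (dyad w x)) (at 0)"
    using DERIV_cmult[OF darea_line[OF f, of P 0 "dyad w x"]] P by simp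
  then have "((\<lambda>s. sect_area f (P ** A + s *\<^sub>R dyad w (x v* A))) has_real_derivative
      jacobian ((*v) A) * darea f P (dyad w x)) (at 0)"
    using DERIV_cong_ev[OF refl ev refl] by blast
  moreover have "((\<lambda>s. sect_area f (P ** A + s *\<^sub>R dyad w (x v* A))) has_real_derivative
      darea f (P ** A) (dyad w (x v* A))) (at 0)"
    using darea_line[OF f, of "P ** A" 0 "dyad w (x v* A)"] PA by simp
  ultimately show ?thesis using DERIV_unique by blast
qed

text \<open>Shearing a hyperplane along a transversal \<open>w\<close> changes its area element to first order by a
  linear functional of the shear, which vanishes for a suitable choice of \<open>w\<close>: tangential
  corrections of \<open>w\<close> contribute every linear functional.\<close>

lemma stationary_transversal:
  fixes P :: "real^'m^'n"
  assumes f: "pos_homogeneous f" "hd_on (- {0}) f 1" and P: "P \<in> inj_mats"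
    and a: "a \<noteq> 0" "\<And>v. a \<bullet> (P *v v) = 0"
  obtains w where "a \<bullet> w = 1" "\<And>x. darea f P (dyad w x) = 0"
proof -
  define n where "n = inverse (a \<bullet> a) *\<^sub>R a"
  define c :: "real^'m" where "c = (\<chi> k. - darea f P (dyad n (axis k 1)) / sect_area f P)"
  have L: "0 < sect_area f P" by (rule sect_area_pos[OF f(1) hd_imp_continuous[OF f(2)] P])
  note lin = darea_linear[OF f P]
  have "a \<bullet> (n + P *v c) = 1" using a by (simp add: n_def inner_add_right)
  moreover have "darea f P (dyad (n + P *v c) x) = 0" for x
  proof -
    have "darea f P (dyad n x) = (\<Sum>k\<in>UNIV. x $ k * darea f P (dyad n (axis k 1)))"
      by (subst dyad_expansion) (simp add: linear_sum[OF lin] linear_scale[OF lin])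
    also have "\<dots> = - (x \<bullet> c) * sect_area f P"
      using L by (simp add: c_def inner_vec_def sum_distrib_right sum_negf)
    finally show ?thesis
      by (simp add: dyad_add_left linear_add[OF lin] darea_tangential[OF f P])
  qed
  ultimately show ?thesis by (rule that)
qed

text \<open>The shear along \<open>w\<close> moves the given section, at \<open>t = 0\<close>, to the hyperplane orthogonal to \<open>a\<close>, at
  \<open>t = -1\<close>. On this line the area integrand is strictly convex, and at \<open>t = -1\<close> it is stationary by the
  choice of \<open>w\<close>; hence its derivative at \<open>t = 0\<close> is positive. If \<open>w\<close> is tangential, the shear is a mere dilation of the
  parameters.\<close>

theorem darea_shear_pos:
  fixes P0 P :: "real^'m^'n"
  assumes dim: "CARD('n) = CARD('m) + 1"
    and uc: "uniformly_convex_norm f" and smooth: "hd_on (- {0}) f 1"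
    and P0: "P0 \<in> inj_mats" and a: "a \<noteq> 0" "\<And>v. a \<bullet> (P0 *v v) = 0"
    and w: "a \<bullet> w = 1" "\<And>x. darea f P0 (dyad w x) = 0"
    and P: "P \<in> inj_mats" and x: "a v* P \<noteq> 0"
  shows "0 < darea f P (dyad w (a v* P))"
proof -
  let ?x = "a v* P"
  have ph: "pos_homogeneous f" and cont: "continuous_on (- {0}) f"
    using uc by (auto simp: uniformly_convex_norm_def even_norm_def)
  have xv: "?x \<bullet> v = a \<bullet> (P *v v)" for v by (simp add: dot_lmul_matrix)
  have sub: "subspace (range ((*v) P))" by (intro linear_subspace_image matrix_vector_mul_linear subspace_UNIV)
  show ?thesis
  proof (cases "w \<in> range ((*v) P)")
    case True
    then obtain c where c: "w = P *v c" by blast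
    have "?x \<bullet> c = 1" using xv[of c] w(1) c by simp
    then have "darea f P (dyad w ?x) = sect_area f P" using darea_tangential[OF ph smooth P, of c ?x] c by simp
    then show ?thesis using sect_area_pos[OF ph cont P] by simp
  next
    case False
    define Q where "Q t = P + t *\<^sub>R dyad w ?x" for t
    have Qv: "Q t *v v = P *v v + (t * (a \<bullet> (P *v v))) *\<^sub>R w" for t v
      by (simp add: Q_def matrix_vector_mult_add_rdistrib scaleR_matrix_vector_assoc[symmetric] dyad_mult xv)
    have key: "r = 0" if "P *v v + r *\<^sub>R w = 0" for r v
    proof (rule ccontr)
      assume "r \<noteq> 0"
      have "P *v v = (- r) *\<^sub>R w" using that by (simp add: eq_neg_iff_add_eq_0)
      then have "w = (- inverse r) *\<^sub>R (P *v v)" using \<open>r \<noteq> 0\<close> by simp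
      then have "w = P *v ((- inverse r) *\<^sub>R v)" by (simp only: matrix_vector_mult_scaleR)
      then show False using False by blast
    qed
    have Qinj: "Q t \<in> inj_mats" for t unfolding inj_mats_iff
    proof (intro allI impI)
      fix v assume v: "Q t *v v = 0"
      then have h: "t * (a \<bullet> (P *v v)) = 0" unfolding Qv by (rule key)
      have "P *v v = 0" using v unfolding Qv h by simp
      then show "v = 0" using P by (simp add: inj_mats_iff)
    qed
    have wQ: "w \<notin> range ((*v) (Q t))" for t
    proof
      assume "w \<in> range ((*v) (Q t))"
      then obtain v where v: "w = P *v v + (t * (a \<bullet> (P *v v))) *\<^sub>R w" unfolding Qv by blast
      then have "P *v v + (t * (a \<bullet> (P *v v)) - 1) *\<^sub>R w = 0" by (simp add: algebra_simps)
      from key[OF this] have h: "t * (a \<bullet> (P *v v)) = 1" by simp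
      have "P *v v = 0" using v unfolding h by simp
      then show False using h by simp
    qed
    define g where "g t = sect_area f (Q t)" for t
    define g' where "g' t = darea f (Q t) (dyad w ?x)" for t
    have der: "(g has_real_derivative g' t) (at t)" for t
      unfolding g_def[abs_def] g'_def Q_def by (rule darea_line[OF ph smooth]) (use Qinj in \<open>simp add: Q_def\<close>)
    have strict: "g ((1 - l) * s + l * t) < (1 - l) * g s + l * g t" if "0 < l" "l < 1" "s \<noteq> t" for l s t
      unfolding g_def Q_def
      by (rule sect_area_strictly_convex[OF uc that(1,2)]) (use Qinj wQ x that(3) in \<open>simp_all add: Q_def\<close>)
    have conv: "convex_on UNIV g"
    proof (rule convex_onI)
      fix l s t :: real assume "0 < l" "l < 1"
      then show "g ((1 - l) *\<^sub>R s + l *\<^sub>R t) \<le> (1 - l) * g s + l * g t"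
        using strict[of l s t] by (cases "s = t") (auto simp: algebra_simps)
    qed simp
    have tangent: "g s - g t \<ge> g' t * (s - t)" for s t
      by (rule convex_on_imp_above_tangent[OF conv]) (use der in auto)
    have g'0: "g' (- 1) = 0"
    proof -
      have aQ: "a \<bullet> (Q (- 1) *v v) = 0" for v unfolding Qv using w(1) by (simp add: inner_add_right inner_diff_right)
      obtain B0 where B0: "B0 ** P0 = mat 1"
        using P0 matrix_left_invertible_injective[of P0] by (auto simp: inj_mats_def)
      have range: "range ((*v) P0) = {y. a \<bullet> y = 0}"
      proof (rule subspace_dim_equal)
        show "subspace (range ((*v) P0))" by (intro linear_subspace_image matrix_vector_mul_linear subspace_UNIV)
        show "subspace {y. a \<bullet> y = 0}" by (rule subspace_hyperplane)
        show "range ((*v) P0) \<subseteq> {y. a \<bullet> y = 0}" using a(2) by auto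
        have "dim (range ((*v) P0)) = CARD('m)"
          using dim_image_eq[of "(*v) P0" UNIV] P0 by (simp add: inj_mats_def inj_on_def dim_UNIV)
        moreover have "dim {y. a \<bullet> y = 0} = CARD('n) - 1" using dim_hyperplane[OF a(1)] by simp
        ultimately show "dim {y. a \<bullet> y = 0} \<le> dim (range ((*v) P0))" using dim by simp
      qed
      define A where "A = B0 ** Q (- 1)"
      have PA: "P0 ** A = Q (- 1)"
      proof -
        have "P0 ** A *v v = Q (- 1) *v v" for v
        proof -
          have "Q (- 1) *v v \<in> range ((*v) P0)" unfolding range using aQ by simp
          then obtain u where u: "Q (- 1) *v v = P0 *v u" by blast
          have "P0 ** A *v v = P0 *v (B0 *v (Q (- 1) *v v))" by (simp add: A_def matrix_vector_mul_assoc)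
          also have "\<dots> = P0 *v (B0 ** P0 *v u)" unfolding u by (simp add: matrix_vector_mul_assoc)
          finally show ?thesis by (simp add: B0 u)
        qed
        then show ?thesis by (simp add: matrix_eq)
      qed
      have injA: "inj ((*v) A)"
      proof (subst linear_injective_0[OF matrix_vector_mul_linear], intro allI impI)
        fix v assume "A *v v = 0"
        then have "Q (- 1) *v v = 0" unfolding PA[symmetric] by (simp flip: matrix_vector_mul_assoc)
        then show "v = 0" using Qinj[of "- 1"] by (simp add: inj_mats_iff)
      qed
      then obtain A' where A': "A' ** A = mat 1" using matrix_left_invertible_injective by blast
      have vA: "y v* A' v* A = y" for y :: "real^'m" by (simp add: vector_matrix_mul_assoc A')
      have "?x v* A' v* A = ?x" by (rule vA)
      then have "g' (- 1) = darea f (P0 ** A) (dyad w (?x v* A' v* A))" by (simp add: g'_def PA)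
      also have "\<dots> = jacobian ((*v) A) * darea f P0 (dyad w (?x v* A'))"
        by (rule darea_reparametrize[OF ph smooth P0 injA])
      finally show ?thesis using w(2) by simp
    qed
    have "g (- 1) \<le> g (- 1 / 2)" using tangent[of "- 1" "- 1 / 2"] g'0 by simp
    moreover have "g (- 1 / 2) < (g (- 1) + g 0) / 2" using strict[of "1/2" "- 1" 0] by simp
    ultimately have "g (- 1) < g 0" by simp
    then have "0 < g' 0" using tangent[of 0 "- 1"] by simp
    then show ?thesis by (simp add: g'_def Q_def)
  qed
qed

section \<open>Integration by parts against compactly supported functions\<close>

text \<open>Translating a function whose support stays inside the box does not change its integral;
  differentiating in the translation parameter gives the claim.\<close>

lemma integral_derivative_compact_support:
  fixes \<psi> :: "'a::euclidean_space \<Rightarrow> real"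
  assumes \<psi>: "\<And>x. (\<psi> has_derivative D x) (at x)" and cont: "continuous_on UNIV (\<lambda>x. D x e)"
    and K: "compact K" "K \<subseteq> box a b" "\<And>x. x \<notin> K \<Longrightarrow> \<psi> x = 0"
  shows "integral (cbox a b) (\<lambda>x. D x e) = 0"
proof -
  define I where "I s = integral (cbox a b) (\<lambda>x. \<psi> (x + s *\<^sub>R e))" for s
  have c\<psi>: "continuous_on T \<psi>" for T
    using \<psi> by (meson continuous_at_imp_continuous_on has_derivative_continuous)
  have "(I has_real_derivative integral (cbox a b) (\<lambda>x. D (x + 0 *\<^sub>R e) e)) (at 0 within UNIV)"
    unfolding I_def
  proof (rule leibniz_rule_field_derivative[where f = "\<lambda>s x. \<psi> (x + s *\<^sub>R e)"
        and fx = "\<lambda>s x. D (x + s *\<^sub>R e) e" and U = UNIV])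
    fix s :: real and x
    have 1: "((\<lambda>s. x + s *\<^sub>R e) has_derivative (\<lambda>h. h *\<^sub>R e)) (at s)"
      by (auto intro!: derivative_eq_intros)
    have lin: "linear (D (x + s *\<^sub>R e))" using \<psi> has_derivative_linear by blast
    show "((\<lambda>s. \<psi> (x + s *\<^sub>R e)) has_real_derivative D (x + s *\<^sub>R e) e) (at s within UNIV)"
      unfolding has_field_derivative_def
      by (rule has_derivative_eq_rhs[OF has_derivative_compose[OF 1 \<psi>]])
        (simp add: fun_eq_iff linear_scale[OF lin])
  next
    show "continuous_on (UNIV \<times> cbox a b) (\<lambda>(s, x). D (x + s *\<^sub>R e) e)"
      unfolding split_beta
      by (rule continuous_on_compose2[OF cont]) (auto intro!: continuous_intros)
    fix s :: real
    show "(\<lambda>x. \<psi> (x + s *\<^sub>R e)) integrable_on cbox a b"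
      by (rule integrable_continuous, rule continuous_on_compose2[OF c\<psi>[of UNIV]])
        (auto intro!: continuous_intros)
  qed auto
  then have der: "(I has_real_derivative integral (cbox a b) (\<lambda>x. D x e)) (at 0)" by simp
  obtain \<rho> where \<rho>: "0 < \<rho>" "(\<Union>x\<in>K. ball x \<rho>) \<subseteq> box a b"
    by (rule compact_subset_open_imp_ball_epsilon_subset[OF K(1) open_box K(2)])
  have restrict: "integral T \<psi> = integral UNIV \<psi>" if "K \<subseteq> T" for T
  proof -
    have "(\<lambda>x. if x \<in> T then \<psi> x else 0) = \<psi>" using that K(3) by (auto simp: fun_eq_iff)
    then show ?thesis using integral_restrict_UNIV[of T \<psi>] by simp
  qed
  have const: "I s = integral UNIV \<psi>" if s: "norm (s *\<^sub>R e) < \<rho>" for s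
  proof -
    have "x \<in> cbox (a + s *\<^sub>R e) (b + s *\<^sub>R e)" if "x \<in> K" for x
    proof -
      have "x - s *\<^sub>R e \<in> ball x \<rho>" using s by (simp add: dist_norm)
      then have "x - s *\<^sub>R e \<in> box a b" using \<rho>(2) \<open>x \<in> K\<close> by blast
      then show ?thesis by (auto simp: mem_box inner_diff_left inner_add_left field_simps less_imp_le)
    qed
    then have "integral (cbox (a + s *\<^sub>R e) (b + s *\<^sub>R e)) \<psi> = integral UNIV \<psi>"
      by (intro restrict) auto
    then show ?thesis
      unfolding I_def using integral_shift_cbox_plus[of a b \<psi> "s *\<^sub>R e"] by (simp add: o_def add.commute)
  qed
  have "(I has_real_derivative 0) (at 0)"
  proof (rule has_field_derivative_transform_within_open)
    show "((\<lambda>s. integral UNIV \<psi>) has_real_derivative 0) (at 0)" by simp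
    show "open {s. norm (s *\<^sub>R e) < \<rho>}" by (intro open_Collect_less continuous_intros)
  qed (use const \<rho>(1) in auto)
  then show ?thesis using der DERIV_unique by blast
qed

definition divergence :: "('a::euclidean_space \<Rightarrow> 'a) \<Rightarrow> 'a \<Rightarrow> real" where
  "divergence G x = (\<Sum>e\<in>Basis. frechet_derivative G (at x) e \<bullet> e)"

lemma continuous_on_divergence:
  assumes "hd_on S G 1" shows "continuous_on S (divergence G)"
  unfolding divergence_def using assms by (auto intro!: continuous_intros)

text \<open>The field \<open>G\<close> is only defined near the box, but its product with \<open>\<phi>\<close> vanishes off \<open>K\<close> and so is
  differentiable everywhere.\<close>

lemma integration_by_parts:
  fixes \<phi> :: "'a::euclidean_space \<Rightarrow> real" and G :: "'a \<Rightarrow> 'a"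
  assumes G: "open S" "hd_on S G 1" "cbox a b \<subseteq> S"
    and \<phi>: "\<And>x. (\<phi> has_derivative D x) (at x)" "\<And>v. continuous_on UNIV (\<lambda>x. D x v)"
    and K: "compact K" "K \<subseteq> box a b" "\<And>x. x \<notin> K \<Longrightarrow> \<phi> x = 0"
  shows "integral (cbox a b) (\<lambda>x. D x (G x)) = - integral (cbox a b) (\<lambda>x. \<phi> x * divergence G x)"
proof -
  let ?G' = "\<lambda>x. frechet_derivative G (at x)"
  have dG: "(G has_derivative ?G' x) (at x)" if "x \<in> S" for x
    using hd_SucE[of S G 0 x] G(2) that by simp
  have cG: "continuous_on S G" "continuous_on S (\<lambda>x. ?G' x v)" for v
    using hd_imp_continuous[OF G(2)] G(2) by auto
  have KS: "K \<subseteq> S" using K(2) G(3) box_subset_cbox by blast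
  have opK: "open (- K)" using compact_imp_closed[OF K(1)] by auto
  have D0: "D x v = 0" if "x \<notin> K" for x v
  proof -
    have "(\<phi> has_derivative (\<lambda>h. 0)) (at x)"
      by (rule has_derivative_transform_within_open[of "\<lambda>_. 0", OF _ opK]) (use that K(3) in auto)
    then have "D x = (\<lambda>h. 0)" using \<phi>(1) has_derivative_unique by blast
    then show ?thesis by simp
  qed
  have c\<phi>: "continuous_on T \<phi>" for T
    using \<phi>(1) by (meson continuous_at_imp_continuous_on has_derivative_continuous)
  have cD: "continuous_on T (\<lambda>x. D x v)" for v T using \<phi>(2) continuous_on_subset by blast
  have cov: "S \<union> - K = UNIV" using KS by auto
  have main: "integral (cbox a b) (\<lambda>x. D x e * (G x \<bullet> e) + \<phi> x * (?G' x e \<bullet> e)) = 0" for e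
  proof (rule integral_derivative_compact_support[OF _ _ K(1,2),
        where \<psi> = "\<lambda>x. \<phi> x * (G x \<bullet> e)" and D = "\<lambda>x v. D x v * (G x \<bullet> e) + \<phi> x * (?G' x v \<bullet> e)"])
    fix x
    show "((\<lambda>x. \<phi> x * (G x \<bullet> e)) has_derivative (\<lambda>v. D x v * (G x \<bullet> e) + \<phi> x * (?G' x v \<bullet> e))) (at x)"
    proof (cases "x \<in> S")
      case True
      show ?thesis
        by (rule has_derivative_eq_rhs[OF has_derivative_mult[OF \<phi>(1)
              has_derivative_inner_left[OF dG[OF True]]]]) (simp add: fun_eq_iff)
    next
      case False
      then have xK: "x \<notin> K" using KS by blast
      have "((\<lambda>x. \<phi> x * (G x \<bullet> e)) has_derivative (\<lambda>h. 0)) (at x)"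
        by (rule has_derivative_transform_within_open[of "\<lambda>_. 0", OF has_derivative_const opK])
          (use xK K(3) in auto)
      then show ?thesis by (simp add: D0[OF xK] K(3)[OF xK])
    qed
  next
    have "continuous_on S (\<lambda>x. D x e * (G x \<bullet> e) + \<phi> x * (?G' x e \<bullet> e))"
      by (intro continuous_intros cD c\<phi> cG)
    moreover have "continuous_on (- K) (\<lambda>x. D x e * (G x \<bullet> e) + \<phi> x * (?G' x e \<bullet> e))"
      by (rule continuous_on_eq[of _ "\<lambda>_. 0"]) (use D0 K(3) in auto)
    ultimately show "continuous_on UNIV (\<lambda>x. D x e * (G x \<bullet> e) + \<phi> x * (?G' x e \<bullet> e))"
      using continuous_on_open_Un[OF G(1) opK, of "\<lambda>x. D x e * (G x \<bullet> e) + \<phi> x * (?G' x e \<bullet> e)"]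
      unfolding cov by blast
    show "\<phi> x * (G x \<bullet> e) = 0" if "x \<notin> K" for x using K(3)[OF that] by simp
  qed
  have cont: "continuous_on (cbox a b) (\<lambda>x. D x e * (G x \<bullet> e))"
    "continuous_on (cbox a b) (\<lambda>x. \<phi> x * (?G' x e \<bullet> e))" for e
    by (intro continuous_intros cD c\<phi> continuous_on_subset[OF cG(1) G(3)] continuous_on_subset[OF cG(2) G(3)])+
  have eq: "integral (cbox a b) (\<lambda>x. D x e * (G x \<bullet> e)) = - integral (cbox a b) (\<lambda>x. \<phi> x * (?G' x e \<bullet> e))" for e
    using main[of e] integral_add[OF integrable_continuous[OF cont(1)[of e]] integrable_continuous[OF cont(2)[of e]]]
    by simp
  have "integral (cbox a b) (\<lambda>x. D x (G x)) = integral (cbox a b) (\<lambda>x. \<Sum>e\<in>Basis. D x e * (G x \<bullet> e))"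
  proof (rule arg_cong[where f = "integral (cbox a b)"], rule ext)
    fix x
    have "linear (D x)" using \<phi>(1) has_derivative_linear by blast
    from linear_componentwise_basis[OF this, of "G x"]
    show "D x (G x) = (\<Sum>e\<in>Basis. D x e * (G x \<bullet> e))" by (simp add: mult.commute)
  qed
  also have "\<dots> = (\<Sum>e\<in>Basis. integral (cbox a b) (\<lambda>x. D x e * (G x \<bullet> e)))"
    by (rule integral_sum) (auto intro: integrable_continuous cont)
  also have "\<dots> = - (\<Sum>e\<in>Basis. integral (cbox a b) (\<lambda>x. \<phi> x * (?G' x e \<bullet> e)))"
    by (simp add: eq sum_negf)
  also have "(\<Sum>e\<in>Basis. integral (cbox a b) (\<lambda>x. \<phi> x * (?G' x e \<bullet> e))) =
      integral (cbox a b) (\<lambda>x. \<Sum>e\<in>Basis. \<phi> x * (?G' x e \<bullet> e))"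
    by (rule integral_sum[symmetric]) (auto intro: integrable_continuous cont)
  also have "\<dots> = integral (cbox a b) (\<lambda>x. \<phi> x * divergence G x)"
    by (simp add: divergence_def sum_distrib_left)
  finally show ?thesis .
qed

text \<open>If \<open>h\<close> had a sign at \<open>x0\<close>, it would keep it on a small ball, and a bump supported there would
  detect it.\<close>

lemma bump_orthogonal_imp_zero:
  fixes h :: "'a::euclidean_space \<Rightarrow> real"
  assumes h: "continuous_on (cbox a b) h"
    and orth: "\<And>x0 r. 0 < r \<Longrightarrow> cball x0 r \<subseteq> box a b \<Longrightarrow> integral (cbox a b) (\<lambda>x. bump x0 r x * h x) = 0"
    and x0: "x0 \<in> box a b"
  shows "h x0 = 0"
proof (rule ccontr)
  assume nz: "h x0 \<noteq> 0"
  have hb: "continuous_on (box a b) (\<lambda>x. sgn (h x0) * h x)"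
    by (intro continuous_intros continuous_on_subset[OF h] box_subset_cbox)
  have "open {x \<in> box a b. 0 < sgn (h x0) * h x}"
    using continuous_on_open_vimage[OF open_box, THEN iffD1, OF hb, rule_format, of "{0<..}"]
    by (simp add: vimage_def Collect_conj_eq Int_commute)
  moreover have "x0 \<in> {x \<in> box a b. 0 < sgn (h x0) * h x}" using x0 nz by (simp add: sgn_if)
  ultimately obtain r where r: "0 < r" "cball x0 r \<subseteq> {x \<in> box a b. 0 < sgn (h x0) * h x}"
    using open_contains_cball by metis
  let ?g = "\<lambda>x. bump x0 r x * (sgn (h x0) * h x)"
  have "integral (cbox a b) (\<lambda>x. sgn (h x0) * (bump x0 r x * h x)) = 0"
    using orth[of r x0] r by (subst integral_mult_right) auto
  then have "integral (cbox a b) ?g = 0" by (simp add: mult.left_commute)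
  moreover have "continuous_on (cbox a b) ?g"
    by (intro continuous_intros h continuous_on_subset[OF hd_imp_continuous[OF hd_bump[where k = 0]]]) auto
  moreover have "0 \<le> ?g x" for x
  proof (cases "x \<in> ball x0 r")
    case True
    then have "x \<in> cball x0 r" by auto
    then have "0 < sgn (h x0) * h x" using r(2) by blast
    then show ?thesis using mult_nonneg_nonneg[OF bump_nonneg[of x0 r x], of "sgn (h x0) * h x"] by simp
  qed (simp add: bump_eq_0[OF r(1)])
  ultimately have "\<forall>x\<in>cbox a b. ?g x = 0"
    using integral_cbox_eq_0_iff[of a b ?g] x0 by auto
  then have "?g x0 = 0" using x0 box_subset_cbox by blast
  moreover have "0 < bump x0 r x0" using bump_pos_iff[OF r(1), of x0 x0] r(1) by simp
  ultimately show False using nz by (simp add: sgn_if split: if_splits)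
qed

text \<open>A field that is weakly divergence free when tested with bump functions is divergence free,
  hence it may be tested with functions that are merely continuously differentiable.\<close>

lemma weakly_divergence_free:
  fixes \<phi> :: "'a::euclidean_space \<Rightarrow> real" and G :: "'a \<Rightarrow> 'a"
  assumes G: "open S" "hd_on S G 1" "cbox a b \<subseteq> S"
    and weak: "\<And>x0 r. 0 < r \<Longrightarrow> cball x0 r \<subseteq> box a b \<Longrightarrow>
      integral (cbox a b) (\<lambda>x. frechet_derivative (bump x0 r) (at x) (G x)) = 0"
    and \<phi>: "\<And>x. (\<phi> has_derivative D x) (at x)" "\<And>v. continuous_on UNIV (\<lambda>x. D x v)"
    and K: "compact K" "K \<subseteq> box a b" "\<And>x. x \<notin> K \<Longrightarrow> \<phi> x = 0"
  shows "integral (cbox a b) (\<lambda>x. D x (G x)) = 0"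
proof -
  have "integral (cbox a b) (\<lambda>x. bump x0 r x * divergence G x) = 0"
    if r: "0 < r" "cball x0 r \<subseteq> box a b" for x0 r
  proof -
    have "integral (cbox a b) (\<lambda>x. frechet_derivative (bump x0 r) (at x) (G x)) =
        - integral (cbox a b) (\<lambda>x. bump x0 r x * divergence G x)"
    proof (rule integration_by_parts[OF G _ _ compact_cball r(2)])
      show "(bump x0 r has_derivative frechet_derivative (bump x0 r) (at x)) (at x)" for x
        using hd_SucE[OF hd_bump[where k = "Suc 0"]] by simp
      show "continuous_on UNIV (\<lambda>x. frechet_derivative (bump x0 r) (at x) v)" for v
        using hd_bump[of x0 r "Suc 0"] by simp
      show "bump x0 r x = 0" if "x \<notin> cball x0 r" for x
        by (rule bump_eq_0[OF r(1)]) (use that in auto)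
    qed
    then show ?thesis using weak[OF r] by simp
  qed
  then have "divergence G x = 0" if "x \<in> box a b" for x
    by (rule bump_orthogonal_imp_zero[OF continuous_on_subset[OF continuous_on_divergence[OF G(2)] G(3)] _ that])
  then have "(\<lambda>x. \<phi> x * divergence G x) = (\<lambda>x. 0)" using K(2,3) by fastforce
  then have "integral (cbox a b) (\<lambda>x. \<phi> x * divergence G x) = 0" by simp
  then show ?thesis using integration_by_parts[OF G \<phi> K] by simp
qed

section \<open>The area of a chart box\<close>

text \<open>Volumes of unit balls see a Finsler norm only through the mean of its \<open>m\<close>-th inverse power over
  antipodal points. This is why the harmonic symmetrization governs the area.\<close>

lemma measure_sublevel_symmetrized:
  fixes f g :: "'a::euclidean_space \<Rightarrow> real"
  assumes f: "pos_homogeneous f" "continuous_on (- {0}) f" and g: "pos_homogeneous g" "continuous_on (- {0}) g"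
    and sym: "\<And>v. v \<noteq> 0 \<Longrightarrow> inverse (g v) ^ DIM('a) = (inverse (f v) ^ DIM('a) + inverse (f (- v)) ^ DIM('a)) / 2"
  shows "measure lborel {v. g v \<le> 1} = measure lborel {v. f v \<le> 1}"
proof -
  let ?i = "\<lambda>v. tent (norm v) * inverse (f v) ^ DIM('a)"
  have cont: "continuous_on UNIV ?i"
    by (intro tent_continuous_extension continuous_intros f(2)) (use pos_homogeneous_pos[OF f(1)] in force)
  have int: "?i integrable_on big_box" "(\<lambda>v. ?i (- v)) integrable_on big_box"
    by (rule integrable_continuous, rule continuous_on_compose2[OF cont]; auto intro!: continuous_intros)+
  have reflected: "integral big_box (\<lambda>v. ?i (- v)) = integral big_box ?i"
    using integral_reflect[of "2 *\<^sub>R One" "- 2 *\<^sub>R One" ?i] by simp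
  have "tent (norm v) * inverse (g v) ^ DIM('a) = (?i v + ?i (- v)) / 2" for v
  proof (cases "v = 0")
    case False
    show ?thesis unfolding sym[OF False] by (simp add: algebra_simps)
  qed (simp add: tent_zero)
  then have "integral big_box (\<lambda>v. tent (norm v) * inverse (g v) ^ DIM('a)) = integral big_box (\<lambda>v. (?i v + ?i (- v)) / 2)"
    by presburger
  also have "\<dots> = (integral big_box ?i + integral big_box (\<lambda>v. ?i (- v))) / 2"
    using integral_add[OF int] by simp
  finally have "integral big_box (\<lambda>v. tent (norm v) * inverse (g v) ^ DIM('a)) = integral big_box ?i"
    unfolding reflected by simp
  then show ?thesis unfolding volume_formula_measure[OF f] volume_formula_measure[OF g] by simp
qed

lemma inverse_harmonic_sym_power:
  assumes "0 < F x y" "0 < F x (- y)" "0 < m" "y \<noteq> 0"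
  shows "inverse (harmonic_sym m F x y) ^ m = (inverse (F x y) ^ m + inverse (F x (- y)) ^ m) / 2"
proof -
  define s where "s = F x y powr (- real m) + F x (- y) powr (- real m)"
  have p: "F x z powr (- real m) = inverse (F x z) ^ m" if "0 < F x z" for z
    using that by (simp add: powr_minus powr_realpow power_inverse)
  have s: "0 < s" unfolding s_def using assms by (simp add: add_pos_pos)
  have "harmonic_sym m F x y ^ m = ((2 / s) powr (1 / real m)) powr real m"
    using assms s by (subst powr_realpow) (simp_all add: harmonic_sym_def s_def)
  also have "\<dots> = 2 / s" using assms s by (simp add: powr_powr)
  finally show ?thesis using p[OF assms(1)] p[OF assms(2)] by (simp add: power_inverse s_def)
qed

lemma sect_vol_harmonic_sym:
  fixes F :: "real^'n \<Rightarrow> real^'n \<Rightarrow> real" and P :: "real^'m^'n"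
  assumes F: "finsler_metric F" and S: "finsler_metric (harmonic_sym CARD('m) F)" and P: "P \<in> inj_mats"
  shows "sect_vol (harmonic_sym CARD('m) F x) P = measure lborel {v. F x (P *v v) \<le> 1}"
  unfolding sect_vol_def
proof (rule measure_sublevel_symmetrized)
  have c: "continuous_on (- {0}) (F x)" "continuous_on (- {0}) (harmonic_sym CARD('m) F x)"
    using hd_imp_continuous[OF finsler_slice(1)[OF F, of x 0]]
      hd_imp_continuous[OF finsler_slice(1)[OF S, of x 0]] by auto
  note F' = pos_homogeneous_section[OF finsler_slice(2)[OF F, of x] c(1) P]
  show "pos_homogeneous (\<lambda>v. F x (P *v v))" "continuous_on (- {0}) (\<lambda>v. F x (P *v v))" using F' by auto
  show "pos_homogeneous (\<lambda>v. harmonic_sym CARD('m) F x (P *v v))"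
    "continuous_on (- {0}) (\<lambda>v. harmonic_sym CARD('m) F x (P *v v))"
    using pos_homogeneous_section[OF finsler_slice(2)[OF S, of x] c(2) P] by auto
  fix v :: "real^'m" assume v: "v \<noteq> 0"
  then have nz: "P *v v \<noteq> 0" using P by (auto simp: inj_mats_iff)
  show "inverse (harmonic_sym CARD('m) F x (P *v v)) ^ DIM(real^'m) =
      (inverse (F x (P *v v)) ^ DIM(real^'m) + inverse (F x (P *v - v)) ^ DIM(real^'m)) / 2"
    using inverse_harmonic_sym_power[of F x "P *v v" "CARD('m)"] nz
      pos_homogeneous_pos[OF finsler_slice(2)[OF F, of x], of "P *v v"]
      pos_homogeneous_pos[OF finsler_slice(2)[OF F, of x], of "- (P *v v)"]
    by (simp add: linear_neg[OF matrix_vector_mul_linear])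
qed

abbreviation ball_volume :: "'m::finite itself \<Rightarrow> real" where
  "ball_volume _ \<equiv> measure lborel (ball (0 :: real^'m) 1)"

text \<open>The constant between Hausdorff and Lebesgue measure cancels in the quotient.\<close>

lemma area_density_eq_sect_area:
  fixes F :: "real^'n \<Rightarrow> real^'n \<Rightarrow> real" and P :: "real^'m^'n"
  assumes F: "finsler_metric F" and S: "finsler_metric (harmonic_sym CARD('m) F)"
    and Y: "(Y has_derivative (*v) P) (at u)" and P: "P \<in> inj_mats"
  shows "area_density F Y u = ennreal (ball_volume TYPE('m) * sect_area (harmonic_sym CARD('m) F (Y u)) P)"
proof -
  let ?B = "{v. F (Y u) (P *v v) \<le> 1}"
  obtain \<gamma> where \<gamma>: "0 < \<gamma>" "\<And>A::(real^'m) set. A \<in> sets lebesgue \<Longrightarrow> bounded A \<Longrightarrow>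
      hausdorff_measure CARD('m) A = ennreal \<gamma> * emeasure lebesgue A"
    using hausdorff_eq_lebesgue[where 'a = "real^'m"] by (metis DIM_cart DIM_real mult.right_neutral)
  have c: "continuous_on (- {0}) (F (Y u))"
    using hd_imp_continuous[OF finsler_slice(1)[OF F, of "Y u" 0]] .
  note sl = pos_homogeneous_sublevel[OF pos_homogeneous_section[OF finsler_slice(2)[OF F, of "Y u"] c P]]
  have fd: "frechet_derivative Y (at u) = (*v) P" using frechet_derivative_at[OF Y] by simp
  have pos: "0 < measure lborel ?B" using sl(4) .
  have h: "hausdorff_measure CARD('m) A = ennreal (\<gamma> * measure lborel A)"
    if "A \<in> sets borel" "bounded A" for A :: "(real^'m) set"
  proof -
    have "A \<in> lmeasurable" using that by (simp add: bounded_set_imp_lmeasurable)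
    then have "emeasure lebesgue A = ennreal (measure lebesgue A)" by (simp add: emeasure_eq_measure2)
    moreover have "measure lebesgue A = measure lborel A" using that by (simp add: measure_completion)
    ultimately show ?thesis using \<gamma>(1) \<gamma>(2)[of A] that by (simp add: ennreal_mult)
  qed
  have "area_density F Y u = ennreal (\<gamma> * ball_volume TYPE('m)) / ennreal (\<gamma> * measure lborel ?B)"
    unfolding area_density_def fd using h[of "ball 0 1"] h[of ?B] sl(1,2) by simp
  also have "\<dots> = ennreal (\<gamma> * ball_volume TYPE('m) / (\<gamma> * measure lborel ?B))"
    by (rule divide_ennreal) (use \<gamma>(1) pos in auto)
  also have "\<gamma> * ball_volume TYPE('m) / (\<gamma> * measure lborel ?B) = ball_volume TYPE('m) / measure lborel ?B"
    using \<gamma>(1) by simp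
  finally show ?thesis
    unfolding sect_area_def sect_vol_harmonic_sym[OF F S P] by (simp add: inverse_eq_divide)
qed

lemma chart_facts:
  assumes "is_chart M c"
  shows "p \<in> fst c \<Longrightarrow> chart_inv c (snd c p) = p"
    and "x \<in> chart_image c \<Longrightarrow> chart_inv c x \<in> fst c"
    and "x \<in> chart_image c \<Longrightarrow> snd c (chart_inv c x) = x"
    and "continuous_on (fst c) (snd c)" "continuous_on (chart_image c) (chart_inv c)"
    and "openin (top_of_set M) (fst c)" "fst c \<subseteq> M"
proof -
  have h: "homeomorphism (fst c) (chart_image c) (snd c) (chart_inv c)" and o: "openin (top_of_set M) (fst c)"
    using assms by (auto simp: is_chart_def)
  show "openin (top_of_set M) (fst c)" "fst c \<subseteq> M" using o openin_imp_subset by auto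
  show "continuous_on (fst c) (snd c)" "continuous_on (chart_image c) (chart_inv c)"
    using h unfolding homeomorphism_def by auto
  show "p \<in> fst c \<Longrightarrow> chart_inv c (snd c p) = p" using h unfolding homeomorphism_def by blast
  show "x \<in> chart_image c \<Longrightarrow> chart_inv c x \<in> fst c" by (rule inv_into_into)
  show "x \<in> chart_image c \<Longrightarrow> snd c (chart_inv c x) = x" by (rule f_inv_into_f)
qed

text \<open>Second countability provides a countable subcover, so the choice in the definition is not void.\<close>

lemma chart_enum:
  fixes M :: "'a::{t2_space,second_countable_topology} set" and A :: "('a, 'm::finite) chart set"
  assumes M: "oriented_manifold M A" and ne: "A \<noteq> {}"
  shows "range (chart_enum A) \<subseteq> A" "(\<Union>n. fst (chart_enum A n)) = M"
proof -
  have U: "M = (\<Union>c\<in>A. fst c)" using M by (simp add: oriented_manifold_def)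
  obtain \<F> where \<F>: "\<F> \<subseteq> fst ` A" "countable \<F>" "\<Union>\<F> = \<Union>(fst ` A)"
    by (rule Lindelof_openin[of "fst ` A" M]) (use M in \<open>auto simp: oriented_manifold_def is_chart_def\<close>)
  obtain C where C: "C \<subseteq> A" "countable C" "\<F> = fst ` C"
    using countable_subset_image[of \<F> fst A] \<F>(1,2) by auto
  obtain c0 where c0: "c0 \<in> A" using ne by blast
  let ?e = "from_nat_into (insert c0 C)"
  have r: "range ?e = insert c0 C" by (rule range_from_nat_into) (use C in auto)
  have "(\<Union>n. fst (?e n)) = \<Union>(fst ` range ?e)" by auto
  also have "\<dots> = (\<Union>c\<in>A. fst c)" unfolding r using \<F>(3) C c0 by auto
  finally have "range ?e \<subseteq> A \<and> (\<Union>n. fst (?e n)) = (\<Union>c\<in>A. fst c)" unfolding r using c0 C by auto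
  then have "range (chart_enum A) \<subseteq> A \<and> (\<Union>n. fst (chart_enum A n)) = (\<Union>c\<in>A. fst c)"
    unfolding chart_enum_def by (rule someI[of "\<lambda>c. range c \<subseteq> A \<and> (\<Union>n. fst (c n)) = (\<Union>c\<in>A. fst c)"])
  then show "range (chart_enum A) \<subseteq> A" "(\<Union>n. fst (chart_enum A n)) = M" using U by auto
qed

text \<open>Near interior points the change of charts is a diffeomorphism of open sets: by invariance of
  domain it maps open sets to open sets, so that one-sided derivatives of the inverse transition are
  derivatives.\<close>

lemma transition:
  fixes M :: "'a::{t2_space,second_countable_topology} set" and A :: "('a, 'm::finite) chart set"
  assumes M: "oriented_manifold M A" and c: "c \<in> A" and d: "d \<in> A"
    and N: "open N" "N \<subseteq> chart_image c" "chart_inv c ` N \<subseteq> fst d"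
  defines "\<tau> \<equiv> snd d \<circ> chart_inv c"
  shows "inj_on \<tau> N" "open (\<tau> ` N)"
    and "\<And>x. x \<in> N \<Longrightarrow> chart_inv d (\<tau> x) = chart_inv c x"
    and "x \<in> N \<Longrightarrow> \<exists>D D'. (\<tau> has_derivative D) (at x) \<and>
      ((snd c \<circ> chart_inv d) has_derivative D') (at (\<tau> x)) \<and> D' \<circ> D = id \<and> D \<circ> D' = id"
proof -
  have ch: "is_chart M c" "is_chart M d" and comp: "oriented_compatible c d" "oriented_compatible d c"
    using M c d by (auto simp: oriented_manifold_def)
  note C = chart_facts[OF ch(1)] note D = chart_facts[OF ch(2)]
  have Nc: "chart_inv c x \<in> fst c \<inter> fst d" if "x \<in> N" for x using C(2)[of x] N that by blast
  have "continuous_on N (chart_inv c)" using C(5) N(2) continuous_on_subset by blast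
  then have ct: "continuous_on N \<tau>"
    unfolding \<tau>_def by (rule continuous_on_compose[OF _ continuous_on_subset[OF D(4) N(3)]])
  show inv: "chart_inv d (\<tau> x) = chart_inv c x" if "x \<in> N" for x
    unfolding \<tau>_def using D(1) Nc[OF that] by simp
  have ginv: "(snd c \<circ> chart_inv d) (\<tau> x) = x" if "x \<in> N" for x
    using inv[OF that] C(3)[of x] N(2) that by auto
  then show inj: "inj_on \<tau> N" by (metis inj_on_inverseI)
  show op: "open (\<tau> ` N)" by (rule invariance_of_domain[OF ct N(1) inj])
  have sub: "\<tau> ` N \<subseteq> snd d ` (fst d \<inter> fst c)" unfolding \<tau>_def using Nc by auto
  have subc: "N \<subseteq> snd c ` (fst c \<inter> fst d)"
  proof
    fix x assume x: "x \<in> N"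
    then have "x = snd c (chart_inv c x)" using C(3)[of x] N(2) by auto
    then show "x \<in> snd c ` (fst c \<inter> fst d)" using Nc[OF x] by (rule image_eqI)
  qed
  assume x: "x \<in> N"
  then have x': "\<tau> x \<in> \<tau> ` N" by simp
  obtain D1 where "((snd d \<circ> chart_inv c) has_derivative D1) (at x within snd c ` (fst c \<inter> fst d))"
    using comp(1) subc x unfolding oriented_compatible_def Let_def by blast
  then have D1: "(\<tau> has_derivative D1) (at x)"
    using has_derivative_subset[OF _ subc] at_within_open[OF x N(1)] unfolding \<tau>_def by metis
  obtain D2 where "((snd c \<circ> chart_inv d) has_derivative D2) (at (\<tau> x) within snd d ` (fst d \<inter> fst c))"
    using comp(2) sub x' unfolding oriented_compatible_def Let_def by blast
  then have D2: "((snd c \<circ> chart_inv d) has_derivative D2) (at (\<tau> x))"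
    using has_derivative_subset[OF _ sub] at_within_open[OF x' op] by metis
  have "((snd c \<circ> chart_inv d) \<circ> \<tau> has_derivative D2 \<circ> D1) (at x)"
    by (rule diff_chain_at[OF D1 D2])
  then have "(id has_derivative D2 \<circ> D1) (at x)"
    by (rule has_derivative_transform_within_open[OF _ N(1) x]) (use ginv in auto)
  then have 1: "D2 \<circ> D1 = id" using has_derivative_unique[OF _ has_derivative_id] by (metis id_def)
  have "linear D1" "linear D2" using D1 D2 has_derivative_linear by auto
  then have "D1 \<circ> D2 = id" using linear_inverse_left[of D2 D1] 1 by (simp add: id_def)
  then show "\<exists>D D'. (\<tau> has_derivative D) (at x) \<and>
      ((snd c \<circ> chart_inv d) has_derivative D') (at (\<tau> x)) \<and> D' \<circ> D = id \<and> D \<circ> D' = id"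
    using D1 D2 1 by blast
qed

lemma open_chart_overlap:
  assumes "is_chart M c" "is_chart M d" "open N" "N \<subseteq> chart_image c"
  shows "open (N \<inter> chart_inv c -` fst d)"
proof -
  have "openin (top_of_set N) (N \<inter> chart_inv c -` fst d)"
    by (rule continuous_openin_preimage[OF continuous_on_subset[OF chart_facts(5)[OF assms(1)] assms(4)]
          _ chart_facts(6)[OF assms(2)]])
      (use chart_facts(2,7)[OF assms(1)] assms(4) in blast)
  then show ?thesis using openin_open_eq[OF assms(3)] by simp
qed

lemma nn_integral_absolutely_integrable:
  fixes h :: "'a::euclidean_space \<Rightarrow> real"
  assumes h: "h absolutely_integrable_on T" and nonneg: "\<And>y. y \<in> T \<Longrightarrow> 0 \<le> h y"
  shows "(\<integral>\<^sup>+y\<in>T. ennreal (h y) \<partial>lebesgue) = ennreal (integral T h)"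
proof -
  have "(\<integral>\<^sup>+y\<in>T. ennreal (h y) \<partial>lebesgue) = (\<integral>\<^sup>+y. ennreal (indicat_real T y *\<^sub>R h y) \<partial>lebesgue)"
    by (rule nn_integral_cong) (simp add: indicator_def)
  also have "\<dots> = ennreal (\<integral>y. indicat_real T y *\<^sub>R h y \<partial>lebesgue)"
    using h nonneg by (intro nn_integral_eq_integral) (auto simp: set_integrable_def indicator_def)
  also have "(\<integral>y. indicat_real T y *\<^sub>R h y \<partial>lebesgue) = integral T h"
    using set_lebesgue_integral_eq_integral(2)[OF h] by (simp add: set_lebesgue_integral_def)
  finally show ?thesis .
qed

text \<open>The area density transforms like the Jacobian of the change of charts, so that a part of a
  chart box contributes the same amount to the area in any other chart.\<close>

lemma area_chart_independent:
  fixes F :: "real^'n \<Rightarrow> real^'n \<Rightarrow> real"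
    and M :: "'a::{t2_space,second_countable_topology} set" and A :: "('a, 'm::finite) chart set"
    and P :: "real^'m \<Rightarrow> real^'m^'n" and Z :: "'a \<Rightarrow> real^'n"
  assumes M: "oriented_manifold M A" and c: "c \<in> A" and d: "d \<in> A"
    and F: "finsler_metric F" and S: "finsler_metric (harmonic_sym CARD('m) F)"
    and \<Phi>: "\<And>x. harmonic_sym CARD('m) F x = \<Phi>"
    and B: "cbox a b \<subseteq> interior (chart_image c)"
    and P: "continuous_on (cbox a b) P" "\<And>u. u \<in> cbox a b \<Longrightarrow> P u \<in> inj_mats"
    and Z: "\<And>u. u \<in> cbox a b \<Longrightarrow> ((Z \<circ> chart_inv c) has_derivative (*v) (P u)) (at u)"
    and E: "E \<subseteq> chart_inv c ` cbox a b \<inter> fst d" "snd c ` E \<in> sets lebesgue"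
  shows "(\<integral>\<^sup>+y\<in>snd d ` E. area_density F (Z \<circ> chart_inv d) y \<partial>lebesgue) =
    (\<integral>\<^sup>+u\<in>snd c ` E. ennreal (ball_volume TYPE('m) * sect_area \<Phi> (P u)) \<partial>lebesgue)"
proof -
  define \<tau> where "\<tau> = snd d \<circ> chart_inv c"
  define N where "N = interior (chart_image c) \<inter> chart_inv c -` fst d"
  define T where "T = snd c ` E"
  define \<omega> where "\<omega> = ball_volume TYPE('m)"
  have \<omega>: "0 \<le> \<omega>" by (simp add: \<omega>_def)
  have ch: "is_chart M c" "is_chart M d" using M c d by (auto simp: oriented_manifold_def)
  note C = chart_facts[OF ch(1)]
  have sub: "interior (chart_image c) \<subseteq> chart_image c" by (rule interior_subset)
  have N: "open N" "N \<subseteq> chart_image c" "chart_inv c ` N \<subseteq> fst d"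
    unfolding N_def using open_chart_overlap[OF ch open_interior sub] sub by auto
  note tr = transition[OF M c d N, folded \<tau>_def]
  have \<Phi>F: "finsler_metric (\<lambda>x. \<Phi>)" using S \<Phi> by (metis (no_types, lifting) ext)
  have ph: "pos_homogeneous \<Phi>" "continuous_on (- {0}) \<Phi>"
    using finsler_slice(2)[OF \<Phi>F] hd_imp_continuous[OF finsler_slice(1)[OF \<Phi>F, of 0]] by auto
  have TE: "chart_inv c u \<in> E \<and> u \<in> cbox a b" if uT: "u \<in> T" for u
  proof -
    obtain p where p: "p \<in> E" "u = snd c p" using uT unfolding T_def by blast
    obtain u' where u': "u' \<in> cbox a b" "p = chart_inv c u'" using E(1) p(1) by blast
    have "u' \<in> chart_image c" using u'(1) B sub by blast
    then have "u = u'" using p(2) u'(2) C(3) by simp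
    then show ?thesis using p(1) u' by simp
  qed
  have TN: "T \<subseteq> N" using TE B E(1) unfolding N_def by blast
  have TB: "T \<subseteq> cbox a b" using TE by blast
  have img: "snd d ` E = \<tau> ` T"
  proof -
    have "chart_inv c (snd c p) = p" if "p \<in> E" for p
    proof -
      obtain u' where "u' \<in> cbox a b" "p = chart_inv c u'" using E(1) \<open>p \<in> E\<close> by blast
      then have "p \<in> fst c" using C(2)[of u'] B sub by blast
      then show ?thesis using C(1) by simp
    qed
    then show ?thesis by (auto simp: T_def \<tau>_def image_iff)
  qed
  let ?Q = "\<lambda>y. matrix (frechet_derivative (Z \<circ> chart_inv d) (at y)) :: real^'m^'n"
  let ?D = "\<lambda>x. frechet_derivative \<tau> (at x)"
  have pt: "(\<tau> has_derivative ?D x) (at x) \<and> area_density F (Z \<circ> chart_inv d) (\<tau> x) = ennreal (\<omega> * sect_area \<Phi> (?Q (\<tau> x)))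
      \<and> jacobian (?D x) * (\<omega> * sect_area \<Phi> (?Q (\<tau> x))) = \<omega> * sect_area \<Phi> (P x) \<and> 0 \<le> sect_area \<Phi> (?Q (\<tau> x))"
    if x: "x \<in> T" for x
  proof -
    have xN: "x \<in> N" and xB: "x \<in> cbox a b" using x TN TB by auto
    obtain D D' where D: "(\<tau> has_derivative D) (at x)" "((snd c \<circ> chart_inv d) has_derivative D') (at (\<tau> x))"
      "D' \<circ> D = id" "D \<circ> D' = id"
      using tr(4)[OF xN] by blast
    have DD: "?D x = D" using frechet_derivative_at[OF D(1)] by simp
    have lin: "linear D" "linear D'" using D has_derivative_linear by auto
    have mat: "(*v) (matrix D) = D" "(*v) (matrix D') = D'" using matrix_works lin by auto
    let ?R = "P x ** matrix D'"
    have returns: "(snd c \<circ> chart_inv d) (\<tau> u) = u" if "u \<in> N" for u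
      using tr(3)[OF that] C(3)[of u] N(2) that by auto
    have "((Z \<circ> chart_inv c) \<circ> (snd c \<circ> chart_inv d) has_derivative (*v) (P x) \<circ> D') (at (\<tau> x))"
      by (rule diff_chain_at[OF D(2)]) (use Z[OF xB] returns[OF xN] in simp)
    then have "((Z \<circ> chart_inv d) has_derivative (*v) (P x) \<circ> D') (at (\<tau> x))"
    proof (rule has_derivative_transform_within_open[OF _ tr(2)])
      show "\<tau> x \<in> \<tau> ` N" using xN by simp
      fix y assume "y \<in> \<tau> ` N"
      then obtain u where u: "u \<in> N" "y = \<tau> u" by blast
      then show "((Z \<circ> chart_inv c) \<circ> (snd c \<circ> chart_inv d)) y = (Z \<circ> chart_inv d) y"
        using returns[OF u(1)] tr(3)[OF u(1)] by simp
    qed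
    moreover have "(*v) (P x) \<circ> D' = (*v) ?R"
      using mat(2) by (auto simp: fun_eq_iff simp flip: matrix_vector_mul_assoc)
    ultimately have ZR: "((Z \<circ> chart_inv d) has_derivative (*v) ?R) (at (\<tau> x))" by simp
    have QR: "?Q (\<tau> x) = ?R"
      using frechet_derivative_at[OF ZR] matrix_of_matrix_vector_mul[of ?R] by simp
    have inj: "inj D" "inj D'" using D(3,4) by (metis inj_on_id inj_on_imageI2)+
    have Rinj: "?R \<in> inj_mats" by (rule inj_mats_mult[OF P(2)[OF xB]]) (simp add: mat inj)
    have "matrix D' ** matrix D = mat 1"
      using matrix_compose[OF lin] D(3) by (simp add: matrix_id_mat_1)
    then have "?R ** matrix D = P x" by (simp flip: matrix_mul_assoc)
    then have jac: "jacobian D * sect_area \<Phi> ?R = sect_area \<Phi> (P x)"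
      using sect_area_mult[OF ph Rinj, of "matrix D"] mat inj by simp
    show ?thesis
      unfolding QR DD \<omega>_def using D(1) area_density_eq_sect_area[OF F S ZR Rinj] jac
        sect_area_pos[OF ph Rinj] \<Phi> by (simp add: less_imp_le mult.left_commute)
  qed
  have cont: "continuous_on (cbox a b) (\<lambda>u. \<omega> * sect_area \<Phi> (P u))"
    by (intro continuous_intros continuous_on_compose2[OF hd_imp_continuous[OF hd_sect_area[OF ph(1), of 0]] P(1)])
      (use P(2) ph(2) in auto)
  have "(\<lambda>u. \<omega> * sect_area \<Phi> (P u)) absolutely_integrable_on cbox a b"
    by (rule absolutely_integrable_continuous[OF cont])
  then have intP: "(\<lambda>u. \<omega> * sect_area \<Phi> (P u)) absolutely_integrable_on T"
    by (rule set_integrable_subset) (use E(2) TB in \<open>auto simp: T_def\<close>)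
  let ?f = "\<lambda>y. \<omega> * sect_area \<Phi> (?Q y)"
  have eqi: "jacobian (?D x) * ?f (\<tau> x) = \<omega> * sect_area \<Phi> (P x)" if "x \<in> T" for x
    using pt[OF that] by blast
  have int: "(\<lambda>x. jacobian (?D x) * ?f (\<tau> x)) absolutely_integrable_on T"
    by (subst set_integrable_cong[OF refl refl eqi]) (use intP in auto)
  have der: "(\<tau> has_derivative ?D x) (at x within T)" if "x \<in> T" for x
    using pt[OF that] has_derivative_at_withinI by blast
  have Tm: "T \<in> sets lebesgue" using E(2) by (simp add: T_def)
  have inj: "inj_on \<tau> T" using tr(1) TN inj_on_subset by blast
  note cov = change_of_variables[where f = ?f, OF Tm der inj int]
  have "(\<integral>\<^sup>+y\<in>\<tau> ` T. area_density F (Z \<circ> chart_inv d) y \<partial>lebesgue) = (\<integral>\<^sup>+y\<in>\<tau> ` T. ennreal (?f y) \<partial>lebesgue)"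
  proof (rule nn_integral_cong)
    fix y
    show "area_density F (Z \<circ> chart_inv d) y * indicator (\<tau> ` T) y = ennreal (?f y) * indicator (\<tau> ` T) y"
    proof (cases "y \<in> \<tau> ` T")
      case True
      then obtain x where "x \<in> T" "y = \<tau> x" by blast
      then show ?thesis using pt[of x] by simp
    qed simp
  qed
  also have "\<dots> = ennreal (integral (\<tau> ` T) ?f)"
  proof (rule nn_integral_absolutely_integrable[OF cov(1)])
    fix y assume "y \<in> \<tau> ` T"
    then obtain x where x: "x \<in> T" "y = \<tau> x" by blast
    have "0 \<le> sect_area \<Phi> (?Q (\<tau> x))" using pt[OF x(1)] by blast
    then show "0 \<le> ?f y" unfolding x(2) by (rule mult_nonneg_nonneg[OF \<omega>])
  qed
  also have "integral (\<tau> ` T) ?f = integral T (\<lambda>u. \<omega> * sect_area \<Phi> (P u))"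
    by (rule trans[OF cov(2)], assumption, rule integral_cong) (rule eqi)
  also have "ennreal \<dots> = (\<integral>\<^sup>+u\<in>T. ennreal (\<omega> * sect_area \<Phi> (P u)) \<partial>lebesgue)"
    by (rule nn_integral_absolutely_integrable[OF intP, symmetric])
      (rule mult_nonneg_nonneg[OF \<omega> less_imp_le[OF sect_area_pos[OF ph P(2)]]], use TB in blast)
  finally show ?thesis unfolding img T_def[symmetric] \<omega>_def .
qed

text \<open>The definition cuts the box into pieces that lie in different charts. Each piece is transported to the
  given chart, where the pieces are disjoint and fill the box.\<close>

lemma finsler_area_box:
  fixes F :: "real^'n \<Rightarrow> real^'n \<Rightarrow> real"
    and M :: "'a::{t2_space,second_countable_topology} set" and A :: "('a, 'm::finite) chart set"
    and P :: "real^'m \<Rightarrow> real^'m^'n" and Z :: "'a \<Rightarrow> real^'n"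
  assumes M: "oriented_manifold M A" and c: "c \<in> A"
    and F: "finsler_metric F" and S: "finsler_metric (harmonic_sym CARD('m) F)"
    and \<Phi>: "\<And>x. harmonic_sym CARD('m) F x = \<Phi>"
    and B: "cbox a b \<subseteq> interior (chart_image c)"
    and P: "continuous_on (cbox a b) P" "\<And>u. u \<in> cbox a b \<Longrightarrow> P u \<in> inj_mats"
    and Z: "\<And>u. u \<in> cbox a b \<Longrightarrow> ((Z \<circ> chart_inv c) has_derivative (*v) (P u)) (at u)"
  shows "finsler_area F A Z (chart_inv c ` cbox a b) =
    ennreal (ball_volume TYPE('m) * integral (cbox a b) (\<lambda>u. sect_area \<Phi> (P u)))"
proof -
  define \<omega> where "\<omega> = ball_volume TYPE('m)"
  let ?K = "chart_inv c ` cbox a b"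
  let ?U = "\<lambda>n. fst (chart_enum A n)"
  have ch: "is_chart M c" using M c by (auto simp: oriented_manifold_def)
  note C = chart_facts[OF ch]
  have Bc: "cbox a b \<subseteq> chart_image c" using B interior_subset by blast
  have inv: "snd c (chart_inv c u) = u" if "u \<in> cbox a b" for u using C(3) Bc that by blast
  have en: "chart_enum A n \<in> A" "(\<Union>n. ?U n) = M" for n using chart_enum[OF M] c by auto
  have chn: "is_chart M (chart_enum A n)" for n using en(1) M by (auto simp: oriented_manifold_def)
  have \<Phi>F: "finsler_metric (\<lambda>x. \<Phi>)" using S \<Phi> by (metis (no_types, lifting) ext)
  have ph: "pos_homogeneous \<Phi>" "continuous_on (- {0}) \<Phi>"
    using finsler_slice(2)[OF \<Phi>F] hd_imp_continuous[OF finsler_slice(1)[OF \<Phi>F, of 0]] by auto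
  define O' where "O' n = {u \<in> cbox a b. chart_inv c u \<in> ?U n}" for n
  define T where "T n = {u \<in> cbox a b. chart_inv c u \<in> disjointed ?U n}" for n
  have "O' n \<in> sets borel" for n
  proof -
    have "openin (top_of_set (cbox a b)) (cbox a b \<inter> chart_inv c -` ?U n)"
      by (rule continuous_openin_preimage[OF continuous_on_subset[OF C(5) Bc] _ chart_facts(6)[OF chn]])
        (use C(2,7) Bc in blast)
    then obtain W where "open W" "cbox a b \<inter> chart_inv c -` ?U n = cbox a b \<inter> W" by (auto simp: openin_open)
    moreover have "O' n = cbox a b \<inter> chart_inv c -` ?U n" by (auto simp: O'_def)
    ultimately show ?thesis by simp
  qed
  moreover have "T n = O' n - (\<Union>k<n. O' k)" for n
    unfolding T_def O'_def disjointed_def by auto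
  ultimately have Tb: "T n \<in> sets borel" for n by auto
  have img: "snd c ` (?K \<inter> disjointed ?U n) = T n" for n
  proof
    show "snd c ` (?K \<inter> disjointed ?U n) \<subseteq> T n" using inv by (auto simp: T_def)
    show "T n \<subseteq> snd c ` (?K \<inter> disjointed ?U n)"
    proof
      fix u assume "u \<in> T n"
      then have "u = snd c (chart_inv c u)" "chart_inv c u \<in> ?K \<inter> disjointed ?U n"
        using inv by (auto simp: T_def)
      then show "u \<in> snd c ` (?K \<inter> disjointed ?U n)" by (rule image_eqI)
    qed
  qed
  have disj: "disjoint_family T"
    using disjoint_family_disjointed[of ?U] by (auto simp: disjoint_family_on_def T_def)
  have "(\<Union>n. disjointed ?U n) = M" by (simp add: UN_disjointed_eq en(2))
  moreover have "chart_inv c u \<in> M" if "u \<in> cbox a b" for u using C(2,7) Bc that by blast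
  ultimately have un: "(\<Union>n. T n) = cbox a b" by (auto simp: T_def)
  let ?\<psi> = "\<lambda>u. ennreal (\<omega> * sect_area \<Phi> (P u)) * indicator (cbox a b) u"
  have cont: "continuous_on (cbox a b) (\<lambda>u. \<omega> * sect_area \<Phi> (P u))"
    by (intro continuous_intros continuous_on_compose2[OF hd_imp_continuous[OF hd_sect_area[OF ph(1), of 0]] P(1)])
      (use P(2) ph(2) in auto)
  have "(\<lambda>u. indicator (cbox a b) u *\<^sub>R (\<omega> * sect_area \<Phi> (P u))) \<in> borel_measurable borel"
    by (rule borel_measurable_continuous_on_indicator[OF _ cont]) simp
  then have "(\<lambda>u. ennreal (indicator (cbox a b) u *\<^sub>R (\<omega> * sect_area \<Phi> (P u)))) \<in> borel_measurable borel" by simp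
  moreover have "(\<lambda>u. ennreal (indicator (cbox a b) u *\<^sub>R (\<omega> * sect_area \<Phi> (P u)))) = ?\<psi>"
    by (auto simp: fun_eq_iff indicator_def)
  ultimately have \<psi>m: "?\<psi> \<in> borel_measurable lebesgue" by (simp add: measurable_completion)
  have piece: "(\<integral>\<^sup>+y\<in>snd (chart_enum A n) ` (?K \<inter> disjointed ?U n). area_density F (Z \<circ> chart_inv (chart_enum A n)) y \<partial>lebesgue)
      = emeasure (density lebesgue ?\<psi>) (T n)" for n
  proof -
    have Tl: "T n \<in> sets lebesgue" using Tb by simp
    have "?K \<inter> disjointed ?U n \<subseteq> ?K \<inter> ?U n" using disjointed_subset[of ?U n] by auto
    note sub = this
    have "(\<integral>\<^sup>+y\<in>snd (chart_enum A n) ` (?K \<inter> disjointed ?U n). area_density F (Z \<circ> chart_inv (chart_enum A n)) y \<partial>lebesgue)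
        = (\<integral>\<^sup>+u\<in>snd c ` (?K \<inter> disjointed ?U n). ennreal (\<omega> * sect_area \<Phi> (P u)) \<partial>lebesgue)"
      unfolding \<omega>_def
      by (rule area_chart_independent[OF M c en(1) F S \<Phi> B P Z sub]) (simp_all add: img Tl)
    also have "\<dots> = (\<integral>\<^sup>+u. ?\<psi> u * indicator (T n) u \<partial>lebesgue)"
      unfolding img by (rule nn_integral_cong) (auto simp: T_def indicator_def)
    also have "\<dots> = emeasure (density lebesgue ?\<psi>) (T n)" by (rule emeasure_density[OF \<psi>m Tl, symmetric])
    finally show ?thesis .
  qed
  have "finsler_area F A Z ?K = (\<Sum>n. emeasure (density lebesgue ?\<psi>) (T n))"
    unfolding finsler_area_def Let_def piece ..
  also have "\<dots> = emeasure (density lebesgue ?\<psi>) (\<Union>n. T n)"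
    by (rule suminf_emeasure[OF _ disj]) (use Tb in auto)
  also have "\<dots> = (\<integral>\<^sup>+u\<in>cbox a b. ennreal (\<omega> * sect_area \<Phi> (P u)) \<partial>lebesgue)"
    unfolding un by (subst emeasure_density[OF \<psi>m]) (auto intro!: nn_integral_cong simp: indicator_def)
  also have "\<dots> = ennreal (integral (cbox a b) (\<lambda>u. \<omega> * sect_area \<Phi> (P u)))"
    by (rule nn_integral_absolutely_integrable[OF absolutely_integrable_continuous[OF cont]])
      (use sect_area_pos[OF ph P(2)] in \<open>force simp: \<omega>_def intro!: mult_nonneg_nonneg less_imp_le\<close>)
  finally show ?thesis by (simp add: \<omega>_def)
qed

section \<open>The first variation\<close>

lemma manifold_measurable_chart_box:
  fixes M :: "'a::{t2_space,second_countable_topology} set" and A :: "('a, 'm::finite) chart set"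
  assumes M: "oriented_manifold M A" and c: "c \<in> A" and B: "cbox a b \<subseteq> interior (chart_image c)"
  shows "manifold_measurable A (chart_inv c ` cbox a b)"
  unfolding manifold_measurable_def
proof (intro conjI ballI)
  have ch: "is_chart M c" using M c by (auto simp: oriented_manifold_def)
  note C = chart_facts[OF ch]
  have Bc: "cbox a b \<subseteq> chart_image c" using B interior_subset by blast
  show "chart_inv c ` cbox a b \<subseteq> (\<Union>c\<in>A. fst c)"
  proof
    fix p assume "p \<in> chart_inv c ` cbox a b"
    then obtain u where "u \<in> cbox a b" "p = chart_inv c u" by blast
    then have "p \<in> fst c" using C(2)[of u] Bc by blast
    then show "p \<in> (\<Union>c\<in>A. fst c)" using c by blast
  qed
  fix d assume d: "d \<in> A"
  then have chd: "is_chart M d" using M by (auto simp: oriented_manifold_def)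
  define N where "N = interior (chart_image c) \<inter> chart_inv c -` fst d"
  have N: "open N" "N \<subseteq> chart_image c" "chart_inv c ` N \<subseteq> fst d"
    unfolding N_def using open_chart_overlap[OF ch chd open_interior interior_subset] interior_subset by auto
  note tr = transition[OF M c d N]
  have "(snd d \<circ> chart_inv c) differentiable_on (cbox a b \<inter> N)"
    unfolding differentiable_on_def
  proof
    fix x assume "x \<in> cbox a b \<inter> N"
    then obtain D where "(snd d \<circ> chart_inv c has_derivative D) (at x)" using tr(4)[of x] by blast
    then show "(snd d \<circ> chart_inv c) differentiable at x within cbox a b \<inter> N"
      using has_derivative_at_withinI differentiableI by blast
  qed
  moreover have "cbox a b \<inter> N \<in> sets lebesgue" using N(1) by simp
  ultimately have "(snd d \<circ> chart_inv c) ` (cbox a b \<inter> N) \<in> sets lebesgue"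
    by (intro differentiable_image_in_sets_lebesgue) auto
  moreover have "(snd d \<circ> chart_inv c) ` (cbox a b \<inter> N) = snd d ` (chart_inv c ` cbox a b \<inter> fst d)"
    using B by (auto simp: N_def)
  ultimately show "snd d ` (chart_inv c ` cbox a b \<inter> fst d) \<in> sets lebesgue" by simp
qed

lemma chart_box_interior:
  fixes M :: "'a::{t2_space,second_countable_topology} set" and A :: "('a, 'm::finite) chart set"
  assumes M: "oriented_manifold M A" and c: "c \<in> A" and B: "cbox a b \<subseteq> interior (chart_image c)"
  shows "compact (chart_inv c ` cbox a b)" "chart_inv c ` cbox a b \<subseteq> manifold_interior A"
proof -
  have ch: "is_chart M c" using M c by (auto simp: oriented_manifold_def)
  note C = chart_facts[OF ch]
  have Bc: "cbox a b \<subseteq> chart_image c" using B interior_subset by blast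
  show "compact (chart_inv c ` cbox a b)"
    by (intro compact_continuous_image continuous_on_subset[OF C(5) Bc] compact_cbox)
  show "chart_inv c ` cbox a b \<subseteq> manifold_interior A"
  proof
    fix p assume "p \<in> chart_inv c ` cbox a b"
    then obtain u where u: "u \<in> cbox a b" "p = chart_inv c u" by blast
    then have "p \<in> fst c" "snd c p = u" using C(2,3)[of u] Bc by auto
    then show "p \<in> manifold_interior A" using u(1) B c by (auto simp: manifold_interior_def)
  qed
qed

definition bump_displacement ::
  "('a, 'm::finite) chart \<Rightarrow> (real^'m) set \<Rightarrow> real^'m \<Rightarrow> real \<Rightarrow> real^'n \<Rightarrow> real \<Rightarrow> 'a \<Rightarrow> real^'n" where
  "bump_displacement c B x0 r w t p =
     (if p \<in> chart_inv c ` B then (t * bump x0 r (snd c p)) *\<^sub>R w else 0)"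

text \<open>In another chart the displacement is, near a point of the box, the composition of the bump with
  a smooth extension of the transition map, and it vanishes away from the support of the bump.\<close>

lemma smooth_variation_bump:
  fixes M :: "'a::{t2_space,second_countable_topology} set" and A :: "('a, 'm::finite) chart set"
    and w :: "real^'n"
  assumes M: "oriented_manifold M A" and c: "c \<in> A" and B: "cbox a b \<subseteq> interior (chart_image c)"
    and r: "0 < r" "cball x0 r \<subseteq> box a b"
  shows "smooth_variation A 1 (chart_inv c ` cbox a b) (bump_displacement c (cbox a b) x0 r w)"
  unfolding smooth_variation_def
proof (intro conjI allI impI ballI)
  let ?\<zeta> = "bump_displacement c (cbox a b) x0 r w"
  have ch: "is_chart M c" using M c by (auto simp: oriented_manifold_def)
  note C = chart_facts[OF ch]
  have Bc: "cbox a b \<subseteq> chart_image c" using B interior_subset by blast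
  have boxc: "box a b \<subseteq> chart_image c" using Bc box_subset_cbox by blast
  show "compact (chart_inv c ` cbox a b)" "chart_inv c ` cbox a b \<subseteq> manifold_interior A"
    by (rule chart_box_interior[OF M c B])+
  show "?\<zeta> 0 p = 0" for p by (simp add: bump_displacement_def)
  show "?\<zeta> t p = 0" if "p \<notin> chart_inv c ` cbox a b" for t p using that by (simp add: bump_displacement_def)
  fix d assume d: "d \<in> A"
  then have chd: "is_chart M d" using M by (auto simp: oriented_manifold_def)
  note D = chart_facts[OF chd]
  let ?f = "\<lambda>z. ?\<zeta> (fst z) (chart_inv d (snd z))"
  show "smooth_on ({- 1<..<1} \<times> interior (chart_image d)) ?f"
    unfolding smooth_on_def
  proof (intro allI hd_local)
    fix k and z :: "real \<times> (real^'m)" assume "z \<in> {- 1<..<1} \<times> interior (chart_image d)"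
    then obtain t y where z: "z = (t, y)" "y \<in> interior (chart_image d)" by blast
    then have y: "y \<in> chart_image d" using interior_subset by blast
    show "\<exists>V. open V \<and> z \<in> V \<and> hd_on V ?f k"
    proof (cases "chart_inv d y \<in> chart_inv c ` box a b")
      case True
      then obtain u where u: "u \<in> box a b" "chart_inv d y = chart_inv c u" by blast
      define N where "N = box a b \<inter> chart_inv c -` fst d"
      have N: "open N" "N \<subseteq> chart_image c" "chart_inv c ` N \<subseteq> fst d"
        unfolding N_def using open_chart_overlap[OF ch chd open_box boxc] boxc by auto
      note tr = transition[OF M c d N]
      have "u \<in> N" using u D(2)[OF y] by (simp add: N_def)
      moreover have "(snd d \<circ> chart_inv c) u = y" using u(2) D(3)[OF y] by simp
      ultimately have y\<tau>: "y \<in> (snd d \<circ> chart_inv c) ` N" by (metis imageI)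
      have sub: "(snd d \<circ> chart_inv c) ` N \<subseteq> snd d ` (fst d \<inter> fst c)"
      proof (rule image_subsetI)
        fix u' assume "u' \<in> N"
        then have "chart_inv c u' \<in> fst d \<inter> fst c" using N(2,3) C(2)[of u'] by blast
        then show "(snd d \<circ> chart_inv c) u' \<in> snd d ` (fst d \<inter> fst c)" by simp
      qed
      have "smooth_within (snd d ` (fst d \<inter> fst c)) (snd c \<circ> chart_inv d)"
        using M c d by (simp add: oriented_manifold_def oriented_compatible_def Let_def)
      from this[unfolded smooth_within_def, rule_format, OF subsetD[OF sub y\<tau>]]
      obtain V h where V: "open V" "y \<in> V" "smooth_on V h"
        "\<And>y'. y' \<in> V \<inter> snd d ` (fst d \<inter> fst c) \<Longrightarrow> h y' = (snd c \<circ> chart_inv d) y'"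
        by blast
      let ?V = "UNIV \<times> (V \<inter> (snd d \<circ> chart_inv c) ` N) :: (real \<times> (real^'m)) set"
      have op: "open ?V" using V(1) tr(2) by (intro open_Times open_UNIV open_Int)
      have "hd_on ?V (\<lambda>z. h (snd z)) k"
        by (rule hd_compose[OF op V(1) hd_linear[OF bounded_linear_snd]])
          (use V(3) in \<open>auto simp: smooth_on_def\<close>)
      then have "hd_on ?V (\<lambda>z. bump x0 r (h (snd z))) k"
        by (rule hd_compose[OF op open_UNIV _ hd_bump]) auto
      then have "hd_on ?V (\<lambda>z. (fst z * bump x0 r (h (snd z))) *\<^sub>R w) k"
        by (intro hd_scaleR hd_mult op hd_const hd_linear[OF bounded_linear_fst])
      then have "hd_on ?V ?f k"
      proof (rule hd_cong[OF op, rotated])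
        fix z' :: "real \<times> (real^'m)" assume "z' \<in> ?V"
        then obtain t' u' where z': "z' = (t', (snd d \<circ> chart_inv c) u')" "u' \<in> N" "(snd d \<circ> chart_inv c) u' \<in> V"
          by (cases z') auto
        have back': "chart_inv d ((snd d \<circ> chart_inv c) u') = chart_inv c u'" by (rule tr(3)[OF z'(2)])
        have u'c: "snd c (chart_inv c u') = u'" using C(3)[of u'] N(2) z'(2) by auto
        have "h ((snd d \<circ> chart_inv c) u') = (snd c \<circ> chart_inv d) ((snd d \<circ> chart_inv c) u')"
          by (rule V(4)) (use sub z' in blast)
        also have "\<dots> = u'" using back' u'c by simp
        finally have h: "h ((snd d \<circ> chart_inv c) u') = u'" .
        have "u' \<in> cbox a b" using z'(2) box_subset_cbox by (auto simp: N_def)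
        then show "(fst z' * bump x0 r (h (snd z'))) *\<^sub>R w = ?f z'"
          using back' u'c h unfolding z'(1) bump_displacement_def by simp
      qed
      then show ?thesis using op V(2) y\<tau> z(1) by (intro exI[of _ ?V]) simp
    next
      case False
      have cb: "cball x0 r \<subseteq> chart_image c" using r(2) boxc by blast
      have "compact (chart_inv c ` cball x0 r)"
        by (intro compact_continuous_image continuous_on_subset[OF C(5) cb] compact_cball)
      then have "open (- chart_inv c ` cball x0 r)" using compact_imp_closed by blast
      then have "openin (top_of_set (interior (chart_image d)))
          (interior (chart_image d) \<inter> chart_inv d -` (- chart_inv c ` cball x0 r))"
        by (rule continuous_openin_preimage_gen[OF continuous_on_subset[OF D(5) interior_subset]])
      then have opW: "open (interior (chart_image d) \<inter> chart_inv d -` (- chart_inv c ` cball x0 r))" (is "open ?W")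
        using openin_open_eq[OF open_interior] by blast
      have op: "open (UNIV \<times> ?W :: (real \<times> (real^'m)) set)" using opW by (intro open_Times open_UNIV)
      have "hd_on (UNIV \<times> ?W) ?f k"
      proof (rule hd_cong[OF op _ hd_const[of _ 0]])
        fix z' :: "real \<times> (real^'m)" assume "z' \<in> UNIV \<times> ?W"
        then have W: "chart_inv d (snd z') \<notin> chart_inv c ` cball x0 r" by auto
        show "0 = ?f z'"
        proof (cases "chart_inv d (snd z') \<in> chart_inv c ` cbox a b")
          case True
          then obtain u where u: "u \<in> cbox a b" "chart_inv d (snd z') = chart_inv c u" by blast
          then have "u \<notin> ball x0 r" using W by auto
          moreover have "snd c (chart_inv c u) = u" using C(3) u(1) Bc by blast
          ultimately show ?thesis using bump_eq_0[OF r(1), of u x0] by (simp add: bump_displacement_def u)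
        qed (simp add: bump_displacement_def)
      qed
      moreover have "y \<in> ?W" using z(2) False r(2) by auto
      ultimately show ?thesis using op z(1) by (intro exI[of _ "UNIV \<times> ?W"]) simp
    qed
  qed
qed

definition grad :: "(real^'m \<Rightarrow> real) \<Rightarrow> real^'m \<Rightarrow> real^'m" where
  "grad \<phi> u = (\<chi> i. frechet_derivative \<phi> (at u) (axis i 1))"

lemma grad_inner:
  assumes "(\<phi> has_derivative D) (at u)" shows "grad \<phi> u \<bullet> v = D v"
proof -
  have D: "frechet_derivative \<phi> (at u) = D" using frechet_derivative_at[OF assms] by simp
  have "linear D" using assms has_derivative_linear by blast
  from linear_axis_expansion[OF this, of v] show ?thesis
    unfolding grad_def D by (simp add: inner_vec_def mult.commute)
qed

lemma continuous_on_grad: "hd_on S \<phi> (Suc 0) \<Longrightarrow> continuous_on S (grad \<phi>)"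
  unfolding grad_def[abs_def] by (intro continuous_on_vec_lambda) simp

lemma darea_dyad_expansion:
  assumes "pos_homogeneous f" "hd_on (- {0}) f 1" "P \<in> inj_mats"
  shows "darea f P (dyad w x) = (\<Sum>k\<in>UNIV. x $ k * darea f P (dyad w (axis k 1)))"
  by (subst dyad_expansion)
    (simp add: linear_sum[OF darea_linear[OF assms]] linear_scale[OF darea_linear[OF assms]])

lemma continuous_on_dyad: "continuous_on S x \<Longrightarrow> continuous_on S (\<lambda>u. dyad w (x u))"
  unfolding dyad_def by (intro continuous_on_vec_lambda continuous_intros) auto

lemma continuous_on_darea_dyad:
  fixes P :: "'a::topological_space \<Rightarrow> real^'m^'n" and x :: "'a \<Rightarrow> real^'m"
  assumes f: "pos_homogeneous f" "hd_on (- {0}) f 1"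
    and P: "continuous_on S P" "P ` S \<subseteq> inj_mats" and x: "continuous_on S x"
  shows "continuous_on S (\<lambda>z. darea f (P z) (dyad w (x z)))"
proof -
  have cd: "continuous_on inj_mats (\<lambda>R. darea f R V)" for V :: "real^'m^'n"
  proof -
    have "hd_on inj_mats (sect_area f :: real^'m^'n \<Rightarrow> real) (Suc 0)" using hd_sect_area[OF f] by simp
    then show ?thesis by (simp add: darea_def)
  qed
  have "continuous_on S (\<lambda>z. \<Sum>k\<in>UNIV. x z $ k * darea f (P z) (dyad w (axis k 1)))"
    by (intro continuous_intros continuous_on_compose2[OF cd P] continuous_on_component x)
  then show ?thesis
    by (rule continuous_on_eq) (rule darea_dyad_expansion[OF f, symmetric], use P(2) in blast)
qed

text \<open>The derivative of the area under a displacement \<open>t \<phi> w\<close>: the derivative matrix changes by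
  \<open>t w (\<nabla>\<phi>)\<^sup>T\<close>.\<close>

lemma first_variation_integral:
  fixes P :: "real^'m \<Rightarrow> real^'m^'n" and x :: "real^'m \<Rightarrow> real^'m"
  assumes f: "pos_homogeneous f" "hd_on (- {0}) f 1"
    and P: "continuous_on (cbox a b) P" "P ` cbox a b \<subseteq> inj_mats" and x: "continuous_on (cbox a b) x"
  obtains \<delta> where "0 < \<delta>" "\<And>t u. \<bar>t\<bar> < \<delta> \<Longrightarrow> u \<in> cbox a b \<Longrightarrow> P u + t *\<^sub>R dyad w (x u) \<in> inj_mats"
    "((\<lambda>t. integral (cbox a b) (\<lambda>u. sect_area f (P u + t *\<^sub>R dyad w (x u)))) has_real_derivative
      integral (cbox a b) (\<lambda>u. darea f (P u) (dyad w (x u)))) (at 0)"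
proof -
  let ?Q = "\<lambda>u. dyad w (x u)"
  have cQ: "continuous_on (cbox a b) ?Q" by (rule continuous_on_dyad[OF x])
  obtain \<epsilon> where \<epsilon>: "0 < \<epsilon>" "(\<Union>R\<in>P ` cbox a b. ball R \<epsilon>) \<subseteq> inj_mats"
    by (rule compact_subset_open_imp_ball_epsilon_subset[OF compact_continuous_image[OF P(1) compact_cbox] open_inj_mats P(2)])
  have "bounded (?Q ` cbox a b)" by (intro compact_imp_bounded compact_continuous_image cQ compact_cbox)
  then obtain C where C: "0 < C" "\<And>u. u \<in> cbox a b \<Longrightarrow> norm (?Q u) \<le> C" by (auto simp: bounded_pos)
  define \<delta> where "\<delta> = \<epsilon> / C"
  have \<delta>: "0 < \<delta>" using \<epsilon>(1) C(1) by (simp add: \<delta>_def)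
  have inj: "P u + t *\<^sub>R ?Q u \<in> inj_mats" if t: "\<bar>t\<bar> < \<delta>" and u: "u \<in> cbox a b" for t u
  proof -
    have "\<bar>t\<bar> * norm (?Q u) \<le> \<bar>t\<bar> * C" using C(2)[OF u] by (rule mult_left_mono) simp
    also have "\<dots> < \<epsilon>" using t C(1) by (simp add: \<delta>_def pos_less_divide_eq)
    finally have "P u + t *\<^sub>R ?Q u \<in> ball (P u) \<epsilon>" by (simp add: dist_norm)
    then show ?thesis using \<epsilon>(2) u by blast
  qed
  let ?U = "{- \<delta><..<\<delta>}"
  have U: "\<bar>t\<bar> < \<delta>" if "t \<in> ?U" for t using that by auto
  have hs: "hd_on inj_mats (sect_area f :: real^'m^'n \<Rightarrow> real) (Suc 0)" using hd_sect_area[OF f] by simp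
  have cP: "continuous_on (?U \<times> cbox a b) (\<lambda>z. P (snd z) + fst z *\<^sub>R ?Q (snd z))"
    by (intro continuous_intros continuous_on_compose2[OF P(1)] continuous_on_compose2[OF cQ]) auto
  have Pin: "(\<lambda>z. P (snd z) + fst z *\<^sub>R ?Q (snd z)) ` (?U \<times> cbox a b) \<subseteq> inj_mats"
    using inj U by auto
  have "((\<lambda>t. integral (cbox a b) (\<lambda>u. sect_area f (P u + t *\<^sub>R ?Q u))) has_real_derivative
      integral (cbox a b) (\<lambda>u. darea f (P u + 0 *\<^sub>R ?Q u) (?Q u))) (at 0 within ?U)"
  proof (rule leibniz_rule_field_derivative[where f = "\<lambda>t u. sect_area f (P u + t *\<^sub>R ?Q u)"
        and fx = "\<lambda>t u. darea f (P u + t *\<^sub>R ?Q u) (?Q u)" and U = ?U])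
    fix t u assume t: "t \<in> ?U" and u: "u \<in> cbox a b"
    show "((\<lambda>t. sect_area f (P u + t *\<^sub>R ?Q u)) has_real_derivative darea f (P u + t *\<^sub>R ?Q u) (?Q u)) (at t within ?U)"
      by (rule has_field_derivative_at_within[OF darea_line[OF f inj[OF U[OF t] u]]])
  next
    fix t assume t: "t \<in> ?U"
    show "(\<lambda>u. sect_area f (P u + t *\<^sub>R ?Q u)) integrable_on cbox a b"
      by (rule integrable_continuous, rule continuous_on_compose2[OF hd_imp_continuous[OF hs]])
        (use inj U[OF t] in \<open>auto intro!: continuous_intros P(1) cQ\<close>)
  next
    show "continuous_on (?U \<times> cbox a b) (\<lambda>(t, u). darea f (P u + t *\<^sub>R ?Q u) (?Q u))"
      unfolding split_beta
      by (rule continuous_on_darea_dyad[OF f cP Pin]) (auto intro!: continuous_on_compose2[OF x] continuous_intros)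
  qed (use \<delta> in auto)
  then have "((\<lambda>t. integral (cbox a b) (\<lambda>u. sect_area f (P u + t *\<^sub>R ?Q u))) has_real_derivative
      integral (cbox a b) (\<lambda>u. darea f (P u) (?Q u))) (at 0)"
    using at_within_open[of 0 ?U] \<delta> by simp
  with \<delta> inj that show ?thesis by blast
qed

lemma first_variation_bump:
  fixes F :: "real^'n \<Rightarrow> real^'n \<Rightarrow> real"
    and M :: "'a::{t2_space,second_countable_topology} set" and A :: "('a, 'm::finite) chart set"
    and X :: "'a \<Rightarrow> real^'n"
  assumes M: "oriented_manifold M A" and c: "c \<in> A"
    and F: "finsler_metric F" and S: "finsler_metric (harmonic_sym CARD('m) F)"
    and \<Phi>: "\<And>x. harmonic_sym CARD('m) F x = \<Phi>"
    and B: "cbox a b \<subseteq> interior (chart_image c)"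
    and X: "finsler_minimal F A X" and r: "0 < r" "cball x0 r \<subseteq> box a b"
  defines "P \<equiv> \<lambda>u. matrix (frechet_derivative (X \<circ> chart_inv c) (at u))"
  shows "integral (cbox a b) (\<lambda>u. darea \<Phi> (P u) (dyad w (grad (bump x0 r) u))) = 0"
proof -
  define \<omega> where "\<omega> = ball_volume TYPE('m)"
  have \<omega>: "0 < \<omega>" by (simp add: \<omega>_def)
  let ?O = "interior (chart_image c)" and ?Y = "X \<circ> chart_inv c" and ?g = "grad (bump x0 r)"
  let ?K = "chart_inv c ` cbox a b" and ?\<zeta> = "bump_displacement c (cbox a b) x0 r w"
  have ch: "is_chart M c" using M c by (auto simp: oriented_manifold_def)
  note C = chart_facts[OF ch]
  have Bc: "cbox a b \<subseteq> chart_image c" using B interior_subset by blast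
  have \<Phi>F: "finsler_metric (\<lambda>x. \<Phi>)" using S \<Phi> by (metis (no_types, lifting) ext)
  have ph: "pos_homogeneous \<Phi>" "hd_on (- {0}) \<Phi> 1"
    using finsler_slice(2)[OF \<Phi>F] finsler_slice(1)[OF \<Phi>F, of 1] by auto
  have im: "hd_on ?O ?Y 2" "\<And>u. u \<in> ?O \<Longrightarrow> inj (frechet_derivative ?Y (at u))"
    using X c by (auto simp: finsler_minimal_def C2_immersion_def)
  have Y: "(?Y has_derivative frechet_derivative ?Y (at u)) (at u)" if "u \<in> ?O" for u
    using hd_SucE[of ?O ?Y 1 u] im(1) that by (simp add: numeral_2_eq_2)
  have PY: "(*v) (P u) = frechet_derivative ?Y (at u)" if "u \<in> ?O" for u
  proof -
    have "linear (frechet_derivative ?Y (at u))" using Y[OF that] has_derivative_linear by blast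
    then show ?thesis unfolding P_def using matrix_works by auto
  qed
  have Pinj: "P ` cbox a b \<subseteq> inj_mats" using im(2) PY B by (auto simp: inj_mats_def)
  have "hd_on ?O (\<lambda>u. frechet_derivative ?Y (at u) v) 1" for v using im(1) by (simp add: numeral_2_eq_2)
  then have "continuous_on ?O P"
    unfolding P_def matrix_def using hd_imp_continuous
    by (intro continuous_on_vec_lambda continuous_on_component) blast
  then have Pcont: "continuous_on (cbox a b) P" using B continuous_on_subset by blast
  have gcont: "continuous_on (cbox a b) ?g"
    using continuous_on_grad[OF hd_bump] continuous_on_subset by blast
  obtain \<delta> where \<delta>: "0 < \<delta>" "\<And>t u. \<bar>t\<bar> < \<delta> \<Longrightarrow> u \<in> cbox a b \<Longrightarrow> P u + t *\<^sub>R dyad w (?g u) \<in> inj_mats"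
    "((\<lambda>t. integral (cbox a b) (\<lambda>u. sect_area \<Phi> (P u + t *\<^sub>R dyad w (?g u)))) has_real_derivative
      integral (cbox a b) (\<lambda>u. darea \<Phi> (P u) (dyad w (?g u)))) (at 0)"
    by (rule first_variation_integral[OF ph Pcont Pinj gcont, of w]) (rule that; assumption)
  let ?I = "\<lambda>t. integral (cbox a b) (\<lambda>u. sect_area \<Phi> (P u + t *\<^sub>R dyad w (?g u)))"
  have shift: "((\<lambda>p. X p + ?\<zeta> t p) \<circ> chart_inv c) u = ?Y u + (t * bump x0 r u) *\<^sub>R w" if u: "u \<in> ?O" for t u
  proof -
    have uc: "u \<in> chart_image c" using u interior_subset by blast
    have "bump x0 r u = 0" if "chart_inv c u \<notin> ?K"
    proof -
      have "u \<notin> cbox a b" using that by blast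
      then have "u \<notin> ball x0 r" using r(2) box_subset_cbox ball_subset_cball by blast
      then show ?thesis by (rule bump_eq_0[OF r(1)])
    qed
    then show ?thesis using C(3)[OF uc] by (simp add: bump_displacement_def)
  qed
  have der: "((\<lambda>p. X p + ?\<zeta> t p) \<circ> chart_inv c has_derivative (*v) (P u + t *\<^sub>R dyad w (?g u))) (at u)"
    if u: "u \<in> ?O" for t u
  proof -
    have b: "(bump x0 r has_derivative frechet_derivative (bump x0 r) (at u)) (at u)"
      using hd_SucE[OF hd_bump[where k = "Suc 0"]] by simp
    have "((\<lambda>u. ?Y u + (t * bump x0 r u) *\<^sub>R w) has_derivative
        (\<lambda>v. frechet_derivative ?Y (at u) v + (t * frechet_derivative (bump x0 r) (at u) v) *\<^sub>R w)) (at u)"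
      by (rule has_derivative_add[OF Y[OF u]
            has_derivative_scaleR_left[OF has_derivative_mult_right[OF b]]])
    moreover have "(\<lambda>v. frechet_derivative ?Y (at u) v + (t * frechet_derivative (bump x0 r) (at u) v) *\<^sub>R w) =
        (*v) (P u + t *\<^sub>R dyad w (?g u))"
      by (simp add: fun_eq_iff matrix_vector_mult_add_rdistrib scaleR_matrix_vector_assoc[symmetric]
          dyad_mult grad_inner[OF b] PY[OF u])
    ultimately have "((\<lambda>u. ?Y u + (t * bump x0 r u) *\<^sub>R w) has_derivative (*v) (P u + t *\<^sub>R dyad w (?g u))) (at u)"
      by simp
    then show ?thesis
      by (rule has_derivative_transform_within_open[OF _ open_interior u]) (simp only: shift)
  qed
  have area: "enn2real (finsler_area F A (\<lambda>p. X p + ?\<zeta> t p) ?K) = \<omega> * ?I t" if t: "\<bar>t\<bar> < \<delta>" for t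
  proof -
    have "finsler_area F A (\<lambda>p. X p + ?\<zeta> t p) ?K = ennreal (\<omega> * ?I t)"
      unfolding \<omega>_def
    proof (rule finsler_area_box[OF M c F S \<Phi> B])
      show "continuous_on (cbox a b) (\<lambda>u. P u + t *\<^sub>R dyad w (?g u))"
        by (intro continuous_intros Pcont continuous_on_dyad gcont)
    qed (use \<delta>(2)[OF t] der B in auto)
    moreover have "0 \<le> ?I t"
    proof (rule integral_nonneg)
      show "(\<lambda>u. sect_area \<Phi> (P u + t *\<^sub>R dyad w (?g u))) integrable_on cbox a b"
        by (rule integrable_continuous, rule continuous_on_compose2[OF hd_imp_continuous[OF hd_sect_area[OF ph]]])
          (use \<delta>(2)[OF t] in \<open>auto intro!: continuous_intros Pcont continuous_on_dyad gcont\<close>)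
      show "0 \<le> sect_area \<Phi> (P u + t *\<^sub>R dyad w (?g u))" if "u \<in> cbox a b" for u
        using sect_area_pos[OF ph(1) hd_imp_continuous[OF ph(2)] \<delta>(2)[OF t that]] by simp
    qed
    ultimately show ?thesis using \<omega> by (simp add: enn2real_ennreal)
  qed
  have "((\<lambda>t. enn2real (finsler_area F A (\<lambda>p. X p + ?\<zeta> t p) ?K)) has_real_derivative 0) (at 0)"
    using X smooth_variation_bump[OF M c B r, of w] manifold_measurable_chart_box[OF M c B]
      chart_box_interior[OF M c B]
    unfolding finsler_minimal_def critical_for_area_def by (meson order_refl zero_less_one)
  then have "((\<lambda>t. \<omega> * ?I t) has_real_derivative 0) (at 0)"
  proof (rule has_field_derivative_transform_within_open)
    show "open {- \<delta><..<\<delta>}" by simp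
  qed (use area \<delta>(1) in auto)
  moreover have "((\<lambda>t. \<omega> * ?I t) has_real_derivative \<omega> * integral (cbox a b) (\<lambda>u. darea \<Phi> (P u) (dyad w (?g u)))) (at 0)"
    by (rule DERIV_cmult[OF \<delta>(3)])
  ultimately show ?thesis using \<omega> DERIV_unique by fastforce
qed

lemma hd_darea_field:
  fixes P :: "real^'m \<Rightarrow> real^'m^'n" and Y :: "real^'m \<Rightarrow> real^'n"
  assumes f: "pos_homogeneous f" "hd_on (- {0}) f 2" and S: "open S" and Y: "hd_on S Y 2"
  defines "P \<equiv> \<lambda>u. matrix (frechet_derivative Y (at u))"
  assumes inj: "P ` S \<subseteq> inj_mats"
  shows "hd_on S (\<lambda>u. \<Sum>k\<in>UNIV. darea f (P u) (dyad w (axis k 1)) *\<^sub>R axis k 1 :: real^'m) 1"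
proof -
  let ?L = "\<lambda>u k. dyad (frechet_derivative Y (at u) (axis k 1)) (axis k 1 :: real^'m) :: real^'m^'n"
  have PL: "P u = (\<Sum>k\<in>UNIV. ?L u k)" for u
    by (simp add: P_def vec_eq_iff matrix_def dyad_def axis_def if_distrib cong: if_cong)
  have bl: "bounded_linear (\<lambda>w. dyad w (axis k 1 :: real^'m) :: real^'m^'n)" for k
    unfolding linear_conv_bounded_linear[symmetric]
    by (rule linearI) (simp_all add: dyad_add_left dyad_scaleR_left)
  have dY: "hd_on S (\<lambda>u. frechet_derivative Y (at u) v) 1" for v
    using Y by (simp add: numeral_2_eq_2)
  have "hd_on S (\<lambda>u. ?L u k) 1" for k
    by (rule hd_compose[OF S open_UNIV dY hd_linear[OF bl]]) simp
  then have "hd_on S (\<lambda>u. \<Sum>k\<in>UNIV. ?L u k) 1" by (intro hd_sum[OF S])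
  then have hP: "hd_on S P 1" by (simp only: PL[symmetric])
  have hs: "hd_on inj_mats (sect_area f :: real^'m^'n \<Rightarrow> real) 2" by (rule hd_sect_area[OF f])
  have "hd_on inj_mats (\<lambda>R. darea f R V) 1" for V :: "real^'m^'n"
    using hs by (simp add: darea_def numeral_2_eq_2)
  then have "hd_on S (\<lambda>u. darea f (P u) V) 1" for V :: "real^'m^'n"
    by (rule hd_compose[OF S open_inj_mats hP _ inj])
  then show ?thesis by (intro hd_sum[OF S] hd_scaleR S hd_const)
qed

text \<open>The field paired with the gradient in the first variation is differentiable, so it is
  divergence free and the test functions need only be continuously differentiable.\<close>

lemma first_variation_C1:
  fixes F :: "real^'n \<Rightarrow> real^'n \<Rightarrow> real"
    and M :: "'a::{t2_space,second_countable_topology} set" and A :: "('a, 'm::finite) chart set"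
    and X :: "'a \<Rightarrow> real^'n"
  assumes M: "oriented_manifold M A" and c: "c \<in> A"
    and F: "finsler_metric F" and S: "finsler_metric (harmonic_sym CARD('m) F)"
    and \<Phi>: "\<And>x. harmonic_sym CARD('m) F x = \<Phi>"
    and B: "cbox a b \<subseteq> interior (chart_image c)" and X: "finsler_minimal F A X"
    and \<phi>: "\<And>u. (\<phi> has_derivative D u) (at u)" "\<And>v. continuous_on UNIV (\<lambda>u. D u v)"
    and K: "compact K" "K \<subseteq> box a b" "\<And>u. u \<notin> K \<Longrightarrow> \<phi> u = 0"
  defines "P \<equiv> \<lambda>u. matrix (frechet_derivative (X \<circ> chart_inv c) (at u))"
  shows "integral (cbox a b) (\<lambda>u. darea \<Phi> (P u) (dyad w (grad \<phi> u))) = 0"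
proof -
  let ?O = "interior (chart_image c)" and ?Y = "X \<circ> chart_inv c"
  have \<Phi>F: "finsler_metric (\<lambda>x. \<Phi>)" using S \<Phi> by (metis (no_types, lifting) ext)
  have ph: "pos_homogeneous \<Phi>" "hd_on (- {0}) \<Phi> 1" "hd_on (- {0}) \<Phi> 2"
    using finsler_slice(2)[OF \<Phi>F] finsler_slice(1)[OF \<Phi>F, of 1] finsler_slice(1)[OF \<Phi>F, of 2] by auto
  have im: "hd_on ?O ?Y 2" "\<And>u. u \<in> ?O \<Longrightarrow> inj (frechet_derivative ?Y (at u))"
    using X c by (auto simp: finsler_minimal_def C2_immersion_def)
  have Pinj: "P u \<in> inj_mats" if "u \<in> ?O" for u
  proof -
    have "(?Y has_derivative frechet_derivative ?Y (at u)) (at u)"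
      using hd_SucE[of ?O ?Y 1 u] im(1) that by (simp add: numeral_2_eq_2)
    then have "linear (frechet_derivative ?Y (at u))" using has_derivative_linear by blast
    then have "(*v) (P u) = frechet_derivative ?Y (at u)" unfolding P_def using matrix_works by auto
    then show ?thesis using im(2)[OF that] by (simp add: inj_mats_def)
  qed
  define G :: "real^'m \<Rightarrow> real^'m" where
    "G u = (\<Sum>k\<in>UNIV. darea \<Phi> (P u) (dyad w (axis k 1)) *\<^sub>R axis k 1)" for u
  have G: "hd_on ?O G 1"
    using hd_darea_field[OF ph(1,3) open_interior im(1), of w] Pinj unfolding G_def P_def by auto
  have pair: "D' (G u) = darea \<Phi> (P u) (dyad w (grad \<psi> u))"
    if u: "u \<in> cbox a b" and d: "(\<psi> has_derivative D') (at u)" for \<psi> D' u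
  proof -
    have Pu: "P u \<in> inj_mats" using Pinj u B by blast
    have "D' (G u) = grad \<psi> u \<bullet> G u" by (rule grad_inner[OF d, symmetric])
    also have "\<dots> = (\<Sum>k\<in>UNIV. grad \<psi> u $ k * darea \<Phi> (P u) (dyad w (axis k 1)))"
      by (simp add: G_def inner_sum_right inner_axis mult.commute)
    also have "\<dots> = darea \<Phi> (P u) (dyad w (grad \<psi> u))" by (rule darea_dyad_expansion[OF ph(1,2) Pu, symmetric])
    finally show ?thesis .
  qed
  have "integral (cbox a b) (\<lambda>u. D u (G u)) = 0"
  proof (rule weakly_divergence_free[OF open_interior G B _ \<phi> K])
    fix x0 :: "real^'m" and r :: real assume r: "0 < r" "cball x0 r \<subseteq> box a b"
    have "integral (cbox a b) (\<lambda>u. frechet_derivative (bump x0 r) (at u) (G u)) =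
        integral (cbox a b) (\<lambda>u. darea \<Phi> (P u) (dyad w (grad (bump x0 r) u)))"
      by (rule integral_cong, rule pair) (use hd_SucE[OF hd_bump[where k = "Suc 0"]] in auto)
    also have "\<dots> = 0" unfolding P_def by (rule first_variation_bump[OF M c F S \<Phi> B X r])
    finally show "integral (cbox a b) (\<lambda>u. frechet_derivative (bump x0 r) (at u) (G u)) = 0" .
  qed
  moreover have "integral (cbox a b) (\<lambda>u. D u (G u)) = integral (cbox a b) (\<lambda>u. darea \<Phi> (P u) (dyad w (grad \<phi> u)))"
    by (rule integral_cong, rule pair) (auto intro: \<phi>(1))
  ultimately show ?thesis by simp
qed

section \<open>The enclosure theorem\<close>

lemma has_derivative_positive_part_squared:
  "((\<lambda>s::real. (max 0 s)\<^sup>2) has_real_derivative 2 * max 0 s) (at s)"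
proof -
  consider "s < 0" | "s = 0" | "0 < s" by linarith
  then show ?thesis
  proof cases
    case 1
    have "((\<lambda>s::real. 0) has_real_derivative 2 * max 0 s) (at s)" using 1 by simp
    then show ?thesis
      by (rule has_field_derivative_transform_within_open[of _ _ _ "{..<0}"]) (use 1 in auto)
  next
    case 2
    have "((\<lambda>h::real. (max 0 h)\<^sup>2 / h) \<longlongrightarrow> 0) (at 0)"
    proof (rule Lim_null_comparison)
      show "\<forall>\<^sub>F h::real in at 0. norm ((max 0 h)\<^sup>2 / h) \<le> \<bar>h\<bar>"
        by (intro always_eventually allI) (auto simp: max_def power2_eq_square)
      show "((\<lambda>h::real. \<bar>h\<bar>) \<longlongrightarrow> 0) (at 0)" by (intro tendsto_rabs_zero tendsto_ident_at)
    qed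
    then show ?thesis using 2 by (simp add: DERIV_def)
  next
    case 3
    have "((\<lambda>s::real. s\<^sup>2) has_real_derivative 2 * max 0 s) (at s)"
      using 3 by (auto intro!: derivative_eq_intros)
    then show ?thesis
      by (rule has_field_derivative_transform_within_open[of _ _ _ "{0<..}"]) (use 3 in auto)
  qed
qed

text \<open>An injective derivative separates a point from its neighbours.\<close>

lemma immersion_locally_separated:
  fixes Y :: "'a::euclidean_space \<Rightarrow> 'b::euclidean_space"
  assumes Y: "(Y has_derivative L) (at x)" and L: "inj L"
  obtains r where "0 < r" "\<And>y. y \<in> ball x r \<Longrightarrow> y \<noteq> x \<Longrightarrow> Y y \<noteq> Y x"
proof -
  have "linear L" using Y has_derivative_linear by blast
  then obtain \<beta> where \<beta>: "0 < \<beta>" "\<And>v. \<beta> * norm v \<le> norm (L v)"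
    using linear_inj_bounded_below_pos[OF _ L] by blast
  obtain r where r: "0 < r" "\<And>y. norm (y - x) < r \<Longrightarrow> norm (Y y - Y x - L (y - x)) \<le> \<beta> / 2 * norm (y - x)"
    using Y \<beta>(1) unfolding has_derivative_at_alt by (meson half_gt_zero)
  have "Y y \<noteq> Y x" if y: "y \<in> ball x r" "y \<noteq> x" for y
  proof
    assume "Y y = Y x"
    then have "norm (L (y - x)) \<le> \<beta> / 2 * norm (y - x)"
      using r(2)[of y] y(1) by (simp add: dist_norm norm_minus_commute)
    then have "\<beta> * norm (y - x) \<le> \<beta> / 2 * norm (y - x)" using \<beta>(2)[of "y - x"] by linarith
    then show False using \<beta>(1) y(2) by simp
  qed
  then show ?thesis using r(1) that by blast
qed

text \<open>A Finsler-minimal immersion cannot touch a sphere from inside. The first variation is tested with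
  the square of the positive part of \<open>a \<bullet> Y - m0\<close>, displaced in a direction \<open>w\<close> that is stationary for the
  tangent plane at the touching point. The resulting integrand is positive wherever the gradient of
  the test function does not vanish.\<close>

lemma no_interior_touching:
  fixes F :: "real^'n \<Rightarrow> real^'n \<Rightarrow> real"
    and M :: "'a::{t2_space,second_countable_topology} set" and A :: "('a, 'm::finite) chart set"
    and X :: "'a \<Rightarrow> real^'n"
  assumes dim: "CARD('n) = CARD('m) + 1"
    and M: "oriented_manifold M A" and c: "c \<in> A"
    and F: "finsler_metric F" and S: "finsler_metric (harmonic_sym CARD('m) F)"
    and \<Phi>: "\<And>x. harmonic_sym CARD('m) F x = \<Phi>"
    and X: "finsler_minimal F A X"
    and u0: "u0 \<in> interior (chart_image c)" and \<epsilon>: "0 < \<epsilon>"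
    and touch: "\<And>u. u \<in> interior (chart_image c) \<Longrightarrow>
      a \<bullet> X (chart_inv c u) \<le> a \<bullet> X (chart_inv c u0) - \<epsilon> * (norm (X (chart_inv c u) - X (chart_inv c u0)))\<^sup>2"
  shows False
proof -
  let ?O = "interior (chart_image c)"
  define Y where "Y = X \<circ> chart_inv c"
  define P where "P u = matrix (frechet_derivative Y (at u))" for u
  have touchY: "a \<bullet> Y u \<le> a \<bullet> Y u0 - \<epsilon> * (norm (Y u - Y u0))\<^sup>2" if "u \<in> ?O" for u
    using touch[OF that] by (simp add: Y_def)
  have \<Phi>F: "finsler_metric (\<lambda>x. \<Phi>)" using S \<Phi> by (metis (no_types, lifting) ext)
  have ph: "pos_homogeneous \<Phi>" "hd_on (- {0}) \<Phi> 1"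
    using finsler_slice(2)[OF \<Phi>F] finsler_slice(1)[OF \<Phi>F, of 1] by auto
  have uc: "uniformly_convex_norm \<Phi>" using harmonic_sym_uniformly_convex[OF S] \<Phi> by metis
  have im: "hd_on ?O Y 2" "\<And>u. u \<in> ?O \<Longrightarrow> inj (frechet_derivative Y (at u))"
    using X c by (auto simp: finsler_minimal_def C2_immersion_def Y_def)
  have Yd: "(Y has_derivative frechet_derivative Y (at u)) (at u)" if "u \<in> ?O" for u
    using hd_SucE[of ?O Y 1 u] im(1) that by (simp add: numeral_2_eq_2)
  have PY: "(*v) (P u) = frechet_derivative Y (at u)" if "u \<in> ?O" for u
  proof -
    have "linear (frechet_derivative Y (at u))" using Yd[OF that] has_derivative_linear by blast
    then show ?thesis unfolding P_def using matrix_works by auto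
  qed
  have Pinj: "P u \<in> inj_mats" if "u \<in> ?O" for u using im(2)[OF that] PY[OF that] by (simp add: inj_mats_def)
  have cY: "continuous_on ?O Y" by (rule hd_imp_continuous[OF im(1)])
  have cdY: "continuous_on ?O (\<lambda>u. frechet_derivative Y (at u) v)" for v
    using im(1) hd_imp_continuous[of ?O "\<lambda>u. frechet_derivative Y (at u) v" 1] by (simp add: numeral_2_eq_2)
  have cP: "continuous_on ?O P"
    unfolding P_def matrix_def by (intro continuous_on_vec_lambda continuous_on_component cdY)
  have ad: "((\<lambda>u. a \<bullet> Y u) has_derivative (\<lambda>v. a \<bullet> (P u *v v))) (at u)" if "u \<in> ?O" for u
    using has_derivative_inner_right[OF Yd[OF that], of a] by (simp add: PY[OF that])
  obtain r where r: "0 < r" "\<And>y. y \<in> ball u0 r \<Longrightarrow> y \<noteq> u0 \<Longrightarrow> Y y \<noteq> Y u0"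
    using immersion_locally_separated[OF Yd[OF u0] im(2)[OF u0]] by blast
  have "open (?O \<inter> ball u0 r)" "u0 \<in> ?O \<inter> ball u0 r" using u0 r(1) by auto
  then obtain p q where pq: "cbox p q \<subseteq> ?O \<inter> ball u0 r" "u0 \<in> box p q" using open_contains_cbox by metis
  have B: "cbox p q \<subseteq> ?O" using pq(1) by blast
  have below: "a \<bullet> Y u < a \<bullet> Y u0" if "u \<in> cbox p q" "u \<noteq> u0" for u
  proof -
    have "Y u \<noteq> Y u0" using r(2) pq(1) that by blast
    then have "0 < \<epsilon> * (norm (Y u - Y u0))\<^sup>2" using \<epsilon> by simp
    then show ?thesis using touchY[of u] B that(1) by (smt (verit) subsetD)
  qed
  have q: "q \<in> cbox p q" "q \<notin> box p q"
  proof -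
    show "q \<in> cbox p q" using pq(2) by (fastforce simp: mem_box)
    obtain i :: "real^'m" where "i \<in> Basis" using nonempty_Basis by blast
    then show "q \<notin> box p q" by (auto simp: mem_box)
  qed
  have a0: "a \<noteq> 0" using below[OF q(1)] q(2) pq(2) by (metis inner_zero_left less_irrefl)
  have orth: "a \<bullet> (P u0 *v v) = 0" for v
  proof -
    have "a \<bullet> Y u \<le> a \<bullet> Y u0" if "u \<in> ?O" for u
    proof -
      have "0 \<le> \<epsilon> * (norm (Y u - Y u0))\<^sup>2" using \<epsilon> by simp
      then show ?thesis using touchY[OF that] by linarith
    qed
    then have "(\<lambda>v. a \<bullet> (P u0 *v v)) = (\<lambda>v. 0)"
      using differential_zero_maxmin[OF u0 open_interior ad[OF u0]] by blast
    then show ?thesis by (rule fun_cong)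
  qed
  obtain w where w: "a \<bullet> w = 1" "\<And>x. darea \<Phi> (P u0) (dyad w x) = 0"
    using stationary_transversal[OF ph Pinj[OF u0] a0 orth] by blast
  obtain m0 where m0: "m0 < a \<bullet> Y u0" "\<And>u. u \<in> cbox p q - box p q \<Longrightarrow> a \<bullet> Y u < m0"
  proof -
    have "compact (cbox p q - box p q)" by (intro compact_diff compact_cbox open_box)
    moreover have "continuous_on (cbox p q - box p q) (\<lambda>u. a \<bullet> Y u)"
      using B by (intro continuous_intros continuous_on_subset[OF cY]) auto
    ultimately obtain u1 where u1: "u1 \<in> cbox p q - box p q" "\<And>u. u \<in> cbox p q - box p q \<Longrightarrow> a \<bullet> Y u \<le> a \<bullet> Y u1"
      using continuous_attains_sup[of "cbox p q - box p q" "\<lambda>u. a \<bullet> Y u"] q by blast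
    have "a \<bullet> Y u1 < a \<bullet> Y u0" using below[of u1] u1(1) pq(2) by blast
    then obtain m0 where "a \<bullet> Y u1 < m0" "m0 < a \<bullet> Y u0" using dense by blast
    then show ?thesis using that[of m0] u1(2) by (meson le_less_trans)
  qed
  \<comment> \<open>The level \<open>m0\<close> separates \<open>a \<bullet> Y u0\<close> from the values on the boundary of the box, so that \<open>\<phi>\<close> has compact
    support inside.\<close>
  define s where "s u = max 0 (a \<bullet> Y u - m0)" for u
  define K where "K = {u \<in> cbox p q. m0 \<le> a \<bullet> Y u}"
  define \<phi> where "\<phi> u = (if u \<in> K then (s u)\<^sup>2 else 0)" for u
  define D where "D u v = (if u \<in> K then 2 * s u * (a \<bullet> (P u *v v)) else 0)" for u v
  have Kbox: "K \<subseteq> box p q" using m0(2) unfolding K_def by force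
  have caY: "continuous_on (cbox p q) (\<lambda>u. a \<bullet> Y u)"
    by (intro continuous_intros continuous_on_subset[OF cY B])
  have K: "compact K"
  proof -
    have "K = cbox p q \<inter> (\<lambda>u. a \<bullet> Y u) -` {m0..}" by (auto simp: K_def)
    then have "closed K" using continuous_closed_preimage[OF caY closed_cbox closed_atLeast] by simp
    moreover have "bounded K" by (rule bounded_subset[OF bounded_cbox]) (auto simp: K_def)
    ultimately show ?thesis by (simp add: compact_eq_bounded_closed)
  qed
  have s0: "s u = 0" if "u \<in> cbox p q" "u \<notin> K" for u using that by (simp add: s_def K_def)
  have \<phi>s: "\<phi> u = (s u)\<^sup>2" and Ds: "D u v = 2 * s u * (a \<bullet> (P u *v v))" if "u \<in> cbox p q" for u v
    using s0[OF that] by (simp_all add: \<phi>_def D_def)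
  have boxc: "u \<in> cbox p q" if "u \<in> box p q" for u using that box_subset_cbox by blast
  have opK: "open (- K)" using compact_imp_closed[OF K] by auto
  have cover: "box p q \<union> - K = UNIV" using Kbox by auto
  have d\<phi>: "(\<phi> has_derivative D u) (at u)" for u
  proof (cases "u \<in> box p q")
    case True
    have "((\<lambda>u. a \<bullet> Y u - m0) has_derivative (\<lambda>v. a \<bullet> (P u *v v))) (at u)"
      using has_derivative_diff[OF ad has_derivative_const, of u] B boxc[OF True] by auto
    from has_derivative_compose[OF this has_derivative_positive_part_squared[unfolded has_field_derivative_def]]
    have "((\<lambda>u. (s u)\<^sup>2) has_derivative D u) (at u)"
      unfolding s_def by (rule has_derivative_eq_rhs) (simp add: fun_eq_iff Ds[OF boxc[OF True]] s_def)
    then show ?thesis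
      by (rule has_derivative_transform_within_open[OF _ open_box True]) (simp add: \<phi>s boxc)
  next
    case False
    then have u: "u \<in> - K" using Kbox by blast
    have "(\<phi> has_derivative (\<lambda>v. 0)) (at u)"
      by (rule has_derivative_transform_within_open[OF has_derivative_const opK u]) (simp add: \<phi>_def)
    moreover have "D u = (\<lambda>v. 0)" using u by (simp add: D_def fun_eq_iff)
    ultimately show ?thesis by simp
  qed
  have cs: "continuous_on (cbox p q) s"
    unfolding s_def by (intro continuous_intros caY)
  have cPB: "continuous_on (cbox p q) P" by (rule continuous_on_subset[OF cP B])
  have cD: "continuous_on UNIV (\<lambda>u. D u v)" for v
  proof -
    have "continuous_on (cbox p q) (\<lambda>u. 2 * s u * (a \<bullet> (P u *v v)))"
      by (intro continuous_intros cs bounded_bilinear.continuous_on[OF bounded_bilinear_matrix_vector_mult] cPB)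
    then have "continuous_on (box p q) (\<lambda>u. 2 * s u * (a \<bullet> (P u *v v)))"
      using box_subset_cbox continuous_on_subset by blast
    then have "continuous_on (box p q) (\<lambda>u. D u v)"
      by (rule continuous_on_eq) (simp add: Ds boxc)
    moreover have "continuous_on (- K) (\<lambda>u. D u v)"
      by (rule continuous_on_eq[OF continuous_on_const[of _ 0]]) (simp add: D_def)
    ultimately show ?thesis
      using continuous_on_open_Un[OF open_box opK, of p q "\<lambda>u. D u v"] unfolding cover by blast
  qed
  have \<phi>0: "\<phi> u = 0" if "u \<notin> K" for u using that by (simp add: \<phi>_def)
  have int0: "integral (cbox p q) (\<lambda>u. darea \<Phi> (P u) (dyad w (grad \<phi> u))) = 0"
    using first_variation_C1[OF M c F S \<Phi> B X d\<phi> cD K Kbox \<phi>0] unfolding P_def Y_def .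
  have gr: "grad \<phi> u = (2 * s u) *\<^sub>R (a v* P u)" if "u \<in> cbox p q" for u
  proof (rule vector_eq_rdot[THEN iffD1], rule allI)
    fix v show "grad \<phi> u \<bullet> v = ((2 * s u) *\<^sub>R (a v* P u)) \<bullet> v"
      by (simp add: grad_inner[OF d\<phi>] Ds[OF that] dot_lmul_matrix)
  qed
  have PB: "P u \<in> inj_mats" if "u \<in> cbox p q" for u using Pinj B that by blast
  have int_eq: "darea \<Phi> (P u) (dyad w (grad \<phi> u)) = 2 * s u * darea \<Phi> (P u) (dyad w (a v* P u))"
    if "u \<in> cbox p q" for u
    using linear_scale[OF darea_linear[OF ph PB[OF that]]] by (simp add: gr[OF that] dyad_scaleR_right)
  have pos: "0 < darea \<Phi> (P u) (dyad w (a v* P u))" if "u \<in> cbox p q" "a v* P u \<noteq> 0" for u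
    by (rule darea_shear_pos[OF dim uc ph(2) Pinj[OF u0] a0 orth w PB[OF that(1)] that(2)])
  have zero: "darea \<Phi> (P u) (dyad w (a v* P u)) = 0" if "u \<in> cbox p q" "a v* P u = 0" for u
  proof -
    have "dyad w (0 :: real^'m) = 0" using dyad_scaleR_right[of w 0 0] by simp
    then show ?thesis using linear_0[OF darea_linear[OF ph PB[OF that(1)]]] that(2) by simp
  qed
  have sn: "0 \<le> s u" for u by (simp add: s_def)
  have cont: "continuous_on (cbox p q) (\<lambda>u. darea \<Phi> (P u) (dyad w (grad \<phi> u)))"
  proof (rule continuous_on_darea_dyad[OF ph cPB])
    show "P ` cbox p q \<subseteq> inj_mats" using PB by blast
    have "frechet_derivative \<phi> (at u) = D u" for u using frechet_derivative_at[OF d\<phi>] by simp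
    then show "continuous_on (cbox p q) (grad \<phi>)"
      unfolding grad_def[abs_def] using continuous_on_subset[OF cD]
      by (intro continuous_on_vec_lambda) simp
  qed
  have "\<forall>u\<in>cbox p q. darea \<Phi> (P u) (dyad w (grad \<phi> u)) = 0"
  proof (rule integral_cbox_eq_0_iff[THEN iffD1, OF cont _ _ int0])
    show "box p q \<noteq> {}" using pq(2) by blast
    fix u assume u: "u \<in> cbox p q"
    show "0 \<le> darea \<Phi> (P u) (dyad w (grad \<phi> u))"
      unfolding int_eq[OF u] using pos[OF u] zero[OF u] sn[of u]
      by (cases "a v* P u = 0") (auto intro: mult_nonneg_nonneg)
  qed
  then have "2 * s u * darea \<Phi> (P u) (dyad w (a v* P u)) = 0" if "u \<in> cbox p q" for u
    using int_eq[OF that] that by simp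
  then have "grad \<phi> u = 0" if "u \<in> cbox p q" for u
    unfolding gr[OF that] using that pos[OF that] by (cases "a v* P u = 0") force+
  then have "D u v = 0" if "u \<in> cbox p q" for u v
    using grad_inner[OF d\<phi>, of u v] that by simp
  then have "D u = (\<lambda>v. 0)" if "u \<in> cbox p q" for u using that by (simp add: fun_eq_iff)
  then have "(\<phi> has_derivative (\<lambda>v. 0)) (at u within cbox p q)" if "u \<in> cbox p q" for u
    using has_derivative_at_withinI[OF d\<phi>[of u]] that by simp
  then obtain k where k: "\<And>u. u \<in> cbox p q \<Longrightarrow> \<phi> u = k"
    using has_derivative_zero_constant[OF convex_box(1)] by blast
  have "\<phi> q = 0" using Kbox q(2) by (auto simp: \<phi>_def)
  moreover have "0 < \<phi> u0"
    unfolding \<phi>s[OF boxc[OF pq(2)]] s_def using m0(1) by simp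
  ultimately show False using k[OF q(1)] k[OF boxc[OF pq(2)]] by simp
qed

lemma compact_manifold_boundary:
  fixes M :: "'a::{t2_space,second_countable_topology} set" and A :: "('a, 'm::finite) chart set"
  assumes M: "oriented_manifold M A" "compact M"
  shows "compact (manifold_boundary M A)"
proof -
  let ?V = "\<lambda>c. fst c \<inter> snd c -` interior (chart_image c)"
  have op: "openin (top_of_set M) (?V c)" if "c \<in> A" for c
  proof -
    have ch: "is_chart M c" using M(1) that by (auto simp: oriented_manifold_def)
    have "openin (top_of_set (fst c)) (?V c)"
      by (rule continuous_openin_preimage_gen[OF chart_facts(4)[OF ch] open_interior])
    then show ?thesis using openin_trans chart_facts(6)[OF ch] by blast
  qed
  have eq: "manifold_interior A = (\<Union>c\<in>A. ?V c)" by (auto simp: manifold_interior_def)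
  have "openin (top_of_set M) (manifold_interior A)"
    unfolding eq by (rule openin_Union) (use op in auto)
  then have "closedin (top_of_set M) (M - manifold_interior A)"
    using closedin_diff[of "top_of_set M" M "manifold_interior A"] by simp
  then show "compact (manifold_boundary M A)"
    unfolding manifold_boundary_def by (rule closedin_compact[OF M(2)])
qed

theorem theorem1p4:
  fixes F :: "real^'n \<Rightarrow> real^'n \<Rightarrow> real"
    and M :: "'a::{t2_space,second_countable_topology} set"
    and A :: "('a, 'm::finite) chart set"
    and X :: "'a \<Rightarrow> real^'n"
  assumes dim: "CARD('n) = CARD('m) + 1"
    and F: "minkowski_metric F"
    and F_sym: "finsler_metric (harmonic_sym CARD('m) F)"
    and M: "oriented_manifold M A" "compact M"
    and X_cont: "continuous_on M X"
    and X_minimal: "finsler_minimal F A X"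
  shows "X ` M \<subseteq> convex hull (X ` manifold_boundary M A)"
proof (rule ccontr)
  let ?b = "manifold_boundary M A"
  assume "\<not> X ` M \<subseteq> convex hull (X ` ?b)"
  then obtain p0 where p0: "p0 \<in> M" "X p0 \<notin> convex hull (X ` ?b)" by blast
  have FF: "finsler_metric F" and indep: "F x y = F x' y" for x x' y
    using F by (auto simp: minkowski_metric_def)
  have \<Phi>: "harmonic_sym CARD('m) F x = harmonic_sym CARD('m) F 0" for x
    by (simp add: harmonic_sym_def fun_eq_iff indep[of x _ 0])
  have bM: "?b \<subseteq> M" by (auto simp: manifold_boundary_def)
  have "compact (X ` ?b)"
    by (rule compact_continuous_image[OF continuous_on_subset[OF X_cont bM] compact_manifold_boundary[OF M]])
  then have "closed (convex hull (X ` ?b))" using compact_convex_hull compact_imp_closed by blast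
  from separating_hyperplane_closed_point[OF convex_convex_hull this p0(2)]
  obtain e \<beta> where sep: "e \<bullet> X p0 < \<beta>" "\<And>x. x \<in> convex hull (X ` ?b) \<Longrightarrow> \<beta> < e \<bullet> x" by blast
  have "bounded (X ` M)" by (intro compact_imp_bounded compact_continuous_image X_cont M(2))
  then obtain R where R: "\<And>p. p \<in> M \<Longrightarrow> norm (X p) \<le> R" by (auto simp: bounded_iff)
  \<comment> \<open>so small that adding \<open>\<epsilon> * (X p \<bullet> X p)\<close> does not close the gap between \<open>X p0\<close> and the boundary\<close>
  define \<epsilon> where "\<epsilon> = (\<beta> - e \<bullet> X p0) / (R\<^sup>2 + 1)"
  have R1: "0 < R\<^sup>2 + 1" by (simp add: add_nonneg_pos)
  have \<epsilon>: "0 < \<epsilon>" using sep(1) R1 by (simp add: \<epsilon>_def)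
  define h where "h p = \<epsilon> * (X p \<bullet> X p) - e \<bullet> X p" for p
  have "continuous_on M h" unfolding h_def by (intro continuous_intros X_cont)
  then obtain p where p: "p \<in> M" "\<And>q. q \<in> M \<Longrightarrow> h q \<le> h p"
    using continuous_attains_sup[OF M(2)] p0(1) by blast
  have "p \<notin> ?b"
  proof
    assume "p \<in> ?b"
    then have "\<beta> < e \<bullet> X p" by (intro sep(2) hull_inc) simp
    moreover have "\<epsilon> * (X p \<bullet> X p) \<le> \<beta> - e \<bullet> X p0"
    proof -
      have "X p \<bullet> X p \<le> R\<^sup>2" using R[OF p(1)] by (simp add: dot_square_norm power_mono)
      then have "\<epsilon> * (X p \<bullet> X p) \<le> \<epsilon> * (R\<^sup>2 + 1)" using \<epsilon> by (intro mult_left_mono) auto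
      also have "\<dots> = \<beta> - e \<bullet> X p0" using R1 by (simp add: \<epsilon>_def)
      finally show ?thesis .
    qed
    moreover have "0 \<le> \<epsilon> * (X p0 \<bullet> X p0)" using \<epsilon> by simp
    ultimately show False using p(2)[OF p0(1)] by (simp add: h_def)
  qed
  then obtain c where c: "c \<in> A" "p \<in> fst c" "snd c p \<in> interior (chart_image c)"
    using p(1) by (auto simp: manifold_boundary_def manifold_interior_def)
  have ch: "is_chart M c" using M(1) c(1) by (auto simp: oriented_manifold_def)
  have cp: "chart_inv c (snd c p) = p" by (rule chart_facts(1)[OF ch c(2)])
  define a where "a = (2 * \<epsilon>) *\<^sub>R X p - e"
  have touch: "a \<bullet> X q \<le> a \<bullet> X p - \<epsilon> * (norm (X q - X p))\<^sup>2" if "q \<in> M" for q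
  proof -
    have "\<epsilon> * (norm (X q - X p))\<^sup>2 = \<epsilon> * (X q \<bullet> X q) - 2 * \<epsilon> * (X p \<bullet> X q) + \<epsilon> * (X p \<bullet> X p)"
      by (simp add: power2_norm_eq_inner algebra_simps inner_commute)
    moreover have "a \<bullet> X q = 2 * \<epsilon> * (X p \<bullet> X q) - e \<bullet> X q" "a \<bullet> X p = 2 * \<epsilon> * (X p \<bullet> X p) - e \<bullet> X p"
      by (simp_all add: a_def inner_diff_left)
    ultimately show ?thesis using p(2)[OF that] by (simp add: h_def)
  qed
  show False
  proof (rule no_interior_touching[OF dim M(1) c(1) FF F_sym \<Phi> X_minimal c(3) \<epsilon>, of a])
    fix u assume "u \<in> interior (chart_image c)"
    then have "u \<in> chart_image c" using interior_subset by blast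
    then have "chart_inv c u \<in> M" using chart_facts(2,7)[OF ch] by blast
    then show "a \<bullet> X (chart_inv c u) \<le> a \<bullet> X (chart_inv c (snd c p)) -
        \<epsilon> * (norm (X (chart_inv c u) - X (chart_inv c (snd c p))))\<^sup>2"
      unfolding cp by (rule touch)
  qed
qed

end
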